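(* Let $\nu$ be a probability measure on $\mathbb{R}^d$ that is absolutely continuous with respect to the Lebesgue measure and has a finite second moment. Suppose that $\nu$ satisfies one or more of the following, with $D:=(1/\sqrt2)\,\mathrm{diam}(\mathrm{supp}(\nu))$: (A1) $\nu$ is $\beta$-semi-log-convex for some $\beta>0$ and $\kappa$-semi-log-concave for some $\kappa>0$, with $\mathrm{supp}(\nu)=\mathbb{R}^d$; (A2) $\nu$ is $\kappa$-semi-log-concave for some $\kappa\in\mathbb{R}$ with $D\in(0,\infty)$; (A3) $\nu=N(0,\sigma^2\mathbf{I}_d)*\rho$ with $\sigma>0$, where $\rho$ is a probability measure supported on a Euclidean ball of radius $R$ in $\mathbb{R}^d$; (A4) $\nu$ is $\beta$-semi-log-convex for some $\beta>0$, $\kappa$-semi-log-concave for some $\kappa\le0$, and $\frac{d\nu}{d\gamma_d}(x)$ is $L$-log-Lipschitz in $x$ for some $L\ge0$, with $\mathrm{supp}(\nu)=\mathbb{R}^d$. Let $v$ be the velocity field associated with $\nu$, let $\theta_t$ be such that $\nabla_xv(t,x)\preceq\theta_t\mathbf{I}_d$ for all $(t,x)\in[0,1]\times\mathbb{R}^d$, and let $\tilde v:[0,1]\times\mathbb{R}^d\to\mathbb{R}^d$ be a velocity field with flow $(Y_t)_{t\in[0,1]}$ solving $\frac{dY_t}{dt}=\tilde v(t,Y_t)$, $Y_0=x_0$. Let $\tilde q_t$ denote the density function of ${Y_t}_{\#}\mu$. (i) Suppose that $$\int_0^1\int_{\mathbb{R}^d}\|v(t,x)-\tilde v(t,x)\|^2\tilde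 q_t(x)\,dx\,dt\le\varepsilon.$$ Then $$W_2^2({Y_1}_{\#}\mu,\nu)\le\varepsilon\int_0^1\exp\left(2\int_s^1\theta_u\,du\right)ds.$$ (ii) Suppose that $\tilde v$ is of class $C^1$ in $x$ and $\sup_{(t,x)\in[0,1]\times\mathbb{R}^d}\|\nabla_x\tilde v(t,x)\|_{2,2}\le C_3$. Then $$W_2^2({Y_1}_{\#}\mu,\nu)\le\frac{\exp(2C_3)-1}{2C_3}\int_0^1\int_{\mathbb{R}^d}\|v(t,x)-\tilde v(t,x)\|^2p_t(x)\,dx\,dt.$$
   Context: Fix functions $a_t,b_t$ of $t\in[0,1]$ (a dot denotes the time derivative) satisfying: $\dot a_t\le 0$, $\dot b_t\ge 0$, $a_0>0$, $b_0\ge 0$, $a_1=0$, $b_1=1$; $a_t>0$ and $b_t>0$ for all $t\in(0,1)$; $a_t,b_t\in C^2([0,1))$, $a_t^2\in C^1([0,1])$, $b_t\in C^1([0,1])$. Let $\gamma_d:=N(0,\mathbf{I}_d)$, let $\mathsf{Z}\sim\gamma_d$ and $\mathsf{X}_1\sim\nu$ be independent, $\mathsf{X}_t=a_t\mathsf{Z}+b_t\mathsf{X}_1$ with density $p_t$, and $\mu=\mathrm{Law}(\mathsf{X}_0)$. The velocity field is $v(t,x)=\mathbb{E}[\dot a_t\mathsf{Z}+\dot b_t\mathsf{X}_1\mid\mathsf{X}_t=x]$ for $t\in(0,1)$, $v(0,x)=\lim_{t\downarrow0}v(t,x)$, $v(1,x)=\lim_{t\uparrow1}v(t,x)$. A probability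 measure $\exp(-U)\,dx$ is $\kappa$-semi-log-concave ($\kappa\in\mathbb{R}$) if its support $\Omega\subseteq\mathbb{R}^d$ is convex and $U\in C^2(\Omega)$ satisfies $\nabla^2U(x)\succeq\kappa\mathbf{I}_d$ on $\Omega$; it is $\beta$-semi-log-convex ($\beta>0$) if its support $\Omega$ is convex and $U\in C^2(\Omega)$ satisfies $\nabla^2U(x)\preceq\beta\mathbf{I}_d$ on $\Omega$. A function $f:\mathbb{R}^d\to\mathbb{R}_+$ is $L$-log-Lipschitz if $\log f$ is $L$-Lipschitz. $W_2$ is the quadratic Wasserstein distance and $\|\cdot\|_{2,2}$ the spectral norm. *)

theory Defs
  imports "HOL-Probability.Probability"
begin

definition C1_on :: "real set \<Rightarrow> (real \<Rightarrow> real) \<Rightarrow> bool" where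
  "C1_on S f \<longleftrightarrow> (\<exists>f'. (\<forall>t\<in>S. (f has_real_derivative f' t) (at t within S)) \<and> continuous_on S f')"

definition C2_on :: "real set \<Rightarrow> (real \<Rightarrow> real) \<Rightarrow> bool" where
  "C2_on S f \<longleftrightarrow> (\<exists>f'. (\<forall>t\<in>S. (f has_real_derivative f' t) (at t within S)) \<and> C1_on S f')"

(* The sign conditions on the derivatives are required on the open interval only: a need not be
   differentiable at 1, and at all other endpoints they follow by continuity. *)
definition interpolation_schedule :: "(real \<Rightarrow> real) \<Rightarrow> (real \<Rightarrow> real) \<Rightarrow> bool" where
  "interpolation_schedule a b \<longleftrightarrow>
     C2_on {0..<1} a \<and> C2_on {0..<1} b \<and> C1_on {0..1} (\<lambda>t. (a t)\<^sup>2) \<and> C1_on {0..1} b \<and>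
     (\<forall>t\<in>{0<..<1}. deriv a t \<le> 0 \<and> deriv b t \<ge> 0 \<and> a t > 0 \<and> b t > 0) \<and>
     a 0 > 0 \<and> b 0 \<ge> 0 \<and> a 1 = 0 \<and> b 1 = 1"

(* N(0, s^2 I): the coordinates are independent N(0, s^2) *)
definition gaussian :: "real \<Rightarrow> (real ^ 'd) measure" where
  "gaussian s = density lborel (\<lambda>x. ennreal (\<Prod>i\<in>UNIV. normal_density 0 s (x $ i)))"

definition msupport :: "'a::metric_space measure \<Rightarrow> 'a set" where
  "msupport M = {x. \<forall>r>0. emeasure M (ball x r) > 0}"

(* For symmetric matrices this is the usual positive semidefinite order. *)
definition loewner_le :: "real ^ 'd ^ 'd \<Rightarrow> real ^ 'd ^ 'd \<Rightarrow> bool" (infix "\<preceq>\<^sub>L" 50) where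
  "A \<preceq>\<^sub>L B \<longleftrightarrow> (\<forall>h. h \<bullet> (A *v h) \<le> h \<bullet> (B *v h))"

definition C2_with_hessian ::
    "(real ^ 'd) set \<Rightarrow> (real ^ 'd \<Rightarrow> real) \<Rightarrow> (real ^ 'd \<Rightarrow> real ^ 'd ^ 'd) \<Rightarrow> bool" where
  "C2_with_hessian S U H \<longleftrightarrow>
     (\<exists>g. \<forall>x\<in>S. (U has_derivative (\<lambda>h. g x \<bullet> h)) (at x) \<and>
                (g has_derivative (\<lambda>h. H x *v h)) (at x)) \<and>
     continuous_on S H"

(* The measure is exp(-U) dx on its convex support. The topological support is closed; U is only
   required to be finite and twice continuously differentiable on the interior (the boundary of a
   convex set is a null set), so that densities vanishing or singular at the boundary are covered. *)
definition has_potential ::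
    "(real ^ 'd) measure \<Rightarrow> (real ^ 'd \<Rightarrow> real) \<Rightarrow> (real ^ 'd \<Rightarrow> real ^ 'd ^ 'd) \<Rightarrow> bool" where
  "has_potential \<nu> U H \<longleftrightarrow>
     convex (msupport \<nu>) \<and>
     \<nu> = density lborel (\<lambda>x. ennreal (exp (- U x)) * indicator (interior (msupport \<nu>)) x) \<and>
     C2_with_hessian (interior (msupport \<nu>)) U H"

definition semi_log_concave :: "real \<Rightarrow> (real ^ 'd) measure \<Rightarrow> bool" where
  "semi_log_concave \<kappa> \<nu> \<longleftrightarrow>
     (\<exists>U H. has_potential \<nu> U H \<and> (\<forall>x\<in>interior (msupport \<nu>). mat \<kappa> \<preceq>\<^sub>L H x))"

definition semi_log_convex :: "real \<Rightarrow> (real ^ 'd) measure \<Rightarrow> bool" where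
  "semi_log_convex \<beta> \<nu> \<longleftrightarrow>
     \<beta> > 0 \<and> (\<exists>U H. has_potential \<nu> U H \<and> (\<forall>x\<in>interior (msupport \<nu>). H x \<preceq>\<^sub>L mat \<beta>))"

definition log_lipschitz :: "real \<Rightarrow> ('a::metric_space \<Rightarrow> real) \<Rightarrow> bool" where
  "log_lipschitz L f \<longleftrightarrow> (\<forall>x. f x > 0) \<and> L-lipschitz_on UNIV (\<lambda>x. ln (f x))"

definition cond_A1 :: "(real ^ 'd) measure \<Rightarrow> bool" where
  "cond_A1 \<nu> \<longleftrightarrow>
     (\<exists>\<beta>>0. semi_log_convex \<beta> \<nu>) \<and> (\<exists>\<kappa>>0. semi_log_concave \<kappa> \<nu>) \<and> msupport \<nu> = UNIV"

(* D < \<infinity> is boundedness of the support: diameter is a junk value on unbounded sets. *)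
definition cond_A2 :: "(real ^ 'd) measure \<Rightarrow> bool" where
  "cond_A2 \<nu> \<longleftrightarrow>
     (\<exists>\<kappa>. semi_log_concave \<kappa> \<nu>) \<and>
     bounded (msupport \<nu>) \<and> (1 / sqrt 2) * diameter (msupport \<nu>) > 0"

definition cond_A3 :: "(real ^ 'd) measure \<Rightarrow> bool" where
  "cond_A3 \<nu> \<longleftrightarrow>
     (\<exists>s \<rho> c R. s > 0 \<and> prob_space \<rho> \<and> sets \<rho> = sets borel \<and> msupport \<rho> \<subseteq> cball c R \<and>
        \<nu> = (gaussian s \<star> \<rho>))"

definition cond_A4 :: "(real ^ 'd) measure \<Rightarrow> bool" where
  "cond_A4 \<nu> \<longleftrightarrow>
     (\<exists>\<beta>>0. semi_log_convex \<beta> \<nu>) \<and> (\<exists>\<kappa>\<le>0. semi_log_concave \<kappa> \<nu>) \<and>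
     (\<exists>L\<ge>0. \<exists>f. log_lipschitz L f \<and> \<nu> = density (gaussian 1) (\<lambda>x. ennreal (f x))) \<and>
     msupport \<nu> = UNIV"

definition interpolant ::
    "(real \<Rightarrow> real) \<Rightarrow> (real \<Rightarrow> real) \<Rightarrow> ('w \<Rightarrow> real ^ 'd) \<Rightarrow> ('w \<Rightarrow> real ^ 'd) \<Rightarrow> real \<Rightarrow> 'w \<Rightarrow> real ^ 'd" where
  "interpolant a b Z X1 t \<omega> = a t *\<^sub>R Z \<omega> + b t *\<^sub>R X1 \<omega>"

(* For 0 < t < 1, x \<mapsto> v t x is a version of E[a' Z + b' X1 | X_t = x], taken coordinatewise
   w.r.t. the sigma-algebra generated by X_t. Such versions are unique only almost everywhere;
   continuity selects the pointwise one (X_t has a positive density).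
   The endpoint values are the limits wherever these exist: for compactly supported X1 the limit
   t \<rightarrow> 1 need not exist outside the support. *)
definition velocity_field ::
    "'w measure \<Rightarrow> (real \<Rightarrow> real) \<Rightarrow> (real \<Rightarrow> real) \<Rightarrow> ('w \<Rightarrow> real ^ 'd) \<Rightarrow> ('w \<Rightarrow> real ^ 'd) \<Rightarrow>
     (real \<Rightarrow> real ^ 'd \<Rightarrow> real ^ 'd) \<Rightarrow> bool" where
  "velocity_field M a b Z X1 v \<longleftrightarrow>
     (\<forall>t\<in>{0<..<1}. continuous_on UNIV (v t) \<and>
        (\<forall>i. AE \<omega> in M. v t (interpolant a b Z X1 t \<omega>) $ i =
           real_cond_exp M (vimage_algebra (space M) (interpolant a b Z X1 t) borel)
             (\<lambda>\<omega>. (deriv a t *\<^sub>R Z \<omega> + deriv b t *\<^sub>R X1 \<omega>) $ i) \<omega>)) \<and>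
     (\<forall>x l. ((\<lambda>t. v t x) \<longlongrightarrow> l) (at_right 0) \<longrightarrow> v 0 x = l) \<and>
     (\<forall>x l. ((\<lambda>t. v t x) \<longlongrightarrow> l) (at_left 1) \<longrightarrow> v 1 x = l)"

definition flow_of ::
    "(real \<Rightarrow> real ^ 'd \<Rightarrow> real ^ 'd) \<Rightarrow> (real \<Rightarrow> real ^ 'd \<Rightarrow> real ^ 'd) \<Rightarrow> bool" where
  "flow_of w Y \<longleftrightarrow>
     (\<forall>x0. Y 0 x0 = x0 \<and>
        (\<forall>t\<in>{0..1}. ((\<lambda>s. Y s x0) has_vector_derivative w t (Y t x0)) (at t within {0..1})))"

definition couplings :: "'a::metric_space measure \<Rightarrow> 'a measure \<Rightarrow> ('a \<times> 'a) measure set" where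
  "couplings M N =
     {P. sets P = sets (borel \<Otimes>\<^sub>M borel) \<and> distr P borel fst = M \<and> distr P borel snd = N}"

definition ennreal_sqrt :: "ennreal \<Rightarrow> ennreal" where
  "ennreal_sqrt x = (if x = \<top> then \<top> else ennreal (sqrt (enn2real x)))"

definition W2 :: "'a::metric_space measure \<Rightarrow> 'a measure \<Rightarrow> ennreal" where
  "W2 M N = ennreal_sqrt (INF P\<in>couplings M N. \<integral>\<^sup>+ (x, y). ennreal ((dist x y)\<^sup>2) \<partial>P)"

definition spectral_norm :: "real ^ 'd ^ 'd \<Rightarrow> real" where
  "spectral_norm A = onorm (\<lambda>h. A *v h)"

end

theory Submission
  imports Defs
begin

text \<open>
  No flow of the field \<open>v\<close> is ever constructed. Divide \<open>[0, T]\<close>, \<open>T < 1\<close>, into short steps. At the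
  beginning of each step the pair \<open>(Z, X1)\<close> is resampled from its conditional law given the current
  position \<open>X\<close>, and during the step \<open>X\<close> follows the straight interpolation of the new pair. The law of
  \<open>X\<close> at time \<open>s\<close> is then exactly \<open>p s\<close>, while its velocity is \<open>v s X\<close> plus a noise that is centred given
  \<open>X\<close>. Run together with \<open>Y\<close> from a common starting point, the noise enters the derivative of
  \<open>E |X - Y|^2\<close> only through \<open>E (Y \<bullet> noise)\<close>, which tends to 0 with the step size, because \<open>Y\<close> depends
  on the starting point alone and the noise is continuous in time in \<open>L2\<close>. What remains is a
  Gronwall inequality: for part (i) \<open>v\<close> is one-sided Lipschitz with constant \<open>\<theta>\<close>, for part (ii) \<open>w\<close> is
  Lipschitz with constant \<open>C3\<close>. Finally \<open>T \<rightarrow> 1\<close>.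
\<close>

section \<open>Calculus of absolutely continuous functions\<close>

text \<open>Resampling is forced by a correlation: if the original pair \<open>(Z, X1)\<close> drove
  \<open>X\<close> up to time 1, its noise would in general be correlated with the starting point,
  hence with \<open>Y\<close>, and the cross term would not vanish. Just after a resampling the
  noise is centred given the whole past, and it stays nearly so for a short time. The partner term
  \<open>E (X \<bullet> noise)\<close> is exactly zero at every time, since the noise is the
  residual of a conditional expectation given \<open>X\<close>. The bound \<open>\<theta>\<close> is
  merely integrable, so Gronwall weights are absolutely continuous and need not be differentiable
  everywhere; \<open>primitive_on\<close> therefore records a derivative as an integral density
  rather than as a pointwise limit. Time 1 is excluded because \<open>a\<close> vanishes there and
  its derivative may blow up. To lose no constant in the limit, Young's inequality is absorbed by
  the weight, and the last triangle inequality is used in a form with factor \<open>1 + k\<close>,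
  where \<open>k\<close> tends to 0.\<close>

definition primitive_on :: "real \<Rightarrow> real \<Rightarrow> (real \<Rightarrow> real) \<Rightarrow> (real \<Rightarrow> real) \<Rightarrow> bool" where
  "primitive_on t t' F f \<longleftrightarrow>
     set_integrable lborel {t..t'} f \<and> (\<forall>s\<in>{t..t'}. F s = F t + (LINT r:{t..s}|lborel. f r))"

lemma set_integrable_Icc_subset:
  fixes f :: "real \<Rightarrow> 'a::{banach, second_countable_topology}"
  shows "set_integrable lborel {t..t'} f \<Longrightarrow> t \<le> s \<Longrightarrow> s' \<le> t' \<Longrightarrow> set_integrable lborel {s..s'} f"
  by (rule set_integrable_subset) auto

lemma set_integral_Icc_combine:
  fixes f :: "real \<Rightarrow> 'a::euclidean_space"
  assumes "set_integrable lborel {t..t'} f" "t \<le> s" "s \<le> t'"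
  shows "(LINT r:{t..t'}|lborel. f r) = (LINT r:{t..s}|lborel. f r) + (LINT r:{s..t'}|lborel. f r)"
proof -
  have i: "set_integrable lborel {t..s} f" "set_integrable lborel {s..t'} f"
    using assms by (auto intro: set_integrable_Icc_subset)
  show ?thesis
    unfolding set_borel_integral_eq_integral(2)[OF assms(1)]
      set_borel_integral_eq_integral(2)[OF i(1)] set_borel_integral_eq_integral(2)[OF i(2)]
    using Henstock_Kurzweil_Integration.integral_combine[OF assms(2,3) set_borel_integral_eq_integral(1)[OF assms(1)]] by simp
qed

lemma primitive_on_integrable: "primitive_on t t' F f \<Longrightarrow> set_integrable lborel {t..t'} f"
  by (simp add: primitive_on_def)

lemma primitive_on_eq:
  "primitive_on t t' F f \<Longrightarrow> t \<le> s \<Longrightarrow> s \<le> t' \<Longrightarrow> F s = F t + (LINT r:{t..s}|lborel. f r)"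
  unfolding primitive_on_def by (metis atLeastAtMost_iff)

lemma primitive_on_diff:
  assumes "primitive_on t t' F f" "t \<le> s" "s \<le> s'" "s' \<le> t'"
  shows "F s' - F s = (LINT r:{s..s'}|lborel. f r)"
proof -
  have "set_integrable lborel {t..s'} f"
    using primitive_on_integrable[OF assms(1)] assms by (auto intro: set_integrable_Icc_subset)
  from set_integral_Icc_combine[OF this assms(2,3)]
    primitive_on_eq[OF assms(1), of s] primitive_on_eq[OF assms(1), of s'] assms show ?thesis
    by linarith
qed

lemma primitive_on_subinterval:
  assumes "primitive_on t t' F f" "t \<le> s" "s' \<le> t'"
  shows "primitive_on s s' F f"
  unfolding primitive_on_def
proof (intro conjI ballI)
  show "set_integrable lborel {s..s'} f"
    using primitive_on_integrable[OF assms(1)] assms(2-) by (auto intro: set_integrable_Icc_subset)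
  fix r assume "r \<in> {s..s'}"
  with primitive_on_diff[OF assms(1), of s r] assms show "F r = F s + (LINT r:{s..r}|lborel. f r)"
    by auto
qed

lemma primitive_on_continuous:
  assumes "primitive_on t t' F f" shows "continuous_on {t..t'} F"
proof -
  have i: "set_integrable lborel {t..t'} f" using assms by (rule primitive_on_integrable)
  have "continuous_on {t..t'} (\<lambda>s. F t + integral {t..s} f)"
    by (intro continuous_intros indefinite_integral_continuous_1 set_borel_integral_eq_integral i)
  moreover have "F t + integral {t..s} f = F s" if "s \<in> {t..t'}" for s
  proof -
    have "set_integrable lborel {t..s} f" using i that by (auto intro: set_integrable_Icc_subset)
    from set_borel_integral_eq_integral(2)[OF this] show ?thesis
      using primitive_on_eq[OF assms, of s] that by simp
  qed
  ultimately show ?thesis by (rule continuous_on_eq)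
qed

text \<open>The fundamental theorem for the Henstock-Kurzweil integral asks for no continuity of
  \<open>f\<close>; Lebesgue integrability then identifies the two integrals. This matters for the
  flow \<open>Y\<close>, whose velocity along a path is only measurable in time.\<close>

lemma primitive_on_deriv:
  assumes d: "\<And>s. s \<in> {t..t'} \<Longrightarrow> (F has_real_derivative f s) (at s within {t..t'})"
    and i: "set_integrable lborel {t..t'} f"
  shows "primitive_on t t' F f"
  unfolding primitive_on_def
proof (intro conjI ballI i)
  fix s assume s: "s \<in> {t..t'}"
  have "(f has_integral (F s - F t)) {t..s}"
  proof (rule fundamental_theorem_of_calculus)
    show "t \<le> s" using s by simp
    fix x assume "x \<in> {t..s}"
    then have "(F has_real_derivative f x) (at x within {t..s})"
      using s by (intro DERIV_subset[OF d]) auto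
    then show "(F has_vector_derivative f x) (at x within {t..s})"
      by (simp add: has_real_derivative_iff_has_vector_derivative)
  qed
  moreover have "set_integrable lborel {t..s} f" using i s by (auto intro: set_integrable_Icc_subset)
  ultimately show "F s = F t + (LINT r:{t..s}|lborel. f r)"
    using set_borel_integral_eq_integral(2)[of "{t..s}" f] by (auto dest: integral_unique)
qed

lemma primitive_on_add:
  assumes "primitive_on t t' F f" "primitive_on t t' G g"
  shows "primitive_on t t' (\<lambda>s. F s + G s) (\<lambda>s. f s + g s)"
  unfolding primitive_on_def
proof (intro conjI ballI)
  show "set_integrable lborel {t..t'} (\<lambda>s. f s + g s)"
    using assms[THEN primitive_on_integrable] by (rule set_integral_add(1))
  fix s assume s: "s \<in> {t..t'}"
  have "set_integrable lborel {t..s} f" "set_integrable lborel {t..s} g"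
    using assms[THEN primitive_on_integrable] s by (auto intro: set_integrable_Icc_subset)
  from set_integral_add(2)[OF this]
  show "F s + G s = F t + G t + (LINT r:{t..s}|lborel. f r + g r)"
    using assms[THEN primitive_on_eq, of s] s by simp
qed

lemma primitive_on_cmult:
  assumes "primitive_on t t' F f"
  shows "primitive_on t t' (\<lambda>s. c * F s) (\<lambda>s. c * f s)"
  unfolding primitive_on_def
proof (intro conjI ballI)
  show "set_integrable lborel {t..t'} (\<lambda>s. c * f s)"
    by (rule set_integrable_mult_right[OF primitive_on_integrable[OF assms]])
  fix s assume "s \<in> {t..t'}"
  then have "F s = F t + (LINT r:{t..s}|lborel. f r)" by (intro primitive_on_eq[OF assms]) auto
  then show "c * F s = c * F t + (LINT r:{t..s}|lborel. c * f r)"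
    by (simp only: distrib_left set_integral_mult_right)
qed

lemma set_integrable_continuous_mult:
  fixes f g :: "real \<Rightarrow> real"
  assumes f: "set_integrable lborel {t..t'} f" and g: "continuous_on {t..t'} g"
  shows "set_integrable lborel {t..t'} (\<lambda>s. g s * f s)"
proof -
  have "bounded (g ` {t..t'})" using g compact_continuous_image compact_imp_bounded compact_Icc by blast
  then obtain B where B: "\<And>s. s \<in> {t..t'} \<Longrightarrow> \<bar>g s\<bar> \<le> B" unfolding bounded_iff by (metis imageI real_norm_def)
  have gm: "(\<lambda>s. indicator {t..t'} s *\<^sub>R g s) \<in> borel_measurable lborel"
    using borel_measurable_continuous_on_indicator[OF _ g] by simp
  have fm: "(\<lambda>s. indicator {t..t'} s *\<^sub>R f s) \<in> borel_measurable lborel"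
    using f by (auto simp: set_integrable_def)
  have "integrable lborel (\<lambda>s. (indicator {t..t'} s *\<^sub>R g s) * (indicator {t..t'} s *\<^sub>R f s))"
  proof (rule Bochner_Integration.integrable_bound)
    show "integrable lborel (\<lambda>s. B * (indicator {t..t'} s *\<^sub>R f s))"
      using f by (auto simp: set_integrable_def)
    show "AE s in lborel. norm ((indicator {t..t'} s *\<^sub>R g s) * (indicator {t..t'} s *\<^sub>R f s))
        \<le> norm (B * (indicator {t..t'} s *\<^sub>R f s))"
      using B by (auto simp: abs_mult indicator_def intro!: mult_right_mono order_trans[OF B abs_ge_self])
  qed (use gm fm in measurable)
  moreover have "(\<lambda>s. (indicator {t..t'} s *\<^sub>R g s) * (indicator {t..t'} s *\<^sub>R f s))
      = (\<lambda>s. indicator {t..t'} s *\<^sub>R (g s * f s))"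
    by (auto simp: indicator_def)
  ultimately show ?thesis by (simp add: set_integrable_def)
qed

text \<open>Cut \<open>[t, s]\<close> into equal pieces shorter than \<open>d\<close> and telescope:
  the total change of \<open>H\<close> is at most \<open>e\<close> times that of the control
  function \<open>A\<close>, for every \<open>e\<close>. This takes the place of the argument that
  an absolutely continuous function with zero derivative almost everywhere is constant.\<close>

lemma eq_of_small_increments:
  fixes H A :: "real \<Rightarrow> real"
  assumes F: "\<And>e. e > 0 \<Longrightarrow> \<exists>d>0. \<forall>s s'. t \<le> s \<longrightarrow> s \<le> s' \<longrightarrow> s' \<le> t' \<longrightarrow> s' - s < d \<longrightarrow>
       \<bar>H s' - H s\<bar> \<le> e * (A s' - A s)"
    and "t \<le> s" "s \<le> t'"
  shows "H s = H t"
proof (rule ccontr)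
  assume ne: "H s \<noteq> H t"
  \<comment> \<open>With this \<open>e\<close> the telescoped bound is at most half of the nonzero
    gap; the \<open>+ 1\<close> keeps the denominator positive when
    \<open>A s = A t\<close>.\<close>
  define e where "e = \<bar>H s - H t\<bar> / (2 * (\<bar>A s - A t\<bar> + 1))"
  have pos: "0 < 2 * (\<bar>A s - A t\<bar> + 1)" by (simp add: add_nonneg_pos)
  then have e: "e > 0" using ne by (simp add: e_def)
  from F[OF this] obtain d where d: "d > 0"
    "\<And>s s'. t \<le> s \<Longrightarrow> s \<le> s' \<Longrightarrow> s' \<le> t' \<Longrightarrow> s' - s < d \<Longrightarrow> \<bar>H s' - H s\<bar> \<le> e * (A s' - A s)"
    by blast
  obtain N :: nat where N: "(s - t) / d < real N" using reals_Archimedean2 by blast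
  have N0: "N > 0" using N assms d by (cases N) (auto simp: field_simps)
  define h where "h = (s - t) / N"
  have h: "0 \<le> h" "h < d" using N N0 d assms by (auto simp: h_def field_simps)
  have Nh: "t + real N * h = s" using N0 by (auto simp: h_def)
  have "k \<le> N \<Longrightarrow> \<bar>H (t + real k * h) - H t\<bar> \<le> e * (A (t + real k * h) - A t)" for k
  proof (induction k)
    case (Suc k)
    have "t + real (Suc k) * h \<le> s"
      unfolding Nh[symmetric] using Suc.prems h by (intro add_left_mono mult_right_mono) auto
    then have "t + real (Suc k) * h \<le> t'" using assms by simp
    then have "\<bar>H (t + real (Suc k) * h) - H (t + real k * h)\<bar>
       \<le> e * (A (t + real (Suc k) * h) - A (t + real k * h))"
      using h by (intro d(2)) (auto simp: algebra_simps)
    with Suc show ?case by (auto simp: algebra_simps)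
  qed simp
  from this[of N] have "\<bar>H s - H t\<bar> \<le> e * (A s - A t)" by (simp add: Nh)
  also have "\<dots> \<le> e * \<bar>A s - A t\<bar>" using e by (intro mult_left_mono) auto
  also have "\<dots> < e * (2 * (\<bar>A s - A t\<bar> + 1))" using e pos by (intro mult_strict_left_mono) auto
  also have "\<dots> = \<bar>H s - H t\<bar>" using pos by (simp add: e_def)
  finally show False by simp
qed

text \<open>On a short interval the increment of \<open>\<phi> \<circ> F\<close> is
  \<open>\<phi>' (F \<sigma>)\<close> times that of \<open>F\<close>. Uniform continuity of
  \<open>\<phi>' \<circ> F\<close> makes this differ from the integral of
  \<open>\<phi>' (F r) * f r\<close> by at most \<open>e\<close> times the integral of
  \<open>\<bar>f r\<bar>\<close>, so \<open>eq_of_small_increments\<close> applies with that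
  integral as control function.\<close>

lemma primitive_on_chain:
  fixes \<phi> \<phi>' :: "real \<Rightarrow> real"
  assumes F: "primitive_on t t' F f"
    and \<phi>: "\<And>x. (\<phi> has_real_derivative \<phi>' x) (at x)" and c: "continuous_on UNIV \<phi>'"
  shows "primitive_on t t' (\<lambda>s. \<phi> (F s)) (\<lambda>s. \<phi>' (F s) * f s)"
proof -
  have fi: "set_integrable lborel {t..t'} f" using F by (rule primitive_on_integrable)
  have Fc: "continuous_on {t..t'} F" by (rule primitive_on_continuous[OF F])
  have gc: "continuous_on {t..t'} (\<lambda>s. \<phi>' (F s))"
    by (rule continuous_on_compose2[OF c Fc]) auto
  have gi: "set_integrable lborel {t..t'} (\<lambda>s. \<phi>' (F s) * f s)"
    by (rule set_integrable_continuous_mult[OF fi gc])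
  define A where "A s = (LINT r:{t..s}|lborel. \<bar>f r\<bar>)" for s
  define I where "I s = (LINT r:{t..s}|lborel. \<phi>' (F r) * f r)" for s
  have uc: "uniformly_continuous_on {t..t'} (\<lambda>s. \<phi>' (F s))"
    by (intro compact_uniformly_continuous gc compact_Icc)
  have eq: "\<phi> (F s) - I s = \<phi> (F t) - I t" if "t \<le> s" "s \<le> t'" for s
  proof (rule eq_of_small_increments[OF _ that, where A = A and H = "\<lambda>s. \<phi> (F s) - I s"])
    fix e :: real assume e: "e > 0"
    from uniformly_continuous_onE[OF uc e] obtain d where d: "d > 0"
      "\<And>s s'. s \<in> {t..t'} \<Longrightarrow> s' \<in> {t..t'} \<Longrightarrow> dist s' s < d \<Longrightarrow> dist (\<phi>' (F s')) (\<phi>' (F s)) < e"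
      by metis
    show "\<exists>d>0. \<forall>s s'. t \<le> s \<longrightarrow> s \<le> s' \<longrightarrow> s' \<le> t' \<longrightarrow> s' - s < d \<longrightarrow>
       \<bar>(\<phi> (F s') - I s') - (\<phi> (F s) - I s)\<bar> \<le> e * (A s' - A s)"
    proof (intro exI[of _ d] conjI d(1) allI impI)
      fix s s' assume s: "t \<le> s" "s \<le> s'" "s' \<le> t'" "s' - s < d"
      have i: "set_integrable lborel {s..s'} f" "set_integrable lborel {s..s'} (\<lambda>s. \<phi>' (F s) * f s)"
        using s fi gi by (auto intro: set_integrable_Icc_subset)
      \<comment> \<open>The mean value theorem yields an intermediate value \<open>z\<close> between
        \<open>F s\<close> and \<open>F s'\<close>; by continuity of \<open>F\<close> it is attained
        at some time \<open>\<sigma>\<close> of the same interval, where the modulus of continuity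
        of \<open>\<phi>' \<circ> F\<close> can be used.\<close>
      have "\<exists>\<sigma>\<in>{s..s'}. \<phi> (F s') - \<phi> (F s) = (F s' - F s) * \<phi>' (F \<sigma>)"
      proof -
        have cs: "continuous_on {s..s'} F" using Fc s by (auto intro: continuous_on_subset)
        consider "F s < F s'" | "F s > F s'" | "F s = F s'" by linarith
        then show ?thesis
        proof cases
          case 1
          from MVT2[OF 1 \<phi>] obtain z where z: "F s < z" "z < F s'"
            "\<phi> (F s') - \<phi> (F s) = (F s' - F s) * \<phi>' z" by blast
          with IVT'[of F s z s'] cs s obtain \<sigma> where "\<sigma> \<in> {s..s'}" "F \<sigma> = z" by auto
          with z show ?thesis by auto
        next
          case 2
          from MVT2[OF 2 \<phi>] obtain z where z: "F s' < z" "z < F s"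
            "\<phi> (F s) - \<phi> (F s') = (F s - F s') * \<phi>' z" by blast
          with IVT2'[of F s' z s] cs s obtain \<sigma> where "\<sigma> \<in> {s..s'}" "F \<sigma> = z" by auto
          with z show ?thesis by (intro bexI[of _ \<sigma>]) (auto simp: algebra_simps)
        next
          case 3 then show ?thesis using s by auto
        qed
      qed
      then obtain \<sigma> where \<sigma>: "\<sigma> \<in> {s..s'}" "\<phi> (F s') - \<phi> (F s) = (F s' - F s) * \<phi>' (F \<sigma>)" by blast
      have "I s' - I s = (LINT r:{s..s'}|lborel. \<phi>' (F r) * f r)"
        unfolding I_def using set_integral_Icc_combine[OF set_integrable_Icc_subset[OF gi], of t s' s] s
        by simp
      moreover have "F s' - F s = (LINT r:{s..s'}|lborel. f r)"
        using primitive_on_diff[OF F] s by simp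
      ultimately have "(\<phi> (F s') - I s') - (\<phi> (F s) - I s) =
          (LINT r:{s..s'}|lborel. f r * \<phi>' (F \<sigma>)) - (LINT r:{s..s'}|lborel. \<phi>' (F r) * f r)"
        using \<sigma> by simp
      also have "\<dots> = (LINT r:{s..s'}|lborel. f r * \<phi>' (F \<sigma>) - \<phi>' (F r) * f r)"
        by (rule set_integral_diff(2)[symmetric]) (use i in auto)
      finally have eq': "(\<phi> (F s') - I s') - (\<phi> (F s) - I s) =
         (LINT r:{s..s'}|lborel. f r * \<phi>' (F \<sigma>) - \<phi>' (F r) * f r)" .
      have i2: "set_integrable lborel {s..s'} (\<lambda>r. f r * \<phi>' (F \<sigma>) - \<phi>' (F r) * f r)"
        by (rule set_integral_diff(1)) (use i in auto)
      have "\<bar>LINT r:{s..s'}|lborel. f r * \<phi>' (F \<sigma>) - \<phi>' (F r) * f r\<bar>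
          \<le> (LINT r:{s..s'}|lborel. \<bar>f r * \<phi>' (F \<sigma>) - \<phi>' (F r) * f r\<bar>)"
        using integral_abs_bound[of lborel "\<lambda>r. indicator {s..s'} r *\<^sub>R (f r * \<phi>' (F \<sigma>) - \<phi>' (F r) * f r)"]
        by (simp add: abs_mult set_lebesgue_integral_def)
      also have "\<dots> \<le> (LINT r:{s..s'}|lborel. e * \<bar>f r\<bar>)"
      proof (rule set_integral_mono)
        fix r assume r: "r \<in> {s..s'}"
        have "dist (\<phi>' (F \<sigma>)) (\<phi>' (F r)) < e"
          using r \<sigma> s by (intro d(2)) (auto simp: dist_real_def)
        then have "\<bar>\<phi>' (F \<sigma>) - \<phi>' (F r)\<bar> * \<bar>f r\<bar> \<le> e * \<bar>f r\<bar>"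
          by (intro mult_right_mono) (auto simp: dist_real_def)
        then show "\<bar>f r * \<phi>' (F \<sigma>) - \<phi>' (F r) * f r\<bar> \<le> e * \<bar>f r\<bar>"
          by (simp add: abs_mult[symmetric] algebra_simps)
      qed (use i i2 in \<open>auto intro: set_integrable_abs\<close>)
      also have "\<dots> = e * (A s' - A s)"
        unfolding A_def
        using set_integral_Icc_combine[OF set_integrable_Icc_subset[OF set_integrable_abs[OF fi]], of t s' s] s
        by simp
      finally show "\<bar>(\<phi> (F s') - I s') - (\<phi> (F s) - I s)\<bar> \<le> e * (A s' - A s)" unfolding eq' .
    qed
  qed
  have I0: "I t = 0"
    unfolding I_def using set_borel_integral_eq_integral(2)[of "{t..t}" "\<lambda>r. \<phi>' (F r) * f r"]
      set_borel_integrable_singleton by simp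
  have "\<phi> (F s) = \<phi> (F t) + I s" if "s \<in> {t..t'}" for s
    using eq[of s] that I0 by simp
  then show ?thesis unfolding primitive_on_def I_def[symmetric] using gi by blast
qed

text \<open>Polarisation reduces the product to two squares, and a square is the chain rule for
  \<open>x\<^sup>2\<close>.\<close>

lemma primitive_on_mult:
  assumes F: "primitive_on t t' F f" and G: "primitive_on t t' G g"
  shows "primitive_on t t' (\<lambda>s. F s * G s) (\<lambda>s. f s * G s + F s * g s)"
proof -
  have sq: "primitive_on t t' (\<lambda>s. (H s)\<^sup>2) (\<lambda>s. 2 * H s * h s)" if "primitive_on t t' H h" for H h
    by (rule primitive_on_chain[OF that]) (auto intro!: derivative_eq_intros continuous_intros)
  have "primitive_on t t'
      (\<lambda>s. (1/4) * (F s + G s)\<^sup>2 + (-1/4) * (F s + (-1) * G s)\<^sup>2)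
      (\<lambda>s. (1/4) * (2 * (F s + G s) * (f s + g s)) + (-1/4) * (2 * (F s + (-1) * G s) * (f s + (-1) * g s)))"
    by (intro primitive_on_add primitive_on_cmult sq F G)
  moreover have "(1/4) * (F s + G s)\<^sup>2 + (-1/4) * (F s + (-1) * G s)\<^sup>2 = F s * G s" for s
    by (simp add: power2_eq_square algebra_simps)
  moreover have "(1/4) * (2 * (F s + G s) * (f s + g s)) + (-1/4) * (2 * (F s + (-1) * G s) * (f s + (-1) * g s))
      = f s * G s + F s * g s" for s
    by (simp add: algebra_simps)
  ultimately show ?thesis by simp
qed

section \<open>Energy estimate with a Riccati weight\<close>

lemma set_integrable_continuous_inner:
  fixes D d :: "real \<Rightarrow> 'a::euclidean_space"
  assumes d: "set_integrable lborel {t..t'} d" and D: "continuous_on {t..t'} D"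
  shows "set_integrable lborel {t..t'} (\<lambda>s. D s \<bullet> d s)"
proof -
  have "bounded (D ` {t..t'})" using D compact_continuous_image compact_imp_bounded compact_Icc by blast
  then obtain B where B: "\<And>s. s \<in> {t..t'} \<Longrightarrow> norm (D s) \<le> B" unfolding bounded_iff by (metis imageI)
  have Dm: "(\<lambda>s. indicator {t..t'} s *\<^sub>R D s) \<in> borel_measurable lborel"
    using borel_measurable_continuous_on_indicator[OF _ D] by simp
  have dm: "(\<lambda>s. indicator {t..t'} s *\<^sub>R d s) \<in> borel_measurable lborel"
    using d by (auto simp: set_integrable_def)
  have "integrable lborel (\<lambda>s. (indicator {t..t'} s *\<^sub>R D s) \<bullet> (indicator {t..t'} s *\<^sub>R d s))"
  proof (rule Bochner_Integration.integrable_bound)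
    show "integrable lborel (\<lambda>s. B *\<^sub>R (indicator {t..t'} s *\<^sub>R d s))"
      using d unfolding set_integrable_def by (rule integrable_scaleR_right)
    show "AE s in lborel. norm ((indicator {t..t'} s *\<^sub>R D s) \<bullet> (indicator {t..t'} s *\<^sub>R d s))
        \<le> norm (B *\<^sub>R (indicator {t..t'} s *\<^sub>R d s))"
    proof (intro AE_I2)
      fix s show "norm ((indicator {t..t'} s *\<^sub>R D s) \<bullet> (indicator {t..t'} s *\<^sub>R d s))
        \<le> norm (B *\<^sub>R (indicator {t..t'} s *\<^sub>R d s))"
      proof (cases "s \<in> {t..t'}")
        case True
        have "norm (D s \<bullet> d s) \<le> norm (D s) * norm (d s)"
          using Cauchy_Schwarz_ineq2 by (simp add: abs_le_iff)
        also have "\<dots> \<le> \<bar>B\<bar> * norm (d s)" using B[OF True] by (intro mult_right_mono) auto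
        finally show ?thesis using True by simp
      qed simp
    qed
  qed (use Dm dm in measurable)
  moreover have "(\<lambda>s. (indicator {t..t'} s *\<^sub>R D s) \<bullet> (indicator {t..t'} s *\<^sub>R d s))
      = (\<lambda>s. indicator {t..t'} s *\<^sub>R (D s \<bullet> d s))"
    by (auto simp: indicator_def)
  ultimately show ?thesis by (simp add: set_integrable_def)
qed

lemma set_integrable_continuous_Icc:
  fixes f :: "real \<Rightarrow> 'a::{banach, second_countable_topology}"
  shows "continuous_on {t..t'} f \<Longrightarrow> set_integrable lborel {t..t'} f"
  unfolding set_integrable_def by (rule borel_integrable_compact) auto

text \<open>In the derivative of \<open>W * (norm D)\<^sup>2\<close> the hypothesis on
  \<open>D s \<bullet> d s\<close> cancels the \<open>l\<close> terms, and the
  \<open>W\<^sup>2\<close> term of the Riccati equation pays for \<open>2 * W * norm D * r\<close>.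
  The remainder \<open>g\<close> is kept linear and unsigned: it will be the noise, which is small
  only in expectation, so no absolute value may be taken at this stage.\<close>

lemma weighted_energy_le:
  fixes D d :: "real \<Rightarrow> 'a::euclidean_space" and W l g r :: "real \<Rightarrow> real"
  assumes tt: "t \<le> t'"
    and D: "\<And>s. s \<in> {t..t'} \<Longrightarrow> (D has_vector_derivative d s) (at s within {t..t'})"
    and d: "set_integrable lborel {t..t'} d"
    and W: "primitive_on t t' W (\<lambda>s. - (2 * l s * W s + (W s)\<^sup>2))"
    and W0: "\<And>s. s \<in> {t..t'} \<Longrightarrow> W s \<ge> 0"
    and i: "set_integrable lborel {t..t'} (\<lambda>s. (r s)\<^sup>2 + 2 * W s * g s)"
    and ineq: "AE s in lborel. s \<in> {t..t'} \<longrightarrow>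
      D s \<bullet> d s \<le> l s * (norm (D s))\<^sup>2 + norm (D s) * r s + g s"
  shows "W t' * (norm (D t'))\<^sup>2 \<le> W t * (norm (D t))\<^sup>2 + (LINT s:{t..t'}|lborel. (r s)\<^sup>2 + 2 * W s * g s)"
proof -
  have Dc: "continuous_on {t..t'} D"
    unfolding continuous_on_eq_continuous_within
    using has_vector_derivative_continuous[OF D] by blast
  have Di: "set_integrable lborel {t..t'} (\<lambda>s. D s \<bullet> d s)"
    by (rule set_integrable_continuous_inner[OF d Dc])
  have P: "primitive_on t t' (\<lambda>s. (norm (D s))\<^sup>2) (\<lambda>s. 2 * (D s \<bullet> d s))"
  proof (rule primitive_on_deriv)
    fix s assume s: "s \<in> {t..t'}"
    have "((\<lambda>s. D s \<bullet> D s) has_derivative (\<lambda>h. D s \<bullet> (h *\<^sub>R d s) + (h *\<^sub>R d s) \<bullet> D s)) (at s within {t..t'})"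
      using D[OF s] unfolding has_vector_derivative_def by (intro has_derivative_inner)
    then show "((\<lambda>s. (norm (D s))\<^sup>2) has_real_derivative 2 * (D s \<bullet> d s)) (at s within {t..t'})"
      unfolding has_field_derivative_def power2_norm_eq_inner
      by (rule has_derivative_eq_rhs) (auto simp: inner_commute)
  qed (use set_integrable_mult_right[of 2 lborel _ "\<lambda>s. D s \<bullet> d s"] Di in auto)
  have PW: "primitive_on t t' (\<lambda>s. W s * (norm (D s))\<^sup>2)
     (\<lambda>s. - (2 * l s * W s + (W s)\<^sup>2) * (norm (D s))\<^sup>2 + W s * (2 * (D s \<bullet> d s)))"
    by (rule primitive_on_mult[OF W P])
  have "W t' * (norm (D t'))\<^sup>2 - W t * (norm (D t))\<^sup>2 =
     (LINT s:{t..t'}|lborel. - (2 * l s * W s + (W s)\<^sup>2) * (norm (D s))\<^sup>2 + W s * (2 * (D s \<bullet> d s)))"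
    using primitive_on_diff[OF PW, of t t'] tt by simp
  also have "\<dots> \<le> (LINT s:{t..t'}|lborel. (r s)\<^sup>2 + 2 * W s * g s)"
  proof (rule set_integral_mono_AE[OF primitive_on_integrable[OF PW] i])
    show "AE s\<in>{t..t'} in lborel. - (2 * l s * W s + (W s)\<^sup>2) * (norm (D s))\<^sup>2 + W s * (2 * (D s \<bullet> d s))
        \<le> (r s)\<^sup>2 + 2 * W s * g s"
      using ineq
    proof eventually_elim
      case (elim s)
      show ?case
      proof
        assume s: "s \<in> {t..t'}"
        have "W s * (2 * (D s \<bullet> d s)) \<le> W s * (2 * (l s * (norm (D s))\<^sup>2 + norm (D s) * r s + g s))"
          using elim s W0[OF s] by (intro mult_left_mono) auto
        moreover have "0 \<le> (W s * norm (D s) - r s)\<^sup>2" by simp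
        ultimately show "- (2 * l s * W s + (W s)\<^sup>2) * (norm (D s))\<^sup>2 + W s * (2 * (D s \<bullet> d s))
           \<le> (r s)\<^sup>2 + 2 * W s * g s"
          by (simp add: power2_eq_square algebra_simps)
      qed
    qed
  qed
  finally show ?thesis by simp
qed

text \<open>With the Riccati equation \<open>W' = - 2 l W - W^2\<close>, Young's inequality in the form
  \<open>2 W |D| r \<le> W^2 |D|^2 + r^2\<close> costs nothing: \<open>1 / W\<close> at time 1 tends to the sharp factor
  \<open>\<integral> exp (2 \<integral> l)\<close> as \<open>\<eta> \<rightarrow> 0\<close>. The parameter \<open>\<eta>\<close> removes the singularity of \<open>W\<close> at time 0.\<close>

definition weight :: "(real \<Rightarrow> real) \<Rightarrow> real \<Rightarrow> real \<Rightarrow> real" where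
  "weight l \<eta> s = exp (- 2 * (LINT r:{0..s}|lborel. l r)) /
     (\<eta> + (LINT u:{0..s}|lborel. exp (- 2 * (LINT r:{0..u}|lborel. l r))))"

lemma LINT_singleton: "(LINT r:{t}|lborel. f r) = (0::real)" for t :: real
  using set_borel_integral_eq_integral(2)[of "{t}" f] set_borel_integrable_singleton by simp

lemma primitive_on_LINT:
  assumes "set_integrable lborel {t..t'} f"
  shows "primitive_on t t' (\<lambda>s. LINT r:{t..s}|lborel. f r) f"
  unfolding primitive_on_def using assms by (simp add: LINT_singleton)

context
  fixes l :: "real \<Rightarrow> real" and \<eta> :: real
  assumes l: "set_integrable lborel {0..1} l" and \<eta>: "\<eta> > 0"
begin

private definition "L s = (LINT r:{0..s}|lborel. l r)"
private definition "G s = (LINT u:{0..s}|lborel. exp (- 2 * L u))"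

private lemma L: "primitive_on 0 1 L l"
  using primitive_on_LINT[OF l] by (simp add: L_def[abs_def])

private lemma expL_cont: "continuous_on {0..1} (\<lambda>u. exp (- 2 * L u))"
  by (intro continuous_intros primitive_on_continuous[OF L])

private lemma G_nonneg: "s \<in> {0..1} \<Longrightarrow> G s \<ge> 0"
  unfolding G_def set_lebesgue_integral_def by (intro integral_nonneg_AE) auto

private lemma G_deriv:
  assumes s: "s \<in> {0..1}"
  shows "(G has_real_derivative exp (- 2 * L s)) (at s within {0..1})"
proof -
  have D: "((\<lambda>s. integral {0..s} (\<lambda>u. exp (- 2 * L u))) has_real_derivative exp (- 2 * L s)) (at s within {0..1})"
    by (rule integral_has_real_derivative[OF expL_cont s])
  have eq: "G s = integral {0..s} (\<lambda>u. exp (- 2 * L u))" if "s \<in> {0..1}" for s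
    unfolding G_def using that
    by (intro set_borel_integral_eq_integral(2) set_integrable_continuous_Icc
        continuous_on_subset[OF expL_cont]) auto
  show ?thesis
    unfolding has_real_derivative_iff_has_vector_derivative
    by (rule has_vector_derivative_transform[OF s _ D[unfolded has_real_derivative_iff_has_vector_derivative]])
       (rule eq)
qed

lemma weight_pos: "s \<in> {0..1} \<Longrightarrow> weight l \<eta> s > 0"
  using G_nonneg[of s] \<eta> by (auto simp: weight_def G_def L_def intro!: divide_pos_pos add_pos_nonneg)

text \<open>Written as \<open>exp (- (2 * L + ln (\<eta> + G)))\<close>, with
  \<open>G' = exp (- 2 * L)\<close>, the weight has logarithmic derivative
  \<open>- 2 * l - W\<close>, because \<open>G' / (\<eta> + G)\<close> is \<open>W\<close> itself.
  \<open>G\<close> is continuously differentiable, whereas \<open>L\<close> is only absolutely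
  continuous; hence the chain rule for \<open>primitive_on\<close>.\<close>

lemma weight_primitive:
  "primitive_on 0 1 (weight l \<eta>) (\<lambda>s. - (2 * l s * weight l \<eta> s + (weight l \<eta> s)\<^sup>2))"
proof -
  have W: "weight l \<eta> s = exp (- 2 * L s) / (\<eta> + G s)" for s by (simp add: weight_def G_def L_def)
  have pos: "\<eta> + G s > 0" if "s \<in> {0..1}" for s using G_nonneg[OF that] \<eta> by simp
  have Gc: "continuous_on {0..1} G"
    by (rule DERIV_continuous_on[OF G_deriv])
  have lnG: "primitive_on 0 1 (\<lambda>s. ln (\<eta> + G s)) (\<lambda>s. exp (- 2 * L s) / (\<eta> + G s))"
  proof (rule primitive_on_deriv)
    fix s :: real assume s: "s \<in> {0..1}"
    show "((\<lambda>s. ln (\<eta> + G s)) has_real_derivative exp (- 2 * L s) / (\<eta> + G s)) (at s within {0..1})"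
      by (rule derivative_eq_intros G_deriv s refl pos[OF s])+ simp
  next
    show "set_integrable lborel {0..1} (\<lambda>s. exp (- 2 * L s) / (\<eta> + G s))"
      by (intro set_integrable_continuous_Icc continuous_intros expL_cont[simplified] Gc primitive_on_continuous[OF L])
         (use pos in force)
  qed
  have "primitive_on 0 1 (\<lambda>s. exp (- 1 * (2 * L s + ln (\<eta> + G s))))
     (\<lambda>s. exp (- 1 * (2 * L s + ln (\<eta> + G s))) * (- 1 * (2 * l s + exp (- 2 * L s) / (\<eta> + G s))))"
    by (rule primitive_on_chain[where \<phi> = exp and \<phi>' = exp], intro primitive_on_cmult primitive_on_add lnG L)
       (auto intro!: continuous_intros)
  moreover have e: "exp (- 1 * (2 * L s + ln (\<eta> + G s))) = weight l \<eta> s" if "s \<in> {0..1}" for s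
    using pos[OF that] by (simp add: W exp_diff exp_minus field_simps)
  ultimately have P: "primitive_on 0 1 (\<lambda>s. exp (- 1 * (2 * L s + ln (\<eta> + G s))))
     (\<lambda>s. exp (- 1 * (2 * L s + ln (\<eta> + G s))) * (- 1 * (2 * l s + weight l \<eta> s)))"
    by (simp add: W)
  have c: "set_integrable lborel {0..1} (\<lambda>s. exp (- 1 * (2 * L s + ln (\<eta> + G s))) * (- 1 * (2 * l s + weight l \<eta> s)))
     = set_integrable lborel {0..1} (\<lambda>s. - (2 * l s * weight l \<eta> s + (weight l \<eta> s)\<^sup>2))"
    by (rule set_integrable_cong) (use e in \<open>auto simp: power2_eq_square algebra_simps\<close>)
  show ?thesis
    unfolding primitive_on_def
  proof (intro conjI ballI)
    show "set_integrable lborel {0..1} (\<lambda>s. - (2 * l s * weight l \<eta> s + (weight l \<eta> s)\<^sup>2))"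
      using primitive_on_integrable[OF P] c by simp
    fix s :: real assume s: "s \<in> {0..1}"
    have "(LINT r:{0..s}|lborel. exp (- 1 * (2 * L r + ln (\<eta> + G r))) * (- 1 * (2 * l r + weight l \<eta> r)))
       = (LINT r:{0..s}|lborel. - (2 * l r * weight l \<eta> r + (weight l \<eta> r)\<^sup>2))"
      by (rule set_lebesgue_integral_cong) (use s e in \<open>auto simp: power2_eq_square algebra_simps\<close>)
    then show "weight l \<eta> s = weight l \<eta> 0 + (LINT r:{0..s}|lborel. - (2 * l r * weight l \<eta> r + (weight l \<eta> r)\<^sup>2))"
      using primitive_on_eq[OF P, of s] s e[of s] e[of 0] by simp
  qed
qed

lemma weight_continuous: "continuous_on {0..1} (weight l \<eta>)"
  by (rule primitive_on_continuous[OF weight_primitive])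

text \<open>\<open>exp (2 * L 1) * exp (- 2 * L s)\<close> is the exponential of twice the integral
  of \<open>l\<close> over \<open>[s, 1]\<close>, so the denominator of the weight turns into the
  constant of the final estimate, up to a term that vanishes with \<open>\<eta>\<close>.\<close>

lemma inverse_weight_1:
  "inverse (weight l \<eta> 1) = \<eta> * exp (2 * (LINT r:{0..1}|lborel. l r))
     + (LINT s:{0..1}|lborel. exp (2 * (LINT u:{s..1}|lborel. l u)))"
proof -
  have "(LINT s:{0..1}|lborel. exp (2 * (LINT u:{s..1}|lborel. l u))) = (LINT s:{0..1}|lborel. exp (2 * L 1) * exp (- 2 * L s))"
  proof (rule set_lebesgue_integral_cong)
    show "\<forall>s. s \<in> {0..1} \<longrightarrow> exp (2 * (LINT u:{s..1}|lborel. l u)) = exp (2 * L 1) * exp (- 2 * L s)"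
      using primitive_on_diff[OF L, of _ 1]
      by (auto simp: exp_add[symmetric] algebra_simps)
  qed simp
  also have "\<dots> = exp (2 * L 1) * G 1" by (simp add: G_def)
  finally show ?thesis
    by (simp add: weight_def G_def L_def exp_minus field_simps)
qed

end

section \<open>The standard Gaussian measure\<close>

lemma nn_integral_lborel_affine:
  fixes f :: "'a::euclidean_space \<Rightarrow> ennreal"
  assumes [measurable]: "f \<in> borel_measurable borel" and c: "c \<noteq> 0"
  shows "(\<integral>\<^sup>+x. f x \<partial>lborel) = ennreal (\<bar>c\<bar> ^ DIM('a)) * (\<integral>\<^sup>+x. f (t + c *\<^sub>R x) \<partial>lborel)"
  by (subst lborel_affine[OF c, of t])
     (simp add: nn_integral_density nn_integral_distr nn_integral_cmult ennreal_power)

definition gauss_const :: "'d::finite itself \<Rightarrow> real" where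
  "gauss_const _ = (1 / sqrt (2 * pi)) ^ CARD('d)"

lemma gauss_const_pos: "gauss_const TYPE('d::finite) > 0"
  by (simp add: gauss_const_def)

lemma gaussian_1_density:
  "(gaussian 1 :: (real ^ 'd) measure) =
     density lborel (\<lambda>z. ennreal (gauss_const TYPE('d) * exp (- (norm z)\<^sup>2 / 2)))"
proof -
  have "(\<Prod>i\<in>UNIV. normal_density 0 1 (z $ i)) = gauss_const TYPE('d) * exp (- (norm z)\<^sup>2 / 2)"
    for z :: "real ^ 'd"
  proof -
    have "(\<Prod>i\<in>UNIV. normal_density 0 1 (z $ i)) =
        (\<Prod>i\<in>(UNIV::'d set). (1 / sqrt (2 * pi)) * exp (- (z $ i)\<^sup>2 / 2))"
      by (intro prod.cong) (auto simp: normal_density_def)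
    also have "\<dots> = gauss_const TYPE('d) * exp (\<Sum>i\<in>UNIV. - (z $ i)\<^sup>2 / 2)"
      by (simp only: prod.distrib prod_constant gauss_const_def exp_sum finite)
    also have "(\<Sum>i\<in>UNIV. - (z $ i)\<^sup>2 / 2) = - (norm z)\<^sup>2 / 2"
      unfolding power2_norm_eq_inner inner_vec_def
      by (simp add: power2_eq_square sum_negf sum_divide_distrib)
    finally show ?thesis .
  qed
  then show ?thesis by (simp add: gaussian_def)
qed

lemma nn_integral_gaussian_1:
  fixes f :: "real ^ 'd \<Rightarrow> ennreal"
  assumes [measurable]: "f \<in> borel_measurable borel"
  shows "(\<integral>\<^sup>+z. f z \<partial>gaussian 1) = (\<integral>\<^sup>+z. ennreal (gauss_const TYPE('d) * exp (- (norm z)\<^sup>2 / 2)) * f z \<partial>lborel)"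
  unfolding gaussian_1_density by (subst nn_integral_density) auto

lemma sets_gaussian [measurable_cong]: "sets (gaussian s) = sets borel"
  by (simp add: gaussian_def)

lemma space_gaussian [simp]: "space (gaussian s) = UNIV"
  by (simp add: gaussian_def)

text \<open>Change of variables for the law of \<open>\<alpha> Z + u\<close>. With
  \<open>u = \<beta> y\<close> its density is a constant times
  \<open>lik \<alpha> \<beta> x y\<close>, the conditional density of the position given
  \<open>X1 = y\<close>.\<close>

lemma nn_integral_gaussian_1_affine:
  fixes f :: "real ^ 'd \<Rightarrow> ennreal"
  assumes [measurable]: "f \<in> borel_measurable borel" and \<alpha>: "\<alpha> > 0"
  shows "(\<integral>\<^sup>+z. f (\<alpha> *\<^sub>R z + u) \<partial>gaussian 1) =
    (\<integral>\<^sup>+x. ennreal (gauss_const TYPE('d) / \<alpha> ^ CARD('d) * exp (- (norm (x - u))\<^sup>2 / (2 * \<alpha>\<^sup>2))) * f x \<partial>lborel)"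
proof -
  have "(\<integral>\<^sup>+z. f (\<alpha> *\<^sub>R z + u) \<partial>gaussian 1) =
    (\<integral>\<^sup>+z. ennreal (gauss_const TYPE('d) * exp (- (norm z)\<^sup>2 / 2)) * f (\<alpha> *\<^sub>R z + u) \<partial>lborel)"
    by (rule nn_integral_gaussian_1) simp
  also have "\<dots> = ennreal (\<bar>1/\<alpha>\<bar> ^ DIM(real^'d)) * (\<integral>\<^sup>+x. ennreal (gauss_const TYPE('d) * exp (- (norm (- (u /\<^sub>R \<alpha>) + (1/\<alpha>) *\<^sub>R x))\<^sup>2 / 2)) *
      f (\<alpha> *\<^sub>R (- (u /\<^sub>R \<alpha>) + (1/\<alpha>) *\<^sub>R x) + u) \<partial>lborel)"
    using \<alpha> by (intro nn_integral_lborel_affine) auto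
  also have "\<dots> = (\<integral>\<^sup>+x. ennreal (\<bar>1/\<alpha>\<bar> ^ DIM(real^'d)) * (ennreal (gauss_const TYPE('d) * exp (- (norm (- (u /\<^sub>R \<alpha>) + (1/\<alpha>) *\<^sub>R x))\<^sup>2 / 2)) *
      f (\<alpha> *\<^sub>R (- (u /\<^sub>R \<alpha>) + (1/\<alpha>) *\<^sub>R x) + u)) \<partial>lborel)"
    by (rule nn_integral_cmult[symmetric]) measurable
  also have "\<dots> = (\<integral>\<^sup>+x. ennreal (gauss_const TYPE('d) / \<alpha> ^ CARD('d) * exp (- (norm (x - u))\<^sup>2 / (2 * \<alpha>\<^sup>2))) * f x \<partial>lborel)"
  proof (rule nn_integral_cong)
    fix x :: "real ^ 'd"
    have e: "- (u /\<^sub>R \<alpha>) + (1/\<alpha>) *\<^sub>R x = (1/\<alpha>) *\<^sub>R (x - u)"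
      by (simp add: algebra_simps inverse_eq_divide)
    have n: "- (norm (- (u /\<^sub>R \<alpha>) + (1/\<alpha>) *\<^sub>R x))\<^sup>2 / 2 = - (norm (x - u))\<^sup>2 / (2 * \<alpha>\<^sup>2)"
      unfolding e by (simp add: power_divide)
    have "\<alpha> *\<^sub>R (- (u /\<^sub>R \<alpha>) + (1/\<alpha>) *\<^sub>R x) + u = x"
      unfolding e using \<alpha> by simp
    moreover have "\<bar>1/\<alpha>\<bar> ^ DIM(real^'d) = 1 / \<alpha> ^ CARD('d)" using \<alpha> by (simp add: power_divide)
    ultimately show "ennreal (\<bar>1/\<alpha>\<bar> ^ DIM(real^'d)) * (ennreal (gauss_const TYPE('d) * exp (- (norm (- (u /\<^sub>R \<alpha>) + (1/\<alpha>) *\<^sub>R x))\<^sup>2 / 2)) *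
      f (\<alpha> *\<^sub>R (- (u /\<^sub>R \<alpha>) + (1/\<alpha>) *\<^sub>R x) + u))
      = ennreal (gauss_const TYPE('d) / \<alpha> ^ CARD('d) * exp (- (norm (x - u))\<^sup>2 / (2 * \<alpha>\<^sup>2))) * f x"
      using \<alpha> gauss_const_pos[where 'd='d] unfolding n
      by (simp add: mult.assoc[symmetric] ennreal_mult[symmetric])
  qed
  finally show ?thesis .
qed

lemma prob_space_gaussian_1: "prob_space (gaussian 1 :: (real ^ 'd) measure)"
proof
  have "(\<integral>\<^sup>+(x::real^'d). ennreal (\<Prod>i\<in>UNIV. normal_density 0 1 (x $ i)) \<partial>lborel) =
     (\<integral>\<^sup>+(x::real^'d). (\<Prod>b\<in>Basis. ennreal (normal_density 0 1 (x \<bullet> b))) \<partial>lborel)"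
  proof (rule nn_integral_cong)
    fix x :: "real ^ 'd"
    have "(\<Prod>b\<in>Basis. ennreal (normal_density 0 1 (x \<bullet> b)))
       = (\<Prod>b\<in>range (\<lambda>i. axis i 1). ennreal (normal_density 0 1 (x \<bullet> b)))"
      by (intro prod.cong) (auto simp: Basis_vec_def)
    also have "\<dots> = (\<Prod>i\<in>UNIV. ennreal (normal_density 0 1 (x $ i)))"
      by (subst prod.reindex) (auto simp: inj_on_def axis_eq_axis inner_axis)
    finally show "ennreal (\<Prod>i\<in>UNIV. normal_density 0 1 (x $ i)) =
        (\<Prod>b\<in>Basis. ennreal (normal_density 0 1 (x \<bullet> b)))"
      by (simp add: prod_ennreal)
  qed
  also have "\<dots> = (\<Prod>b\<in>(Basis::(real^'d) set). \<integral>\<^sup>+x. ennreal (normal_density 0 1 x) \<partial>lborel)"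
    by (rule nn_integral_lborel_prod) auto
  also have "(\<integral>\<^sup>+x. ennreal (normal_density 0 1 x) \<partial>lborel) = 1"
    using prob_space.emeasure_space_1[OF prob_space_normal_density[of 1 0]]
    by (simp add: emeasure_density)
  finally show "emeasure (gaussian 1 :: (real ^ 'd) measure) (space (gaussian 1)) = 1"
    by (simp add: gaussian_def emeasure_density)
qed

lemma integrable_gaussian_1_norm2: "integrable (gaussian 1 :: (real ^ 'd) measure) (\<lambda>z. (norm z)\<^sup>2)"
proof (rule integrableI_bounded)
  interpret prob_space "gaussian 1 :: (real ^ 'd) measure" by (rule prob_space_gaussian_1)
  let ?c = "gauss_const TYPE('d)"
  \<comment> \<open>Since \<open>s \<le> exp s\<close> at \<open>s = (norm z)\<^sup>2 / 4\<close>,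
    the integrand is at most \<open>4\<close> times a Gaussian of variance 2 with the same
    prefactor; the power of \<open>sqrt 2\<close> restores the normalisation of that
    Gaussian.\<close>
  let ?K = "4 * sqrt 2 ^ CARD('d)"
  have le: "?c * exp (- (norm z)\<^sup>2 / 2) * (norm z)\<^sup>2 \<le>
      ?K * (?c / sqrt 2 ^ CARD('d) * exp (- (norm (z - 0))\<^sup>2 / (2 * (sqrt 2)\<^sup>2)))" for z :: "real ^ 'd"
  proof -
    have "(norm z)\<^sup>2 / 4 \<le> exp ((norm z)\<^sup>2 / 4)"
      using exp_ge_add_one_self[of "(norm z)\<^sup>2 / 4"] by linarith
    then have "exp (- (norm z)\<^sup>2 / 2) * (norm z)\<^sup>2 \<le> exp (- (norm z)\<^sup>2 / 2) * (4 * exp ((norm z)\<^sup>2 / 4))"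
      by (intro mult_left_mono) auto
    also have "\<dots> = 4 * exp (- (norm z)\<^sup>2 / 4)" by (simp add: exp_add[symmetric])
    finally have "?c * (exp (- (norm z)\<^sup>2 / 2) * (norm z)\<^sup>2) \<le> ?c * (4 * exp (- (norm z)\<^sup>2 / 4))"
      using gauss_const_pos[where 'd='d] by (intro mult_left_mono) auto
    then show ?thesis by (simp add: algebra_simps)
  qed
  have "(\<integral>\<^sup>+z. ennreal ((norm z)\<^sup>2) \<partial>(gaussian 1 :: (real ^ 'd) measure)) =
     (\<integral>\<^sup>+(z::real^'d). ennreal (?c * exp (- (norm z)\<^sup>2 / 2)) * ennreal ((norm z)\<^sup>2) \<partial>lborel)"
    by (rule nn_integral_gaussian_1) simp
  also have "\<dots> \<le> (\<integral>\<^sup>+(z::real^'d). ennreal ?K * (ennreal (?c / sqrt 2 ^ CARD('d) * exp (- (norm (z - 0))\<^sup>2 / (2 * (sqrt 2)\<^sup>2))) * 1) \<partial>lborel)"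
    using le gauss_const_pos[where 'd='d]
    by (intro nn_integral_mono) (simp add: ennreal_mult[symmetric] ennreal_leI)
  also have "\<dots> = ennreal ?K * (\<integral>\<^sup>+(z::real^'d). 1 \<partial>gaussian 1)"
    by (subst nn_integral_cmult, measurable)
       (subst nn_integral_gaussian_1_affine[of "\<lambda>_. 1" "sqrt 2" 0, symmetric], auto)
  also have "\<dots> < \<infinity>" by (simp add: ennreal_mult_less_top emeasure_space_1[unfolded space_gaussian])
  finally show "(\<integral>\<^sup>+z. ennreal (norm ((norm z)\<^sup>2)) \<partial>(gaussian 1 :: (real ^ 'd) measure)) < \<infinity>" by simp
qed simp

text \<open>Integrability follows from \<open>norm (f x) \<le> 1 + (norm (f x))\<^sup>2\<close>, and
  Jensen's inequality for the squared norm is read off from the nonnegative variance of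
  \<open>f\<close>.\<close>

lemma (in prob_space) norm_expectation_power2_le:
  fixes f :: "'a \<Rightarrow> 'b::euclidean_space"
  assumes [measurable]: "f \<in> borel_measurable M" and i2: "integrable M (\<lambda>x. (norm (f x))\<^sup>2)"
  shows "integrable M f" "(norm (expectation f))\<^sup>2 \<le> expectation (\<lambda>x. (norm (f x))\<^sup>2)"
proof -
  show i: "integrable M f"
  proof (rule Bochner_Integration.integrable_bound[where f = "\<lambda>x. 1 + (norm (f x))\<^sup>2"])
    show "AE x in M. norm (f x) \<le> norm (1 + (norm (f x))\<^sup>2)"
    proof (intro AE_I2)
      fix x
      have "0 \<le> (norm (f x) - 1)\<^sup>2" by simp
      then show "norm (f x) \<le> norm (1 + (norm (f x))\<^sup>2)"
        by (simp add: power2_eq_square algebra_simps) (smt (verit) norm_ge_zero)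
    qed
  qed (use i2 in auto)
  let ?c = "expectation f"
  have "0 \<le> expectation (\<lambda>x. (norm (f x - ?c))\<^sup>2)" by (intro integral_nonneg_AE) auto
  also have "(\<lambda>x. (norm (f x - ?c))\<^sup>2) = (\<lambda>x. (norm (f x))\<^sup>2 - 2 * (f x \<bullet> ?c) + (norm ?c)\<^sup>2)"
    by (auto simp: power2_norm_eq_inner inner_diff inner_commute)
  also have "expectation \<dots> = expectation (\<lambda>x. (norm (f x))\<^sup>2) - 2 * (?c \<bullet> ?c) + (norm ?c)\<^sup>2"
    using i i2 by (subst Bochner_Integration.integral_add Bochner_Integration.integral_diff, (auto simp: prob_space)[2])+
       (auto simp: prob_space)
  finally show "(norm ?c)\<^sup>2 \<le> expectation (\<lambda>x. (norm (f x))\<^sup>2)" by (simp add: power2_norm_eq_inner)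
qed

section \<open>Conditioning the interpolation on its position\<close>

text \<open>The Gaussian density at \<open>x\<close> with mean \<open>\<beta> y\<close> and
  covariance \<open>\<alpha>\<^sup>2 I\<close>, without its constant. The constant cancels in Bayes'
  formula, and without it the values stay in \<open>(0, 1]\<close>, so that an integral against
  \<open>lik\<close> is dominated by the other factor alone.\<close>

definition lik :: "real \<Rightarrow> real \<Rightarrow> 'a::real_normed_vector \<Rightarrow> 'a \<Rightarrow> real" where
  "lik \<alpha> \<beta> x y = exp (- (norm (x - \<beta> *\<^sub>R y))\<^sup>2 / (2 * \<alpha>\<^sup>2))"

lemma lik_pos: "lik \<alpha> \<beta> x y > 0" and lik_le_1: "lik \<alpha> \<beta> x y \<le> 1"
  by (auto simp: lik_def)

lemma lik_measurable [measurable]: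
  fixes x y :: "'m \<Rightarrow> 'a::euclidean_space"
  assumes [measurable]: "\<alpha> \<in> borel_measurable M" "\<beta> \<in> borel_measurable M" "x \<in> borel_measurable M" "y \<in> borel_measurable M"
  shows "(\<lambda>\<omega>. lik (\<alpha> \<omega>) (\<beta> \<omega>) (x \<omega>) (y \<omega>)) \<in> borel_measurable M"
  unfolding lik_def by measurable

locale target_law =
  fixes \<nu> :: "(real ^ 'd) measure"
  assumes prob_target: "prob_space \<nu>"
    and sets_target [measurable_cong]: "sets \<nu> = sets borel"
    and second_moment: "integrable \<nu> (\<lambda>y. (norm y)\<^sup>2)"
begin

sublocale T: prob_space \<nu> by (rule prob_target)

sublocale G: prob_space "gaussian 1 :: (real ^ 'd) measure" by (rule prob_space_gaussian_1)

sublocale GT: pair_prob_space "gaussian 1 :: (real ^ 'd) measure" \<nu> ..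

lemma space_target [simp]: "space \<nu> = UNIV"
  using sets_eq_imp_space_eq[OF sets_target] by simp

lemma integrable_id: "integrable \<nu> (\<lambda>y. y)"
  by (rule T.norm_expectation_power2_le(1)[OF _ second_moment]) measurable

text \<open>Denominator of Bayes' formula: up to the factor
  \<open>gauss_const TYPE('d) / \<alpha> ^ CARD('d)\<close> this is the density of
  \<open>\<alpha> Z + \<beta> X1\<close> when \<open>\<alpha>\<close> is positive.\<close>

definition nrm :: "real \<Rightarrow> real \<Rightarrow> real ^ 'd \<Rightarrow> real" where
  "nrm \<alpha> \<beta> x = (\<integral>y. lik \<alpha> \<beta> x y \<partial>\<nu>)"

definition post :: "real \<Rightarrow> real \<Rightarrow> real ^ 'd \<Rightarrow> (real ^ 'd) measure" where
  "post \<alpha> \<beta> x = density \<nu> (\<lambda>y. ennreal (lik \<alpha> \<beta> x y / nrm \<alpha> \<beta> x))"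

lemma integrable_lik: "integrable \<nu> (lik \<alpha> \<beta> x)"
  by (rule T.integrable_const_bound[where B = 1]) (auto simp: lik_le_1 lik_pos less_imp_le)

lemma integrable_lik_scaleR:
  fixes g :: "real ^ 'd \<Rightarrow> 'b::{banach, second_countable_topology}"
  assumes g: "integrable \<nu> g"
  shows "integrable \<nu> (\<lambda>y. lik \<alpha> \<beta> x y *\<^sub>R g y)"
proof (rule Bochner_Integration.integrable_bound[OF g])
  have [measurable]: "g \<in> borel_measurable \<nu>" using g by simp
  show "(\<lambda>y. lik \<alpha> \<beta> x y *\<^sub>R g y) \<in> borel_measurable \<nu>" by measurable
  show "AE y in \<nu>. norm (lik \<alpha> \<beta> x y *\<^sub>R g y) \<le> norm (g y)"
    using lik_pos[of \<alpha> \<beta> x] lik_le_1[of \<alpha> \<beta> x] by (auto simp: less_imp_le intro!: mult_left_le_one_le)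
qed

text \<open>A vanishing integral would force \<open>lik\<close> to vanish almost everywhere, but it
  vanishes nowhere. Positivity at every \<open>x\<close>, not only almost everywhere, is what makes
  the conditional laws \<open>post \<alpha> \<beta> x\<close> available pointwise.\<close>

lemma nrm_pos: "nrm \<alpha> \<beta> x > 0"
proof -
  have "nrm \<alpha> \<beta> x \<ge> 0" unfolding nrm_def by (intro integral_nonneg_AE) (auto simp: lik_pos less_imp_le)
  moreover have "nrm \<alpha> \<beta> x \<noteq> 0"
  proof
    assume "nrm \<alpha> \<beta> x = 0"
    then have "AE y in \<nu>. lik \<alpha> \<beta> x y = 0"
      unfolding nrm_def
      by (subst (asm) integral_nonneg_eq_0_iff_AE[OF integrable_lik]) (auto simp: lik_pos less_imp_le)
    then have "AE y in \<nu>. False" by eventually_elim (use lik_pos in \<open>auto simp: less_le\<close>)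
    then show False by simp
  qed
  ultimately show ?thesis by simp
qed

lemma sets_post [measurable_cong]: "sets (post \<alpha> \<beta> x) = sets borel"
  by (simp add: post_def sets_target)

lemma integral_post:
  fixes g :: "real ^ 'd \<Rightarrow> 'b::{banach, second_countable_topology}"
  assumes [measurable]: "g \<in> borel_measurable borel"
  shows "(\<integral>y. g y \<partial>post \<alpha> \<beta> x) = (1 / nrm \<alpha> \<beta> x) *\<^sub>R (\<integral>y. lik \<alpha> \<beta> x y *\<^sub>R g y \<partial>\<nu>)"
proof -
  have "(\<integral>y. g y \<partial>post \<alpha> \<beta> x) = (\<integral>y. (lik \<alpha> \<beta> x y / nrm \<alpha> \<beta> x) *\<^sub>R g y \<partial>\<nu>)"
    unfolding post_def
    by (rule integral_density) (use nrm_pos[of \<alpha> \<beta> x] lik_pos[of \<alpha> \<beta> x] in \<open>auto simp: less_imp_le\<close>)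
  also have "\<dots> = (\<integral>y. (1 / nrm \<alpha> \<beta> x) *\<^sub>R (lik \<alpha> \<beta> x y *\<^sub>R g y) \<partial>\<nu>)"
    by (intro Bochner_Integration.integral_cong) auto
  also have "\<dots> = (1 / nrm \<alpha> \<beta> x) *\<^sub>R (\<integral>y. lik \<alpha> \<beta> x y *\<^sub>R g y \<partial>\<nu>)"
    by (rule integral_scaleR_right)
  finally show ?thesis .
qed

lemma integrable_post:
  fixes g :: "real ^ 'd \<Rightarrow> 'b::{banach, second_countable_topology}"
  assumes g: "integrable \<nu> g"
  shows "integrable (post \<alpha> \<beta> x) g"
proof -
  have [measurable]: "g \<in> borel_measurable borel" using g by (simp add: measurable_cong_sets[OF sets_target refl])
  have "integrable \<nu> (\<lambda>y. (1 / nrm \<alpha> \<beta> x) *\<^sub>R (lik \<alpha> \<beta> x y *\<^sub>R g y))"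
    by (intro integrable_scaleR_right integrable_lik_scaleR g)
  then have "integrable \<nu> (\<lambda>y. (lik \<alpha> \<beta> x y / nrm \<alpha> \<beta> x) *\<^sub>R g y)" by simp
  then show ?thesis unfolding post_def
    by (subst integrable_density) (use nrm_pos[of \<alpha> \<beta> x] lik_pos[of \<alpha> \<beta> x] in \<open>auto simp: less_imp_le\<close>)
qed

lemma nn_integral_post:
  assumes [measurable]: "g \<in> borel_measurable borel"
  shows "(\<integral>\<^sup>+y. g y \<partial>post \<alpha> \<beta> x) = (\<integral>\<^sup>+y. ennreal (lik \<alpha> \<beta> x y / nrm \<alpha> \<beta> x) * g y \<partial>\<nu>)"
  unfolding post_def by (subst nn_integral_density) auto

lemma prob_space_post: "prob_space (post \<alpha> \<beta> x)"
proof
  have "emeasure (post \<alpha> \<beta> x) (space (post \<alpha> \<beta> x)) = (\<integral>\<^sup>+y. ennreal (lik \<alpha> \<beta> x y / nrm \<alpha> \<beta> x) \<partial>\<nu>)"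
    by (simp add: post_def emeasure_density)
  also have "\<dots> = ennreal (\<integral>y. lik \<alpha> \<beta> x y / nrm \<alpha> \<beta> x \<partial>\<nu>)"
    by (intro nn_integral_eq_integral)
       (use integrable_lik nrm_pos[of \<alpha> \<beta> x] lik_pos[of \<alpha> \<beta> x] in \<open>auto simp: less_imp_le\<close>)
  also have "(\<integral>y. lik \<alpha> \<beta> x y / nrm \<alpha> \<beta> x \<partial>\<nu>) = 1"
    using nrm_pos[of \<alpha> \<beta> x] by (simp add: nrm_def[symmetric])
  finally show "emeasure (post \<alpha> \<beta> x) (space (post \<alpha> \<beta> x)) = 1" by simp
qed

text \<open>As \<open>lik\<close> is at most 1, \<open>norm (g y)\<close> dominates the integrand
  uniformly in all parameters. Continuity is joint in the triple
  \<open>(\<alpha>, \<beta>, x)\<close>, coded as nested pairs, since along the interpolation all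
  three move with time.\<close>

lemma continuous_on_integral_lik:
  fixes g :: "real ^ 'd \<Rightarrow> 'b::{banach, second_countable_topology}"
  assumes g: "integrable \<nu> g"
  shows "continuous_on {u. fst u > 0} (\<lambda>u. \<integral>y. lik (fst u) (fst (snd u)) (snd (snd u)) y *\<^sub>R g y \<partial>\<nu>)"
proof (rule continuous_on_sequentiallyI)
  fix u :: "nat \<Rightarrow> real \<times> real \<times> (real ^ 'd)" and c
  assume u: "\<forall>n. u n \<in> {u. fst u > 0}" and c: "c \<in> {u. fst u > 0}" and lim: "u \<longlonglongrightarrow> c"
  have [measurable]: "g \<in> borel_measurable \<nu>" using g by simp
  show "(\<lambda>n. \<integral>y. lik (fst (u n)) (fst (snd (u n))) (snd (snd (u n))) y *\<^sub>R g y \<partial>\<nu>)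
     \<longlonglongrightarrow> (\<integral>y. lik (fst c) (fst (snd c)) (snd (snd c)) y *\<^sub>R g y \<partial>\<nu>)"
  proof (rule integral_dominated_convergence[where w = "\<lambda>y. norm (g y)"])
    show "integrable \<nu> (\<lambda>y. norm (g y))" using g by simp
    show "AE y in \<nu>. (\<lambda>n. lik (fst (u n)) (fst (snd (u n))) (snd (snd (u n))) y *\<^sub>R g y) \<longlonglongrightarrow>
        lik (fst c) (fst (snd c)) (snd (snd c)) y *\<^sub>R g y"
      unfolding lik_def using c by (intro AE_I2 tendsto_intros lim) auto
    show "AE y in \<nu>. norm (lik (fst (u n)) (fst (snd (u n))) (snd (snd (u n))) y *\<^sub>R g y) \<le> norm (g y)" for n
      by (intro AE_I2) (auto simp: lik_le_1 less_imp_le[OF lik_pos] intro!: mult_left_le_one_le)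
  qed measurable
qed

lemma continuous_on_post:
  fixes g :: "real ^ 'd \<Rightarrow> 'b::{banach, second_countable_topology}"
  assumes g: "integrable \<nu> g"
  shows "continuous_on {u. fst u > 0} (\<lambda>u. \<integral>y. g y \<partial>post (fst u) (fst (snd u)) (snd (snd u)))"
proof -
  have [measurable]: "g \<in> borel_measurable borel" using g by (simp add: measurable_cong_sets[OF sets_target refl])
  have "continuous_on {u. fst u > 0} (\<lambda>u. nrm (fst u) (fst (snd u)) (snd (snd u)))"
    using continuous_on_integral_lik[of "\<lambda>_. 1::real"] by (simp add: nrm_def)
  then show ?thesis
    unfolding integral_post[OF \<open>g \<in> borel_measurable borel\<close>]
    using nrm_pos by (intro continuous_on_scaleR continuous_on_divide continuous_on_const
      continuous_on_integral_lik g) (auto simp: less_le)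
qed

text \<open>\<open>post \<alpha> \<beta> x\<close> is the conditional law of \<open>X1\<close> given \<open>\<alpha> Z + \<beta> X1 = x\<close>. If \<open>h\<close> has the law of
  \<open>\<alpha> Z + \<beta> X1\<close> under \<open>P\<close>, then \<open>extend P h \<alpha> \<beta>\<close> appends to \<open>\<omega>\<close> a fresh \<open>X1\<close> compatible with \<open>h \<omega>\<close> and
  otherwise independent of \<open>\<omega>\<close>.\<close>

definition joint :: "real \<Rightarrow> real \<Rightarrow> ((real ^ 'd) \<times> (real ^ 'd)) measure" where
  "joint \<alpha> \<beta> = distr (gaussian 1 \<Otimes>\<^sub>M \<nu>) (borel \<Otimes>\<^sub>M borel) (\<lambda>(z, y). (\<alpha> *\<^sub>R z + \<beta> *\<^sub>R y, y))"

definition law :: "real \<Rightarrow> real \<Rightarrow> (real ^ 'd) measure" where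
  "law \<alpha> \<beta> = distr (gaussian 1 \<Otimes>\<^sub>M \<nu>) borel (\<lambda>(z, y). \<alpha> *\<^sub>R z + \<beta> *\<^sub>R y)"

definition extend :: "'p measure \<Rightarrow> ('p \<Rightarrow> real ^ 'd) \<Rightarrow> real \<Rightarrow> real \<Rightarrow> ('p \<times> (real ^ 'd)) measure" where
  "extend P h \<alpha> \<beta> = density (P \<Otimes>\<^sub>M \<nu>) (\<lambda>(\<omega>, y). ennreal (lik \<alpha> \<beta> (h \<omega>) y / nrm \<alpha> \<beta> (h \<omega>)))"

lemma nrm_measurable [measurable]: "nrm \<alpha> \<beta> \<in> borel_measurable borel"
  unfolding nrm_def by measurable

lemma sets_joint [measurable_cong]: "sets (joint \<alpha> \<beta>) = sets (borel \<Otimes>\<^sub>M borel)"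
  by (simp add: joint_def)

lemma sets_law [measurable_cong]: "sets (law \<alpha> \<beta>) = sets borel" by (simp add: law_def)

lemma sets_extend [measurable_cong]: "sets (extend P h \<alpha> \<beta>) = sets (P \<Otimes>\<^sub>M borel)"
  unfolding extend_def by (simp cong: sets_pair_measure_cong add: sets_target)

lemma prob_space_law: "prob_space (law \<alpha> \<beta>)"
  unfolding law_def by (rule GT.prob_space_distr) measurable

lemma law_eq_distr_joint: "law \<alpha> \<beta> = distr (joint \<alpha> \<beta>) borel fst"
  unfolding law_def joint_def by (subst distr_distr) (auto simp: comp_def case_prod_unfold)

lemma target_eq_distr_joint: "\<nu> = distr (joint \<alpha> \<beta>) borel snd"
proof (rule measure_eqI)
  fix A assume A: "A \<in> sets \<nu>"
  then have [measurable]: "A \<in> sets borel" by (simp add: sets_target)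
  have eq: "(\<lambda>(z :: real ^ 'd, y). y) -` A = UNIV \<times> A" by auto
  have "emeasure (distr (joint \<alpha> \<beta>) borel snd) A = emeasure ((gaussian 1 :: (real ^ 'd) measure) \<Otimes>\<^sub>M \<nu>) (UNIV \<times> A)"
    unfolding joint_def
    by (subst distr_distr, measurable, subst emeasure_distr)
       (auto simp: space_pair_measure eq)
  also have "\<dots> = emeasure \<nu> A"
    using G.emeasure_space_1 A by (subst T.emeasure_pair_measure_Times) (auto simp: sets_gaussian)
  finally show "emeasure \<nu> A = emeasure (distr (joint \<alpha> \<beta>) borel snd) A" by simp
qed (simp add: sets_target)

text \<open>For fixed \<open>y\<close> the Gaussian variable is replaced by the position; Tonelli
  then puts the position outermost, which is the order needed for conditioning on it.\<close>

lemma nn_integral_joint: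
  assumes [measurable]: "F \<in> borel_measurable (borel \<Otimes>\<^sub>M borel)" and \<alpha>: "\<alpha> > 0"
  shows "(\<integral>\<^sup>+u. F u \<partial>joint \<alpha> \<beta>) =
    (\<integral>\<^sup>+x. \<integral>\<^sup>+y. ennreal (gauss_const TYPE('d) / \<alpha> ^ CARD('d) * lik \<alpha> \<beta> x y) * F (x, y) \<partial>\<nu> \<partial>lborel)"
proof -
  interpret pair_sigma_finite "lborel :: (real ^ 'd) measure" \<nu> ..
  have "(\<integral>\<^sup>+u. F u \<partial>joint \<alpha> \<beta>) = (\<integral>\<^sup>+u. F (case u of (z, y) \<Rightarrow> (\<alpha> *\<^sub>R z + \<beta> *\<^sub>R y, y)) \<partial>(gaussian 1 \<Otimes>\<^sub>M \<nu>))"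
    unfolding joint_def by (subst nn_integral_distr) auto
  also have "\<dots> = (\<integral>\<^sup>+y. \<integral>\<^sup>+z. F (\<alpha> *\<^sub>R z + \<beta> *\<^sub>R y, y) \<partial>gaussian 1 \<partial>\<nu>)"
    by (subst GT.nn_integral_snd[symmetric]) auto
  also have "\<dots> = (\<integral>\<^sup>+y. \<integral>\<^sup>+x. ennreal (gauss_const TYPE('d) / \<alpha> ^ CARD('d) * lik \<alpha> \<beta> x y) * F (x, y) \<partial>lborel \<partial>\<nu>)"
    unfolding lik_def using \<alpha>
    by (intro nn_integral_cong nn_integral_gaussian_1_affine[of "\<lambda>x. F (x, _)"]) auto
  also have "\<dots> = (\<integral>\<^sup>+x. \<integral>\<^sup>+y. ennreal (gauss_const TYPE('d) / \<alpha> ^ CARD('d) * lik \<alpha> \<beta> x y) * F (x, y) \<partial>\<nu> \<partial>lborel)"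
    by (rule Fubini'[of "\<lambda>x y. ennreal (gauss_const TYPE('d) / \<alpha> ^ CARD('d) * lik \<alpha> \<beta> x y) * F (x, y)"]) measurable
  finally show ?thesis .
qed

lemma nn_integral_law:
  assumes [measurable]: "f \<in> borel_measurable borel" and \<alpha>: "\<alpha> > 0"
  shows "(\<integral>\<^sup>+x. f x \<partial>law \<alpha> \<beta>) = (\<integral>\<^sup>+x. ennreal (gauss_const TYPE('d) / \<alpha> ^ CARD('d) * nrm \<alpha> \<beta> x) * f x \<partial>lborel)"
proof -
  let ?c = "gauss_const TYPE('d) / \<alpha> ^ CARD('d)"
  have c: "?c > 0" using \<alpha> gauss_const_pos[where 'd='d] by simp
  have "(\<integral>\<^sup>+x. f x \<partial>law \<alpha> \<beta>) = (\<integral>\<^sup>+u. f (fst u) \<partial>joint \<alpha> \<beta>)"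
    unfolding law_eq_distr_joint by (subst nn_integral_distr) auto
  also have "\<dots> = (\<integral>\<^sup>+x. \<integral>\<^sup>+y. ennreal (?c * lik \<alpha> \<beta> x y) * f x \<partial>\<nu> \<partial>lborel)"
    by (subst nn_integral_joint[OF _ \<alpha>]) auto
  also have "\<dots> = (\<integral>\<^sup>+x. ennreal (?c * nrm \<alpha> \<beta> x) * f x \<partial>lborel)"
  proof (rule nn_integral_cong)
    fix x :: "real ^ 'd"
    have "(\<integral>\<^sup>+y. ennreal (?c * lik \<alpha> \<beta> x y) * f x \<partial>\<nu>) = (\<integral>\<^sup>+y. ennreal (?c * lik \<alpha> \<beta> x y) \<partial>\<nu>) * f x"
      by (rule nn_integral_multc) measurable
    also have "(\<integral>\<^sup>+y. ennreal (?c * lik \<alpha> \<beta> x y) \<partial>\<nu>) = ennreal (\<integral>y. ?c * lik \<alpha> \<beta> x y \<partial>\<nu>)"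
      by (intro nn_integral_eq_integral integrable_mult_right integrable_lik AE_I2
        mult_nonneg_nonneg[OF less_imp_le[OF c] less_imp_le[OF lik_pos]])
    also have "(\<integral>y. ?c * lik \<alpha> \<beta> x y \<partial>\<nu>) = ?c * nrm \<alpha> \<beta> x" by (simp add: nrm_def)
    finally show "(\<integral>\<^sup>+y. ennreal (?c * lik \<alpha> \<beta> x y) * f x \<partial>\<nu>) = ennreal (?c * nrm \<alpha> \<beta> x) * f x" .
  qed
  finally show ?thesis .
qed

lemma nn_integral_extend:
  assumes P: "prob_space P" and h: "h \<in> borel_measurable P" and F: "F \<in> borel_measurable (P \<Otimes>\<^sub>M borel)"
  shows "(\<integral>\<^sup>+u. F u \<partial>extend P h \<alpha> \<beta>) = (\<integral>\<^sup>+\<omega>. \<integral>\<^sup>+y. F (\<omega>, y) \<partial>post \<alpha> \<beta> (h \<omega>) \<partial>P)"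
proof -
  note [measurable] = h F
  interpret P: prob_space P by (rule P)
  have "(\<integral>\<^sup>+u. F u \<partial>extend P h \<alpha> \<beta>) =
    (\<integral>\<^sup>+u. (case u of (\<omega>, y) \<Rightarrow> ennreal (lik \<alpha> \<beta> (h \<omega>) y / nrm \<alpha> \<beta> (h \<omega>))) * F u \<partial>(P \<Otimes>\<^sub>M \<nu>))"
    unfolding extend_def by (subst nn_integral_density) auto
  also have "\<dots> = (\<integral>\<^sup>+\<omega>. \<integral>\<^sup>+y. ennreal (lik \<alpha> \<beta> (h \<omega>) y / nrm \<alpha> \<beta> (h \<omega>)) * F (\<omega>, y) \<partial>\<nu> \<partial>P)"
    by (subst T.nn_integral_fst[symmetric]) auto
  also have "\<dots> = (\<integral>\<^sup>+\<omega>. \<integral>\<^sup>+y. F (\<omega>, y) \<partial>post \<alpha> \<beta> (h \<omega>) \<partial>P)"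
    by (intro nn_integral_cong nn_integral_post[symmetric]) measurable
  finally show ?thesis .
qed

lemma prob_space_extend:
  assumes P: "prob_space P" and h: "h \<in> borel_measurable P"
  shows "prob_space (extend P h \<alpha> \<beta>)"
proof
  have "emeasure (extend P h \<alpha> \<beta>) (space (extend P h \<alpha> \<beta>)) = (\<integral>\<^sup>+u. 1 \<partial>extend P h \<alpha> \<beta>)" by simp
  also have "\<dots> = (\<integral>\<^sup>+\<omega>. \<integral>\<^sup>+y. 1 \<partial>post \<alpha> \<beta> (h \<omega>) \<partial>P)"
    by (rule nn_integral_extend[OF P h]) simp
  also have "\<dots> = 1"
    using prob_space.emeasure_space_1[OF prob_space_post] prob_space.emeasure_space_1[OF P] by simp
  finally show "emeasure (extend P h \<alpha> \<beta>) (space (extend P h \<alpha> \<beta>)) = 1" .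
qed

lemma distr_extend_fst:
  assumes P: "prob_space P" and h: "h \<in> borel_measurable P"
  shows "distr (extend P h \<alpha> \<beta>) P fst = P"
proof (rule measure_eqI)
  fix A assume "A \<in> sets (distr (extend P h \<alpha> \<beta>) P fst)"
  then have A[measurable]: "A \<in> sets P" by simp
  have "emeasure (distr (extend P h \<alpha> \<beta>) P fst) A = (\<integral>\<^sup>+x. indicator A x \<partial>distr (extend P h \<alpha> \<beta>) P fst)" by simp
  also have "\<dots> = (\<integral>\<^sup>+u. indicator A (fst u) \<partial>extend P h \<alpha> \<beta>)"
    by (subst nn_integral_distr) auto
  also have "\<dots> = (\<integral>\<^sup>+\<omega>. \<integral>\<^sup>+y. indicator A \<omega> \<partial>post \<alpha> \<beta> (h \<omega>) \<partial>P)"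
    by (subst nn_integral_extend[OF P h]) auto
  also have "\<dots> = emeasure P A"
    using prob_space.emeasure_space_1[OF prob_space_post] by simp
  finally show "emeasure (distr (extend P h \<alpha> \<beta>) P fst) A = emeasure P A" .
qed simp

text \<open>The position has density proportional to \<open>nrm\<close>, which cancels the
  denominator of \<open>post\<close>; what is left is the \<open>lik\<close> density of
  \<open>joint\<close>. Only the law of \<open>h\<close> enters, so a position that was produced by
  earlier resamplings is as good as the original one.\<close>

lemma distr_extend_joint:
  assumes P: "prob_space P" and h[measurable]: "h \<in> borel_measurable P" and \<alpha>: "\<alpha> > 0"
    and law: "distr P borel h = law \<alpha> \<beta>"
  shows "distr (extend P h \<alpha> \<beta>) (borel \<Otimes>\<^sub>M borel) (\<lambda>u. (h (fst u), snd u)) = joint \<alpha> \<beta>"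
proof (rule measure_eqI)
  fix A assume "A \<in> sets (distr (extend P h \<alpha> \<beta>) (borel \<Otimes>\<^sub>M borel) (\<lambda>u. (h (fst u), snd u)))"
  then have A[measurable]: "A \<in> sets (borel \<Otimes>\<^sub>M borel)" by simp
  let ?c = "gauss_const TYPE('d) / \<alpha> ^ CARD('d)"
  have c: "?c > 0" using \<alpha> gauss_const_pos[where 'd='d] by simp
  have m[measurable]: "(\<lambda>x. \<integral>\<^sup>+y. indicator A (x, y) \<partial>post \<alpha> \<beta> x) \<in> borel_measurable borel"
    by (subst nn_integral_post) auto
  have "emeasure (distr (extend P h \<alpha> \<beta>) (borel \<Otimes>\<^sub>M borel) (\<lambda>u. (h (fst u), snd u))) A =
      (\<integral>\<^sup>+x. indicator A x \<partial>distr (extend P h \<alpha> \<beta>) (borel \<Otimes>\<^sub>M borel) (\<lambda>u. (h (fst u), snd u)))" by simp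
  also have "\<dots> = (\<integral>\<^sup>+u. indicator A (h (fst u), snd u) \<partial>extend P h \<alpha> \<beta>)"
    by (subst nn_integral_distr) auto
  also have "\<dots> = (\<integral>\<^sup>+\<omega>. \<integral>\<^sup>+y. indicator A (h \<omega>, y) \<partial>post \<alpha> \<beta> (h \<omega>) \<partial>P)"
    by (subst nn_integral_extend[OF P h]) auto
  also have "\<dots> = (\<integral>\<^sup>+x. \<integral>\<^sup>+y. indicator A (x, y) \<partial>post \<alpha> \<beta> x \<partial>distr P borel h)"
    by (subst nn_integral_distr) auto
  also have "\<dots> = (\<integral>\<^sup>+x. ennreal (?c * nrm \<alpha> \<beta> x) * (\<integral>\<^sup>+y. indicator A (x, y) \<partial>post \<alpha> \<beta> x) \<partial>lborel)"
    unfolding law by (rule nn_integral_law[OF _ \<alpha>]) measurable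
  also have "\<dots> = (\<integral>\<^sup>+x. \<integral>\<^sup>+y. ennreal (?c * lik \<alpha> \<beta> x y) * indicator A (x, y) \<partial>\<nu> \<partial>lborel)"
  proof (rule nn_integral_cong)
    fix x :: "real ^ 'd"
    have "ennreal (?c * nrm \<alpha> \<beta> x) * (\<integral>\<^sup>+y. indicator A (x, y) \<partial>post \<alpha> \<beta> x) =
      (\<integral>\<^sup>+y. ennreal (?c * nrm \<alpha> \<beta> x) * (ennreal (lik \<alpha> \<beta> x y / nrm \<alpha> \<beta> x) * indicator A (x, y)) \<partial>\<nu>)"
      by (subst nn_integral_post, measurable) (rule nn_integral_cmult[symmetric], measurable)
    also have "\<dots> = (\<integral>\<^sup>+y. ennreal (?c * lik \<alpha> \<beta> x y) * indicator A (x, y) \<partial>\<nu>)"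
    proof (rule nn_integral_cong)
      fix y :: "real ^ 'd"
      have "ennreal (?c * nrm \<alpha> \<beta> x) * ennreal (lik \<alpha> \<beta> x y / nrm \<alpha> \<beta> x) = ennreal (?c * lik \<alpha> \<beta> x y)"
        using mult_pos_pos[OF c nrm_pos[of \<alpha> \<beta> x]] nrm_pos[of \<alpha> \<beta> x] lik_pos[of \<alpha> \<beta> x y]
        by (subst ennreal_mult[symmetric]) (auto simp: less_imp_le)
      then show "ennreal (?c * nrm \<alpha> \<beta> x) * (ennreal (lik \<alpha> \<beta> x y / nrm \<alpha> \<beta> x) * indicator A (x, y)) =
        ennreal (?c * lik \<alpha> \<beta> x y) * indicator A (x, y)"
        by (simp add: mult.assoc[symmetric])
    qed
    finally show "ennreal (?c * nrm \<alpha> \<beta> x) * (\<integral>\<^sup>+y. indicator A (x, y) \<partial>post \<alpha> \<beta> x) =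
      (\<integral>\<^sup>+y. ennreal (?c * lik \<alpha> \<beta> x y) * indicator A (x, y) \<partial>\<nu>)" .
  qed
  also have "\<dots> = (\<integral>\<^sup>+u. indicator A u \<partial>joint \<alpha> \<beta>)"
    by (rule nn_integral_joint[OF _ \<alpha>, symmetric]) measurable
  also have "\<dots> = emeasure (joint \<alpha> \<beta>) A" by (simp add: sets_joint)
  finally show "emeasure (distr (extend P h \<alpha> \<beta>) (borel \<Otimes>\<^sub>M borel) (\<lambda>u. (h (fst u), snd u))) A = emeasure (joint \<alpha> \<beta>) A" .
qed (simp add: sets_joint)

end

section \<open>Square-integrable maps\<close>

lemma norm_add_power2_le: "(norm (x + y))\<^sup>2 \<le> 2 * (norm x)\<^sup>2 + 2 * (norm y)\<^sup>2"
  for x y :: "'a::real_inner"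
proof -
  have "0 \<le> (norm (x - y))\<^sup>2" by simp
  then show ?thesis by (simp add: power2_norm_eq_inner inner_simps inner_commute)
qed

lemma norm_diff_power2_le: "(norm (x - y))\<^sup>2 \<le> 2 * (norm x)\<^sup>2 + 2 * (norm y)\<^sup>2"
  for x y :: "'a::real_inner"
  using norm_add_power2_le[of x "- y"] by simp

lemma integrable_norm2_add:
  fixes f g :: "'a \<Rightarrow> 'b::euclidean_space"
  assumes [measurable]: "f \<in> borel_measurable M" "g \<in> borel_measurable M"
    and "integrable M (\<lambda>x. (norm (f x))\<^sup>2)" "integrable M (\<lambda>x. (norm (g x))\<^sup>2)"
  shows "integrable M (\<lambda>x. (norm (f x + g x))\<^sup>2)"
  by (rule Bochner_Integration.integrable_bound[where f = "\<lambda>x. 2 * (norm (f x))\<^sup>2 + 2 * (norm (g x))\<^sup>2"])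
     (use assms norm_add_power2_le in auto)

lemma integrable_norm2_diff:
  fixes f g :: "'a \<Rightarrow> 'b::euclidean_space"
  assumes [measurable]: "f \<in> borel_measurable M" "g \<in> borel_measurable M"
    and "integrable M (\<lambda>x. (norm (f x))\<^sup>2)" "integrable M (\<lambda>x. (norm (g x))\<^sup>2)"
  shows "integrable M (\<lambda>x. (norm (f x - g x))\<^sup>2)"
  by (rule Bochner_Integration.integrable_bound[where f = "\<lambda>x. 2 * (norm (f x))\<^sup>2 + 2 * (norm (g x))\<^sup>2"])
     (use assms norm_diff_power2_le in auto)

lemma integrable_inner_L2:
  fixes f g :: "'a \<Rightarrow> 'b::euclidean_space"
  assumes [measurable]: "f \<in> borel_measurable M" "g \<in> borel_measurable M"
    and "integrable M (\<lambda>x. (norm (f x))\<^sup>2)" "integrable M (\<lambda>x. (norm (g x))\<^sup>2)"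
  shows "integrable M (\<lambda>x. f x \<bullet> g x)"
proof (rule Bochner_Integration.integrable_bound[where f = "\<lambda>x. (norm (f x))\<^sup>2 + (norm (g x))\<^sup>2"])
  show "AE x in M. norm (f x \<bullet> g x) \<le> norm ((norm (f x))\<^sup>2 + (norm (g x))\<^sup>2)"
  proof (intro AE_I2)
    fix x
    have "\<bar>f x \<bullet> g x\<bar> \<le> norm (f x) * norm (g x)" by (rule Cauchy_Schwarz_ineq2)
    also have "\<dots> \<le> (norm (f x))\<^sup>2 + (norm (g x))\<^sup>2"
      using sum_squares_bound[of "norm (f x)" "norm (g x)"]
        mult_nonneg_nonneg[OF norm_ge_zero[of "f x"] norm_ge_zero[of "g x"]] by linarith
    finally show "norm (f x \<bullet> g x) \<le> norm ((norm (f x))\<^sup>2 + (norm (g x))\<^sup>2)" by simp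
  qed
qed (use assms in auto)

lemma integrable_norm2_of_nn_integral_le:
  fixes f :: "'a \<Rightarrow> 'b::euclidean_space"
  assumes [measurable]: "f \<in> borel_measurable M" and le: "(\<integral>\<^sup>+x. ennreal ((norm (f x))\<^sup>2) \<partial>M) \<le> ennreal C" and C: "C \<ge> 0"
  shows "integrable M (\<lambda>x. (norm (f x))\<^sup>2)" "(\<integral>x. (norm (f x))\<^sup>2 \<partial>M) \<le> C"
proof -
  show i: "integrable M (\<lambda>x. (norm (f x))\<^sup>2)"
    by (rule integrableI_bounded) (use le in \<open>auto simp: top.not_eq_extremum[symmetric] top_unique\<close>)
  have "ennreal (\<integral>x. (norm (f x))\<^sup>2 \<partial>M) \<le> ennreal C"
    using nn_integral_eq_integral[OF i] le by simp
  then show "(\<integral>x. (norm (f x))\<^sup>2 \<partial>M) \<le> C" using C by (simp add: ennreal_le_iff)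
qed

section \<open>Resampled pairs and the posterior mean\<close>

context target_law begin

definition S :: real where "S = (\<integral>y. (norm y)\<^sup>2 \<partial>\<nu>)"

lemma S_nonneg: "S \<ge> 0" unfolding S_def by (intro integral_nonneg_AE) auto

lemma nn_second_moment: "(\<integral>\<^sup>+y. ennreal ((norm y)\<^sup>2) \<partial>\<nu>) = ennreal S"
  unfolding S_def by (intro nn_integral_eq_integral second_moment) auto

abbreviation base :: "((real ^ 'd) \<times> (real ^ 'd)) measure" where "base \<equiv> gaussian 1 \<Otimes>\<^sub>M \<nu>"

lemma distr_extend_snd:
  assumes P: "prob_space P" and h[measurable]: "h \<in> borel_measurable P" and \<alpha>: "\<alpha> > 0"
    and law: "distr P borel h = law \<alpha> \<beta>"
  shows "distr (extend P h \<alpha> \<beta>) borel snd = \<nu>"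
proof -
  have "distr (joint \<alpha> \<beta>) borel snd = distr (extend P h \<alpha> \<beta>) borel snd"
    unfolding distr_extend_joint[OF P h \<alpha> law, symmetric]
    by (subst distr_distr) (auto simp: comp_def)
  then show ?thesis using target_eq_distr_joint by simp
qed

text \<open>The Gaussian part is recovered by solving \<open>\<alpha> z + \<beta> y = h\<close> for
  \<open>z\<close>. Whatever the past, the resampled pair is distributed as the original
  \<open>(Z, X1)\<close>, so expectations that involve only the new pair can be computed under
  \<open>base\<close>.\<close>

lemma distr_extend_base:
  assumes P: "prob_space P" and h[measurable]: "h \<in> borel_measurable P" and \<alpha>: "\<alpha> > 0"
    and law: "distr P borel h = law \<alpha> \<beta>"
  shows "distr (extend P h \<alpha> \<beta>) base (\<lambda>u. ((h (fst u) - \<beta> *\<^sub>R snd u) /\<^sub>R \<alpha>, snd u)) = base"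
proof -
  have "distr (extend P h \<alpha> \<beta>) base (\<lambda>u. ((h (fst u) - \<beta> *\<^sub>R snd u) /\<^sub>R \<alpha>, snd u)) =
     distr (joint \<alpha> \<beta>) base (\<lambda>(x, y). ((x - \<beta> *\<^sub>R y) /\<^sub>R \<alpha>, y))"
    unfolding distr_extend_joint[OF P h \<alpha> law, symmetric]
    by (subst distr_distr) (auto simp: comp_def)
  also have "\<dots> = distr base base (\<lambda>u. u)"
    unfolding joint_def
    by (subst distr_distr, measurable)
       (use \<alpha> in \<open>auto simp: comp_def case_prod_unfold intro!: distr_cong\<close>)
  finally show ?thesis by simp
qed

text \<open>Resampling from the bare position reproduces the joint law of position and target.
  Through this identity the orthogonality proved for \<open>extend\<close> carries over to
  \<open>base\<close>.\<close>

lemma extend_law_id: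
  assumes \<alpha>: "\<alpha> > 0"
  shows "extend (law \<alpha> \<beta>) (\<lambda>x. x) \<alpha> \<beta> = joint \<alpha> \<beta>"
proof -
  have "distr (extend (law \<alpha> \<beta>) (\<lambda>x. x) \<alpha> \<beta>) (borel \<Otimes>\<^sub>M borel) (\<lambda>u. (fst u, snd u)) = joint \<alpha> \<beta>"
    by (rule distr_extend_joint[OF prob_space_law _ \<alpha>]) (auto simp: distr_id2 sets_law)
  moreover have "sets (extend (law \<alpha> \<beta>) (\<lambda>x. x) \<alpha> \<beta>) = sets (borel \<Otimes>\<^sub>M borel)"
    unfolding sets_extend by (rule sets_pair_measure_cong) (auto simp: sets_law)
  ultimately show ?thesis by (simp add: distr_id2)
qed

lemma post_mean_measurable [measurable]:
  fixes g :: "real ^ 'd \<Rightarrow> real ^ 'd"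
  assumes [measurable]: "g \<in> borel_measurable borel"
  shows "(\<lambda>x. \<integral>y. g y \<partial>post \<alpha> \<beta> x) \<in> borel_measurable borel"
  unfolding integral_post[OF assms] by measurable

text \<open>Jensen under each posterior, followed by the tower property: averaging the posteriors
  over the law of the position gives back \<open>\<nu>\<close>. The bound is uniform in
  \<open>\<alpha>\<close> and \<open>\<beta>\<close>.\<close>

lemma nn_integral_post_mean_le:
  fixes g :: "real ^ 'd \<Rightarrow> real ^ 'd"
  assumes P: "prob_space P" and h[measurable]: "h \<in> borel_measurable P" and \<alpha>: "\<alpha> > 0"
    and law: "distr P borel h = law \<alpha> \<beta>"
    and g[measurable]: "g \<in> borel_measurable borel" and g2: "integrable \<nu> (\<lambda>y. (norm (g y))\<^sup>2)"
  shows "(\<integral>\<^sup>+\<omega>. ennreal ((norm (\<integral>y. g y \<partial>post \<alpha> \<beta> (h \<omega>)))\<^sup>2) \<partial>P) \<le> ennreal (\<integral>y. (norm (g y))\<^sup>2 \<partial>\<nu>)"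
proof -
  have "(\<integral>\<^sup>+\<omega>. ennreal ((norm (\<integral>y. g y \<partial>post \<alpha> \<beta> (h \<omega>)))\<^sup>2) \<partial>P) \<le>
    (\<integral>\<^sup>+\<omega>. \<integral>\<^sup>+y. ennreal ((norm (g y))\<^sup>2) \<partial>post \<alpha> \<beta> (h \<omega>) \<partial>P)"
  proof (rule nn_integral_mono)
    fix \<omega>
    interpret K: prob_space "post \<alpha> \<beta> (h \<omega>)" by (rule prob_space_post)
    have i: "integrable (post \<alpha> \<beta> (h \<omega>)) (\<lambda>y. (norm (g y))\<^sup>2)" by (rule integrable_post[OF g2])
    have "(norm (\<integral>y. g y \<partial>post \<alpha> \<beta> (h \<omega>)))\<^sup>2 \<le> (\<integral>y. (norm (g y))\<^sup>2 \<partial>post \<alpha> \<beta> (h \<omega>))"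
      by (rule K.norm_expectation_power2_le(2)[OF _ i]) measurable
    also have "ennreal \<dots> = (\<integral>\<^sup>+y. ennreal ((norm (g y))\<^sup>2) \<partial>post \<alpha> \<beta> (h \<omega>))"
      by (rule nn_integral_eq_integral[OF i, symmetric]) simp
    finally show "ennreal ((norm (\<integral>y. g y \<partial>post \<alpha> \<beta> (h \<omega>)))\<^sup>2) \<le> (\<integral>\<^sup>+y. ennreal ((norm (g y))\<^sup>2) \<partial>post \<alpha> \<beta> (h \<omega>))"
      by (simp add: ennreal_leI)
  qed
  also have "\<dots> = (\<integral>\<^sup>+u. ennreal ((norm (g (snd u)))\<^sup>2) \<partial>extend P h \<alpha> \<beta>)"
    by (subst nn_integral_extend[OF P h]) auto
  also have "\<dots> = (\<integral>\<^sup>+y. ennreal ((norm (g y))\<^sup>2) \<partial>distr (extend P h \<alpha> \<beta>) borel snd)"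
    by (subst nn_integral_distr) auto
  also have "\<dots> = ennreal (\<integral>y. (norm (g y))\<^sup>2 \<partial>\<nu>)"
    unfolding distr_extend_snd[OF P h \<alpha> law] by (rule nn_integral_eq_integral[OF g2]) simp
  finally show ?thesis .
qed

text \<open>A version of \<open>E [X1 | \<alpha> Z + \<beta> X1 = x]\<close> that is defined for
  every \<open>x\<close>.\<close>

definition pmean :: "real \<Rightarrow> real \<Rightarrow> real ^ 'd \<Rightarrow> real ^ 'd" where
  "pmean \<alpha> \<beta> x = (\<integral>y. y \<partial>post \<alpha> \<beta> x)"

lemma pmean_measurable [measurable]: "pmean \<alpha> \<beta> \<in> borel_measurable borel"
  unfolding pmean_def[abs_def] by measurable

lemma continuous_on_pmean:
  "continuous_on {u. fst u > 0} (\<lambda>u. pmean (fst u) (fst (snd u)) (snd (snd u)))"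
  unfolding pmean_def by (rule continuous_on_post[OF integrable_id])

lemma integrable_pmean:
  assumes P: "prob_space P" and h[measurable]: "h \<in> borel_measurable P" and \<alpha>: "\<alpha> > 0"
    and law: "distr P borel h = law \<alpha> \<beta>"
  shows "integrable P (\<lambda>\<omega>. (norm (pmean \<alpha> \<beta> (h \<omega>)))\<^sup>2)" "(\<integral>\<omega>. (norm (pmean \<alpha> \<beta> (h \<omega>)))\<^sup>2 \<partial>P) \<le> S"
proof -
  have "(\<integral>\<^sup>+\<omega>. ennreal ((norm (pmean \<alpha> \<beta> (h \<omega>)))\<^sup>2) \<partial>P) \<le> ennreal S"
    using nn_integral_post_mean_le[OF P h \<alpha> law _ second_moment]
    by (simp add: S_def pmean_def[symmetric])
  from integrable_norm2_of_nn_integral_le[OF _ this S_nonneg]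
  show "integrable P (\<lambda>\<omega>. (norm (pmean \<alpha> \<beta> (h \<omega>)))\<^sup>2)" "(\<integral>\<omega>. (norm (pmean \<alpha> \<beta> (h \<omega>)))\<^sup>2 \<partial>P) \<le> S"
    by auto
qed

text \<open>Given \<open>\<omega>\<close>, the new coordinate has mean
  \<open>pmean \<alpha> \<beta> (h \<omega>)\<close>. The test map \<open>f\<close> may depend on
  all of \<open>\<omega>\<close> and not only on the position \<open>h \<omega>\<close>; this is how
  a term containing \<open>Y\<close>, a function of the starting point, is later seen to
  vanish.\<close>

lemma integral_extend_orthogonal:
  fixes f :: "'p \<Rightarrow> real ^ 'd"
  assumes P: "prob_space P" and h[measurable]: "h \<in> borel_measurable P" and \<alpha>: "\<alpha> > 0"
    and law: "distr P borel h = law \<alpha> \<beta>"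
    and f[measurable]: "f \<in> borel_measurable P" and f2: "integrable P (\<lambda>\<omega>. (norm (f \<omega>))\<^sup>2)"
  shows "integrable (extend P h \<alpha> \<beta>) (\<lambda>u. f (fst u) \<bullet> (snd u - pmean \<alpha> \<beta> (h (fst u))))"
    and "(\<integral>u. f (fst u) \<bullet> (snd u - pmean \<alpha> \<beta> (h (fst u))) \<partial>extend P h \<alpha> \<beta>) = 0"
proof -
  interpret P: prob_space P by (rule P)
  interpret PT: pair_prob_space P \<nu> ..
  let ?E = "extend P h \<alpha> \<beta>"
  have F: "integrable ?E (\<lambda>u. F (fst u))" if "integrable P F" for F :: "'p \<Rightarrow> real"
  proof -
    have "integrable (distr ?E P fst) F" unfolding distr_extend_fst[OF P h] by (rule that)
    then show ?thesis by (subst (asm) integrable_distr_eq) (use that in auto)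
  qed
  have Y: "integrable ?E (\<lambda>u. (norm (snd u))\<^sup>2)"
  proof -
    have "integrable (distr ?E borel snd) (\<lambda>y. (norm y)\<^sup>2)"
      unfolding distr_extend_snd[OF P h \<alpha> law] by (rule second_moment)
    then show ?thesis by (subst (asm) integrable_distr_eq) auto
  qed
  show i: "integrable ?E (\<lambda>u. f (fst u) \<bullet> (snd u - pmean \<alpha> \<beta> (h (fst u))))"
    by (intro integrable_inner_L2 integrable_norm2_diff F f2 Y integrable_pmean[OF P h \<alpha> law]) measurable
  let ?k = "\<lambda>u. lik \<alpha> \<beta> (h (fst u)) (snd u) / nrm \<alpha> \<beta> (h (fst u))"
  let ?G = "\<lambda>u. f (fst u) \<bullet> (snd u - pmean \<alpha> \<beta> (h (fst u)))"
  have nn: "0 \<le> ?k u" for u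
    by (intro divide_nonneg_pos less_imp_le[OF lik_pos] nrm_pos)
  have E: "?E = density (P \<Otimes>\<^sub>M \<nu>) (\<lambda>u. ennreal (?k u))"
    by (simp add: extend_def case_prod_unfold)
  have i': "integrable (P \<Otimes>\<^sub>M \<nu>) (\<lambda>u. ?k u *\<^sub>R ?G u)"
    using i unfolding E by (subst (asm) integrable_density) (use nn in auto)
  have "(\<integral>u. ?G u \<partial>?E) = (\<integral>u. ?k u *\<^sub>R ?G u \<partial>(P \<Otimes>\<^sub>M \<nu>))"
    unfolding E by (subst integral_density) (use nn in auto)
  also have "\<dots> = (\<integral>\<omega>. \<integral>y. (lik \<alpha> \<beta> (h \<omega>) y / nrm \<alpha> \<beta> (h \<omega>)) *\<^sub>R (f \<omega> \<bullet> (y - pmean \<alpha> \<beta> (h \<omega>))) \<partial>\<nu> \<partial>P)"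
    using PT.integral_fst'[OF i'] by simp
  also have "\<dots> = (\<integral>\<omega>. 0 \<partial>P)"
  proof (rule Bochner_Integration.integral_cong[OF refl])
    fix \<omega>
    interpret K: prob_space "post \<alpha> \<beta> (h \<omega>)" by (rule prob_space_post)
    have "(\<integral>y. (lik \<alpha> \<beta> (h \<omega>) y / nrm \<alpha> \<beta> (h \<omega>)) *\<^sub>R (f \<omega> \<bullet> (y - pmean \<alpha> \<beta> (h \<omega>))) \<partial>\<nu>)
      = (\<integral>y. f \<omega> \<bullet> (y - pmean \<alpha> \<beta> (h \<omega>)) \<partial>post \<alpha> \<beta> (h \<omega>))"
      unfolding post_def
      by (rule integral_density[symmetric]) (auto intro!: divide_nonneg_pos less_imp_le[OF lik_pos] nrm_pos)
    also have "\<dots> = f \<omega> \<bullet> (\<integral>y. y - pmean \<alpha> \<beta> (h \<omega>) \<partial>post \<alpha> \<beta> (h \<omega>))"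
      by (intro integral_inner_right impI integrable_post Bochner_Integration.integrable_diff integrable_id) auto
    also have "(\<integral>y. y - pmean \<alpha> \<beta> (h \<omega>) \<partial>post \<alpha> \<beta> (h \<omega>)) = 0"
      by (subst Bochner_Integration.integral_diff) (auto intro: integrable_post integrable_id simp: pmean_def[symmetric] K.prob_space)
    finally show "(\<integral>y. (lik \<alpha> \<beta> (h \<omega>) y / nrm \<alpha> \<beta> (h \<omega>)) *\<^sub>R (f \<omega> \<bullet> (y - pmean \<alpha> \<beta> (h \<omega>))) \<partial>\<nu>) = 0" by simp
  qed
  finally show "(\<integral>u. ?G u \<partial>?E) = 0" by simp
qed

lemma integrable_base:
  "integrable base (\<lambda>u. (norm (fst u))\<^sup>2)" "integrable base (\<lambda>u. (norm (snd u))\<^sup>2)"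
  "(\<integral>u. (norm (snd u))\<^sup>2 \<partial>base) = S"
proof -
  show "integrable base (\<lambda>u. (norm (fst u))\<^sup>2)"
    using GT.Fubini_integrable[of "\<lambda>u. (norm (fst u))\<^sup>2"] integrable_gaussian_1_norm2[where 'd='d] by simp
  have d: "distr base \<nu> snd = \<nu>"
    using target_eq_distr_joint[of 1 0] unfolding joint_def
    by (subst (asm) distr_distr) (auto simp: comp_def case_prod_unfold sets_target cong: distr_cong)
  have "integrable (distr base \<nu> snd) (\<lambda>y. (norm y)\<^sup>2)" unfolding d by (rule second_moment)
  then show "integrable base (\<lambda>u. (norm (snd u))\<^sup>2)" by (subst (asm) integrable_distr_eq) auto
  have "(\<integral>y. (norm y)\<^sup>2 \<partial>distr base \<nu> snd) = (\<integral>u. (norm (snd u))\<^sup>2 \<partial>base)"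
    by (rule integral_distr) auto
  then show "(\<integral>u. (norm (snd u))\<^sup>2 \<partial>base) = S" unfolding d S_def by simp
qed

lemma integrable_base_affine: "integrable base (\<lambda>u. (norm (\<alpha> *\<^sub>R fst u + \<beta> *\<^sub>R snd u))\<^sup>2)"
  using integrable_base by (intro integrable_norm2_add) (auto simp: power_mult_distrib)

lemma distr_base_law: "distr base borel (\<lambda>u. \<alpha> *\<^sub>R fst u + \<beta> *\<^sub>R snd u) = law \<alpha> \<beta>"
  by (simp add: law_def case_prod_unfold)

text \<open>The orthogonality above with the position itself as test map, transported to
  \<open>base\<close> by \<open>extend_law_id\<close>.\<close>

lemma integral_base_orthogonal:
  assumes \<alpha>: "\<alpha> > 0"
  shows "(\<integral>u. (\<alpha> *\<^sub>R fst u + \<beta> *\<^sub>R snd u) \<bullet> (snd u - pmean \<alpha> \<beta> (\<alpha> *\<^sub>R fst u + \<beta> *\<^sub>R snd u)) \<partial>base) = 0"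
proof -
  have i: "integrable (law \<alpha> \<beta>) (\<lambda>x. (norm x)\<^sup>2)"
    unfolding distr_base_law[symmetric]
    by (subst integrable_distr_eq) (auto intro: integrable_base_affine)
  have "0 = (\<integral>u. fst u \<bullet> (snd u - pmean \<alpha> \<beta> (fst u)) \<partial>joint \<alpha> \<beta>)"
    using integral_extend_orthogonal(2)[OF prob_space_law _ \<alpha> _ _ i, of "\<lambda>x. x"]
    by (simp add: extend_law_id[OF \<alpha>] distr_id2 sets_law)
  also have "\<dots> = (\<integral>u. (\<alpha> *\<^sub>R fst u + \<beta> *\<^sub>R snd u) \<bullet> (snd u - pmean \<alpha> \<beta> (\<alpha> *\<^sub>R fst u + \<beta> *\<^sub>R snd u)) \<partial>base)"
    unfolding joint_def by (subst integral_distr) (auto simp: case_prod_unfold)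
  finally show ?thesis by simp
qed

end

section \<open>Continuity in L2 of the conditional noise\<close>

context target_law begin

definition resid :: "real \<Rightarrow> real \<Rightarrow> (real ^ 'd) \<times> (real ^ 'd) \<Rightarrow> real ^ 'd" where
  "resid \<alpha> \<beta> u = snd u - pmean \<alpha> \<beta> (\<alpha> *\<^sub>R fst u + \<beta> *\<^sub>R snd u)"

lemma resid_measurable [measurable]: "resid \<alpha> \<beta> \<in> borel_measurable (borel \<Otimes>\<^sub>M borel)"
  unfolding resid_def by measurable

lemma resid_measurable_base [measurable]: "resid \<alpha> \<beta> \<in> borel_measurable base"
  unfolding resid_def by measurable

lemma integrable_pmean_base:
  assumes \<alpha>: "\<alpha> > 0"
  shows "integrable base (\<lambda>u. (norm (pmean \<alpha> \<beta> (\<alpha> *\<^sub>R fst u + \<beta> *\<^sub>R snd u)))\<^sup>2)"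
    "(\<integral>u. (norm (pmean \<alpha> \<beta> (\<alpha> *\<^sub>R fst u + \<beta> *\<^sub>R snd u)))\<^sup>2 \<partial>base) \<le> S"
  by (rule integrable_pmean[OF GT.prob_space_axioms _ \<alpha> distr_base_law]; measurable)+

lemma integrable_resid:
  assumes \<alpha>: "\<alpha> > 0"
  shows "integrable base (\<lambda>u. (norm (resid \<alpha> \<beta> u))\<^sup>2)" "(\<integral>u. (norm (resid \<alpha> \<beta> u))\<^sup>2 \<partial>base) \<le> 4 * S"
proof -
  let ?p = "\<lambda>u. pmean \<alpha> \<beta> (\<alpha> *\<^sub>R fst u + \<beta> *\<^sub>R snd u)"
  show i: "integrable base (\<lambda>u. (norm (resid \<alpha> \<beta> u))\<^sup>2)"
    unfolding resid_def using integrable_base integrable_pmean_base[OF \<alpha>]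
    by (intro integrable_norm2_diff) auto
  have "(\<integral>u. (norm (resid \<alpha> \<beta> u))\<^sup>2 \<partial>base) \<le> (\<integral>u. 2 * (norm (snd u))\<^sup>2 + 2 * (norm (?p u))\<^sup>2 \<partial>base)"
    using integrable_base integrable_pmean_base[OF \<alpha>] i norm_diff_power2_le
    by (intro integral_mono) (auto simp: resid_def)
  also have "\<dots> = 2 * S + 2 * (\<integral>u. (norm (?p u))\<^sup>2 \<partial>base)"
    using integrable_base integrable_pmean_base[OF \<alpha>] by (subst Bochner_Integration.integral_add) auto
  also have "\<dots> \<le> 4 * S" using integrable_pmean_base(2)[OF \<alpha>] by simp
  finally show "(\<integral>u. (norm (resid \<alpha> \<beta> u))\<^sup>2 \<partial>base) \<le> 4 * S" .
qed

lemma tail_second_moment_tendsto_0: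
  "(\<lambda>K. \<integral>y. (norm (indicator {y. norm y > real K} y *\<^sub>R y))\<^sup>2 \<partial>\<nu>) \<longlonglongrightarrow> 0"
proof -
  have "(\<lambda>K. \<integral>y. (norm (indicator {y. norm y > real K} y *\<^sub>R y))\<^sup>2 \<partial>\<nu>) \<longlonglongrightarrow> (\<integral>y. 0 \<partial>\<nu>)"
  proof (rule integral_dominated_convergence[where w = "\<lambda>y. (norm y)\<^sup>2"])
    show "AE y in \<nu>. (\<lambda>K. (norm (indicator {y. norm y > real K} y *\<^sub>R y))\<^sup>2) \<longlonglongrightarrow> 0"
    proof (intro AE_I2)
      fix y :: "real ^ 'd"
      obtain N :: nat where N: "norm y \<le> real N" using real_arch_simple by blast
      have "eventually (\<lambda>K. (norm (indicator {y. norm y > real K} y *\<^sub>R y))\<^sup>2 = 0) sequentially"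
        using eventually_ge_at_top[of N] by eventually_elim (use N in auto)
      then show "(\<lambda>K. (norm (indicator {y. norm y > real K} y *\<^sub>R y))\<^sup>2) \<longlonglongrightarrow> 0"
        by (rule tendsto_eventually)
    qed
  qed (auto intro: second_moment simp: indicator_def)
  then show ?thesis by simp
qed

text \<open>The posterior mean integrates an unbounded function, so pointwise convergence has no
  evident dominating function. Truncation at radius \<open>K\<close> gives a bounded part
  \<open>G\<close>, handled by dominated convergence, and a remainder \<open>R\<close> whose L2 norm
  is controlled by the second-moment tail of \<open>\<nu>\<close> uniformly in the
  parameters.\<close>

lemma pmean_L2_continuous:
  assumes lim: "\<alpha> \<longlonglongrightarrow> A" "\<beta> \<longlonglongrightarrow> B" and pos: "\<And>n. \<alpha> n > 0" "A > 0"
  shows "(\<lambda>n. \<integral>u. (norm (pmean (\<alpha> n) (\<beta> n) (\<alpha> n *\<^sub>R fst u + \<beta> n *\<^sub>R snd u)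
      - pmean A B (A *\<^sub>R fst u + B *\<^sub>R snd u)))\<^sup>2 \<partial>base) \<longlonglongrightarrow> 0"
    (is "?I \<longlonglongrightarrow> 0")
proof (rule LIMSEQ_I)
  fix e :: real assume e: "e > 0"
  \<comment> \<open>The final estimate weighs the three contributions by 2, 4 and 4, so a share of
    \<open>e / 12\<close> for each leaves a total below \<open>e\<close>.\<close>
  obtain K :: nat where K: "(\<integral>y. (norm (indicator {y. norm y > real K} y *\<^sub>R y))\<^sup>2 \<partial>\<nu>) < e / 12"
    using order_tendstoD(2)[OF tail_second_moment_tendsto_0, of "e / 12"] e
    by (auto simp: eventually_sequentially)
  define r :: "real ^ 'd \<Rightarrow> real ^ 'd" where "r y = indicator {y. norm y > real K} y *\<^sub>R y" for y
  define g :: "real ^ 'd \<Rightarrow> real ^ 'd" where "g y = indicator {y. norm y \<le> real K} y *\<^sub>R y" for y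
  have rm[measurable]: "r \<in> borel_measurable borel" and gm[measurable]: "g \<in> borel_measurable borel"
    unfolding r_def g_def by measurable
  have gr: "y = g y + r y" for y by (auto simp: g_def r_def indicator_def)
  have gK: "norm (g y) \<le> K" for y by (auto simp: g_def indicator_def)
  have gi: "integrable \<nu> g"
    by (rule T.integrable_const_bound[where B = K]) (use gK in auto)
  have r2: "integrable \<nu> (\<lambda>y. (norm (r y))\<^sup>2)"
    by (rule Bochner_Integration.integrable_bound[OF second_moment]) (auto simp: r_def indicator_def)
  have ri: "integrable \<nu> r" by (rule T.norm_expectation_power2_le(1)[OF _ r2]) simp
  define G where "G \<alpha> \<beta> x = (\<integral>y. g y \<partial>post \<alpha> \<beta> x)" for \<alpha> \<beta> x
  define R where "R \<alpha> \<beta> x = (\<integral>y. r y \<partial>post \<alpha> \<beta> x)" for \<alpha> \<beta> x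
  have [measurable]: "G \<alpha> \<beta> \<in> borel_measurable borel" "R \<alpha> \<beta> \<in> borel_measurable borel" for \<alpha> \<beta>
    unfolding G_def R_def by measurable
  have pGR: "pmean \<alpha> \<beta> x = G \<alpha> \<beta> x + R \<alpha> \<beta> x" for \<alpha> \<beta> x
  proof -
    have "pmean \<alpha> \<beta> x = (\<integral>y. g y + r y \<partial>post \<alpha> \<beta> x)"
      unfolding pmean_def by (rule arg_cong[where f = "integral\<^sup>L _"]) (use gr in auto)
    then show ?thesis unfolding G_def R_def
      using integrable_post[OF gi] integrable_post[OF ri] by (simp add: Bochner_Integration.integral_add)
  qed
  have GK: "norm (G \<alpha> \<beta> x) \<le> K" for \<alpha> \<beta> x
  proof -
    interpret K: prob_space "post \<alpha> \<beta> x" by (rule prob_space_post)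
    have "norm (G \<alpha> \<beta> x) \<le> (\<integral>y. norm (g y) \<partial>post \<alpha> \<beta> x)" unfolding G_def by (rule integral_norm_bound)
    also have "\<dots> \<le> K"
      using integrable_post[OF gi] gK by (intro K.integral_le_const) auto
    finally show ?thesis .
  qed
  let ?X = "\<lambda>\<alpha> \<beta> u. \<alpha> *\<^sub>R fst u + \<beta> *\<^sub>R snd u"
  have Rint: "integrable base (\<lambda>u. (norm (R \<alpha> \<beta> (?X \<alpha> \<beta> u)))\<^sup>2)"
     "(\<integral>u. (norm (R \<alpha> \<beta> (?X \<alpha> \<beta> u)))\<^sup>2 \<partial>base) \<le> e / 12" if "\<alpha> > 0" for \<alpha> \<beta>
  proof -
    have "(\<integral>\<^sup>+u. ennreal ((norm (R \<alpha> \<beta> (?X \<alpha> \<beta> u)))\<^sup>2) \<partial>base) \<le> ennreal (\<integral>y. (norm (r y))\<^sup>2 \<partial>\<nu>)"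
      unfolding R_def
      by (rule nn_integral_post_mean_le[OF GT.prob_space_axioms _ that distr_base_law _ r2]) measurable
    also have "\<dots> \<le> ennreal (e / 12)" using K by (intro ennreal_leI) (simp add: r_def)
    finally have le: "(\<integral>\<^sup>+u. ennreal ((norm (R \<alpha> \<beta> (?X \<alpha> \<beta> u)))\<^sup>2) \<partial>base) \<le> ennreal (e / 12)" .
    have m: "(\<lambda>u. R \<alpha> \<beta> (?X \<alpha> \<beta> u)) \<in> borel_measurable base" by measurable
    show "integrable base (\<lambda>u. (norm (R \<alpha> \<beta> (?X \<alpha> \<beta> u)))\<^sup>2)"
       "(\<integral>u. (norm (R \<alpha> \<beta> (?X \<alpha> \<beta> u)))\<^sup>2 \<partial>base) \<le> e / 12"
      using integrable_norm2_of_nn_integral_le[OF m le] e by auto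
  qed
  let ?D = "\<lambda>n u. G (\<alpha> n) (\<beta> n) (?X (\<alpha> n) (\<beta> n) u) - G A B (?X A B u)"
  have "(\<lambda>n. \<integral>u. (norm (?D n u))\<^sup>2 \<partial>base) \<longlonglongrightarrow> (\<integral>u. 0 \<partial>base)"
  proof (rule integral_dominated_convergence[where w = "\<lambda>_. (2 * real K)\<^sup>2"])
    show "AE u in base. (\<lambda>n. (norm (?D n u))\<^sup>2) \<longlonglongrightarrow> 0"
    proof (intro AE_I2)
      fix u :: "(real ^ 'd) \<times> (real ^ 'd)"
      have "(\<lambda>n. (\<alpha> n, \<beta> n, ?X (\<alpha> n) (\<beta> n) u)) \<longlonglongrightarrow> (A, B, ?X A B u)"
        by (intro tendsto_intros lim)
      from continuous_on_tendsto_compose[OF continuous_on_post[OF gi] this]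
      have "(\<lambda>n. G (\<alpha> n) (\<beta> n) (?X (\<alpha> n) (\<beta> n) u)) \<longlonglongrightarrow> G A B (?X A B u)"
        using pos by (simp add: G_def)
      then have "(\<lambda>n. (norm (?D n u))\<^sup>2) \<longlonglongrightarrow> (norm (G A B (?X A B u) - G A B (?X A B u)))\<^sup>2"
        by (intro tendsto_intros)
      then show "(\<lambda>n. (norm (?D n u))\<^sup>2) \<longlonglongrightarrow> 0" by simp
    qed
    show "AE u in base. norm ((norm (?D n u))\<^sup>2) \<le> (2 * real K)\<^sup>2" for n
    proof (intro AE_I2)
      fix u
      have "norm (?D n u) \<le> 2 * real K"
        using norm_triangle_ineq4[of "G (\<alpha> n) (\<beta> n) (?X (\<alpha> n) (\<beta> n) u)" "G A B (?X A B u)"]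
          GK[of "\<alpha> n" "\<beta> n" "?X (\<alpha> n) (\<beta> n) u"] GK[of A B "?X A B u"] by linarith
      then show "norm ((norm (?D n u))\<^sup>2) \<le> (2 * real K)\<^sup>2"
        using power_mono[of "norm (?D n u)" "2 * real K" 2] by simp
    qed
  qed auto
  then obtain N where N: "\<And>n. n \<ge> N \<Longrightarrow> (\<integral>u. (norm (?D n u))\<^sup>2 \<partial>base) < e / 12"
    using order_tendstoD(2)[of _ 0 sequentially "e / 12"] e by (auto simp: eventually_sequentially)
  have Di: "integrable base (\<lambda>u. (norm (?D n u))\<^sup>2)" for n
  proof (rule GT.integrable_const_bound[where B = "(2 * real K)\<^sup>2"])
    show "AE u in base. norm ((norm (?D n u))\<^sup>2) \<le> (2 * real K)\<^sup>2"
    proof (intro AE_I2)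
      fix u
      have "norm (?D n u) \<le> 2 * real K"
        using norm_triangle_ineq4[of "G (\<alpha> n) (\<beta> n) (?X (\<alpha> n) (\<beta> n) u)" "G A B (?X A B u)"]
          GK[of "\<alpha> n" "\<beta> n" "?X (\<alpha> n) (\<beta> n) u"] GK[of A B "?X A B u"] by linarith
      then show "norm ((norm (?D n u))\<^sup>2) \<le> (2 * real K)\<^sup>2"
        using power_mono[of "norm (?D n u)" "2 * real K" 2] by simp
    qed
  qed measurable
  show "\<exists>N. \<forall>n\<ge>N. norm (?I n - 0) < e"
  proof (intro exI[of _ N] allI impI)
    fix n assume n: "n \<ge> N"
    let ?f = "\<lambda>u. pmean (\<alpha> n) (\<beta> n) (?X (\<alpha> n) (\<beta> n) u) - pmean A B (?X A B u)"
    let ?b = "\<lambda>u. 2 * (norm (?D n u))\<^sup>2 + (4 * (norm (R (\<alpha> n) (\<beta> n) (?X (\<alpha> n) (\<beta> n) u)))\<^sup>2 + 4 * (norm (R A B (?X A B u)))\<^sup>2)"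
    have bi: "integrable base ?b" using Di Rint(1)[OF pos(1)] Rint(1)[OF pos(2)] by auto
    have fb: "(norm (?f u))\<^sup>2 \<le> ?b u" for u
    proof -
      have "?f u = ?D n u + (R (\<alpha> n) (\<beta> n) (?X (\<alpha> n) (\<beta> n) u) - R A B (?X A B u))" by (simp add: pGR)
      then have "(norm (?f u))\<^sup>2 \<le> 2 * (norm (?D n u))\<^sup>2
          + 2 * (norm (R (\<alpha> n) (\<beta> n) (?X (\<alpha> n) (\<beta> n) u) - R A B (?X A B u)))\<^sup>2"
        using norm_add_power2_le by metis
      with norm_diff_power2_le[of "R (\<alpha> n) (\<beta> n) (?X (\<alpha> n) (\<beta> n) u)" "R A B (?X A B u)"]
      show ?thesis by linarith
    qed
    have "?I n \<le> integral\<^sup>L base ?b"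
      by (intro integral_mono_AE bi Bochner_Integration.integrable_bound[OF bi] AE_I2)
         (use fb in \<open>auto intro: order_trans[OF _ abs_ge_self]\<close>)
    also have "\<dots> = 2 * (\<integral>u. (norm (?D n u))\<^sup>2 \<partial>base) +
      (4 * (\<integral>u. (norm (R (\<alpha> n) (\<beta> n) (?X (\<alpha> n) (\<beta> n) u)))\<^sup>2 \<partial>base) + 4 * (\<integral>u. (norm (R A B (?X A B u)))\<^sup>2 \<partial>base))"
      using Di[of n] Rint(1)[OF pos(1), of n "\<beta> n"] Rint(1)[OF pos(2), of B]
      by (simp add: Bochner_Integration.integral_add)
    also have "\<dots> < e"
      using N[OF n] Rint(2)[OF pos(1), of n "\<beta> n"] Rint(2)[OF pos(2), of B] e by linarith
    finally have "?I n < e" .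
    moreover have "?I n \<ge> 0" by (intro integral_nonneg_AE) auto
    ultimately show "norm (?I n - 0) < e" by simp
  qed
qed

end

context target_law begin

text \<open>Both residuals contain the same target \<open>snd u\<close>, which cancels: the
  difference is \<open>\<kappa> n - K\<close> times a residual of bounded norm, minus
  \<open>K\<close> times a difference of posterior means.\<close>

lemma scaled_resid_L2_continuous:
  assumes lim: "\<alpha> \<longlonglongrightarrow> A" "\<beta> \<longlonglongrightarrow> B" "\<kappa> \<longlonglongrightarrow> K" and pos: "\<And>n. \<alpha> n > 0" "A > 0"
  shows "(\<lambda>n. \<integral>u. (norm (\<kappa> n *\<^sub>R resid (\<alpha> n) (\<beta> n) u - K *\<^sub>R resid A B u))\<^sup>2 \<partial>base) \<longlonglongrightarrow> 0"
proof (rule tendsto_sandwich[OF _ _ tendsto_const])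
  let ?J = "\<lambda>n. \<integral>u. (norm (pmean (\<alpha> n) (\<beta> n) (\<alpha> n *\<^sub>R fst u + \<beta> n *\<^sub>R snd u)
      - pmean A B (A *\<^sub>R fst u + B *\<^sub>R snd u)))\<^sup>2 \<partial>base"
  show "\<forall>\<^sub>F n in sequentially. 0 \<le> (\<integral>u. (norm (\<kappa> n *\<^sub>R resid (\<alpha> n) (\<beta> n) u - K *\<^sub>R resid A B u))\<^sup>2 \<partial>base)"
    by (intro always_eventually allI integral_nonneg_AE) auto
  have "(\<lambda>n. 2 * (\<kappa> n - K)\<^sup>2 * (4 * S) + 2 * K\<^sup>2 * ?J n) \<longlonglongrightarrow> 2 * (K - K)\<^sup>2 * (4 * S) + 2 * K\<^sup>2 * 0"
    by (intro tendsto_intros lim pmean_L2_continuous pos)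
  then show "(\<lambda>n. 2 * (\<kappa> n - K)\<^sup>2 * (4 * S) + 2 * K\<^sup>2 * ?J n) \<longlonglongrightarrow> 0" by simp
  show "\<forall>\<^sub>F n in sequentially. (\<integral>u. (norm (\<kappa> n *\<^sub>R resid (\<alpha> n) (\<beta> n) u - K *\<^sub>R resid A B u))\<^sup>2 \<partial>base)
      \<le> 2 * (\<kappa> n - K)\<^sup>2 * (4 * S) + 2 * K\<^sup>2 * ?J n"
  proof (intro always_eventually allI)
    fix n
    let ?p = "\<lambda>u. pmean (\<alpha> n) (\<beta> n) (\<alpha> n *\<^sub>R fst u + \<beta> n *\<^sub>R snd u) - pmean A B (A *\<^sub>R fst u + B *\<^sub>R snd u)"
    let ?r = "resid (\<alpha> n) (\<beta> n)"
    have pi: "integrable base (\<lambda>u. (norm (?p u))\<^sup>2)"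
      by (intro integrable_norm2_diff integrable_pmean_base pos) measurable
    have ri: "integrable base (\<lambda>u. (norm (?r u))\<^sup>2)" by (rule integrable_resid[OF pos(1)])
    have le: "(norm (\<kappa> n *\<^sub>R ?r u - K *\<^sub>R resid A B u))\<^sup>2 \<le> 2 * (\<kappa> n - K)\<^sup>2 * (norm (?r u))\<^sup>2 + 2 * K\<^sup>2 * (norm (?p u))\<^sup>2" for u
    proof -
      have "\<kappa> n *\<^sub>R ?r u - K *\<^sub>R resid A B u = (\<kappa> n - K) *\<^sub>R ?r u - K *\<^sub>R ?p u"
        by (simp add: resid_def algebra_simps)
      then show ?thesis
        using norm_diff_power2_le[of "(\<kappa> n - K) *\<^sub>R ?r u" "K *\<^sub>R ?p u"]
        by (simp add: power_mult_distrib mult.assoc)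
    qed
    have bi: "integrable base (\<lambda>u. 2 * (\<kappa> n - K)\<^sup>2 * (norm (?r u))\<^sup>2 + 2 * K\<^sup>2 * (norm (?p u))\<^sup>2)"
      using pi ri by (intro Bochner_Integration.integrable_add integrable_mult_right)
    have "(\<integral>u. (norm (\<kappa> n *\<^sub>R ?r u - K *\<^sub>R resid A B u))\<^sup>2 \<partial>base) \<le>
      (\<integral>u. 2 * (\<kappa> n - K)\<^sup>2 * (norm (?r u))\<^sup>2 + 2 * K\<^sup>2 * (norm (?p u))\<^sup>2 \<partial>base)"
      by (intro integral_mono_AE bi Bochner_Integration.integrable_bound[OF bi] AE_I2)
         (use le in \<open>auto intro: order_trans[OF _ abs_ge_self]\<close>)
    also have "\<dots> = 2 * (\<kappa> n - K)\<^sup>2 * (\<integral>u. (norm (?r u))\<^sup>2 \<partial>base) + 2 * K\<^sup>2 * ?J n"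
      using pi ri by (subst Bochner_Integration.integral_add) (auto intro!: integrable_mult_right)
    also have "\<dots> \<le> 2 * (\<kappa> n - K)\<^sup>2 * (4 * S) + 2 * K\<^sup>2 * ?J n"
      using integrable_resid(2)[OF pos(1)] by (intro add_mono mult_left_mono) auto
    finally show "(\<integral>u. (norm (\<kappa> n *\<^sub>R ?r u - K *\<^sub>R resid A B u))\<^sup>2 \<partial>base)
      \<le> 2 * (\<kappa> n - K)\<^sup>2 * (4 * S) + 2 * K\<^sup>2 * ?J n" .
  qed
qed

text \<open>Heine-Cantor for a curve in L2, by contradiction: offending pairs of times have a common
  accumulation point \<open>c\<close>, where sequential continuity applies. As \<open>D\<close> is a
  squared distance, the triangle inequality through \<open>c\<close> costs a factor 2.\<close>

lemma scaled_resid_uniformly_continuous: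
  fixes a b \<kappa> :: "real \<Rightarrow> real"
  assumes cont: "continuous_on UNIV a" "continuous_on UNIV b" "continuous_on UNIV \<kappa>"
    and pos: "\<And>t. a t > 0" and e: "e > 0"
  shows "\<exists>d>0. \<forall>s\<in>{0..T}. \<forall>t\<in>{0..T}. \<bar>s - t\<bar> < d \<longrightarrow>
    (\<integral>u. (norm (\<kappa> s *\<^sub>R resid (a s) (b s) u - \<kappa> t *\<^sub>R resid (a t) (b t) u))\<^sup>2 \<partial>base) \<le> e"
proof (rule ccontr)
  let ?z = "\<lambda>s u. \<kappa> s *\<^sub>R resid (a s) (b s) u"
  define D where "D s t = (\<integral>u. (norm (?z s u - ?z t u))\<^sup>2 \<partial>base)" for s t
  assume neg: "\<not> ?thesis"
  have "\<exists>s t. s \<in> {0..T} \<and> t \<in> {0..T} \<and> \<bar>s - t\<bar> < 1 / real (Suc n) \<and> D s t > e" for n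
  proof (rule ccontr)
    assume "\<not> ?thesis"
    then have "\<forall>s\<in>{0..T}. \<forall>t\<in>{0..T}. \<bar>s - t\<bar> < 1 / real (Suc n) \<longrightarrow> D s t \<le> e"
      unfolding not_less[symmetric] by blast
    moreover have "1 / real (Suc n) > 0" by simp
    ultimately show False using neg unfolding D_def[symmetric] by blast
  qed
  then obtain s t where st: "\<And>n. s n \<in> {0..T}" "\<And>n. t n \<in> {0..T}" "\<And>n. \<bar>s n - t n\<bar> < 1 / real (Suc n)"
    "\<And>n. D (s n) (t n) > e" by metis
  have "\<forall>n. s n \<in> {0..T}" using st(1) by blast
  with seq_compactE[OF compact_imp_seq_compact[OF compact_Icc]] obtain c r where
    c: "c \<in> {0..T}" "strict_mono r" "(s \<circ> r) \<longlonglongrightarrow> c" by blast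
  have "(\<lambda>n. 1 / real (Suc (r n))) \<longlonglongrightarrow> 0"
    using LIMSEQ_subseq_LIMSEQ[OF LIMSEQ_inverse_real_of_nat c(2)] by (simp add: comp_def inverse_eq_divide)
  then have "(\<lambda>n. s (r n) - t (r n)) \<longlonglongrightarrow> 0"
  proof (rule Lim_null_comparison[rotated])
    show "\<forall>\<^sub>F n in sequentially. norm (s (r n) - t (r n)) \<le> 1 / real (Suc (r n))"
      unfolding real_norm_def by (intro always_eventually allI less_imp_le st(3))
  qed
  from tendsto_diff[OF c(3) this] have t: "(\<lambda>n. t (r n)) \<longlonglongrightarrow> c" by (simp add: comp_def)
  have s: "(\<lambda>n. s (r n)) \<longlonglongrightarrow> c" using c(3) by (simp add: comp_def)
  have comp: "(\<lambda>n. f (x n)) \<longlonglongrightarrow> f c" if "continuous_on UNIV f" "x \<longlonglongrightarrow> c" for f x :: "_ \<Rightarrow> real"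
    using continuous_on_tendsto_compose[OF that(1) that(2)] by simp
  have lim: "(\<lambda>n. D (x n) c) \<longlonglongrightarrow> 0" if "x \<longlonglongrightarrow> c" for x
    unfolding D_def
    by (rule scaled_resid_L2_continuous[OF comp[OF cont(1) that] comp[OF cont(2) that] comp[OF cont(3) that] pos pos])
  have zi: "integrable base (\<lambda>u. (norm (?z s u - ?z t u))\<^sup>2)" for s t
    by (intro integrable_norm2_diff) (auto simp: power_mult_distrib intro!: integrable_resid pos)
  have le: "D (s (r n)) (t (r n)) \<le> 2 * D (s (r n)) c + 2 * D (t (r n)) c" for n
  proof -
    have "D (s (r n)) (t (r n)) \<le> (\<integral>u. 2 * (norm (?z (s (r n)) u - ?z c u))\<^sup>2 + 2 * (norm (?z (t (r n)) u - ?z c u))\<^sup>2 \<partial>base)"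
      unfolding D_def
    proof (intro integral_mono zi Bochner_Integration.integrable_add integrable_mult_right)
      fix u
      show "(norm (?z (s (r n)) u - ?z (t (r n)) u))\<^sup>2 \<le> 2 * (norm (?z (s (r n)) u - ?z c u))\<^sup>2 + 2 * (norm (?z (t (r n)) u - ?z c u))\<^sup>2"
        using norm_diff_power2_le[of "?z (s (r n)) u - ?z c u" "?z (t (r n)) u - ?z c u"] by simp
    qed
    also have "\<dots> = 2 * D (s (r n)) c + 2 * D (t (r n)) c"
      unfolding D_def using zi by (subst Bochner_Integration.integral_add) auto
    finally show ?thesis .
  qed
  have "(\<lambda>n. 2 * D (s (r n)) c + 2 * D (t (r n)) c) \<longlonglongrightarrow> 2 * 0 + 2 * 0"
    by (intro tendsto_intros lim s t)
  then have "(\<lambda>n. 2 * D (s (r n)) c + 2 * D (t (r n)) c) \<longlonglongrightarrow> 0" by simp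
  from order_tendstoD(2)[OF this e] obtain n where "2 * D (s (r n)) c + 2 * D (t (r n)) c < e"
    by (auto simp: eventually_sequentially)
  with le[of n] st(4)[of "r n"] show False by linarith
qed

end

section \<open>The straight interpolation and its noise\<close>

locale interpolation = target_law \<nu> for \<nu> :: "(real ^ 'd) measure" +
  fixes a b a' b' :: "real \<Rightarrow> real" and T :: real
  assumes T: "0 \<le> T" "T \<le> 1"
    and cont: "continuous_on UNIV a" "continuous_on UNIV b" "continuous_on UNIV a'" "continuous_on UNIV b'"
    and a_pos: "\<And>t. a t > 0"
    and a_deriv: "\<And>t. t \<in> {0..T} \<Longrightarrow> (a has_real_derivative a' t) (at t within {0..T})"
    and b_deriv: "\<And>t. t \<in> {0..T} \<Longrightarrow> (b has_real_derivative b' t) (at t within {0..T})"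
begin

text \<open>Coefficient of \<open>X1\<close> after \<open>Z\<close> has been eliminated from
  \<open>a' Z + b' X1\<close> by means of \<open>x = a Z + b X1\<close>. It multiplies both the
  posterior mean in the drift and the residual in the noise \<open>\<zeta>\<close>.\<close>

definition \<kappa> :: "real \<Rightarrow> real" where "\<kappa> t = b' t - a' t * b t / a t"

definition drift :: "real \<Rightarrow> real ^ 'd \<Rightarrow> real ^ 'd" where
  "drift t x = (a' t / a t) *\<^sub>R x + \<kappa> t *\<^sub>R pmean (a t) (b t) x"

definition X :: "real \<Rightarrow> (real ^ 'd) \<times> (real ^ 'd) \<Rightarrow> real ^ 'd" where
  "X t u = a t *\<^sub>R fst u + b t *\<^sub>R snd u"

definition \<zeta> :: "real \<Rightarrow> (real ^ 'd) \<times> (real ^ 'd) \<Rightarrow> real ^ 'd" where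
  "\<zeta> t u = \<kappa> t *\<^sub>R resid (a t) (b t) u"

abbreviation law_at :: "real \<Rightarrow> (real ^ 'd) measure" where "law_at t \<equiv> law (a t) (b t)"

lemma a_nonzero: "a t \<noteq> 0" using a_pos[of t] by simp

lemma \<kappa>_cont: "continuous_on UNIV \<kappa>"
  unfolding \<kappa>_def[abs_def] using a_nonzero by (intro continuous_intros cont) auto

lemma velocity_decomp: "a' t *\<^sub>R fst u + b' t *\<^sub>R snd u = drift t (X t u) + \<zeta> t u"
proof -
  have "drift t (X t u) + \<zeta> t u = (a' t / a t) *\<^sub>R X t u + \<kappa> t *\<^sub>R snd u"
    by (simp add: drift_def \<zeta>_def resid_def X_def algebra_simps)
  also have "\<dots> = (a' t / a t * a t) *\<^sub>R fst u + (a' t / a t * b t + \<kappa> t) *\<^sub>R snd u"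
    by (simp add: X_def algebra_simps)
  also have "\<dots> = a' t *\<^sub>R fst u + b' t *\<^sub>R snd u"
    using a_nonzero[of t] by (simp add: \<kappa>_def)
  finally show ?thesis by simp
qed

lemma pmean_cont: "continuous_on UNIV (\<lambda>(t, x). pmean (a t) (b t) x)"
proof -
  have c: "continuous_on UNIV (\<lambda>u::real \<times> (real ^ 'd). (a (fst u), b (fst u), snd u))"
    by (intro continuous_intros continuous_on_compose2[OF cont(1)] continuous_on_compose2[OF cont(2)]) auto
  show ?thesis
    using continuous_on_compose2[OF continuous_on_pmean c] a_pos by (simp add: case_prod_unfold image_subset_iff)
qed

lemma X_cont: "continuous_on UNIV (\<lambda>(t, u). X t u)"
  unfolding X_def case_prod_unfold
  by (intro continuous_intros continuous_on_compose2[OF cont(1)] continuous_on_compose2[OF cont(2)]) auto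

lemma \<zeta>_cont: "continuous_on UNIV (\<lambda>(t, u). \<zeta> t u)"
proof -
  have c: "continuous_on UNIV (\<lambda>v. (fst v, X (fst v) (snd v)))"
    using X_cont by (intro continuous_intros) (simp add: case_prod_unfold)
  have "continuous_on UNIV (\<lambda>v. pmean (a (fst v)) (b (fst v)) (X (fst v) (snd v)))"
    using continuous_on_compose2[OF pmean_cont c] by simp
  then show ?thesis
    unfolding \<zeta>_def resid_def case_prod_unfold X_def[symmetric]
    by (intro continuous_intros continuous_on_compose2[OF \<kappa>_cont]) auto
qed

lemma measurable_X [measurable (raw)]:
  assumes [measurable]: "f \<in> borel_measurable M" "g \<in> M \<rightarrow>\<^sub>M borel \<Otimes>\<^sub>M borel"
  shows "(\<lambda>\<omega>. X (f \<omega>) (g \<omega>)) \<in> borel_measurable M"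
  using borel_measurable_continuous_onI[OF X_cont] assms
  by (rule_tac measurable_compose[of "\<lambda>\<omega>. (f \<omega>, g \<omega>)" M borel "\<lambda>(t, x). X t x" borel, simplified])
     (auto simp: borel_prod[symmetric])

lemma measurable_\<zeta> [measurable (raw)]:
  assumes [measurable]: "f \<in> borel_measurable M" "g \<in> M \<rightarrow>\<^sub>M borel \<Otimes>\<^sub>M borel"
  shows "(\<lambda>\<omega>. \<zeta> (f \<omega>) (g \<omega>)) \<in> borel_measurable M"
  using borel_measurable_continuous_onI[OF \<zeta>_cont] assms
  by (rule_tac measurable_compose[of "\<lambda>\<omega>. (f \<omega>, g \<omega>)" M borel "\<lambda>(t, x). \<zeta> t x" borel, simplified])
     (auto simp: borel_prod[symmetric])

lemma distr_X: "distr base borel (X t) = law_at t"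
  using distr_base_law[of "a t" "b t"] by (simp add: X_def[abs_def])

lemma \<zeta>_L2: "integrable base (\<lambda>u. (norm (\<zeta> t u))\<^sup>2)" "(\<integral>u. (norm (\<zeta> t u))\<^sup>2 \<partial>base) \<le> (\<kappa> t)\<^sup>2 * (4 * S)"
proof -
  show "integrable base (\<lambda>u. (norm (\<zeta> t u))\<^sup>2)"
    using integrable_resid[OF a_pos, of t] by (simp add: \<zeta>_def power_mult_distrib)
  have "(\<integral>u. (norm (\<zeta> t u))\<^sup>2 \<partial>base) = (\<kappa> t)\<^sup>2 * (\<integral>u. (norm (resid (a t) (b t) u))\<^sup>2 \<partial>base)"
    by (simp add: \<zeta>_def power_mult_distrib)
  then show "(\<integral>u. (norm (\<zeta> t u))\<^sup>2 \<partial>base) \<le> (\<kappa> t)\<^sup>2 * (4 * S)"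
    using integrable_resid(2)[OF a_pos, of t "b t"] by (auto intro: mult_left_mono)
qed

lemma X_L2: "integrable base (\<lambda>u. (norm (X t u))\<^sup>2)"
  unfolding X_def by (rule integrable_base_affine)

lemma X_\<zeta>_orthogonal: "(\<integral>u. X t u \<bullet> \<zeta> t u \<partial>base) = 0"
  using integral_base_orthogonal[OF a_pos, of t "b t"] by (simp add: X_def \<zeta>_def resid_def)

lemma \<zeta>_uniform:
  "e > 0 \<Longrightarrow> \<exists>d>0. \<forall>s\<in>{0..T}. \<forall>t\<in>{0..T}. \<bar>s - t\<bar> < d \<longrightarrow> (\<integral>u. (norm (\<zeta> s u - \<zeta> t u))\<^sup>2 \<partial>base) \<le> e"
  unfolding \<zeta>_def by (rule scaled_resid_uniformly_continuous[OF cont(1,2) \<kappa>_cont a_pos])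

text \<open>An explicit majorant that is continuous in time is used: its boundedness on
  \<open>[0, T]\<close> follows from compactness, without any continuity of the integrals
  themselves.\<close>

lemma L2_bounds:
  "\<exists>C\<ge>0. \<forall>t\<in>{0..T}. (\<integral>u. (norm (X t u))\<^sup>2 \<partial>base) \<le> C \<and> (\<integral>u. (norm (\<zeta> t u))\<^sup>2 \<partial>base) \<le> C"
proof -
  let ?Z = "\<integral>u. (norm (fst u))\<^sup>2 \<partial>base"
  define f where "f t = 2 * (a t)\<^sup>2 * ?Z + 2 * (b t)\<^sup>2 * S + (\<kappa> t)\<^sup>2 * (4 * S)" for t
  have "continuous_on UNIV f"
    unfolding f_def by (intro continuous_intros cont(1,2) \<kappa>_cont)
  then have "continuous_on {0..T} f" by (rule continuous_on_subset) simp
  from compact_imp_bounded[OF compact_continuous_image[OF this compact_Icc]]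
  obtain C where "\<And>x. x \<in> f ` {0..T} \<Longrightarrow> norm x \<le> C" unfolding bounded_iff by blast
  then have C: "norm (2 * (a t)\<^sup>2 * ?Z + 2 * (b t)\<^sup>2 * S + (\<kappa> t)\<^sup>2 * (4 * S)) \<le> C" if "t \<in> {0..T}" for t
    using that unfolding f_def by blast
  have Z: "?Z \<ge> 0" by (intro integral_nonneg_AE) auto
  have "(\<integral>u. (norm (X t u))\<^sup>2 \<partial>base) \<le> 2 * (a t)\<^sup>2 * ?Z + 2 * (b t)\<^sup>2 * S" for t
  proof -
    have "(\<integral>u. (norm (X t u))\<^sup>2 \<partial>base) \<le> (\<integral>u. 2 * (a t)\<^sup>2 * (norm (fst u))\<^sup>2 + 2 * (b t)\<^sup>2 * (norm (snd u))\<^sup>2 \<partial>base)"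
      using norm_add_power2_le[of "a t *\<^sub>R fst _" "b t *\<^sub>R snd _"]
      by (intro integral_mono X_L2 Bochner_Integration.integrable_add integrable_mult_right integrable_base)
         (auto simp: X_def power_mult_distrib mult.assoc)
    also have "\<dots> = 2 * (a t)\<^sup>2 * ?Z + 2 * (b t)\<^sup>2 * S"
      using integrable_base by (subst Bochner_Integration.integral_add) auto
    finally show ?thesis .
  qed
  note X_le = this
  show ?thesis
  proof (intro exI[of _ "\<bar>C\<bar>"] conjI ballI abs_ge_zero)
    fix t assume t: "t \<in> {0..T}"
    have le: "2 * (a t)\<^sup>2 * ?Z + 2 * (b t)\<^sup>2 * S + (\<kappa> t)\<^sup>2 * (4 * S) \<le> \<bar>C\<bar>"
      using C[OF t] unfolding real_norm_def by linarith
    have nn: "0 \<le> 2 * (a t)\<^sup>2 * ?Z" "0 \<le> 2 * (b t)\<^sup>2 * S" "0 \<le> (\<kappa> t)\<^sup>2 * (4 * S)"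
      using Z S_nonneg by (auto intro!: mult_nonneg_nonneg)
    show "(\<integral>u. (norm (X t u))\<^sup>2 \<partial>base) \<le> \<bar>C\<bar>" using X_le[of t] le nn by linarith
    show "(\<integral>u. (norm (\<zeta> t u))\<^sup>2 \<partial>base) \<le> \<bar>C\<bar>" using \<zeta>_L2(2)[of t] le nn by linarith
  qed
qed

end

section \<open>One step of the coupling\<close>

text \<open>Both parts of the result are instances. The modulus \<open>r\<close> stands for the
  error of \<open>w\<close>, measured at the position of \<open>Y\<close> in one case and at that of
  \<open>X\<close> in the other. Since the coupling is only constructed later, \<open>r_L2\<close>
  speaks about every coupling of the two marginals; in each instance the integrand depends on one
  marginal only, so the bound is the same for all of them.\<close>

locale coupled_flow = interpolation \<nu> a b a' b' T
  for \<nu> :: "(real ^ 'd) measure" and a b a' b' :: "real \<Rightarrow> real" and T :: real +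
  fixes w Y :: "real \<Rightarrow> real ^ 'd \<Rightarrow> real ^ 'd" and l e2 :: "real \<Rightarrow> real" and \<eta> C\<^sub>Y :: real
    and r :: "real \<Rightarrow> real ^ 'd \<Rightarrow> real ^ 'd \<Rightarrow> real"
  assumes \<eta>: "\<eta> > 0"
    and Y_deriv: "\<And>s x. s \<in> {0..T} \<Longrightarrow> ((\<lambda>s. Y s x) has_vector_derivative w s (Y s x)) (at s within {0..T})"
    and Y_0: "\<And>x. Y 0 x = x"
    and Y_meas: "(\<lambda>(s, x). Y s x) \<in> borel_measurable (borel \<Otimes>\<^sub>M borel)"
    and Y_int: "AE x in law_at 0. set_integrable lborel {0..T} (\<lambda>s. w s (Y s x))"
    and Y_L2: "\<And>s. s \<in> {0..T} \<Longrightarrow> (\<integral>\<^sup>+x. ennreal ((norm (Y s x))\<^sup>2) \<partial>law_at 0) \<le> ennreal C\<^sub>Y"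
    and C\<^sub>Y: "C\<^sub>Y \<ge> 0"
    and l: "set_integrable lborel {0..1} l"
    and r_meas: "(\<lambda>(s, x, y). r s x y) \<in> borel_measurable (borel \<Otimes>\<^sub>M borel \<Otimes>\<^sub>M borel)"
    and monotone_defect: "\<And>s x y. s \<in> {0<..<T} \<Longrightarrow>
      (x - y) \<bullet> (drift s x - w s y) \<le> l s * (norm (x - y))\<^sup>2 + norm (x - y) * r s x y"
    and r_L2: "AE s in lborel. s \<in> {0..T} \<longrightarrow> (\<forall>P. prob_space P \<longrightarrow> sets P = sets (borel \<Otimes>\<^sub>M borel) \<longrightarrow>
      distr P borel fst = law_at 0 \<longrightarrow> distr P borel snd = law_at s \<longrightarrow>
      (\<integral>\<^sup>+u. ennreal ((r s (snd u) (Y s (fst u)))\<^sup>2) \<partial>P) \<le> ennreal (e2 s))"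
    and e2: "set_integrable lborel {0..T} e2" "\<And>s. e2 s \<ge> 0"
begin

lemma measurable_Y [measurable (raw)]:
  assumes [measurable]: "f \<in> borel_measurable M" "g \<in> borel_measurable M"
  shows "(\<lambda>\<omega>. Y (f \<omega>) (g \<omega>)) \<in> borel_measurable M"
  using measurable_compose[OF measurable_Pair[OF assms] Y_meas] by simp

lemma measurable_r [measurable (raw)]:
  assumes [measurable]: "f \<in> borel_measurable M" "g \<in> borel_measurable M" "h \<in> borel_measurable M"
  shows "(\<lambda>\<omega>. r (f \<omega>) (g \<omega>) (h \<omega>)) \<in> borel_measurable M"
  using measurable_compose[OF measurable_Pair[OF assms(1) measurable_Pair[OF assms(2,3)]] r_meas] by simp

abbreviation W :: "real \<Rightarrow> real" where "W \<equiv> weight l \<eta>"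

text \<open>The first coordinate is the starting point of \<open>Y\<close>, not its current
  position. The flow enters as a deterministic function of that point, so no law of \<open>Y\<close>
  has to be transported along the steps.\<close>

definition coupling_at :: "real \<Rightarrow> ((real ^ 'd) \<times> (real ^ 'd)) measure \<Rightarrow> bool" where
  "coupling_at t P \<longleftrightarrow> prob_space P \<and> sets P = sets (borel \<Otimes>\<^sub>M borel) \<and>
     distr P borel fst = law_at 0 \<and> distr P borel snd = law_at t"

definition cost :: "real \<Rightarrow> ((real ^ 'd) \<times> (real ^ 'd)) measure \<Rightarrow> real" where
  "cost t P = (\<integral>u. (norm (snd u - Y t (fst u)))\<^sup>2 \<partial>P)"

text \<open>For \<open>\<omega> = ((x0, x), y)\<close>, with \<open>x\<close> the position at time
  \<open>t\<close> and \<open>y\<close> the fresh target, this is the pair with target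
  \<open>y\<close> whose straight interpolation passes through \<open>x\<close> at time
  \<open>t\<close>.\<close>

definition latent :: "real \<Rightarrow> ((real ^ 'd) \<times> (real ^ 'd)) \<times> (real ^ 'd) \<Rightarrow> (real ^ 'd) \<times> (real ^ 'd)" where
  "latent t \<omega> = ((snd (fst \<omega>) - b t *\<^sub>R snd \<omega>) /\<^sub>R a t, snd \<omega>)"

lemma latent_measurable [measurable]: "latent t \<in> (borel \<Otimes>\<^sub>M borel) \<Otimes>\<^sub>M borel \<rightarrow>\<^sub>M borel \<Otimes>\<^sub>M borel"
  unfolding latent_def by measurable

lemma X_latent: "X t (latent t \<omega>) = snd (fst \<omega>)"
  using a_nonzero[of t] by (simp add: X_def latent_def)

text \<open>The resampled pair has the law \<open>base\<close>, and \<open>X s\<close> maps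
  \<open>base\<close> to \<open>law_at s\<close>; the starting point is untouched. Hence following
  the interpolation of the new pair from time \<open>t\<close> to any time \<open>s\<close> yields
  exact marginals, with no discretisation error in the law.\<close>

lemma coupling_extend:
  assumes P: "coupling_at t P"
  defines "E \<equiv> extend P snd (a t) (b t)"
  shows "prob_space E" "sets E = sets ((borel \<Otimes>\<^sub>M borel) \<Otimes>\<^sub>M borel)" "distr E P fst = P"
    "distr E base (latent t) = base"
    "coupling_at s (distr E (borel \<Otimes>\<^sub>M borel) (\<lambda>\<omega>. (fst (fst \<omega>), X s (latent t \<omega>))))"
proof -
  have P': "prob_space P" and sP[measurable_cong]: "sets P = sets (borel \<Otimes>\<^sub>M borel)"
    and f: "distr P borel fst = law_at 0" and sn: "distr P borel snd = law_at t"
    using P by (auto simp: coupling_at_def)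
  have h: "snd \<in> borel_measurable P" by measurable
  show E: "prob_space E" unfolding E_def by (rule prob_space_extend[OF P' h])
  show sE[measurable_cong]: "sets E = sets ((borel \<Otimes>\<^sub>M borel) \<Otimes>\<^sub>M borel)"
    unfolding E_def sets_extend by (rule sets_pair_measure_cong[OF sP refl])
  show dP: "distr E P fst = P" unfolding E_def by (rule distr_extend_fst[OF P' h])
  show dB: "distr E base (latent t) = base"
    unfolding E_def latent_def[abs_def] by (rule distr_extend_base[OF P' h a_pos sn])
  have "distr (distr E (borel \<Otimes>\<^sub>M borel) (\<lambda>\<omega>. (fst (fst \<omega>), X s (latent t \<omega>)))) borel fst = distr (distr E P fst) borel fst"
    by (subst (1 2) distr_distr) (auto simp: comp_def)
  moreover have "distr (distr E (borel \<Otimes>\<^sub>M borel) (\<lambda>\<omega>. (fst (fst \<omega>), X s (latent t \<omega>)))) borel snd = distr (distr E base (latent t)) borel (X s)"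
    by (subst (1 2) distr_distr) (auto simp: comp_def)
  ultimately show "coupling_at s (distr E (borel \<Otimes>\<^sub>M borel) (\<lambda>\<omega>. (fst (fst \<omega>), X s (latent t \<omega>))))"
    unfolding coupling_at_def using f distr_X dP dB
    by (auto intro!: prob_space.prob_space_distr[OF E])
qed

lemma Y_L2': "s \<in> {0..T} \<Longrightarrow> integrable (law_at 0) (\<lambda>x. (norm (Y s x))\<^sup>2)"
  "s \<in> {0..T} \<Longrightarrow> (\<integral>x. (norm (Y s x))\<^sup>2 \<partial>law_at 0) \<le> C\<^sub>Y"
  using integrable_norm2_of_nn_integral_le[OF _ Y_L2 C\<^sub>Y] by auto

lemma latent_integral:
  fixes f :: "_ \<Rightarrow> real"
  assumes P: "coupling_at t P"
  defines "E \<equiv> extend P snd (a t) (b t)"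
  shows "f \<in> borel_measurable (borel \<Otimes>\<^sub>M borel) \<Longrightarrow> (\<integral>\<omega>. f (latent t \<omega>) \<partial>E) = (\<integral>u. f u \<partial>base)"
    and "integrable base f \<Longrightarrow> integrable E (\<lambda>\<omega>. f (latent t \<omega>))"
proof -
  note sE[measurable_cong] = coupling_extend(2)[OF P, folded E_def]
  note dB = coupling_extend(4)[OF P, folded E_def]
  show "(\<integral>\<omega>. f (latent t \<omega>) \<partial>E) = (\<integral>u. f u \<partial>base)" if [measurable]: "f \<in> borel_measurable (borel \<Otimes>\<^sub>M borel)"
  proof -
    have "(\<integral>u. f u \<partial>distr E base (latent t)) = (\<integral>\<omega>. f (latent t \<omega>) \<partial>E)"
      by (rule integral_distr) measurable
    then show ?thesis unfolding dB by simp
  qed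
  show "integrable E (\<lambda>\<omega>. f (latent t \<omega>))" if i: "integrable base f"
  proof -
    have [measurable]: "f \<in> borel_measurable base" using i by simp
    have "integrable (distr E base (latent t)) f" unfolding dB by (rule i)
    then show ?thesis by (subst (asm) integrable_distr_eq) measurable
  qed
qed

lemma initial_integral:
  fixes f :: "_ \<Rightarrow> real"
  assumes P: "coupling_at t P"
  defines "E \<equiv> extend P snd (a t) (b t)"
  shows "f \<in> borel_measurable borel \<Longrightarrow> (\<integral>\<omega>. f (fst (fst \<omega>)) \<partial>E) = (\<integral>u. f u \<partial>law_at 0)"
    and "integrable (law_at 0) f \<Longrightarrow> integrable E (\<lambda>\<omega>. f (fst (fst \<omega>)))"
proof -
  note sE[measurable_cong] = coupling_extend(2)[OF P, folded E_def]
  have sP[measurable_cong]: "sets P = sets (borel \<Otimes>\<^sub>M borel)" and f: "distr P borel fst = law_at 0"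
    using P by (auto simp: coupling_at_def)
  have "distr (distr E P fst) borel fst = distr E borel (\<lambda>\<omega>. fst (fst \<omega>))"
    by (subst distr_distr) (auto simp: comp_def)
  then have d: "distr E borel (\<lambda>\<omega>. fst (fst \<omega>)) = law_at 0"
    unfolding coupling_extend(3)[OF P, folded E_def] f by simp
  show "(\<integral>\<omega>. f (fst (fst \<omega>)) \<partial>E) = (\<integral>u. f u \<partial>law_at 0)" if [measurable]: "f \<in> borel_measurable borel"
  proof -
    have "(\<integral>u. f u \<partial>distr E borel (\<lambda>\<omega>. fst (fst \<omega>))) = (\<integral>\<omega>. f (fst (fst \<omega>)) \<partial>E)"
      by (rule integral_distr) measurable
    then show ?thesis unfolding d by simp
  qed
  show "integrable E (\<lambda>\<omega>. f (fst (fst \<omega>)))" if i: "integrable (law_at 0) f"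
  proof -
    have [measurable]: "f \<in> borel_measurable borel" using i by (simp add: measurable_cong_sets[OF sets_law refl])
    have "integrable (distr E borel (\<lambda>\<omega>. fst (fst \<omega>))) f" unfolding d by (rule i)
    then show ?thesis by (subst (asm) integrable_distr_eq) measurable
  qed
qed

text \<open>Three terms: \<open>X s\<close> is orthogonal to its own noise; \<open>Y s\<close> is
  orthogonal to the noise at the resampling time \<open>t\<close>, because it is a function of the
  past; what remains pairs \<open>Y s\<close> with the change of the noise since \<open>t\<close>.
  The noise at time \<open>s\<close> need not be centred given the past, being a residual with
  respect to \<open>X s\<close> only.\<close>

lemma cross_term_le:
  assumes P: "coupling_at t P" and t: "t \<in> {0..T}" and s: "s \<in> {0..T}" and \<delta>: "\<delta> > 0"
    and small: "(\<integral>u. (norm (\<zeta> s u - \<zeta> t u))\<^sup>2 \<partial>base) \<le> \<delta>\<^sup>2"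
  defines "E \<equiv> extend P snd (a t) (b t)"
  shows "integrable E (\<lambda>\<omega>. (X s (latent t \<omega>) - Y s (fst (fst \<omega>))) \<bullet> \<zeta> s (latent t \<omega>))"
    and "(\<integral>\<omega>. (X s (latent t \<omega>) - Y s (fst (fst \<omega>))) \<bullet> \<zeta> s (latent t \<omega>) \<partial>E) \<le> \<delta> * (C\<^sub>Y + 1) / 2"
proof -
  note sE[measurable_cong] = coupling_extend(2)[OF P, folded E_def]
  have P': "prob_space P" and sP[measurable_cong]: "sets P = sets (borel \<Otimes>\<^sub>M borel)"
    and f: "distr P borel fst = law_at 0" and sn: "distr P borel snd = law_at t"
    using P by (auto simp: coupling_at_def)
  have Xm: "(\<lambda>\<omega>. X s (latent t \<omega>)) \<in> borel_measurable E" and Ym: "(\<lambda>\<omega>. Y s (fst (fst \<omega>))) \<in> borel_measurable E"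
    and Zm: "(\<lambda>\<omega>. \<zeta> s (latent t \<omega>)) \<in> borel_measurable E" and Zm': "(\<lambda>\<omega>. \<zeta> t (latent t \<omega>)) \<in> borel_measurable E" by measurable
  note m = Xm Ym Zm Zm'
  have Xi: "integrable E (\<lambda>\<omega>. (norm (X s (latent t \<omega>)))\<^sup>2)"
    unfolding E_def by (rule latent_integral(2)[OF P X_L2])
  have Zi: "integrable E (\<lambda>\<omega>. (norm (\<zeta> s (latent t \<omega>)))\<^sup>2)" for s
    unfolding E_def by (rule latent_integral(2)[OF P \<zeta>_L2(1)])
  have Yi: "integrable E (\<lambda>\<omega>. (norm (Y s (fst (fst \<omega>))))\<^sup>2)"
    unfolding E_def by (rule initial_integral(2)[OF P Y_L2'(1)[OF s]])
  let ?Xs = "\<lambda>\<omega>. X s (latent t \<omega>)" and ?Ys = "\<lambda>\<omega>. Y s (fst (fst \<omega>))"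
  let ?\<Delta> = "\<lambda>\<omega>. \<zeta> s (latent t \<omega>) - \<zeta> t (latent t \<omega>)"
  have \<Delta>i: "integrable E (\<lambda>\<omega>. (norm (?\<Delta> \<omega>))\<^sup>2)" by (rule integrable_norm2_diff[OF Zm Zm' Zi Zi])
  have \<Delta>m: "?\<Delta> \<in> borel_measurable E" by measurable
  have XZ: "integrable E (\<lambda>\<omega>. ?Xs \<omega> \<bullet> \<zeta> s (latent t \<omega>))" by (rule integrable_inner_L2[OF Xm Zm Xi Zi])
  have YZ: "integrable E (\<lambda>\<omega>. ?Ys \<omega> \<bullet> \<zeta> t (latent t \<omega>))" by (rule integrable_inner_L2[OF Ym Zm' Yi Zi])
  have YD: "integrable E (\<lambda>\<omega>. ?Ys \<omega> \<bullet> ?\<Delta> \<omega>)" by (rule integrable_inner_L2[OF Ym \<Delta>m Yi \<Delta>i])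
  have split: "(?Xs \<omega> - ?Ys \<omega>) \<bullet> \<zeta> s (latent t \<omega>) =
     ?Xs \<omega> \<bullet> \<zeta> s (latent t \<omega>) - ?Ys \<omega> \<bullet> \<zeta> t (latent t \<omega>) - ?Ys \<omega> \<bullet> ?\<Delta> \<omega>" for \<omega>
    by (simp add: inner_diff)
  show "integrable E (\<lambda>\<omega>. (?Xs \<omega> - ?Ys \<omega>) \<bullet> \<zeta> s (latent t \<omega>))"
    unfolding split by (intro Bochner_Integration.integrable_diff XZ YZ YD)
  have "(\<integral>\<omega>. ?Xs \<omega> \<bullet> \<zeta> s (latent t \<omega>) \<partial>E) = 0"
    unfolding E_def using latent_integral(1)[OF P, of "\<lambda>u. X s u \<bullet> \<zeta> s u"] X_\<zeta>_orthogonal by simp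
  moreover have "(\<integral>\<omega>. ?Ys \<omega> \<bullet> \<zeta> t (latent t \<omega>) \<partial>E) = 0"
  proof -
    have z: "\<zeta> t (latent t \<omega>) = \<kappa> t *\<^sub>R (snd \<omega> - pmean (a t) (b t) (snd (fst \<omega>)))" for \<omega>
      using X_latent[of t \<omega>] by (simp add: \<zeta>_def resid_def X_def[symmetric]) (simp add: latent_def)
    have Ym': "(\<lambda>u. Y s (fst u)) \<in> borel_measurable P" by measurable
    have Yi': "integrable P (\<lambda>u. (norm (Y s (fst u)))\<^sup>2)"
    proof -
      have "integrable (distr P borel fst) (\<lambda>x. (norm (Y s x))\<^sup>2)" unfolding f by (rule Y_L2'(1)[OF s])
      then show ?thesis by (subst (asm) integrable_distr_eq) auto
    qed
    have hm: "snd \<in> borel_measurable P" by measurable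
    from integral_extend_orthogonal(2)[OF P' hm a_pos sn Ym' Yi']
    show ?thesis unfolding z E_def inner_scaleR_right integral_mult_right_zero by simp
  qed
  ultimately have "(\<integral>\<omega>. (?Xs \<omega> - ?Ys \<omega>) \<bullet> \<zeta> s (latent t \<omega>) \<partial>E) = - (\<integral>\<omega>. ?Ys \<omega> \<bullet> ?\<Delta> \<omega> \<partial>E)"
    unfolding split using XZ YZ YD by (simp add: Bochner_Integration.integral_diff)
  also have "\<dots> = (\<integral>\<omega>. - (?Ys \<omega> \<bullet> ?\<Delta> \<omega>) \<partial>E)" by simp
  also have "\<dots> \<le> (\<integral>\<omega>. \<delta> / 2 * (norm (?Ys \<omega>))\<^sup>2 + 1 / (2 * \<delta>) * (norm (?\<Delta> \<omega>))\<^sup>2 \<partial>E)"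
  proof (intro integral_mono Bochner_Integration.integrable_minus YD Bochner_Integration.integrable_add integrable_mult_right Yi \<Delta>i)
    fix \<omega>
    \<comment> \<open>Young's inequality with weight \<open>\<delta>\<close>: the two terms then
      contribute \<open>\<delta> * C\<^sub>Y / 2\<close> and \<open>\<delta> / 2\<close>, both of
      first order in \<open>\<delta>\<close>.\<close>
    have "0 \<le> (norm (\<delta> *\<^sub>R ?Ys \<omega> + ?\<Delta> \<omega>))\<^sup>2 / (2 * \<delta>)" using \<delta> by simp
    also have "\<dots> = (\<delta>\<^sup>2 * (norm (?Ys \<omega>))\<^sup>2 + 2 * \<delta> * (?Ys \<omega> \<bullet> ?\<Delta> \<omega>) + (norm (?\<Delta> \<omega>))\<^sup>2) / (2 * \<delta>)"
      unfolding power2_norm_eq_inner by (simp add: inner_add inner_commute power2_eq_square)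
    also have "\<dots> = \<delta> / 2 * (norm (?Ys \<omega>))\<^sup>2 + (?Ys \<omega> \<bullet> ?\<Delta> \<omega>) + 1 / (2 * \<delta>) * (norm (?\<Delta> \<omega>))\<^sup>2"
      using \<delta> by (simp add: field_simps power2_eq_square)
    finally show "- (?Ys \<omega> \<bullet> ?\<Delta> \<omega>) \<le> \<delta> / 2 * (norm (?Ys \<omega>))\<^sup>2 + 1 / (2 * \<delta>) * (norm (?\<Delta> \<omega>))\<^sup>2" by simp
  qed
  also have "\<dots> = \<delta> / 2 * (\<integral>\<omega>. (norm (?Ys \<omega>))\<^sup>2 \<partial>E) + 1 / (2 * \<delta>) * (\<integral>\<omega>. (norm (?\<Delta> \<omega>))\<^sup>2 \<partial>E)"
    by (subst Bochner_Integration.integral_add) (intro integrable_mult_right Yi \<Delta>i | simp only: integral_mult_right_zero)+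
  also have "\<dots> \<le> \<delta> / 2 * C\<^sub>Y + 1 / (2 * \<delta>) * \<delta>\<^sup>2"
  proof (intro add_mono mult_left_mono)
    show "(\<integral>\<omega>. (norm (?Ys \<omega>))\<^sup>2 \<partial>E) \<le> C\<^sub>Y"
      unfolding E_def using initial_integral(1)[OF P, of "\<lambda>x. (norm (Y s x))\<^sup>2"] Y_L2'(2)[OF s] by simp
    show "(\<integral>\<omega>. (norm (?\<Delta> \<omega>))\<^sup>2 \<partial>E) \<le> \<delta>\<^sup>2"
      unfolding E_def using latent_integral(1)[OF P, of "\<lambda>u. (norm (\<zeta> s u - \<zeta> t u))\<^sup>2"] small by simp
  qed (use \<delta> in auto)
  also have "\<dots> = \<delta> * (C\<^sub>Y + 1) / 2" using \<delta> by (simp add: field_simps power2_eq_square)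
  finally show "(\<integral>\<omega>. (?Xs \<omega> - ?Ys \<omega>) \<bullet> \<zeta> s (latent t \<omega>) \<partial>E) \<le> \<delta> * (C\<^sub>Y + 1) / 2" .
qed

end

context coupled_flow begin

lemma integral_extend_initial:
  assumes P: "coupling_at t P"
  defines "E \<equiv> extend P snd (a t) (b t)"
  shows "(\<integral>\<omega>. (norm (X t (latent t \<omega>) - Y t (fst (fst \<omega>))))\<^sup>2 \<partial>E) = cost t P"
proof -
  note sE[measurable_cong] = coupling_extend(2)[OF P, folded E_def]
  note dP = coupling_extend(3)[OF P, folded E_def]
  have sP[measurable_cong]: "sets P = sets (borel \<Otimes>\<^sub>M borel)"
    using P by (auto simp: coupling_at_def)
  have "cost t P = (\<integral>u. (norm (snd u - Y t (fst u)))\<^sup>2 \<partial>distr E P fst)"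
    unfolding cost_def dP ..
  also have "\<dots> = (\<integral>\<omega>. (norm (snd (fst \<omega>) - Y t (fst (fst \<omega>))))\<^sup>2 \<partial>E)"
    by (rule integral_distr) measurable
  finally show ?thesis unfolding X_latent by simp
qed

lemma W_bounds: "\<exists>Wm>0. \<forall>s\<in>{0..T}. W s \<le> Wm"
proof -
  from compact_imp_bounded[OF compact_continuous_image[OF weight_continuous[OF l \<eta>] compact_Icc]]
  obtain B where B: "\<And>x. x \<in> W ` {0..1} \<Longrightarrow> norm x \<le> B" unfolding bounded_iff by blast
  have "W s \<le> max 1 B" if "s \<in> {0..T}" for s
  proof -
    have "s \<in> {0..1}" using that T by auto
    from B[OF imageI[OF this]] show ?thesis by simp
  qed
  then show ?thesis by (intro exI[of _ "max 1 B"]) auto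
qed

text \<open>For fixed \<open>\<omega>\<close> the pair is frozen, so \<open>X\<close> moves along a
  continuously differentiable curve whose velocity is drift plus noise, and the energy estimate
  applies path by path with the noise in its linear remainder. Integrability of \<open>w\<close>
  along \<open>Y\<close> is known for almost every starting point, hence the inequality is almost
  sure.\<close>

lemma pathwise_inequality:
  assumes P: "coupling_at t P" and t: "0 \<le> t" "t \<le> t'" "t' \<le> T"
  defines "E \<equiv> extend P snd (a t) (b t)"
  defines "Ds \<equiv> \<lambda>s \<omega>. X s (latent t \<omega>) - Y s (fst (fst \<omega>))"
  assumes i: "AE \<omega> in E. set_integrable lborel {t..t'} (\<lambda>s. (r s (X s (latent t \<omega>)) (Y s (fst (fst \<omega>))))\<^sup>2
     + 2 * W s * (Ds s \<omega> \<bullet> \<zeta> s (latent t \<omega>)))"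
  shows "AE \<omega> in E. W t' * (norm (Ds t' \<omega>))\<^sup>2 \<le> W t * (norm (Ds t \<omega>))\<^sup>2 +
     (LINT s:{t..t'}|lborel. (r s (X s (latent t \<omega>)) (Y s (fst (fst \<omega>))))\<^sup>2 + 2 * W s * (Ds s \<omega> \<bullet> \<zeta> s (latent t \<omega>)))"
proof -
  note sE[measurable_cong] = coupling_extend(2)[OF P, folded E_def]
  have d: "distr E borel (\<lambda>\<omega>. fst (fst \<omega>)) = law_at 0"
  proof -
    have sP[measurable_cong]: "sets P = sets (borel \<Otimes>\<^sub>M borel)" and f: "distr P borel fst = law_at 0"
      using P by (auto simp: coupling_at_def)
    have "distr (distr E P fst) borel fst = distr E borel (\<lambda>\<omega>. fst (fst \<omega>))"
      by (subst distr_distr) (auto simp: comp_def)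
    then show ?thesis unfolding coupling_extend(3)[OF P, folded E_def] f by simp
  qed
  have m0: "(\<lambda>\<omega>. fst (fst \<omega>)) \<in> borel_measurable E" by measurable
  have "AE \<omega> in E. set_integrable lborel {0..T} (\<lambda>s. w s (Y s (fst (fst \<omega>))))"
    by (rule AE_distrD[OF m0, of "\<lambda>x. set_integrable lborel {0..T} (\<lambda>s. w s (Y s x))"])
       (unfold d, rule Y_int)
  with i show ?thesis
  proof eventually_elim
    case (elim \<omega>)
    define z y x where "z = fst (latent t \<omega>)" and "y = snd (latent t \<omega>)" and "x = fst (fst \<omega>)"
    have u: "latent t \<omega> = (z, y)" by (simp add: z_def y_def)
    let ?d = "\<lambda>s. (a' s *\<^sub>R z + b' s *\<^sub>R y) - w s (Y s x)"
    show ?case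
      unfolding Ds_def
    proof (rule weighted_energy_le[where d = ?d and l = l and g = "\<lambda>s. (X s (latent t \<omega>) - Y s (fst (fst \<omega>))) \<bullet> \<zeta> s (latent t \<omega>)"
          and D = "\<lambda>s. X s (latent t \<omega>) - Y s (fst (fst \<omega>))" and r = "\<lambda>s. r s (X s (latent t \<omega>)) (Y s (fst (fst \<omega>)))"])
      show "t \<le> t'" by (rule t)
      fix s assume s: "s \<in> {t..t'}"
      then have s': "s \<in> {0..T}" using t by auto
      have sub: "{t..t'} \<subseteq> {0..T}" using t by auto
      have "((\<lambda>s. a s *\<^sub>R z + b s *\<^sub>R y - Y s x) has_vector_derivative ?d s) (at s within {0..T})"
      proof -
        have "((\<lambda>s. a s *\<^sub>R z) has_vector_derivative a' s *\<^sub>R z) (at s within {0..T})"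
          "((\<lambda>s. b s *\<^sub>R y) has_vector_derivative b' s *\<^sub>R y) (at s within {0..T})"
          using a_deriv[OF s'] b_deriv[OF s']
          by (auto simp: has_vector_derivative_def has_field_derivative_def
              intro!: derivative_eq_intros)
        then show ?thesis
          by (intro has_vector_derivative_diff has_vector_derivative_add Y_deriv s')
      qed
      then show "((\<lambda>s. X s (latent t \<omega>) - Y s (fst (fst \<omega>))) has_vector_derivative ?d s) (at s within {t..t'})"
        unfolding X_def u x_def[symmetric] fst_conv snd_conv
        by (rule has_vector_derivative_within_subset[OF _ sub])
      show "0 \<le> W s" using weight_pos[OF l \<eta>, of s] s' T by auto
    next
      have "set_integrable lborel {t..t'} (\<lambda>s. a' s *\<^sub>R z + b' s *\<^sub>R y)"
        by (intro set_integrable_continuous_Icc continuous_intros continuous_on_subset[OF cont(3) subset_UNIV]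
          continuous_on_subset[OF cont(4) subset_UNIV])
      moreover have "set_integrable lborel {t..t'} (\<lambda>s. w s (Y s x))"
        using elim(2) t unfolding x_def by (auto intro: set_integrable_Icc_subset)
      ultimately show "set_integrable lborel {t..t'} ?d" by (rule set_integral_diff(1))
      show "primitive_on t t' W (\<lambda>s. - (2 * l s * W s + (W s)\<^sup>2))"
        by (rule primitive_on_subinterval[OF weight_primitive[OF l \<eta>]]) (use t T in auto)
      show "set_integrable lborel {t..t'} (\<lambda>s. (r s (X s (latent t \<omega>)) (Y s (fst (fst \<omega>))))\<^sup>2 +
          2 * W s * ((X s (latent t \<omega>) - Y s (fst (fst \<omega>))) \<bullet> \<zeta> s (latent t \<omega>)))"
        using elim(1) unfolding Ds_def .
      \<comment> \<open>The monotonicity hypothesis is available in the open interval only; its end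
        points form a null set.\<close>
      have "AE s in lborel. s \<noteq> 0 \<and> s \<noteq> T" using AE_lborel_singleton[of 0] AE_lborel_singleton[of T] by eventually_elim auto
      then show "AE s in lborel. s \<in> {t..t'} \<longrightarrow>
          (X s (latent t \<omega>) - Y s (fst (fst \<omega>))) \<bullet> ?d s
          \<le> l s * (norm (X s (latent t \<omega>) - Y s (fst (fst \<omega>))))\<^sup>2 +
            norm (X s (latent t \<omega>) - Y s (fst (fst \<omega>))) * r s (X s (latent t \<omega>)) (Y s (fst (fst \<omega>))) +
            (X s (latent t \<omega>) - Y s (fst (fst \<omega>))) \<bullet> \<zeta> s (latent t \<omega>)"
      proof eventually_elim
        case (elim s)
        show ?case
        proof
          assume "s \<in> {t..t'}"
          then have s: "s \<in> {0<..<T}" using elim t by auto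
          have "a' s *\<^sub>R z + b' s *\<^sub>R y = drift s (X s (latent t \<omega>)) + \<zeta> s (latent t \<omega>)"
            using velocity_decomp[of s "latent t \<omega>"] by (simp add: z_def y_def)
          then have "?d s = (drift s (X s (latent t \<omega>)) - w s (Y s (fst (fst \<omega>)))) + \<zeta> s (latent t \<omega>)"
            by (simp add: x_def)
          then show "(X s (latent t \<omega>) - Y s (fst (fst \<omega>))) \<bullet> ?d s
          \<le> l s * (norm (X s (latent t \<omega>) - Y s (fst (fst \<omega>))))\<^sup>2 +
            norm (X s (latent t \<omega>) - Y s (fst (fst \<omega>))) * r s (X s (latent t \<omega>)) (Y s (fst (fst \<omega>))) +
            (X s (latent t \<omega>) - Y s (fst (fst \<omega>))) \<bullet> \<zeta> s (latent t \<omega>)"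
            using monotone_defect[OF s, of "X s (latent t \<omega>)" "Y s (fst (fst \<omega>))"]
            by (simp only: inner_add_right)
        qed
      qed
    qed
  qed
qed

text \<open>Tonelli for the error term and Fubini for the cross term. The cross term has a small
  integral but no small absolute value, so its integrability has to be secured by a separate, crude
  bound before the order of integration is exchanged.\<close>

lemma step_integrals:
  assumes P: "coupling_at t P" and t: "0 \<le> t" "t \<le> t'" "t' \<le> T" and \<delta>: "\<delta> > 0"
    and small: "\<And>s. s \<in> {t..t'} \<Longrightarrow> (\<integral>u. (norm (\<zeta> s u - \<zeta> t u))\<^sup>2 \<partial>base) \<le> \<delta>\<^sup>2"
    and Wm: "\<And>s. s \<in> {0..T} \<Longrightarrow> W s \<le> Wm" "Wm > 0"
  defines "E \<equiv> extend P snd (a t) (b t)"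
  defines "F1 \<equiv> \<lambda>(\<omega>, s). (r s (X s (latent t \<omega>)) (Y s (fst (fst \<omega>))))\<^sup>2"
  defines "F2 \<equiv> \<lambda>(\<omega>, s). 2 * W s * ((X s (latent t \<omega>) - Y s (fst (fst \<omega>))) \<bullet> \<zeta> s (latent t \<omega>))"
  defines "\<tau> \<equiv> restrict_space lborel {t..t'}"
  shows "integrable (E \<Otimes>\<^sub>M \<tau>) F1" "(\<integral>p. F1 p \<partial>(E \<Otimes>\<^sub>M \<tau>)) \<le> (LINT s:{t..t'}|lborel. e2 s)"
    and "integrable (E \<Otimes>\<^sub>M \<tau>) F2" "(\<integral>p. F2 p \<partial>(E \<Otimes>\<^sub>M \<tau>)) \<le> (t' - t) * (Wm * \<delta> * (C\<^sub>Y + 1))"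
    and "pair_sigma_finite E \<tau>"
proof -
  note sE[measurable_cong] = coupling_extend(2)[OF P, folded E_def]
  interpret E: prob_space E unfolding E_def by (rule coupling_extend(1)[OF P])
  have em: "emeasure \<tau> (space \<tau>) = ennreal (t' - t)"
    using t by (simp add: \<tau>_def emeasure_restrict_space space_restrict_space)
  interpret \<tau>: finite_measure \<tau> by standard (simp add: em)
  show psf: "pair_sigma_finite E \<tau>" ..
  interpret pair_sigma_finite E \<tau> by (rule psf)
  have sp: "space \<tau> = {t..t'}" by (simp add: \<tau>_def space_restrict_space)
  have s\<tau>[measurable_cong]: "sets \<tau> = sets (restrict_space borel {t..t'})" by (simp add: \<tau>_def sets_restrict_space)
  have sT: "s \<in> {0..T}" if "s \<in> space \<tau>" for s using that t by (auto simp: sp)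
  have id\<tau>[measurable]: "(\<lambda>s. s) \<in> borel_measurable \<tau>"
    unfolding \<tau>_def by (rule measurable_restrict_space1) simp
  have snd_m[measurable]: "snd \<in> borel_measurable (E \<Otimes>\<^sub>M \<tau>)"
    using measurable_compose[OF measurable_snd id\<tau>] by (simp add: comp_def)
  have W\<tau>[measurable]: "W \<in> borel_measurable \<tau>"
    unfolding measurable_cong_sets[OF s\<tau> refl]
    by (rule borel_measurable_continuous_on_restrict, rule continuous_on_subset[OF weight_continuous[OF l \<eta>]])
       (use t T in auto)
  have W_m[measurable]: "(\<lambda>p. W (snd p)) \<in> borel_measurable (E \<Otimes>\<^sub>M \<tau>)"
    by (rule measurable_compose[OF measurable_snd W\<tau>])
  have F1m[measurable]: "F1 \<in> borel_measurable (E \<Otimes>\<^sub>M \<tau>)" unfolding F1_def case_prod_unfold by measurable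
  have F2m[measurable]: "F2 \<in> borel_measurable (E \<Otimes>\<^sub>M \<tau>)" unfolding F2_def case_prod_unfold by measurable
  have e2i: "set_integrable lborel {t..t'} e2" using e2(1) t by (auto intro: set_integrable_Icc_subset)
  have e2\<tau>: "integrable \<tau> e2" using e2i unfolding \<tau>_def by (subst set_integrable_eq[symmetric]) auto
  have LIe2: "(LINT s:{t..t'}|lborel. e2 s) = (\<integral>s. e2 s \<partial>\<tau>)"
    unfolding \<tau>_def by (subst integral_restrict_space) (auto simp: set_lebesgue_integral_def)
  have F1nn: "0 \<le> F1 p" for p by (auto simp: F1_def split: prod.split)
  have AEr: "AE s in \<tau>. (\<integral>\<^sup>+\<omega>. ennreal (F1 (\<omega>, s)) \<partial>E) \<le> ennreal (e2 s)"
    unfolding \<tau>_def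
  proof (subst AE_restrict_space_iff)
    show "AE s in lborel. s \<in> {t..t'} \<longrightarrow> (\<integral>\<^sup>+\<omega>. ennreal (F1 (\<omega>, s)) \<partial>E) \<le> ennreal (e2 s)"
      using r_L2
    proof eventually_elim
      case (elim s)
      show ?case
      proof
        assume "s \<in> {t..t'}"
        then have s: "s \<in> {0..T}" using t by auto
        let ?P = "distr E (borel \<Otimes>\<^sub>M borel) (\<lambda>\<omega>. (fst (fst \<omega>), X s (latent t \<omega>)))"
        \<comment> \<open>The pair of starting point and moved position is again a coupling, now at
          time \<open>s\<close>, and so falls under the universally quantified error bound.\<close>
        have "coupling_at s ?P" unfolding E_def by (rule coupling_extend(5)[OF P])
        then have "(\<integral>\<^sup>+u. ennreal ((r s (snd u) (Y s (fst u)))\<^sup>2) \<partial>?P) \<le> ennreal (e2 s)"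
          using elim s by (auto simp: coupling_at_def)
        then show "(\<integral>\<^sup>+\<omega>. ennreal (F1 (\<omega>, s)) \<partial>E) \<le> ennreal (e2 s)"
          by (subst (asm) nn_integral_distr) (auto simp: F1_def)
      qed
    qed
  qed simp
  have nnF1: "(\<integral>\<^sup>+p. ennreal (F1 p) \<partial>(E \<Otimes>\<^sub>M \<tau>)) \<le> ennreal (LINT s:{t..t'}|lborel. e2 s)"
  proof -
    have "(\<integral>\<^sup>+p. ennreal (F1 p) \<partial>(E \<Otimes>\<^sub>M \<tau>)) = (\<integral>\<^sup>+s. \<integral>\<^sup>+\<omega>. ennreal (F1 (\<omega>, s)) \<partial>E \<partial>\<tau>)"
      by (subst nn_integral_snd[symmetric]) auto
    also have "\<dots> \<le> (\<integral>\<^sup>+s. ennreal (e2 s) \<partial>\<tau>)" by (rule nn_integral_mono_AE[OF AEr])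
    also have "\<dots> = ennreal (\<integral>s. e2 s \<partial>\<tau>)" by (rule nn_integral_eq_integral[OF e2\<tau>]) (simp add: e2)
    finally show ?thesis unfolding LIe2 .
  qed
  show F1i: "integrable (E \<Otimes>\<^sub>M \<tau>) F1"
    by (rule integrableI_bounded[OF F1m]) (use nnF1 F1nn in \<open>auto simp: less_top[symmetric] top_unique\<close>)
  have "ennreal (\<integral>p. F1 p \<partial>(E \<Otimes>\<^sub>M \<tau>)) \<le> ennreal (LINT s:{t..t'}|lborel. e2 s)"
    using nnF1 F1nn by (subst nn_integral_eq_integral[symmetric]) (auto simp: F1i)
  moreover have "(LINT s:{t..t'}|lborel. e2 s) \<ge> 0"
    unfolding LIe2 by (intro integral_nonneg_AE) (simp add: e2)
  ultimately show "(\<integral>p. F1 p \<partial>(E \<Otimes>\<^sub>M \<tau>)) \<le> (LINT s:{t..t'}|lborel. e2 s)" by simp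
  \<comment> \<open>A crude bound by second moments that only serves to justify Fubini; the
    smallness in \<open>\<delta>\<close> comes from \<open>cross_term_le\<close> further
    down.\<close>
  obtain C where C: "C \<ge> 0" "\<And>s. s \<in> {0..T} \<Longrightarrow> (\<integral>u. (norm (X s u))\<^sup>2 \<partial>base) \<le> C"
    "\<And>s. s \<in> {0..T} \<Longrightarrow> (\<integral>u. (norm (\<zeta> s u))\<^sup>2 \<partial>base) \<le> C" using L2_bounds by blast
  have nnF2: "(\<integral>\<^sup>+\<omega>. ennreal (norm (F2 (\<omega>, s))) \<partial>E) \<le> ennreal (2 * Wm * (2 * C + 2 * C\<^sub>Y + C))" if s: "s \<in> space \<tau>" for s
  proof -
    let ?x = "\<lambda>\<omega>. X s (latent t \<omega>)" and ?y = "\<lambda>\<omega>. Y s (fst (fst \<omega>))" and ?z = "\<lambda>\<omega>. \<zeta> s (latent t \<omega>)"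
    have s': "s \<in> {0..T}" by (rule sT[OF s])
    have xi: "integrable E (\<lambda>\<omega>. (norm (?x \<omega>))\<^sup>2)" and zi: "integrable E (\<lambda>\<omega>. (norm (?z \<omega>))\<^sup>2)"
      and yi: "integrable E (\<lambda>\<omega>. (norm (?y \<omega>))\<^sup>2)"
      unfolding E_def by (rule latent_integral(2)[OF P X_L2] latent_integral(2)[OF P \<zeta>_L2(1)] initial_integral(2)[OF P Y_L2'(1)[OF s']])+
    let ?B = "\<lambda>\<omega>. 2 * Wm * ((2 * (norm (?x \<omega>))\<^sup>2 + 2 * (norm (?y \<omega>))\<^sup>2) + (norm (?z \<omega>))\<^sup>2)"
    have Bi: "integrable E ?B"
      by (intro integrable_mult_right Bochner_Integration.integrable_add xi yi zi)
    have Ws: "0 < W s" using weight_pos[OF l \<eta>, of s] s' T by auto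
    have le: "norm (F2 (\<omega>, s)) \<le> ?B \<omega>" for \<omega>
    proof -
      have "\<bar>(?x \<omega> - ?y \<omega>) \<bullet> ?z \<omega>\<bar> \<le> norm (?x \<omega> - ?y \<omega>) * norm (?z \<omega>)" by (rule Cauchy_Schwarz_ineq2)
      also have "\<dots> \<le> (norm (?x \<omega> - ?y \<omega>))\<^sup>2 + (norm (?z \<omega>))\<^sup>2"
        using sum_squares_bound[of "norm (?x \<omega> - ?y \<omega>)" "norm (?z \<omega>)"]
          mult_nonneg_nonneg[OF norm_ge_zero[of "?x \<omega> - ?y \<omega>"] norm_ge_zero[of "?z \<omega>"]] by linarith
      also have "\<dots> \<le> (2 * (norm (?x \<omega>))\<^sup>2 + 2 * (norm (?y \<omega>))\<^sup>2) + (norm (?z \<omega>))\<^sup>2"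
        by (intro add_right_mono norm_diff_power2_le)
      finally have "2 * W s * \<bar>(?x \<omega> - ?y \<omega>) \<bullet> ?z \<omega>\<bar> \<le> 2 * Wm * ((2 * (norm (?x \<omega>))\<^sup>2 + 2 * (norm (?y \<omega>))\<^sup>2) + (norm (?z \<omega>))\<^sup>2)"
        using Wm(1)[OF s'] Wm(2) Ws by (intro mult_mono) auto
      moreover note Ws
      ultimately show ?thesis by (simp add: F2_def abs_mult)
    qed
    have "(\<integral>\<^sup>+\<omega>. ennreal (norm (F2 (\<omega>, s))) \<partial>E) \<le> (\<integral>\<^sup>+\<omega>. ennreal (?B \<omega>) \<partial>E)"
      by (intro nn_integral_mono ennreal_leI le)
    also have "\<dots> = ennreal (\<integral>\<omega>. ?B \<omega> \<partial>E)"
      using Wm(2) by (intro nn_integral_eq_integral Bi AE_I2) simp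
    also have "(\<integral>\<omega>. ?B \<omega> \<partial>E) = 2 * Wm * ((2 * (\<integral>\<omega>. (norm (?x \<omega>))\<^sup>2 \<partial>E) + 2 * (\<integral>\<omega>. (norm (?y \<omega>))\<^sup>2 \<partial>E)) + (\<integral>\<omega>. (norm (?z \<omega>))\<^sup>2 \<partial>E))"
      using xi yi zi by (simp add: Bochner_Integration.integral_add)
    also have "\<dots> \<le> 2 * Wm * (2 * C + 2 * C\<^sub>Y + C)"
    proof (intro mult_left_mono add_mono)
      show "(\<integral>\<omega>. (norm (?x \<omega>))\<^sup>2 \<partial>E) \<le> C"
        unfolding E_def using latent_integral(1)[OF P, of "\<lambda>u. (norm (X s u))\<^sup>2"] C(2)[OF s'] by simp
      show "(\<integral>\<omega>. (norm (?z \<omega>))\<^sup>2 \<partial>E) \<le> C"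
        unfolding E_def using latent_integral(1)[OF P, of "\<lambda>u. (norm (\<zeta> s u))\<^sup>2"] C(3)[OF s'] by simp
      show "(\<integral>\<omega>. (norm (?y \<omega>))\<^sup>2 \<partial>E) \<le> C\<^sub>Y"
        unfolding E_def using initial_integral(1)[OF P, of "\<lambda>x. (norm (Y s x))\<^sup>2"] Y_L2'(2)[OF s'] by simp
    qed (use Wm(2) in auto)
    finally show ?thesis by (simp add: ennreal_leI)
  qed
  have "(\<integral>\<^sup>+p. ennreal (norm (F2 p)) \<partial>(E \<Otimes>\<^sub>M \<tau>)) = (\<integral>\<^sup>+s. \<integral>\<^sup>+\<omega>. ennreal (norm (F2 (\<omega>, s))) \<partial>E \<partial>\<tau>)"
    by (subst nn_integral_snd[symmetric]) auto
  also have "\<dots> \<le> (\<integral>\<^sup>+s. ennreal (2 * Wm * (2 * C + 2 * C\<^sub>Y + C)) \<partial>\<tau>)" by (intro nn_integral_mono nnF2)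
  also have "\<dots> < \<infinity>" by (simp add: em ennreal_mult_less_top)
  finally show F2i: "integrable (E \<Otimes>\<^sub>M \<tau>) F2" by (intro integrableI_bounded) auto
  have "(\<integral>p. F2 p \<partial>(E \<Otimes>\<^sub>M \<tau>)) = (\<integral>s. \<integral>\<omega>. F2 (\<omega>, s) \<partial>E \<partial>\<tau>)"
    using integral_snd[of "\<lambda>\<omega> s. F2 (\<omega>, s)"] F2i by simp
  also have "\<dots> \<le> (\<integral>s. Wm * \<delta> * (C\<^sub>Y + 1) \<partial>\<tau>)"
  proof (rule integral_mono)
    show "integrable \<tau> (\<lambda>s. \<integral>\<omega>. F2 (\<omega>, s) \<partial>E)" using integrable_snd[of "\<lambda>\<omega> s. F2 (\<omega>, s)"] F2i by simp
    show "integrable \<tau> (\<lambda>s. Wm * \<delta> * (C\<^sub>Y + 1))" by simp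
    fix s assume s: "s \<in> space \<tau>"
    have s': "s \<in> {0..T}" "s \<in> {t..t'}" using sT[OF s] s by (auto simp: sp)
    have "(\<integral>\<omega>. F2 (\<omega>, s) \<partial>E) = 2 * W s * (\<integral>\<omega>. (X s (latent t \<omega>) - Y s (fst (fst \<omega>))) \<bullet> \<zeta> s (latent t \<omega>) \<partial>E)"
      by (simp add: F2_def)
    also have "\<dots> \<le> 2 * W s * (\<delta> * (C\<^sub>Y + 1) / 2)"
      unfolding E_def using weight_pos[OF l \<eta>, of s] s' T t
      by (intro mult_left_mono cross_term_le(2)[OF P _ s'(1) \<delta> small]) auto
    also have "\<dots> = W s * (\<delta> * (C\<^sub>Y + 1))" by simp
    also have "\<dots> \<le> Wm * (\<delta> * (C\<^sub>Y + 1))" using Wm(1)[OF s'(1)] \<delta> C\<^sub>Y by (intro mult_right_mono) auto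
    finally show "(\<integral>\<omega>. F2 (\<omega>, s) \<partial>E) \<le> Wm * \<delta> * (C\<^sub>Y + 1)" by (simp add: mult.assoc)
  qed
  also have "\<dots> = (t' - t) * (Wm * \<delta> * (C\<^sub>Y + 1))"
    using t by (simp add: measure_def em)
  finally show "(\<integral>p. F2 p \<partial>(E \<Otimes>\<^sub>M \<tau>)) \<le> (t' - t) * (Wm * \<delta> * (C\<^sub>Y + 1))" .
qed

text \<open>The pathwise inequality is integrated over the resampled space. The fresh target is
  forgotten afterwards: the new coupling keeps only starting point and position, so the next step
  can resample again. The additive error is proportional to the length of the step.\<close>

lemma coupling_step:
  assumes P: "coupling_at t P" and t: "0 \<le> t" "t \<le> t'" "t' \<le> T" and \<delta>: "\<delta> > 0"
    and small: "\<And>s. s \<in> {t..t'} \<Longrightarrow> (\<integral>u. (norm (\<zeta> s u - \<zeta> t u))\<^sup>2 \<partial>base) \<le> \<delta>\<^sup>2"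
    and Wm: "\<And>s. s \<in> {0..T} \<Longrightarrow> W s \<le> Wm" "Wm > 0"
  shows "\<exists>P'. coupling_at t' P' \<and> W t' * cost t' P' \<le> W t * cost t P + (LINT s:{t..t'}|lborel. e2 s)
     + (t' - t) * (Wm * \<delta> * (C\<^sub>Y + 1))"
proof -
  define E where "E = extend P snd (a t) (b t)"
  define F1 where "F1 = (\<lambda>(\<omega>, s). (r s (X s (latent t \<omega>)) (Y s (fst (fst \<omega>))))\<^sup>2)"
  define F2 where "F2 = (\<lambda>(\<omega>, s). 2 * W s * ((X s (latent t \<omega>) - Y s (fst (fst \<omega>))) \<bullet> \<zeta> s (latent t \<omega>)))"
  define \<tau> where "\<tau> = restrict_space lborel {t..t'}"
  define Ds where "Ds = (\<lambda>s \<omega>. X s (latent t \<omega>) - Y s (fst (fst \<omega>)))"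
  note sE[measurable_cong] = coupling_extend(2)[OF P, folded E_def]
  note SI = step_integrals[OF P t \<delta> small Wm, folded E_def F1_def F2_def \<tau>_def]
  interpret pair_sigma_finite E \<tau> by (rule SI(5)) auto
  have Fi: "integrable (E \<Otimes>\<^sub>M \<tau>) (\<lambda>p. F1 p + F2 p)"
    by (rule Bochner_Integration.integrable_add[OF SI(1,3)]) auto
  let ?f = "\<lambda>\<omega> s. (r s (X s (latent t \<omega>)) (Y s (fst (fst \<omega>))))\<^sup>2 + 2 * W s * (Ds s \<omega> \<bullet> \<zeta> s (latent t \<omega>))"
  have F: "F1 (\<omega>, s) + F2 (\<omega>, s) = ?f \<omega> s" for \<omega> s by (simp add: F1_def F2_def Ds_def)
  have LI: "(LINT s:{t..t'}|lborel. ?f \<omega> s) = (\<integral>s. F1 (\<omega>, s) + F2 (\<omega>, s) \<partial>\<tau>)" for \<omega>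
    unfolding F \<tau>_def by (subst integral_restrict_space) (auto simp: set_lebesgue_integral_def)
  have "AE \<omega> in E. integrable \<tau> (\<lambda>s. F1 (\<omega>, s) + F2 (\<omega>, s))" by (rule AE_integrable_fst'[OF Fi])
  then have "AE \<omega> in E. set_integrable lborel {t..t'} (?f \<omega>)"
    unfolding F \<tau>_def by (subst set_integrable_eq) auto
  from pathwise_inequality[OF P t, folded E_def, OF this[unfolded Ds_def]]
  have AE: "AE \<omega> in E. W t' * (norm (Ds t' \<omega>))\<^sup>2 \<le> W t * (norm (Ds t \<omega>))\<^sup>2 + (\<integral>s. F1 (\<omega>, s) + F2 (\<omega>, s) \<partial>\<tau>)"
    unfolding LI[symmetric] Ds_def .
  have Dm: "Ds s \<in> borel_measurable E" for s unfolding Ds_def by measurable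
  have Di: "integrable E (\<lambda>\<omega>. (norm (Ds s \<omega>))\<^sup>2)" if s: "s \<in> {0..T}" for s
  proof -
    have "integrable E (\<lambda>\<omega>. (norm (X s (latent t \<omega>)))\<^sup>2)" "integrable E (\<lambda>\<omega>. (norm (Y s (fst (fst \<omega>))))\<^sup>2)"
      unfolding E_def by (rule latent_integral(2)[OF P X_L2] initial_integral(2)[OF P Y_L2'(1)[OF s]])+
    then show ?thesis unfolding Ds_def by (intro integrable_norm2_diff) measurable
  qed
  have tt: "t \<in> {0..T}" "t' \<in> {0..T}" using t by auto
  let ?P = "distr E (borel \<Otimes>\<^sub>M borel) (\<lambda>\<omega>. (fst (fst \<omega>), X t' (latent t \<omega>)))"
  have c': "cost t' ?P = (\<integral>\<omega>. (norm (Ds t' \<omega>))\<^sup>2 \<partial>E)"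
    unfolding cost_def Ds_def by (subst integral_distr) auto
  have c: "cost t P = (\<integral>\<omega>. (norm (Ds t \<omega>))\<^sup>2 \<partial>E)"
    unfolding Ds_def E_def by (rule integral_extend_initial[OF P, symmetric])
  have "W t' * cost t' ?P = (\<integral>\<omega>. W t' * (norm (Ds t' \<omega>))\<^sup>2 \<partial>E)" unfolding c' by simp
  also have "\<dots> \<le> (\<integral>\<omega>. W t * (norm (Ds t \<omega>))\<^sup>2 + (\<integral>s. F1 (\<omega>, s) + F2 (\<omega>, s) \<partial>\<tau>) \<partial>E)"
    by (intro integral_mono_AE AE integrable_mult_right Di tt Bochner_Integration.integrable_add integrable_fst'[OF Fi])
  also have "\<dots> = (\<integral>\<omega>. W t * (norm (Ds t \<omega>))\<^sup>2 \<partial>E) + (\<integral>\<omega>. (\<integral>s. F1 (\<omega>, s) + F2 (\<omega>, s) \<partial>\<tau>) \<partial>E)"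
    by (intro Bochner_Integration.integral_add integrable_mult_right Di tt integrable_fst'[OF Fi])
  also have "(\<integral>\<omega>. (\<integral>s. F1 (\<omega>, s) + F2 (\<omega>, s) \<partial>\<tau>) \<partial>E) = (\<integral>p. F1 p + F2 p \<partial>(E \<Otimes>\<^sub>M \<tau>))"
    by (rule integral_fst'[OF Fi])
  also have "\<dots> = (\<integral>p. F1 p \<partial>(E \<Otimes>\<^sub>M \<tau>)) + (\<integral>p. F2 p \<partial>(E \<Otimes>\<^sub>M \<tau>))"
    by (rule Bochner_Integration.integral_add[OF SI(1,3)]) auto
  also have "(\<integral>\<omega>. W t * (norm (Ds t \<omega>))\<^sup>2 \<partial>E) = W t * cost t P" unfolding c by simp
  finally have "W t' * cost t' ?P \<le> W t * cost t P + ((\<integral>p. F1 p \<partial>(E \<Otimes>\<^sub>M \<tau>)) + (\<integral>p. F2 p \<partial>(E \<Otimes>\<^sub>M \<tau>)))" .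
  also have "\<dots> \<le> W t * cost t P + ((LINT s:{t..t'}|lborel. e2 s) + (t' - t) * (Wm * \<delta> * (C\<^sub>Y + 1)))"
    by (intro add_left_mono add_mono SI(2,4)) auto
  finally show ?thesis
    using coupling_extend(5)[OF P, folded E_def, of t'] by (intro exI[of _ ?P]) auto
qed

section \<open>Iteration over a fine partition\<close>

lemma coupling_initial: "\<exists>P. coupling_at 0 P \<and> cost 0 P = 0"
proof (intro exI conjI)
  let ?P = "distr (law_at 0) (borel \<Otimes>\<^sub>M borel) (\<lambda>x. (x, x))"
  show "coupling_at 0 ?P"
    unfolding coupling_at_def
    by (auto simp: distr_distr comp_def distr_id2 sets_law intro!: prob_space.prob_space_distr prob_space_law)
  show "cost 0 ?P = 0"
    unfolding cost_def by (subst integral_distr) (auto simp: Y_0)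
qed

text \<open>The errors of the steps add up to at most \<open>T\<close> times a multiple of
  \<open>\<delta>\<close>, independently of the number of steps; \<open>\<delta>\<close> is chosen
  according to \<open>e\<close>, and the mesh according to \<open>\<delta>\<close> by uniform
  continuity of the noise. The cost starts at 0 because \<open>X\<close> and \<open>Y\<close> start
  together.\<close>

theorem coupling_exists:
  assumes e: "e > 0"
  shows "\<exists>P. coupling_at T P \<and> W T * cost T P \<le> (LINT s:{0..T}|lborel. e2 s) + e"
proof -
  obtain Wm where Wm: "Wm > 0" "\<And>s. s \<in> {0..T} \<Longrightarrow> W s \<le> Wm" using W_bounds by blast
  \<comment> \<open>\<open>T + 1\<close> in place of \<open>T\<close> keeps \<open>K\<close>
    positive, so that \<open>\<delta> = e / K\<close> is meaningful even for
    \<open>T = 0\<close>.\<close>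
  define K where "K = (T + 1) * Wm * (C\<^sub>Y + 1)"
  define \<delta> where "\<delta> = e / K"
  have pos: "K > 0" unfolding K_def using T Wm C\<^sub>Y by (intro mult_pos_pos) auto
  have \<delta>: "\<delta> > 0" unfolding \<delta>_def using e pos by (rule divide_pos_pos)
  have \<delta>e: "T * (Wm * \<delta> * (C\<^sub>Y + 1)) \<le> e"
  proof -
    have "T * (Wm * \<delta> * (C\<^sub>Y + 1)) \<le> (T + 1) * (Wm * \<delta> * (C\<^sub>Y + 1))"
      using \<delta> Wm C\<^sub>Y by (intro mult_right_mono) auto
    also have "\<dots> = \<delta> * K" unfolding K_def by (simp only: mult_ac)
    also have "\<dots> = e" using pos by (simp add: \<delta>_def)
    finally show ?thesis .
  qed
  have "\<delta>\<^sup>2 > 0" using \<delta> by simp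
  from \<zeta>_uniform[OF this] obtain d where d: "d > 0" "\<And>s t. s \<in> {0..T} \<Longrightarrow> t \<in> {0..T} \<Longrightarrow> \<bar>s - t\<bar> < d \<Longrightarrow>
    (\<integral>u. (norm (\<zeta> s u - \<zeta> t u))\<^sup>2 \<partial>base) \<le> \<delta>\<^sup>2" by blast
  obtain N :: nat where N: "T / d < real N" using reals_Archimedean2 by blast
  have "0 \<le> T / d" using T d by simp
  then have N0: "real N > 0" using N by linarith
  define h where "h = T / N"
  have h: "0 \<le> h" "h < d" using N N0 d T by (auto simp: h_def field_simps)
  have Nh: "real N * h = T" using N0 by (simp add: h_def)
  have "k \<le> N \<Longrightarrow> \<exists>P. coupling_at (real k * h) P \<and> W (real k * h) * cost (real k * h) P \<le>
     (LINT s:{0..real k * h}|lborel. e2 s) + (real k * h) * (Wm * \<delta> * (C\<^sub>Y + 1))" for k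
  proof (induction k)
    case 0
    from coupling_initial obtain P where "coupling_at 0 P" "cost 0 P = 0" by blast
    then show ?case by (intro exI[of _ P]) (simp add: LINT_singleton)
  next
    case (Suc k)
    then obtain P where P: "coupling_at (real k * h) P" "W (real k * h) * cost (real k * h) P \<le>
     (LINT s:{0..real k * h}|lborel. e2 s) + (real k * h) * (Wm * \<delta> * (C\<^sub>Y + 1))" by auto
    have k: "0 \<le> real k * h" "real k * h \<le> real (Suc k) * h" "real (Suc k) * h \<le> T"
      using h Suc.prems unfolding Nh[symmetric] by (auto intro!: mult_right_mono)
    have kd: "real (Suc k) * h - real k * h = h" by (simp add: algebra_simps)
    have "(\<integral>u. (norm (\<zeta> s u - \<zeta> (real k * h) u))\<^sup>2 \<partial>base) \<le> \<delta>\<^sup>2" if "s \<in> {real k * h..real (Suc k) * h}" for s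
    proof (intro d(2))
      have "real k * h \<le> s" "s \<le> real (Suc k) * h" using that by auto
      then show "s \<in> {0..T}" "\<bar>s - real k * h\<bar> < d" using k kd h(2) unfolding atLeastAtMost_iff by linarith+
      show "real k * h \<in> {0..T}" using k by simp
    qed
    from coupling_step[OF P(1) k \<delta> this Wm(2) Wm(1)] obtain P' where
      P': "coupling_at (real (Suc k) * h) P'" "W (real (Suc k) * h) * cost (real (Suc k) * h) P' \<le> W (real k * h) * cost (real k * h) P
        + (LINT s:{real k * h..real (Suc k) * h}|lborel. e2 s) + h * (Wm * \<delta> * (C\<^sub>Y + 1))"
      unfolding kd by blast
    have "set_integrable lborel {0..real (Suc k) * h} e2" using e2(1) k by (auto intro: set_integrable_Icc_subset)
    from set_integral_Icc_combine[OF this k(1,2)] P(2) P'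
    have "W (real (Suc k) * h) * cost (real (Suc k) * h) P' \<le> (LINT s:{0..real (Suc k) * h}|lborel. e2 s)
      + (real k * h * (Wm * \<delta> * (C\<^sub>Y + 1)) + h * (Wm * \<delta> * (C\<^sub>Y + 1)))" by linarith
    also have "real k * h * (Wm * \<delta> * (C\<^sub>Y + 1)) + h * (Wm * \<delta> * (C\<^sub>Y + 1)) = real (Suc k) * h * (Wm * \<delta> * (C\<^sub>Y + 1))"
      by (simp add: algebra_simps)
    finally show ?case using P'(1) by blast
  qed
  from this[of N] show ?thesis unfolding Nh using \<delta>e by force
qed

end

section \<open>Passage to the terminal time\<close>

text \<open>Young's inequality with a free parameter: the leading factor tends to 1 as
  \<open>k\<close> tends to 0, whereas the symmetric form would lose a factor 2 in the final
  constant.\<close>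

lemma norm_add_power2_le_weighted:
  fixes x y :: "'a::real_inner"
  assumes k: "k > 0"
  shows "(norm (x + y))\<^sup>2 \<le> (1 + k) * (norm x)\<^sup>2 + (1 + 1 / k) * (norm y)\<^sup>2"
proof -
  have "0 \<le> (norm (k *\<^sub>R x - y))\<^sup>2 / k" using k by simp
  also have "\<dots> = k * (norm x)\<^sup>2 - 2 * (x \<bullet> y) + 1 / k * (norm y)\<^sup>2"
    using k unfolding power2_norm_eq_inner by (simp add: inner_diff inner_commute field_simps power2_eq_square)
  finally show ?thesis
    unfolding power2_norm_eq_inner by (simp add: inner_add inner_commute algebra_simps)
qed

context coupled_flow begin

text \<open>One more resampling at time \<open>T\<close> replaces the position by its target, whose
  law is \<open>\<nu>\<close> exactly. The price is the mean squared distance of \<open>X T\<close>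
  and its target, which later tends to 0 as \<open>T\<close> approaches 1 and can therefore afford
  the large factor \<open>1 + 1 / k\<close>.\<close>

theorem terminal_coupling_exists:
  assumes e: "e > 0" and k: "k > 0"
  shows "\<exists>Q. prob_space Q \<and> sets Q = sets (borel \<Otimes>\<^sub>M borel) \<and> distr Q borel fst = law_at 0 \<and> distr Q borel snd = \<nu> \<and>
    (\<integral>\<^sup>+u. ennreal ((norm (Y T (fst u) - snd u))\<^sup>2) \<partial>Q) \<le>
      ennreal ((1 + k) * (((LINT s:{0..T}|lborel. e2 s) + e) / W T) + (1 + 1 / k) * (\<integral>u. (norm (X T u - snd u))\<^sup>2 \<partial>base))"
proof -
  from coupling_exists[OF e] obtain P where P: "coupling_at T P" "W T * cost T P \<le> (LINT s:{0..T}|lborel. e2 s) + e" by blast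
  define E where "E = extend P snd (a T) (b T)"
  note sE[measurable_cong] = coupling_extend(2)[OF P(1), folded E_def]
  have sP[measurable_cong]: "sets P = sets (borel \<Otimes>\<^sub>M borel)" and pP: "prob_space P"
    and f: "distr P borel fst = law_at 0" and sn: "distr P borel snd = law_at T"
    using P by (auto simp: coupling_at_def)
  interpret E: prob_space E unfolding E_def by (rule coupling_extend(1)[OF P(1)])
  let ?Q = "distr E (borel \<Otimes>\<^sub>M borel) (\<lambda>\<omega>. (fst (fst \<omega>), snd \<omega>))"
  have TT: "T \<in> {0..T}" using T by simp
  have WT: "W T > 0" using weight_pos[OF l \<eta>, of T] T by simp
  have "distr ?Q borel fst = distr (distr E P fst) borel fst"
    by (subst (1 2) distr_distr) (auto simp: comp_def)
  then have Q1: "distr ?Q borel fst = law_at 0" unfolding coupling_extend(3)[OF P(1), folded E_def] f .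
  have hm: "snd \<in> borel_measurable P" by measurable
  have "distr ?Q borel snd = distr E borel snd"
    by (subst distr_distr) (auto simp: comp_def)
  then have Q2: "distr ?Q borel snd = \<nu>" unfolding E_def distr_extend_snd[OF pP hm a_pos sn] .
  let ?u = "\<lambda>\<omega>. X T (latent T \<omega>) - Y T (fst (fst \<omega>))" and ?v = "\<lambda>\<omega>. X T (latent T \<omega>) - snd (latent T \<omega>)"
  have ui: "integrable E (\<lambda>\<omega>. (norm (?u \<omega>))\<^sup>2)"
  proof -
    have "integrable E (\<lambda>\<omega>. (norm (X T (latent T \<omega>)))\<^sup>2)" "integrable E (\<lambda>\<omega>. (norm (Y T (fst (fst \<omega>))))\<^sup>2)"
      unfolding E_def by (rule latent_integral(2)[OF P(1) X_L2] initial_integral(2)[OF P(1) Y_L2'(1)[OF TT]])+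
    then show ?thesis by (intro integrable_norm2_diff) measurable
  qed
  have vi: "integrable E (\<lambda>\<omega>. (norm (?v \<omega>))\<^sup>2)"
    unfolding E_def
    by (rule latent_integral(2)[OF P(1), of "\<lambda>u. (norm (X T u - snd u))\<^sup>2"])
       (intro integrable_norm2_diff X_L2 integrable_base; measurable)
  have le: "(norm (Y T (fst (fst \<omega>)) - snd \<omega>))\<^sup>2 \<le> (1 + k) * (norm (?u \<omega>))\<^sup>2 + (1 + 1 / k) * (norm (?v \<omega>))\<^sup>2" for \<omega>
  proof -
    have "(norm (Y T (fst (fst \<omega>)) - snd \<omega>))\<^sup>2 = (norm (?u \<omega> + (- ?v \<omega>)))\<^sup>2"
      by (simp add: latent_def norm_minus_commute)
    also have "\<dots> \<le> (1 + k) * (norm (?u \<omega>))\<^sup>2 + (1 + 1 / k) * (norm (- ?v \<omega>))\<^sup>2"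
      by (rule norm_add_power2_le_weighted[OF k])
    finally show ?thesis by (simp only: norm_minus_cancel)
  qed
  have "(\<integral>\<^sup>+u. ennreal ((norm (Y T (fst u) - snd u))\<^sup>2) \<partial>?Q) = (\<integral>\<^sup>+\<omega>. ennreal ((norm (Y T (fst (fst \<omega>)) - snd \<omega>))\<^sup>2) \<partial>E)"
    by (subst nn_integral_distr) auto
  also have "\<dots> \<le> (\<integral>\<^sup>+\<omega>. ennreal ((1 + k) * (norm (?u \<omega>))\<^sup>2 + (1 + 1 / k) * (norm (?v \<omega>))\<^sup>2) \<partial>E)"
    by (intro nn_integral_mono ennreal_leI le)
  also have "\<dots> = ennreal (\<integral>\<omega>. (1 + k) * (norm (?u \<omega>))\<^sup>2 + (1 + 1 / k) * (norm (?v \<omega>))\<^sup>2 \<partial>E)"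
    using k by (intro nn_integral_eq_integral Bochner_Integration.integrable_add integrable_mult_right ui vi AE_I2) auto
  also have "(\<integral>\<omega>. (1 + k) * (norm (?u \<omega>))\<^sup>2 + (1 + 1 / k) * (norm (?v \<omega>))\<^sup>2 \<partial>E)
    = (1 + k) * (\<integral>\<omega>. (norm (?u \<omega>))\<^sup>2 \<partial>E) + (1 + 1 / k) * (\<integral>\<omega>. (norm (?v \<omega>))\<^sup>2 \<partial>E)"
    using ui vi by (subst Bochner_Integration.integral_add) (auto intro!: integrable_mult_right)
  also have "(\<integral>\<omega>. (norm (?u \<omega>))\<^sup>2 \<partial>E) = cost T P"
    unfolding E_def by (rule integral_extend_initial[OF P(1)])
  also have "(\<integral>\<omega>. (norm (?v \<omega>))\<^sup>2 \<partial>E) = (\<integral>u. (norm (X T u - snd u))\<^sup>2 \<partial>base)"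
    unfolding E_def by (rule latent_integral(1)[OF P(1), of "\<lambda>u. (norm (X T u - snd u))\<^sup>2"]) measurable
  also have "cost T P \<le> ((LINT s:{0..T}|lborel. e2 s) + e) / W T"
    using P(2) WT by (simp add: field_simps)
  finally have "(\<integral>\<^sup>+u. ennreal ((norm (Y T (fst u) - snd u))\<^sup>2) \<partial>?Q) \<le>
      ennreal ((1 + k) * (((LINT s:{0..T}|lborel. e2 s) + e) / W T) + (1 + 1 / k) * (\<integral>u. (norm (X T u - snd u))\<^sup>2 \<partial>base))"
    using k by (simp add: ennreal_leI mult_left_mono)
  then show ?thesis
    using Q1 Q2 by (intro exI[of _ ?Q]) (auto intro!: E.prob_space_distr)
qed

end

lemma ennreal_sqrt_power2: "(ennreal_sqrt x)\<^sup>2 = x"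
proof (cases "x = \<top>")
  case False
  then show ?thesis
    by (simp add: ennreal_sqrt_def ennreal_power enn2real_nonneg top.not_eq_extremum)
qed (simp add: ennreal_sqrt_def power2_eq_square ennreal_mult_top)

text \<open>The couplings vary with n, but both marginals are fixed; the mass on which \<open>Y n\<close> is far from
  its limit therefore contributes little, uniformly over the couplings.\<close>

lemma (in target_law) W2_limit_le:
  fixes Yn :: "nat \<Rightarrow> real ^ 'd \<Rightarrow> real ^ 'd" and Y1 :: "real ^ 'd \<Rightarrow> real ^ 'd" and B :: "nat \<Rightarrow> real"
  assumes \<mu>: "prob_space \<mu>" "sets \<mu> = sets borel"
    and Yn[measurable]: "\<And>n. Yn n \<in> borel_measurable borel" and Y1[measurable]: "Y1 \<in> borel_measurable borel"
    and lim: "\<And>x. (\<lambda>n. Yn n x) \<longlonglongrightarrow> Y1 x"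
    and Q: "\<And>n. prob_space (Q n)" "\<And>n. sets (Q n) = sets (borel \<Otimes>\<^sub>M borel)"
      "\<And>n. distr (Q n) borel fst = \<mu>" "\<And>n. distr (Q n) borel snd = \<nu>"
    and cost: "\<And>n. (\<integral>\<^sup>+u. ennreal ((norm (Yn n (fst u) - snd u))\<^sup>2) \<partial>Q n) \<le> ennreal (B n)"
    and B: "B \<longlonglongrightarrow> B'" "\<And>n. B n \<ge> 0"
  shows "(W2 (distr \<mu> borel Y1) \<nu>)\<^sup>2 \<le> ennreal B'"
proof -
  interpret \<mu>: prob_space \<mu> by (rule \<mu>)
  note [measurable_cong] = \<mu>(2) Q(2)
  have B'0: "B' \<ge> 0" using B LIMSEQ_le_const by blast
  have fst_int: "(\<integral>\<^sup>+u. f (fst u) \<partial>Q n) = (\<integral>\<^sup>+x. f x \<partial>\<mu>)" if [measurable]: "f \<in> borel_measurable borel" for f n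
    unfolding Q(3)[of n, symmetric] by (subst nn_integral_distr) auto
  have snd_int: "(\<integral>\<^sup>+u. f (snd u) \<partial>Q n) = (\<integral>\<^sup>+x. f x \<partial>\<nu>)" if [measurable]: "f \<in> borel_measurable borel" for f n
    by (subst Q(4)[of n, symmetric], subst nn_integral_distr) auto
  have "(\<integral>\<^sup>+x. ennreal ((norm (Yn n x))\<^sup>2) \<partial>\<mu>) \<le> ennreal (2 * B n + 2 * S)" for n
  proof -
    have "(\<integral>\<^sup>+x. ennreal ((norm (Yn n x))\<^sup>2) \<partial>\<mu>) = (\<integral>\<^sup>+u. ennreal ((norm (Yn n (fst u)))\<^sup>2) \<partial>Q n)"
      by (subst fst_int) auto
    also have "\<dots> \<le> (\<integral>\<^sup>+u. ennreal 2 * ennreal ((norm (Yn n (fst u) - snd u))\<^sup>2) + ennreal 2 * ennreal ((norm (snd u))\<^sup>2) \<partial>Q n)"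
    proof (rule nn_integral_mono)
      fix u
      have "(norm (Yn n (fst u)))\<^sup>2 \<le> 2 * (norm (Yn n (fst u) - snd u))\<^sup>2 + 2 * (norm (snd u))\<^sup>2"
        using norm_add_power2_le[of "Yn n (fst u) - snd u" "snd u"] by simp
      then show "ennreal ((norm (Yn n (fst u)))\<^sup>2) \<le> ennreal 2 * ennreal ((norm (Yn n (fst u) - snd u))\<^sup>2) + ennreal 2 * ennreal ((norm (snd u))\<^sup>2)"
        using ennreal_leI by (fastforce simp: ennreal_mult)
    qed
    also have "\<dots> = ennreal 2 * (\<integral>\<^sup>+u. ennreal ((norm (Yn n (fst u) - snd u))\<^sup>2) \<partial>Q n) + ennreal 2 * (\<integral>\<^sup>+u. ennreal ((norm (snd u))\<^sup>2) \<partial>Q n)"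
      by (subst nn_integral_add, measurable) (subst (1 2) nn_integral_cmult, auto)
    also have "(\<integral>\<^sup>+u. ennreal ((norm (snd u))\<^sup>2) \<partial>Q n) = ennreal S"
      by (subst snd_int) (auto simp: nn_second_moment)
    also have "ennreal 2 * (\<integral>\<^sup>+u. ennreal ((norm (Yn n (fst u) - snd u))\<^sup>2) \<partial>Q n) + ennreal 2 * ennreal S \<le> ennreal 2 * ennreal (B n) + ennreal 2 * ennreal S"
      by (intro add_mono mult_left_mono cost) auto
    also have "\<dots> = ennreal (2 * B n + 2 * S)" using B(2)[of n] S_nonneg by (simp add: ennreal_mult)
    finally show ?thesis .
  qed
  note Yn_le = this
  have "(\<integral>\<^sup>+x. ennreal ((norm (Y1 x))\<^sup>2) \<partial>\<mu>) = (\<integral>\<^sup>+x. liminf (\<lambda>n. ennreal ((norm (Yn n x))\<^sup>2)) \<partial>\<mu>)"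
  proof (rule nn_integral_cong)
    fix x
    have "(\<lambda>n. ennreal ((norm (Yn n x))\<^sup>2)) \<longlonglongrightarrow> ennreal ((norm (Y1 x))\<^sup>2)"
      by (intro tendsto_intros lim)
    then show "ennreal ((norm (Y1 x))\<^sup>2) = liminf (\<lambda>n. ennreal ((norm (Yn n x))\<^sup>2))"
      by (rule lim_imp_Liminf[OF sequentially_bot, symmetric])
  qed
  also have "\<dots> \<le> liminf (\<lambda>n. \<integral>\<^sup>+x. ennreal ((norm (Yn n x))\<^sup>2) \<partial>\<mu>)"
    by (rule nn_integral_liminf) measurable
  also have "\<dots> \<le> liminf (\<lambda>n. ennreal (2 * B n + 2 * S))"
    by (intro Liminf_mono always_eventually allI Yn_le)
  also have "\<dots> = ennreal (2 * B' + 2 * S)"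
    by (intro lim_imp_Liminf sequentially_bot tendsto_intros B)
  finally have Y1_le: "(\<integral>\<^sup>+x. ennreal ((norm (Y1 x))\<^sup>2) \<partial>\<mu>) \<le> ennreal (2 * B' + 2 * S)" .
  \<comment> \<open>Fatou's lemma has transferred the second-moment bounds of the maps
    \<open>Yn n\<close> to \<open>Y1\<close>; the resulting integrability supplies the dominating
    function \<open>dom\<close>.\<close>
  have Y1i: "integrable \<mu> (\<lambda>x. (norm (Y1 x))\<^sup>2)"
    by (rule integrable_norm2_of_nn_integral_le(1)[OF _ Y1_le]) (use B'0 S_nonneg in auto)

  define I where "I = (INF P\<in>couplings (distr \<mu> borel Y1) \<nu>. \<integral>\<^sup>+(x, y). ennreal ((dist x y)\<^sup>2) \<partial>P)"
  define tail where "tail K = (\<integral>y. (norm (indicator {y. norm y > real K} y *\<^sub>R y))\<^sup>2 \<partial>\<nu>)" for K :: nat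
  \<comment> \<open>One index \<open>K\<close> drives two limits: it is the truncation radius for
    the target and fixes \<open>k = 1 / (K + 1)\<close>. For each \<open>K\<close> the limit in
    \<open>n\<close> is taken before \<open>K\<close> is sent to infinity.\<close>
  have bound: "I \<le> ennreal ((1 + 1 / real (Suc K)) * B' + 2 * tail K)" for K
  proof -
    define k where "k = 1 / real (Suc K)"
    have k: "k > 0" by (simp add: k_def)
    define \<Delta> where "\<Delta> n x = norm (Y1 x - Yn n x)" for n x
    \<comment> \<open>Where \<open>Y1\<close> and \<open>Yn n\<close> differ by at most 1, the
      weighted Young inequality is used; elsewhere the crude bound by \<open>Y1\<close> and the
      target, the latter cut at radius \<open>K\<close>. Both pieces are functions of the starting
      point alone with an integrable majorant, and both vanish pointwise as \<open>n\<close>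
      grows.\<close>
    define \<phi> where "\<phi> n x = (1 + 1 / k) * (min (\<Delta> n x) 1)\<^sup>2 + indicator {x. \<Delta> n x > 1} x * (2 * (norm (Y1 x))\<^sup>2 + 2 * (real K)\<^sup>2)" for n x
    define t where "t y = (norm (indicator {y. norm y > real K} y *\<^sub>R y))\<^sup>2" for y :: "real ^ 'd"
    have \<Delta>m[measurable]: "\<Delta> n \<in> borel_measurable borel" for n unfolding \<Delta>_def by measurable
    have \<phi>m[measurable]: "\<phi> n \<in> borel_measurable borel" for n unfolding \<phi>_def by measurable
    have tm[measurable]: "t \<in> borel_measurable borel" unfolding t_def by measurable
    have \<phi>0: "\<phi> n x \<ge> 0" for n x unfolding \<phi>_def using k by auto
    have \<phi>le: "\<phi> n x \<le> (1 + 1 / k) + (2 * (norm (Y1 x))\<^sup>2 + 2 * (real K)\<^sup>2)" for n x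
    proof -
      have "(min (\<Delta> n x) 1)\<^sup>2 \<le> 1\<^sup>2" by (intro power_mono) (auto simp: \<Delta>_def)
      then have "(1 + 1 / k) * (min (\<Delta> n x) 1)\<^sup>2 \<le> (1 + 1 / k) * 1" using k by (intro mult_left_mono) auto
      then show ?thesis unfolding \<phi>_def by (intro add_mono) (auto simp: indicator_def)
    qed
    have dom: "integrable \<mu> (\<lambda>x. (1 + 1 / k) + (2 * (norm (Y1 x))\<^sup>2 + 2 * (real K)\<^sup>2))" using Y1i by auto
    have \<phi>i: "integrable \<mu> (\<phi> n)" for n
    proof (rule Bochner_Integration.integrable_bound[OF dom])
      show "AE x in \<mu>. norm (\<phi> n x) \<le> norm ((1 + 1 / k) + (2 * (norm (Y1 x))\<^sup>2 + 2 * (real K)\<^sup>2))"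
        unfolding real_norm_def abs_of_nonneg[OF \<phi>0]
        by (intro AE_I2 order_trans[OF \<phi>le abs_ge_self])
    qed measurable
    have "(\<lambda>n. \<integral>x. \<phi> n x \<partial>\<mu>) \<longlonglongrightarrow> (\<integral>x. 0 \<partial>\<mu>)"
    proof (rule integral_dominated_convergence[OF _ _ dom])
      show "AE x in \<mu>. (\<lambda>n. \<phi> n x) \<longlonglongrightarrow> 0"
      proof (intro AE_I2)
        fix x
        have D: "(\<lambda>n. \<Delta> n x) \<longlonglongrightarrow> 0"
          using tendsto_norm[OF tendsto_diff[OF tendsto_const[of "Y1 x"] lim[of x]]] by (simp add: \<Delta>_def)
        have "(\<lambda>n. (1 + 1 / k) * (\<Delta> n x)\<^sup>2) \<longlonglongrightarrow> (1 + 1 / k) * 0\<^sup>2" by (intro tendsto_intros D)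
        then have D2: "(\<lambda>n. (1 + 1 / k) * (\<Delta> n x)\<^sup>2) \<longlonglongrightarrow> 0" by simp
        have "\<forall>\<^sub>F n in sequentially. \<phi> n x = (1 + 1 / k) * (\<Delta> n x)\<^sup>2"
          using order_tendstoD(2)[OF D, of 1, simplified] by eventually_elim (auto simp: \<phi>_def)
        then show "(\<lambda>n. \<phi> n x) \<longlonglongrightarrow> 0" using D2 tendsto_cong by fast
      qed
      show "AE x in \<mu>. norm (\<phi> n x) \<le> (1 + 1 / k) + (2 * (norm (Y1 x))\<^sup>2 + 2 * (real K)\<^sup>2)" for n
        using \<phi>0 \<phi>le by (intro AE_I2) (auto simp: abs_of_nonneg)
    qed measurable
    then have \<phi>lim: "(\<lambda>n. \<integral>x. \<phi> n x \<partial>\<mu>) \<longlonglongrightarrow> 0" by simp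
    have t0: "0 \<le> t y" for y by (simp add: t_def)
    have ti: "integrable \<nu> t"
      by (rule Bochner_Integration.integrable_bound[OF second_moment]) (auto simp: t_def indicator_def)
    have pw: "(norm (Y1 x - y))\<^sup>2 \<le> (1 + k) * (norm (Yn n x - y))\<^sup>2 + (\<phi> n x + 2 * t y)" for n x y
    proof (cases "\<Delta> n x > 1")
      case True
      have "(norm y)\<^sup>2 \<le> (real K)\<^sup>2 + t y"
        by (cases "norm y > real K") (auto simp: t_def not_less intro!: power_mono)
      moreover have "(norm (Y1 x - y))\<^sup>2 \<le> 2 * (norm (Y1 x))\<^sup>2 + 2 * (norm y)\<^sup>2" by (rule norm_diff_power2_le)
      moreover have "0 \<le> (1 + k) * (norm (Yn n x - y))\<^sup>2" "0 \<le> (1 + 1 / k) * (min (\<Delta> n x) 1)\<^sup>2" using k by auto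
      ultimately show ?thesis using True by (simp add: \<phi>_def)
    next
      case False
      then have "min (\<Delta> n x) 1 = norm (Y1 x - Yn n x)" by (simp add: \<Delta>_def)
      moreover have "t y \<ge> 0" by (simp add: t_def)
      moreover have "(norm ((Yn n x - y) + (Y1 x - Yn n x)))\<^sup>2 \<le> (1 + k) * (norm (Yn n x - y))\<^sup>2 + (1 + 1 / k) * (norm (Y1 x - Yn n x))\<^sup>2"
        by (rule norm_add_power2_le_weighted[OF k])
      ultimately show ?thesis using False by (simp add: \<phi>_def)
    qed
    have In: "I \<le> ennreal ((1 + k) * B n + ((\<integral>x. \<phi> n x \<partial>\<mu>) + 2 * tail K))" for n
    proof -
      let ?P = "distr (Q n) (borel \<Otimes>\<^sub>M borel) (\<lambda>u. (Y1 (fst u), snd u))"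
      have "distr ?P borel fst = distr (distr (Q n) borel fst) borel Y1"
        by (subst (1 2) distr_distr) (auto simp: comp_def)
      moreover have "distr ?P borel snd = distr (Q n) borel snd"
        by (subst distr_distr) (auto simp: comp_def)
      ultimately have "?P \<in> couplings (distr \<mu> borel Y1) \<nu>"
        unfolding couplings_def using Q(3,4) by simp
      then have "I \<le> (\<integral>\<^sup>+(x, y). ennreal ((dist x y)\<^sup>2) \<partial>?P)" unfolding I_def by (rule INF_lower)
      also have "\<dots> = (\<integral>\<^sup>+u. ennreal ((norm (Y1 (fst u) - snd u))\<^sup>2) \<partial>Q n)"
        by (subst nn_integral_distr) (auto simp: dist_norm)
      also have "\<dots> \<le> (\<integral>\<^sup>+u. ennreal (1 + k) * ennreal ((norm (Yn n (fst u) - snd u))\<^sup>2) + (ennreal (\<phi> n (fst u)) + ennreal 2 * ennreal (t (snd u))) \<partial>Q n)"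
      proof (rule nn_integral_mono)
        fix u
        have "ennreal ((norm (Y1 (fst u) - snd u))\<^sup>2) \<le> ennreal ((1 + k) * (norm (Yn n (fst u) - snd u))\<^sup>2 + (\<phi> n (fst u) + 2 * t (snd u)))"
          by (rule ennreal_leI[OF pw])
        also have "\<dots> = ennreal (1 + k) * ennreal ((norm (Yn n (fst u) - snd u))\<^sup>2) + (ennreal (\<phi> n (fst u)) + ennreal 2 * ennreal (t (snd u)))"
        proof -
          have "ennreal (\<phi> n (fst u) + 2 * t (snd u)) = ennreal (\<phi> n (fst u)) + ennreal 2 * ennreal (t (snd u))"
            using \<phi>0[of n "fst u"] by (subst ennreal_plus) (auto simp: ennreal_mult t_def)
          moreover have "ennreal ((1 + k) * (norm (Yn n (fst u) - snd u))\<^sup>2) = ennreal (1 + k) * ennreal ((norm (Yn n (fst u) - snd u))\<^sup>2)"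
            using k by (intro ennreal_mult) auto
          moreover have "0 \<le> \<phi> n (fst u) + 2 * t (snd u)" using \<phi>0[of n "fst u"] by (auto simp: t_def)
          moreover have "0 \<le> (1 + k) * (norm (Yn n (fst u) - snd u))\<^sup>2" using k by auto
          ultimately show ?thesis by (simp only: ennreal_plus)
        qed
        finally show "ennreal ((norm (Y1 (fst u) - snd u))\<^sup>2) \<le> ennreal (1 + k) * ennreal ((norm (Yn n (fst u) - snd u))\<^sup>2) + (ennreal (\<phi> n (fst u)) + ennreal 2 * ennreal (t (snd u)))" .
      qed
      also have "\<dots> = ennreal (1 + k) * (\<integral>\<^sup>+u. ennreal ((norm (Yn n (fst u) - snd u))\<^sup>2) \<partial>Q n) +
        ((\<integral>\<^sup>+u. ennreal (\<phi> n (fst u)) \<partial>Q n) + ennreal 2 * (\<integral>\<^sup>+u. ennreal (t (snd u)) \<partial>Q n))"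
        by (subst nn_integral_add, measurable, subst nn_integral_add, measurable, subst (1 2) nn_integral_cmult) auto
      also have "(\<integral>\<^sup>+u. ennreal (\<phi> n (fst u)) \<partial>Q n) = ennreal (\<integral>x. \<phi> n x \<partial>\<mu>)"
        using \<phi>0 by (subst fst_int[of "\<lambda>x. ennreal (\<phi> n x)"]) (auto intro!: nn_integral_eq_integral \<phi>i)
      also have "(\<integral>\<^sup>+u. ennreal (t (snd u)) \<partial>Q n) = ennreal (tail K)"
        unfolding tail_def t_def[symmetric]
        by (subst snd_int[of "\<lambda>x. ennreal (t x)"]) (auto intro!: nn_integral_eq_integral ti t0)
      also have "ennreal (1 + k) * (\<integral>\<^sup>+u. ennreal ((norm (Yn n (fst u) - snd u))\<^sup>2) \<partial>Q n) + (ennreal (\<integral>x. \<phi> n x \<partial>\<mu>) + ennreal 2 * ennreal (tail K))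
        \<le> ennreal (1 + k) * ennreal (B n) + (ennreal (\<integral>x. \<phi> n x \<partial>\<mu>) + ennreal 2 * ennreal (tail K))"
        by (intro add_right_mono mult_left_mono cost) auto
      also have "\<dots> = ennreal ((1 + k) * B n + ((\<integral>x. \<phi> n x \<partial>\<mu>) + 2 * tail K))"
      proof -
        have "0 \<le> (\<integral>x. \<phi> n x \<partial>\<mu>)" "0 \<le> tail K" unfolding tail_def using \<phi>0 by (auto intro!: integral_nonneg_AE)
        then show ?thesis using k B(2)[of n] by (simp add: ennreal_mult)
      qed
      finally show ?thesis .
    qed
    have "(\<lambda>n. ennreal ((1 + k) * B n + ((\<integral>x. \<phi> n x \<partial>\<mu>) + 2 * tail K))) \<longlonglongrightarrow> ennreal ((1 + k) * B' + (0 + 2 * tail K))"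
      by (intro tendsto_intros B \<phi>lim)
    from LIMSEQ_le_const[OF this] In show ?thesis by (auto simp: k_def)
  qed
  have "(\<lambda>K. (1 + 1 / real (Suc K)) * B' + 2 * tail K) \<longlonglongrightarrow> (1 + 0) * B' + 2 * 0"
    unfolding tail_def
    by (intro tendsto_intros tail_second_moment_tendsto_0 LIMSEQ_Suc[OF lim_1_over_n])
  then have "(\<lambda>K. ennreal ((1 + 1 / real (Suc K)) * B' + 2 * tail K)) \<longlonglongrightarrow> ennreal B'"
    by (auto intro: tendsto_ennrealI)
  from LIMSEQ_le_const[OF this] bound have "I \<le> ennreal B'" by auto
  then show ?thesis unfolding W2_def ennreal_sqrt_power2 I_def .
qed

section \<open>Letting the end time tend to 1\<close>

context target_law begin

text \<open>The drift with the schedule and its derivatives as free parameters, so that its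
  regularity in \<open>x\<close> can be studied at a fixed time.\<close>

definition velocity :: "real \<Rightarrow> real \<Rightarrow> real \<Rightarrow> real \<Rightarrow> real ^ 'd \<Rightarrow> real ^ 'd" where
  "velocity \<alpha> \<beta> \<alpha>' \<beta>' x = (\<alpha>' / \<alpha>) *\<^sub>R x + (\<beta>' - \<alpha>' * \<beta> / \<alpha>) *\<^sub>R pmean \<alpha> \<beta> x"

text \<open>Freezing the schedule outside \<open>[0, T]\<close> gives functions that are continuous
  on the whole line, with a first coefficient that stays positive, as \<open>interpolation\<close>
  demands; nothing changes on \<open>[0, T]\<close>, where the clamp is the identity.\<close>

lemma has_real_derivative_clamp:
  fixes f :: "real \<Rightarrow> real"
  assumes d: "(f has_real_derivative D) (at t within {0..<1})" and t: "t \<in> {0..T}" and T: "T < 1"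
  shows "((\<lambda>s. f (max 0 (min T s))) has_real_derivative D) (at t within {0..T})"
proof -
  have "{0..T} \<subseteq> {0..<1}" using T by auto
  with d have "(f has_vector_derivative D) (at t within {0..T})"
    unfolding has_real_derivative_iff_has_vector_derivative by (rule has_vector_derivative_within_subset)
  from has_vector_derivative_transform[OF t _ this, of "\<lambda>s. f (max 0 (min T s))"] show ?thesis
    by (auto simp: has_real_derivative_iff_has_vector_derivative)
qed

lemma continuous_on_clamp:
  fixes f :: "real \<Rightarrow> real"
  assumes "continuous_on {0..<1} f" "0 \<le> T" "T < 1"
  shows "continuous_on UNIV (\<lambda>s. f (max 0 (min T s)))"
  by (rule continuous_on_compose2[OF assms(1)]) (use assms in \<open>auto intro!: continuous_intros\<close>)

text \<open>For every \<open>T < 1\<close> the schedule is frozen and the coupling bound applied; as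
  \<open>T\<close> tends to 1, \<open>Y T\<close> tends to \<open>Y 1\<close> and the distance of
  the position to its target to 0. The parameters \<open>k\<close> and \<open>\<eta>\<close> stay
  fixed during this limit and are sent to 0 afterwards, in the real bound that results.\<close>

theorem W2_flow_le:
  fixes a b a' b' l e2 :: "real \<Rightarrow> real" and w Y :: "real \<Rightarrow> real ^ 'd \<Rightarrow> real ^ 'd"
    and r :: "real \<Rightarrow> real ^ 'd \<Rightarrow> real ^ 'd \<Rightarrow> real"
  assumes a_deriv: "\<And>t. t \<in> {0..<1} \<Longrightarrow> (a has_real_derivative a' t) (at t within {0..<1})"
    and b_deriv: "\<And>t. t \<in> {0..<1} \<Longrightarrow> (b has_real_derivative b' t) (at t within {0..<1})"
    and cont: "continuous_on {0..<1} a'" "continuous_on {0..<1} b'"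
    and a_pos: "\<And>t. t \<in> {0..<1} \<Longrightarrow> a t > 0"
    and a_lim: "(a \<longlongrightarrow> 0) (at_left 1)" and b_lim: "(b \<longlongrightarrow> 1) (at_left 1)"
    and Y_deriv: "\<And>s x. s \<in> {0..1} \<Longrightarrow> ((\<lambda>s. Y s x) has_vector_derivative w s (Y s x)) (at s within {0..1})"
    and Y_0: "\<And>x. Y 0 x = x"
    and Y_meas: "(\<lambda>(s, x). Y s x) \<in> borel_measurable (borel \<Otimes>\<^sub>M borel)"
    and Y_int: "\<And>T. T \<in> {0..<1} \<Longrightarrow> AE x in law (a 0) (b 0). set_integrable lborel {0..T} (\<lambda>s. w s (Y s x))"
    and Y_L2: "\<And>T. T \<in> {0..<1} \<Longrightarrow> \<exists>C\<ge>0. \<forall>s\<in>{0..T}. (\<integral>\<^sup>+x. ennreal ((norm (Y s x))\<^sup>2) \<partial>law (a 0) (b 0)) \<le> ennreal C"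
    and l: "set_integrable lborel {0..1} l"
    and r_meas: "(\<lambda>(s, x, y). r s x y) \<in> borel_measurable (borel \<Otimes>\<^sub>M borel \<Otimes>\<^sub>M borel)"
    and monotone_defect: "\<And>s x y. s \<in> {0<..<1} \<Longrightarrow>
      (x - y) \<bullet> (velocity (a s) (b s) (a' s) (b' s) x - w s y) \<le> l s * (norm (x - y))\<^sup>2 + norm (x - y) * r s x y"
    and r_L2: "AE s in lborel. s \<in> {0..<1} \<longrightarrow> (\<forall>P. prob_space P \<longrightarrow> sets P = sets (borel \<Otimes>\<^sub>M borel) \<longrightarrow>
      distr P borel fst = law (a 0) (b 0) \<longrightarrow> distr P borel snd = law (a s) (b s) \<longrightarrow>
      (\<integral>\<^sup>+u. ennreal ((r s (snd u) (Y s (fst u)))\<^sup>2) \<partial>P) \<le> ennreal (e2 s))"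
    and e2: "set_integrable lborel {0..1} e2" "\<And>s. e2 s \<ge> 0"
  shows "(W2 (distr (law (a 0) (b 0)) borel (Y 1)) \<nu>)\<^sup>2 \<le>
    ennreal ((LINT s:{0..1}|lborel. e2 s) * (LINT s:{0..1}|lborel. exp (2 * (LINT u:{s..1}|lborel. l u))))"
proof -
  have a_cont: "continuous_on {0..<1} a" and b_cont: "continuous_on {0..<1} b"
    using DERIV_continuous_on[OF a_deriv] DERIV_continuous_on[OF b_deriv] by auto
  define J where "J = (LINT s:{0..1}|lborel. e2 s)"
  define Zm where "Zm = (\<integral>u. (norm (fst u))\<^sup>2 \<partial>base)"
  have Zm0: "Zm \<ge> 0" unfolding Zm_def by (intro integral_nonneg_AE) auto
  \<comment> \<open>Bounds the mean squared distance of the position at time \<open>T\<close> and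
    its target, from \<open>X T - X1 = a T * Z + (b T - 1) * X1\<close>; it tends to 0 because
    \<open>a\<close> tends to 0 and \<open>b\<close> to 1.\<close>
  define \<tau> where "\<tau> T = 2 * (a T)\<^sup>2 * Zm + 2 * (b T - 1)\<^sup>2 * S" for T
  have J_mono: "(LINT s:{0..T}|lborel. e2 s) \<le> J" "0 \<le> (LINT s:{0..T}|lborel. e2 s)" if "T \<in> {0..1}" for T
  proof -
    have "0 \<le> (LINT s:{T..1}|lborel. e2 s)" "0 \<le> (LINT s:{0..T}|lborel. e2 s)"
      unfolding set_lebesgue_integral_def using e2(2) by (auto intro!: integral_nonneg_AE)
    then show "(LINT s:{0..T}|lborel. e2 s) \<le> J" "0 \<le> (LINT s:{0..T}|lborel. e2 s)"
      using set_integral_Icc_combine[OF e2(1), of T] that by (auto simp: J_def)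
  qed
  have J0: "J \<ge> 0" using J_mono(2)[of 1] by (simp add: J_def)
  have coupling: "\<exists>Q. prob_space Q \<and> sets Q = sets (borel \<Otimes>\<^sub>M borel) \<and> distr Q borel fst = law (a 0) (b 0) \<and> distr Q borel snd = \<nu> \<and>
    (\<integral>\<^sup>+u. ennreal ((norm (Y T (fst u) - snd u))\<^sup>2) \<partial>Q) \<le>
      ennreal ((1 + k) * ((J + e) / weight l \<eta> T) + (1 + 1 / k) * \<tau> T)"
    if T: "T \<in> {0..<1}" and e: "e > 0" and k: "k > 0" and \<eta>: "\<eta> > 0" for T e k \<eta>
  proof -
    let ?c = "\<lambda>s::real. max 0 (min T s)"
    have cl: "?c s = s" if "s \<in> {0..T}" for s using that by auto
    have cr: "?c s \<in> {0..<1}" for s using T by auto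
    obtain C where C: "C \<ge> 0" "\<forall>s\<in>{0..T}. (\<integral>\<^sup>+x. ennreal ((norm (Y s x))\<^sup>2) \<partial>law (a 0) (b 0)) \<le> ennreal C"
      using Y_L2[OF T] by blast
    interpret I: interpolation \<nu> "\<lambda>s. a (?c s)" "\<lambda>s. b (?c s)" "\<lambda>s. a' (?c s)" "\<lambda>s. b' (?c s)" T
    proof
      show "0 \<le> T" "T \<le> 1" using T by auto
      show "continuous_on UNIV (\<lambda>s. a (?c s))" "continuous_on UNIV (\<lambda>s. b (?c s))"
        "continuous_on UNIV (\<lambda>s. a' (?c s))" "continuous_on UNIV (\<lambda>s. b' (?c s))"
        using T by (auto intro!: continuous_on_clamp a_cont b_cont cont)
      show "a (?c t) > 0" for t by (rule a_pos[OF cr])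
      show "((\<lambda>s. a (?c s)) has_real_derivative a' (?c t)) (at t within {0..T})"
        "((\<lambda>s. b (?c s)) has_real_derivative b' (?c t)) (at t within {0..T})" if t: "t \<in> {0..T}" for t
        unfolding cl[OF t] using t T
        by (auto intro!: has_real_derivative_clamp a_deriv b_deriv)
    qed
    have law0: "law (a (?c 0)) (b (?c 0)) = law (a 0) (b 0)" using T by simp
    have drift: "I.drift s x = velocity (a s) (b s) (a' s) (b' s) x" if "s \<in> {0..T}" for s x
      unfolding I.drift_def I.\<kappa>_def velocity_def cl[OF that] ..
    interpret F: coupled_flow \<nu> "\<lambda>s. a (?c s)" "\<lambda>s. b (?c s)" "\<lambda>s. a' (?c s)" "\<lambda>s. b' (?c s)" T w Y l e2 \<eta> C r
    proof
      show "\<eta> > 0" by (rule \<eta>)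
      show "((\<lambda>s. Y s x) has_vector_derivative w s (Y s x)) (at s within {0..T})" if "s \<in> {0..T}" for s x
        by (rule has_vector_derivative_within_subset[OF Y_deriv]) (use that T in auto)
      show "Y 0 x = x" for x by (rule Y_0)
      show "(\<lambda>(s, x). Y s x) \<in> borel_measurable (borel \<Otimes>\<^sub>M borel)" by (rule Y_meas)
      show "AE x in law (a (?c 0)) (b (?c 0)). set_integrable lborel {0..T} (\<lambda>s. w s (Y s x))"
        unfolding law0 by (rule Y_int[OF T])
      show "(\<integral>\<^sup>+x. ennreal ((norm (Y s x))\<^sup>2) \<partial>law (a (?c 0)) (b (?c 0))) \<le> ennreal C" if "s \<in> {0..T}" for s
        unfolding law0 using C(2) that by blast
      show "C \<ge> 0" by (rule C)
      show "set_integrable lborel {0..1} l" by (rule l)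
      show "(\<lambda>(s, x, y). r s x y) \<in> borel_measurable (borel \<Otimes>\<^sub>M borel \<Otimes>\<^sub>M borel)" by (rule r_meas)
      show "(x - y) \<bullet> (I.drift s x - w s y) \<le> l s * (norm (x - y))\<^sup>2 + norm (x - y) * r s x y" if "s \<in> {0<..<T}" for s x y
      proof -
        have s: "s \<in> {0..T}" "s \<in> {0<..<1}" using that T by auto
        show ?thesis unfolding drift[OF s(1)] by (rule monotone_defect[OF s(2)])
      qed
      show "AE s in lborel. s \<in> {0..T} \<longrightarrow> (\<forall>P. prob_space P \<longrightarrow> sets P = sets (borel \<Otimes>\<^sub>M borel) \<longrightarrow>
        distr P borel fst = law (a (?c 0)) (b (?c 0)) \<longrightarrow> distr P borel snd = law (a (?c s)) (b (?c s)) \<longrightarrow>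
        (\<integral>\<^sup>+u. ennreal ((r s (snd u) (Y s (fst u)))\<^sup>2) \<partial>P) \<le> ennreal (e2 s))"
        using r_L2
      proof eventually_elim
        case (elim s)
        show ?case
        proof (intro impI)
          assume s: "s \<in> {0..T}"
          then have "s \<in> {0..<1}" using T by auto
          with elim show "\<forall>P. prob_space P \<longrightarrow> sets P = sets (borel \<Otimes>\<^sub>M borel) \<longrightarrow>
            distr P borel fst = law (a (?c 0)) (b (?c 0)) \<longrightarrow> distr P borel snd = law (a (?c s)) (b (?c s)) \<longrightarrow>
            (\<integral>\<^sup>+u. ennreal ((r s (snd u) (Y s (fst u)))\<^sup>2) \<partial>P) \<le> ennreal (e2 s)"
            unfolding law0 cl[OF s] by blast
        qed
      qed
      show "set_integrable lborel {0..T} e2" by (rule set_integrable_Icc_subset[OF e2(1)]) (use T in auto)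
      show "e2 s \<ge> 0" for s by (rule e2)
    qed
    have TT: "?c T = T" using T by auto
    have W: "weight l \<eta> T > 0" using weight_pos[OF l \<eta>, of T] T by simp
    have "(\<integral>u. (norm (I.X T u - snd u))\<^sup>2 \<partial>base) \<le> (\<integral>u. 2 * (a T)\<^sup>2 * (norm (fst u))\<^sup>2 + 2 * (b T - 1)\<^sup>2 * (norm (snd u))\<^sup>2 \<partial>base)"
    proof (intro integral_mono Bochner_Integration.integrable_add integrable_mult_right integrable_base)
      show "integrable base (\<lambda>u. (norm (I.X T u - snd u))\<^sup>2)"
        by (intro integrable_norm2_diff I.X_L2 integrable_base) measurable
      fix u
      have "I.X T u - snd u = a T *\<^sub>R fst u + (b T - 1) *\<^sub>R snd u" unfolding I.X_def TT by (simp add: algebra_simps)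
      then show "(norm (I.X T u - snd u))\<^sup>2 \<le> 2 * (a T)\<^sup>2 * (norm (fst u))\<^sup>2 + 2 * (b T - 1)\<^sup>2 * (norm (snd u))\<^sup>2"
        using norm_add_power2_le[of "a T *\<^sub>R fst u" "(b T - 1) *\<^sub>R snd u"] by (simp add: power_mult_distrib mult.assoc)
    qed
    also have "\<dots> = \<tau> T"
      using integrable_base unfolding \<tau>_def Zm_def by (subst Bochner_Integration.integral_add) auto
    finally have X: "(\<integral>u. (norm (I.X T u - snd u))\<^sup>2 \<partial>base) \<le> \<tau> T" .
    have "(1 + k) * (((LINT s:{0..T}|lborel. e2 s) + e) / weight l \<eta> T) + (1 + 1 / k) * (\<integral>u. (norm (I.X T u - snd u))\<^sup>2 \<partial>base)
      \<le> (1 + k) * ((J + e) / weight l \<eta> T) + (1 + 1 / k) * \<tau> T"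
      using k W J_mono(1)[of T] T X by (intro add_mono mult_left_mono divide_right_mono) auto
    note le = ennreal_leI[OF this]
    obtain Q where Q: "prob_space Q" "sets Q = sets (borel \<Otimes>\<^sub>M borel)" "distr Q borel fst = law (a 0) (b 0)" "distr Q borel snd = \<nu>"
      and c: "(\<integral>\<^sup>+u. ennreal ((norm (Y T (fst u) - snd u))\<^sup>2) \<partial>Q) \<le>
      ennreal ((1 + k) * (((LINT s:{0..T}|lborel. e2 s) + e) / weight l \<eta> T) + (1 + 1 / k) * (\<integral>u. (norm (I.X T u - snd u))\<^sup>2 \<partial>base))"
      using F.terminal_coupling_exists[OF e k] unfolding law0 by (elim exE conjE)
    show ?thesis by (intro exI[of _ Q] conjI Q order_trans[OF c le])
  qed
  define Tn where "Tn n = 1 - 1 / real (n + 2)" for n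
  have Tn: "Tn n \<in> {0..<1}" for n by (auto simp: Tn_def field_simps)
  have Tn1: "Tn \<longlonglongrightarrow> 1"
  proof -
    have "(\<lambda>n. 1 - 1 / real (n + 2)) \<longlonglongrightarrow> 1 - 0"
      by (intro tendsto_intros LIMSEQ_ignore_initial_segment[OF lim_1_over_n])
    then show ?thesis by (simp add: Tn_def[abs_def])
  qed
  have Tn_left: "filterlim Tn (at_left 1) sequentially"
    using Tn1 Tn by (auto simp: filterlim_at intro!: always_eventually) (metis less_irrefl)
  \<comment> \<open>Here \<open>k\<close> and \<open>\<eta>\<close> are fixed while the end times
    \<open>Tn n\<close> tend to 1 and the discretisation errors \<open>e n\<close> to 0; continuity
    of the weight at 1 yields the limit of the bounds.\<close>
  have bound: "(W2 (distr (law (a 0) (b 0)) borel (Y 1)) \<nu>)\<^sup>2 \<le> ennreal ((1 + k) * (J * inverse (weight l \<eta> 1)))"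
    if k: "k > 0" and \<eta>: "\<eta> > 0" for k \<eta>
  proof -
    define e where "e n = 1 / real (Suc n)" for n
    have e: "e n > 0" for n by (simp add: e_def)
    define B where "B n = (1 + k) * ((J + e n) / weight l \<eta> (Tn n)) + (1 + 1 / k) * \<tau> (Tn n)" for n
    have "\<forall>n. \<exists>Q. prob_space Q \<and> sets Q = sets (borel \<Otimes>\<^sub>M borel) \<and> distr Q borel fst = law (a 0) (b 0) \<and> distr Q borel snd = \<nu> \<and>
      (\<integral>\<^sup>+u. ennreal ((norm (Y (Tn n) (fst u) - snd u))\<^sup>2) \<partial>Q) \<le> ennreal (B n)"
      unfolding B_def using coupling[OF Tn e k \<eta>] by blast
    from choice[OF this] obtain Q where Q: "\<And>n. prob_space (Q n)" "\<And>n. sets (Q n) = sets (borel \<Otimes>\<^sub>M borel)"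
      "\<And>n. distr (Q n) borel fst = law (a 0) (b 0)" "\<And>n. distr (Q n) borel snd = \<nu>"
      "\<And>n. (\<integral>\<^sup>+u. ennreal ((norm (Y (Tn n) (fst u) - snd u))\<^sup>2) \<partial>Q n) \<le> ennreal (B n)" by blast
    have W1: "weight l \<eta> 1 > 0" using weight_pos[OF l \<eta>, of 1] by simp
    have Wl: "(\<lambda>n. weight l \<eta> (Tn n)) \<longlonglongrightarrow> weight l \<eta> 1"
      by (rule continuous_on_tendsto_compose[OF weight_continuous[OF l \<eta>] Tn1]) (use Tn in \<open>auto intro!: always_eventually simp: less_imp_le\<close>)
    have al: "(\<lambda>n. a (Tn n)) \<longlonglongrightarrow> 0" and bl: "(\<lambda>n. b (Tn n)) \<longlonglongrightarrow> 1"
      by (rule filterlim_compose[OF a_lim Tn_left] filterlim_compose[OF b_lim Tn_left])+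
    have "B \<longlonglongrightarrow> (1 + k) * ((J + 0) / weight l \<eta> 1) + (1 + 1 / k) * (2 * 0\<^sup>2 * Zm + 2 * (1 - 1)\<^sup>2 * S)"
      unfolding B_def \<tau>_def e_def
      using W1 by (intro tendsto_intros Wl al bl LIMSEQ_Suc[OF lim_1_over_n]) auto
    then have Bl: "B \<longlonglongrightarrow> (1 + k) * (J * inverse (weight l \<eta> 1))" by (simp add: divide_inverse)
    have B0: "B n \<ge> 0" for n
    proof -
      have "weight l \<eta> (Tn n) > 0" using weight_pos[OF l \<eta>, of "Tn n"] Tn[of n] by simp
      then show ?thesis unfolding B_def \<tau>_def using k J0 e[of n] Zm0 S_nonneg by (intro add_nonneg_nonneg mult_nonneg_nonneg divide_nonneg_pos) auto
    qed
    have Ym: "Y s \<in> borel_measurable borel" for s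
    proof -
      have "(\<lambda>x::real ^ 'd. (s, x)) \<in> borel \<rightarrow>\<^sub>M borel \<Otimes>\<^sub>M borel" by simp
      from measurable_compose[OF this Y_meas] show ?thesis by simp
    qed
    have lim: "(\<lambda>n. Y (Tn n) x) \<longlonglongrightarrow> Y 1 x" for x
    proof (rule continuous_on_tendsto_compose[OF _ Tn1])
      show "continuous_on {0..1} (\<lambda>s. Y s x)"
        unfolding continuous_on_eq_continuous_within
        using has_vector_derivative_continuous[OF Y_deriv] by blast
    qed (use Tn in \<open>auto intro!: always_eventually simp: less_imp_le\<close>)
    show ?thesis
      by (rule W2_limit_le[OF prob_space_law sets_law Ym Ym lim Q(1-5) Bl B0])
  qed
  let ?I = "LINT s:{0..1}|lborel. exp (2 * (LINT u:{s..1}|lborel. l u))"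
  let ?L = "exp (2 * (LINT u:{0..1}|lborel. l u))"
  have "(\<lambda>n. (1 + 1 / real (Suc n)) * (J * (1 / real (Suc n) * ?L + ?I))) \<longlonglongrightarrow> (1 + 0) * (J * (0 * ?L + ?I))"
    by (intro tendsto_intros LIMSEQ_Suc[OF lim_1_over_n])
  then have "(\<lambda>n. ennreal ((1 + 1 / real (Suc n)) * (J * (1 / real (Suc n) * ?L + ?I)))) \<longlonglongrightarrow> ennreal (J * ?I)"
    by (auto intro: tendsto_ennrealI)
  moreover have "(W2 (distr (law (a 0) (b 0)) borel (Y 1)) \<nu>)\<^sup>2 \<le> ennreal ((1 + 1 / real (Suc n)) * (J * (1 / real (Suc n) * ?L + ?I)))" for n
    using bound[of "1 / real (Suc n)" "1 / real (Suc n)"] inverse_weight_1[OF l, of "1 / real (Suc n)"] by simp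
  ultimately have "(W2 (distr (law (a 0) (b 0)) borel (Y 1)) \<nu>)\<^sup>2 \<le> ennreal (J * ?I)"
    by (intro LIMSEQ_le_const[of _ "ennreal (J * ?I)"]) auto
  then show ?thesis unfolding J_def .
qed

end

section \<open>Regularity and identification of the velocity field\<close>

text \<open>Rounding the time down to the grid of mesh \<open>1 / (n + 1)\<close> leaves countably
  many time slices, each measurable; continuity in time recovers the function as the pointwise
  limit.\<close>

lemma borel_measurable_caratheodory:
  fixes f :: "real \<Rightarrow> 'a \<Rightarrow> 'b::metric_space"
  assumes cont: "\<And>x. continuous_on UNIV (\<lambda>s. f s x)" and meas: "\<And>s. f s \<in> borel_measurable M"
  shows "(\<lambda>(s, x). f s x) \<in> borel_measurable (borel \<Otimes>\<^sub>M M)"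
proof (rule borel_measurable_LIMSEQ_metric)
  let ?g = "\<lambda>n s. real_of_int \<lfloor>real (Suc n) * s\<rfloor> / real (Suc n)"
  show "(\<lambda>p. f (?g n (fst p)) (snd p)) \<in> borel_measurable (borel \<Otimes>\<^sub>M M)" for n
  proof (rule measurable_compose_countable[where f = "\<lambda>i p. f (real_of_int i / real (Suc n)) (snd p)" and g = "\<lambda>p. \<lfloor>real (Suc n) * fst p\<rfloor>"])
    show "(\<lambda>p. f (real_of_int i / real (Suc n)) (snd p)) \<in> borel_measurable (borel \<Otimes>\<^sub>M M)" for i
      by (rule measurable_compose[OF measurable_snd meas])
    show "(\<lambda>p. \<lfloor>real (Suc n) * fst p\<rfloor>) \<in> (borel \<Otimes>\<^sub>M M) \<rightarrow>\<^sub>M count_space UNIV" by measurable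
  qed
  fix p :: "real \<times> 'a"
  obtain s x where p: "p = (s, x)" by (cases p)
  have "(\<lambda>n. ?g n s) \<longlonglongrightarrow> s"
  proof (rule tendsto_sandwich[OF _ _ _ tendsto_const])
    have "s - 1 / real (Suc n) \<le> ?g n s \<and> ?g n s \<le> s" for n
    proof -
      have "real (Suc n) * s - 1 \<le> real_of_int \<lfloor>real (Suc n) * s\<rfloor>" "real_of_int \<lfloor>real (Suc n) * s\<rfloor> \<le> real (Suc n) * s"
        by linarith+
      from divide_right_mono[OF this(1), of "real (Suc n)"] divide_right_mono[OF this(2), of "real (Suc n)"]
      show ?thesis by (simp add: diff_divide_distrib)
    qed
    then show "\<forall>\<^sub>F n in sequentially. s - 1 / real (Suc n) \<le> ?g n s" "\<forall>\<^sub>F n in sequentially. ?g n s \<le> s" by auto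
    have "(\<lambda>n. s - 1 / real (Suc n)) \<longlonglongrightarrow> s - 0"
      by (intro tendsto_intros LIMSEQ_Suc[OF lim_1_over_n])
    then show "(\<lambda>n. s - 1 / real (Suc n)) \<longlonglongrightarrow> s" by simp
  qed
  then show "(\<lambda>n. f (?g n (fst p)) (snd p)) \<longlonglongrightarrow> (case p of (s, x) \<Rightarrow> f s x)"
    unfolding p using continuous_on_tendsto_compose[OF cont] by simp
qed

lemma borel_measurable_vec_component [measurable (raw)]:
  fixes f :: "'a \<Rightarrow> real ^ 'd"
  assumes f: "f \<in> borel_measurable M"
  shows "(\<lambda>x. f x $ i) \<in> borel_measurable M"
proof -
  have "(\<lambda>x::real ^ 'd. x $ i) \<in> borel_measurable borel"
    by (intro borel_measurable_continuous_onI continuous_on_component continuous_on_id)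
  from measurable_compose[OF f this] show ?thesis .
qed

text \<open>Dominated convergence for the normalised remainder of the Frechet derivative. A bound on
  the derivative at \<open>x\<close> alone would not dominate it: the increments have to be
  Lipschitz with an integrable constant as well, whence the majorant \<open>2 * G\<close>.\<close>

lemma has_derivative_integral:
  fixes f :: "'a::euclidean_space \<Rightarrow> 'b \<Rightarrow> 'c::euclidean_space" and F :: "'b \<Rightarrow> 'a \<Rightarrow> 'c"
  assumes f: "\<And>x. integrable M (f x)"
    and d: "\<And>y. ((\<lambda>x. f x y) has_derivative F y) (at x)"
    and Fm: "\<And>h. (\<lambda>y. F y h) \<in> borel_measurable M"
    and Fb: "\<And>y h. norm (F y h) \<le> G y * norm h"
    and lip: "\<And>x' y. norm (f x' y - f x y) \<le> G y * norm (x' - x)"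
    and G: "integrable M G"
  shows "((\<lambda>x. \<integral>y. f x y \<partial>M) has_derivative (\<lambda>h. \<integral>y. F y h \<partial>M)) (at x)"
proof -
  have Fi: "integrable M (\<lambda>y. F y h)" for h
    by (rule Bochner_Integration.integrable_bound[OF integrable_mult_left[OF G, of "norm h"] Fm])
       (use Fb[of _ h] in \<open>auto intro!: AE_I2 order_trans[OF Fb abs_ge_self]\<close>)
  have lin: "bounded_linear (\<lambda>h. \<integral>y. F y h \<partial>M)"
  proof (rule bounded_linear_intro)
    fix h k and c :: real
    show "(\<integral>y. F y (h + k) \<partial>M) = (\<integral>y. F y h \<partial>M) + (\<integral>y. F y k \<partial>M)"
      using Fi by (subst Bochner_Integration.integral_add[symmetric])
        (auto simp: linear_add[OF bounded_linear.linear[OF has_derivative_bounded_linear[OF d]]])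
    show "(\<integral>y. F y (c *\<^sub>R h) \<partial>M) = c *\<^sub>R (\<integral>y. F y h \<partial>M)"
      by (subst integral_scaleR_right[symmetric])
        (auto simp: linear_scale[OF bounded_linear.linear[OF has_derivative_bounded_linear[OF d]]])
    have "norm (\<integral>y. F y h \<partial>M) \<le> (\<integral>y. norm (F y h) \<partial>M)" by (rule integral_norm_bound)
    also have "\<dots> \<le> (\<integral>y. G y * norm h \<partial>M)"
      by (intro integral_mono integrable_norm Fi integrable_mult_left G Fb)
    finally show "norm (\<integral>y. F y h \<partial>M) \<le> norm h * (\<integral>y. G y \<partial>M)" by (simp add: mult.commute)
  qed
  have "((\<lambda>x'. norm (((\<integral>y. f x' y \<partial>M) - (\<integral>y. f x y \<partial>M)) - (\<integral>y. F y (x' - x) \<partial>M)) / norm (x' - x)) \<longlongrightarrow> 0) (at x)"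
    unfolding tendsto_at_iff_sequentially comp_def
  proof (intro allI impI)
    fix X :: "nat \<Rightarrow> 'a" assume X: "\<forall>i. X i \<in> UNIV - {x}" and Xl: "X \<longlonglongrightarrow> x"
    define q where "q n y = (1 / norm (X n - x)) *\<^sub>R ((f (X n) y - f x y) - F y (X n - x))" for n y
    have ne: "norm (X n - x) > 0" for n using X by auto
    have qi: "integrable M (q n)" for n
      unfolding q_def by (intro integrable_scaleR_right Bochner_Integration.integrable_diff f Fi)
    have "(\<lambda>n. \<integral>y. q n y \<partial>M) \<longlonglongrightarrow> (\<integral>y. 0 \<partial>M)"
    proof (rule integral_dominated_convergence[where w = "\<lambda>y. 2 * G y"])
      show "AE y in M. (\<lambda>n. q n y) \<longlonglongrightarrow> 0"
      proof (intro AE_I2)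
        fix y
        from d[of y] have "((\<lambda>x'. norm ((f x' y - f x y) - F y (x' - x)) / norm (x' - x)) \<longlongrightarrow> 0) (at x)"
          unfolding has_derivative_iff_norm by blast
        then have "(\<lambda>n. norm ((f (X n) y - f x y) - F y (X n - x)) / norm (X n - x)) \<longlonglongrightarrow> 0"
          unfolding tendsto_at_iff_sequentially comp_def using X Xl by blast
        then have "(\<lambda>n. norm (q n y)) \<longlonglongrightarrow> 0" by (simp add: q_def)
        then show "(\<lambda>n. q n y) \<longlonglongrightarrow> 0" by (rule tendsto_norm_zero_cancel)
      qed
      show "AE y in M. norm (q n y) \<le> 2 * G y" for n
      proof (intro AE_I2)
        fix y
        have "norm ((f (X n) y - f x y) - F y (X n - x)) \<le> norm (f (X n) y - f x y) + norm (F y (X n - x))"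
          by (rule norm_triangle_ineq4)
        also have "\<dots> \<le> 2 * G y * norm (X n - x)" using lip[of "X n" y] Fb[of y "X n - x"] by simp
        finally show "norm (q n y) \<le> 2 * G y"
          unfolding q_def norm_scaleR using ne[of n] by (simp add: pos_divide_le_eq)
      qed
    qed (use qi G in auto)
    then have "(\<lambda>n. norm (\<integral>y. q n y \<partial>M)) \<longlonglongrightarrow> 0" by (auto intro: tendsto_norm_zero)
    moreover have "norm (\<integral>y. q n y \<partial>M) = norm (((\<integral>y. f (X n) y \<partial>M) - (\<integral>y. f x y \<partial>M)) - (\<integral>y. F y (X n - x) \<partial>M)) / norm (X n - x)" for n
    proof -
      have "(\<integral>y. q n y \<partial>M) = (1 / norm (X n - x)) *\<^sub>R (\<integral>y. (f (X n) y - f x y) - F y (X n - x) \<partial>M)"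
        unfolding q_def by (rule integral_scaleR_right)
      also have "(\<integral>y. (f (X n) y - f x y) - F y (X n - x) \<partial>M) = ((\<integral>y. f (X n) y \<partial>M) - (\<integral>y. f x y \<partial>M)) - (\<integral>y. F y (X n - x) \<partial>M)"
        using f Fi by (simp add: Bochner_Integration.integral_diff)
      finally show ?thesis by simp
    qed
    ultimately show "(\<lambda>n. norm (((\<integral>y. f (X n) y \<partial>M) - (\<integral>y. f x y \<partial>M)) - (\<integral>y. F y (X n - x) \<partial>M)) / norm (X n - x)) \<longlonglongrightarrow> 0"
      by simp
  qed
  with lin show ?thesis unfolding has_derivative_iff_norm by blast
qed

section \<open>Spatial derivatives of the likelihood and of the velocity\<close>

lemma has_derivative_lik:
  fixes x y :: "'a::real_inner"
  assumes "\<alpha> > 0"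
  shows "((\<lambda>x. lik \<alpha> \<beta> x y) has_derivative (\<lambda>h. - (lik \<alpha> \<beta> x y * ((x - \<beta> *\<^sub>R y) \<bullet> h) / \<alpha>\<^sup>2))) (at x)"
  unfolding lik_def power2_norm_eq_inner
  using assms by (auto intro!: derivative_eq_intros simp: inner_commute field_simps)

text \<open>With \<open>u = norm (x - \<beta> y) / \<alpha>\<close> the quantity is at most
  \<open>u * exp (- (u\<^sup>2 / 2))\<close> times \<open>norm h / \<alpha>\<close>, and
  \<open>u \<le> 1 + u\<^sup>2 / 2 \<le> exp (u\<^sup>2 / 2)\<close>. The bound does not grow with
  \<open>y\<close>, so differentiating under the integral costs no further moment of
  \<open>\<nu>\<close>.\<close>

lemma abs_lik_derivative_le:
  fixes x y h :: "'a::real_inner"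
  assumes \<alpha>: "\<alpha> > 0"
  shows "\<bar>- (lik \<alpha> \<beta> x y * ((x - \<beta> *\<^sub>R y) \<bullet> h) / \<alpha>\<^sup>2)\<bar> \<le> 1 / \<alpha> * norm h"
proof -
  define u where "u = norm (x - \<beta> *\<^sub>R y) / \<alpha>"
  have u0: "u \<ge> 0" using \<alpha> by (simp add: u_def)
  have L: "lik \<alpha> \<beta> x y = exp (- (u\<^sup>2 / 2))" using \<alpha> by (simp add: lik_def u_def power_divide)
  have "0 \<le> (u - 1)\<^sup>2" by simp
  then have "u \<le> 1 + u\<^sup>2 / 2" by (simp add: power2_eq_square algebra_simps)
  also have "\<dots> \<le> exp (u\<^sup>2 / 2)" by (rule exp_ge_add_one_self)
  finally have "exp (- (u\<^sup>2 / 2)) * u \<le> exp (- (u\<^sup>2 / 2)) * exp (u\<^sup>2 / 2)" by (intro mult_left_mono) auto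
  then have Lu: "lik \<alpha> \<beta> x y * u \<le> 1" unfolding L by (simp add: exp_add[symmetric])
  have "\<bar>- (lik \<alpha> \<beta> x y * ((x - \<beta> *\<^sub>R y) \<bullet> h) / \<alpha>\<^sup>2)\<bar> = lik \<alpha> \<beta> x y * \<bar>(x - \<beta> *\<^sub>R y) \<bullet> h\<bar> / \<alpha>\<^sup>2"
    using lik_pos[of \<alpha> \<beta> x y] by (simp add: abs_mult)
  also have "\<dots> \<le> lik \<alpha> \<beta> x y * (norm (x - \<beta> *\<^sub>R y) * norm h) / \<alpha>\<^sup>2"
    using lik_pos[of \<alpha> \<beta> x y] by (intro divide_right_mono mult_left_mono Cauchy_Schwarz_ineq2) auto
  also have "\<dots> = (lik \<alpha> \<beta> x y * u) * (norm h / \<alpha>)" using \<alpha> by (simp add: u_def power2_eq_square)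
  also have "\<dots> \<le> 1 * (norm h / \<alpha>)" using \<alpha> by (intro mult_right_mono Lu) auto
  finally show ?thesis by simp
qed

lemma lik_lipschitz:
  fixes x x' y :: "'a::euclidean_space"
  assumes \<alpha>: "\<alpha> > 0"
  shows "\<bar>lik \<alpha> \<beta> x' y - lik \<alpha> \<beta> x y\<bar> \<le> 1 / \<alpha> * norm (x' - x)"
proof -
  have "norm (lik \<alpha> \<beta> x' y - lik \<alpha> \<beta> x y) \<le> (1 / \<alpha>) * norm (x' - x)"
  proof (rule differentiable_bound[where S = UNIV])
    fix x
    show "((\<lambda>x. lik \<alpha> \<beta> x y) has_derivative (\<lambda>h. - (lik \<alpha> \<beta> x y * ((x - \<beta> *\<^sub>R y) \<bullet> h) / \<alpha>\<^sup>2))) (at x within UNIV)"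
      by (rule has_derivative_lik[OF \<alpha>])
    show "onorm (\<lambda>h. - (lik \<alpha> \<beta> x y * ((x - \<beta> *\<^sub>R y) \<bullet> h) / \<alpha>\<^sup>2)) \<le> 1 / \<alpha>"
      using abs_lik_derivative_le[OF \<alpha>, of \<beta> x y] \<alpha> by (intro onorm_bound) (auto simp del: abs_minus_cancel)
  qed auto
  then show ?thesis by simp
qed

context target_law begin

lemma differentiable_integral_lik:
  fixes g :: "real ^ 'd \<Rightarrow> 'c::euclidean_space"
  assumes \<alpha>: "\<alpha> > 0" and g: "integrable \<nu> g"
  shows "(\<lambda>x. \<integral>y. lik \<alpha> \<beta> x y *\<^sub>R g y \<partial>\<nu>) differentiable (at x)"
proof -
  have [measurable]: "g \<in> borel_measurable \<nu>" using g by simp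
  have "((\<lambda>x. \<integral>y. lik \<alpha> \<beta> x y *\<^sub>R g y \<partial>\<nu>) has_derivative
     (\<lambda>h. \<integral>y. (- (lik \<alpha> \<beta> x y * ((x - \<beta> *\<^sub>R y) \<bullet> h) / \<alpha>\<^sup>2)) *\<^sub>R g y \<partial>\<nu>)) (at x)"
  proof (rule has_derivative_integral[where G = "\<lambda>y. 1 / \<alpha> * norm (g y)"])
    show "integrable \<nu> (\<lambda>y. lik \<alpha> \<beta> x y *\<^sub>R g y)" for x by (rule integrable_lik_scaleR[OF g])
    show "((\<lambda>x. lik \<alpha> \<beta> x y *\<^sub>R g y) has_derivative (\<lambda>h. (- (lik \<alpha> \<beta> x y * ((x - \<beta> *\<^sub>R y) \<bullet> h) / \<alpha>\<^sup>2)) *\<^sub>R g y)) (at x)" for y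
      by (rule has_derivative_scaleR_left[OF has_derivative_lik[OF \<alpha>]])
    show "(\<lambda>y. (- (lik \<alpha> \<beta> x y * ((x - \<beta> *\<^sub>R y) \<bullet> h) / \<alpha>\<^sup>2)) *\<^sub>R g y) \<in> borel_measurable \<nu>" for h by measurable
    show "norm ((- (lik \<alpha> \<beta> x y * ((x - \<beta> *\<^sub>R y) \<bullet> h) / \<alpha>\<^sup>2)) *\<^sub>R g y) \<le> 1 / \<alpha> * norm (g y) * norm h" for y h
      using mult_right_mono[OF abs_lik_derivative_le[OF \<alpha>, of \<beta> x y h] norm_ge_zero[of "g y"]]
      by (simp only: norm_scaleR mult_ac)
    show "norm (lik \<alpha> \<beta> x' y *\<^sub>R g y - lik \<alpha> \<beta> x y *\<^sub>R g y) \<le> 1 / \<alpha> * norm (g y) * norm (x' - x)" for x' y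
      using mult_right_mono[OF lik_lipschitz[OF \<alpha>, of \<beta> x' y x] norm_ge_zero[of "g y"]]
      by (simp only: norm_scaleR scaleR_left_diff_distrib[symmetric] mult_ac)
    show "integrable \<nu> (\<lambda>y. 1 / \<alpha> * norm (g y))" using g by auto
  qed
  then show ?thesis by (rule differentiableI)
qed

text \<open>As a quotient of integrals against \<open>lik\<close>, the posterior mean is
  differentiable at every point. This is what allows the Jacobian hypothesis, stated where
  \<open>v\<close> is differentiable, to be used along whole segments.\<close>

lemma differentiable_velocity:
  assumes \<alpha>: "\<alpha> > 0"
  shows "velocity \<alpha> \<beta> \<alpha>' \<beta>' differentiable (at x)"
proof -
  have n: "nrm \<alpha> \<beta> differentiable (at x)"
    using differentiable_integral_lik[OF \<alpha>, of "\<lambda>_. 1::real"] by (simp add: nrm_def[abs_def])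
  have N: "(\<lambda>x. \<integral>y. lik \<alpha> \<beta> x y *\<^sub>R y \<partial>\<nu>) differentiable (at x)"
    by (rule differentiable_integral_lik[OF \<alpha> integrable_id])
  have "(\<lambda>x. 1 / nrm \<alpha> \<beta> x) differentiable (at x)"
    using nrm_pos[of \<alpha> \<beta> x] by (intro differentiable_divide n) auto
  then have "(\<lambda>x. (1 / nrm \<alpha> \<beta> x) *\<^sub>R (\<integral>y. lik \<alpha> \<beta> x y *\<^sub>R y \<partial>\<nu>)) differentiable (at x)"
    using N by (rule differentiable_scaleR)
  then have "pmean \<alpha> \<beta> differentiable (at x)"
    unfolding pmean_def[abs_def] by (subst integral_post) auto
  then show ?thesis
    unfolding velocity_def[abs_def] by (intro differentiable_add differentiable_scaleR) auto
qed

lemma continuous_velocity: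
  assumes \<alpha>: "\<alpha> > 0"
  shows "continuous_on UNIV (velocity \<alpha> \<beta> \<alpha>' \<beta>')"
  using differentiable_velocity[OF \<alpha>] by (auto intro!: continuous_at_imp_continuous_on differentiable_imp_continuous_within)

text \<open>The set where two continuous functions differ is open. The law has a strictly positive
  Lebesgue density, so this set is Lebesgue null, which a nonempty open set is not.\<close>

lemma AE_law_imp_eq:
  assumes \<alpha>: "\<alpha> > 0" and AE: "AE x in law \<alpha> \<beta>. f x = g x"
    and f: "continuous_on UNIV f" and g: "continuous_on UNIV (g :: real ^ 'd \<Rightarrow> real ^ 'd)"
  shows "f = g"
proof (rule ccontr)
  assume "f \<noteq> g"
  then obtain x where x: "f x \<noteq> g x" by auto
  let ?N = "{x. f x \<noteq> g x}"
  have N: "open ?N" using open_Collect_neq[OF f g] .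
  have Nm[measurable]: "?N \<in> sets borel" using N by simp
  have "emeasure (law \<alpha> \<beta>) ?N = 0"
    using AE by (subst (asm) AE_iff_measurable[where N = ?N]) (auto simp: sets_law law_def)
  then have "(\<integral>\<^sup>+x. indicator ?N x \<partial>law \<alpha> \<beta>) = 0" by (simp add: sets_law)
  then have "(\<integral>\<^sup>+x. ennreal (gauss_const TYPE('d) / \<alpha> ^ CARD('d) * nrm \<alpha> \<beta> x) * indicator ?N x \<partial>lborel) = 0"
    by (subst (asm) nn_integral_law[OF _ \<alpha>]) auto
  then have "AE x in lborel. ennreal (gauss_const TYPE('d) / \<alpha> ^ CARD('d) * nrm \<alpha> \<beta> x) * indicator ?N x = 0"
    by (subst (asm) nn_integral_0_iff_AE) auto
  then have "AE x in lborel. x \<notin> ?N"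
  proof eventually_elim
    case (elim x)
    have "gauss_const TYPE('d) / \<alpha> ^ CARD('d) * nrm \<alpha> \<beta> x > 0"
      using \<alpha> gauss_const_pos[where 'd='d] nrm_pos[of \<alpha> \<beta> x] by (intro mult_pos_pos divide_pos_pos) auto
    then have "ennreal (gauss_const TYPE('d) / \<alpha> ^ CARD('d) * nrm \<alpha> \<beta> x) \<noteq> 0"
      unfolding ennreal_eq_0_iff by linarith
    with elim show ?case by (auto simp: indicator_def split: if_splits)
  qed
  then have "?N \<in> null_sets lborel" by (subst (asm) AE_iff_null_sets[symmetric]) auto
  then have "negligible ?N" using negligible_iff_null_sets null_sets_completionI by blast
  with open_not_negligible[OF N] x show False by blast
qed

text \<open>Events of the generated sigma-algebra say that the position lies in a Borel set
  \<open>B\<close>. On such an event the integrals of \<open>\<alpha>' Z + \<beta>' X1\<close> and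
  of the velocity differ by a multiple of the integral of the residual, which is orthogonal to
  bounded functions of the position. Continuity of \<open>f\<close> turns almost sure equality into
  equality everywhere.\<close>

lemma velocity_eq_cond_exp:
  fixes f :: "real ^ 'd \<Rightarrow> real ^ 'd" and Z X1 :: "'w \<Rightarrow> real ^ 'd"
  assumes M: "prob_space M" and [measurable]: "Z \<in> borel_measurable M" "X1 \<in> borel_measurable M"
    and joint: "distr M (borel \<Otimes>\<^sub>M borel) (\<lambda>\<omega>. (Z \<omega>, X1 \<omega>)) = base"
    and \<alpha>: "\<alpha> > 0" and f: "continuous_on UNIV f"
    and ce: "\<And>i. AE \<omega> in M. f (\<alpha> *\<^sub>R Z \<omega> + \<beta> *\<^sub>R X1 \<omega>) $ i =
      real_cond_exp M (vimage_algebra (space M) (\<lambda>\<omega>. \<alpha> *\<^sub>R Z \<omega> + \<beta> *\<^sub>R X1 \<omega>) borel)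
        (\<lambda>\<omega>. (\<alpha>' *\<^sub>R Z \<omega> + \<beta>' *\<^sub>R X1 \<omega>) $ i) \<omega>"
  shows "f = velocity \<alpha> \<beta> \<alpha>' \<beta>'"
proof -
  interpret M: prob_space M by (rule M)
  let ?X = "\<lambda>\<omega>. \<alpha> *\<^sub>R Z \<omega> + \<beta> *\<^sub>R X1 \<omega>"
  let ?F = "vimage_algebra (space M) ?X borel"
  let ?v = "velocity \<alpha> \<beta> \<alpha>' \<beta>'"
  define k where "k = \<beta>' - \<alpha>' * \<beta> / \<alpha>"
  have Xm: "?X \<in> borel_measurable M" by measurable
  interpret F: finite_measure_subalgebra M ?F
  proof
    show "subalgebra M ?F"
      unfolding subalgebra_def using measurable_sets[OF Xm] by (auto simp: sets_vimage_algebra2)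
  qed
  have vm[measurable]: "?v \<in> borel_measurable borel"
    by (rule borel_measurable_continuous_onI[OF continuous_velocity[OF \<alpha>]])
  have tr: "integrable M (\<lambda>\<omega>. g (Z \<omega>, X1 \<omega>))" if "integrable base g" for g :: "_ \<Rightarrow> real"
  proof -
    have gm: "g \<in> borel_measurable (borel \<Otimes>\<^sub>M borel)" using that unfolding joint[symmetric] by simp
    have "integrable (distr M (borel \<Otimes>\<^sub>M borel) (\<lambda>\<omega>. (Z \<omega>, X1 \<omega>))) g" unfolding joint by (rule that)
    then show ?thesis by (subst (asm) integrable_distr_eq) (use gm in auto)
  qed
  have tri: "(\<integral>\<omega>. g (Z \<omega>, X1 \<omega>) \<partial>M) = (\<integral>u. g u \<partial>base)" if [measurable]: "g \<in> borel_measurable (borel \<Otimes>\<^sub>M borel)" for g :: "_ \<Rightarrow> real"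
    unfolding joint[symmetric] by (subst integral_distr) auto
  have dec: "\<alpha>' *\<^sub>R z + \<beta>' *\<^sub>R y = ?v (\<alpha> *\<^sub>R z + \<beta> *\<^sub>R y) + k *\<^sub>R (y - pmean \<alpha> \<beta> (\<alpha> *\<^sub>R z + \<beta> *\<^sub>R y))" for z y
    using \<alpha> unfolding velocity_def k_def by (simp add: algebra_simps)
  have x2: "integrable base (\<lambda>u. (norm (\<alpha>' *\<^sub>R fst u + \<beta>' *\<^sub>R snd u))\<^sup>2)" by (rule integrable_base_affine)
  have v2: "integrable base (\<lambda>u. (norm (?v (\<alpha> *\<^sub>R fst u + \<beta> *\<^sub>R snd u)))\<^sup>2)"
  proof -
    have scale: "integrable base (\<lambda>u. (norm (c *\<^sub>R g u))\<^sup>2)" if "integrable base (\<lambda>u. (norm (g u))\<^sup>2)" for c and g :: "_ \<Rightarrow> real ^ 'd"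
      using that by (simp add: power_mult_distrib)
    show ?thesis
      unfolding velocity_def
      by (intro integrable_norm2_add scale integrable_base_affine integrable_pmean_base(1)[OF \<alpha>]) measurable
  qed
  have comp: "integrable base (\<lambda>u. g u $ i)" if "g \<in> borel_measurable base" "integrable base (\<lambda>u. (norm (g u))\<^sup>2)" for g :: "_ \<Rightarrow> real ^ 'd" and i
    using integrable_inner_left[OF GT.norm_expectation_power2_le(1)[OF that], of "axis i 1"] by (simp add: inner_axis)
  have "AE \<omega> in M. real_cond_exp M ?F (\<lambda>\<omega>. (\<alpha>' *\<^sub>R Z \<omega> + \<beta>' *\<^sub>R X1 \<omega>) $ i) \<omega> = ?v (?X \<omega>) $ i" for i
  proof (rule F.real_cond_exp_charact)
    have i1: "integrable base (\<lambda>u. (\<alpha>' *\<^sub>R fst u + \<beta>' *\<^sub>R snd u) $ i)" by (rule comp[OF _ x2]) measurable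
    have i2: "integrable base (\<lambda>u. ?v (\<alpha> *\<^sub>R fst u + \<beta> *\<^sub>R snd u) $ i)" by (rule comp[OF _ v2]) measurable
    show I1: "integrable M (\<lambda>\<omega>. (\<alpha>' *\<^sub>R Z \<omega> + \<beta>' *\<^sub>R X1 \<omega>) $ i)" using tr[OF i1] by simp
    show I2: "integrable M (\<lambda>\<omega>. ?v (?X \<omega>) $ i)" using tr[OF i2] by simp
    have XF: "?X \<in> ?F \<rightarrow>\<^sub>M borel" by (rule measurable_vimage_algebra1) auto
    have "(\<lambda>x. ?v x $ i) \<in> borel_measurable borel"
      by (intro borel_measurable_continuous_onI continuous_on_component continuous_velocity \<alpha>)
    from measurable_compose[OF XF this] show "(\<lambda>\<omega>. ?v (?X \<omega>) $ i) \<in> borel_measurable ?F" .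
    fix A assume "A \<in> sets ?F"
    then obtain B where B[measurable]: "B \<in> sets borel" and A: "A = ?X -` B \<inter> space M"
      by (auto simp: sets_vimage_algebra2)
    have L: "(LINT \<omega>:A|M. g \<omega>) = (\<integral>\<omega>. indicator B (?X \<omega>) * g \<omega> \<partial>M)" for g :: "'w \<Rightarrow> real"
      unfolding set_lebesgue_integral_def A by (intro Bochner_Integration.integral_cong) (auto simp: indicator_def)
    \<comment> \<open>The indicator of \<open>B\<close> times the unit vector of coordinate
      \<open>i\<close>: its inner product with the residual selects that coordinate on the
      event.\<close>
    let ?h = "\<lambda>x. indicator B x *\<^sub>R (axis i 1 :: real ^ 'd)"
    have hi: "integrable (law \<alpha> \<beta>) (\<lambda>x. (norm (?h x))\<^sup>2)"
    proof -
      interpret L: prob_space "law \<alpha> \<beta>" by (rule prob_space_law)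
      show ?thesis by (rule L.integrable_const_bound[where B = 1]) (auto simp: indicator_def)
    qed
    have orth: "(\<integral>u. ?h (fst u) \<bullet> (snd u - pmean \<alpha> \<beta> (fst u)) \<partial>joint \<alpha> \<beta>) = 0"
      "integrable (joint \<alpha> \<beta>) (\<lambda>u. ?h (fst u) \<bullet> (snd u - pmean \<alpha> \<beta> (fst u)))"
      using integral_extend_orthogonal[OF prob_space_law _ \<alpha> _ _ hi, of "\<lambda>x. x"]
      by (simp_all add: extend_law_id[OF \<alpha>] distr_id2 sets_law)
    let ?q = "\<lambda>u. indicator B (\<alpha> *\<^sub>R fst u + \<beta> *\<^sub>R snd u) * (snd u - pmean \<alpha> \<beta> (\<alpha> *\<^sub>R fst u + \<beta> *\<^sub>R snd u)) $ i"
    have q0: "(\<integral>u. ?q u \<partial>base) = 0"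
      using orth(1) unfolding joint_def
      by (subst (asm) integral_distr) (auto simp: case_prod_unfold inner_axis' )
    have qi: "integrable base ?q"
      using orth(2) unfolding joint_def
      by (subst (asm) integrable_distr_eq) (auto simp: case_prod_unfold inner_axis')
    have ind: "integrable M (\<lambda>\<omega>. indicator B (?X \<omega>) * g \<omega>)" if "integrable M g" for g :: "'w \<Rightarrow> real"
    proof (rule Bochner_Integration.integrable_bound[OF that])
      have [measurable]: "g \<in> borel_measurable M" using that by simp
      show "(\<lambda>\<omega>. indicator B (?X \<omega>) * g \<omega>) \<in> borel_measurable M" by measurable
    qed (auto simp: indicator_def)
    have "(\<integral>\<omega>. indicator B (?X \<omega>) * (\<alpha>' *\<^sub>R Z \<omega> + \<beta>' *\<^sub>R X1 \<omega>) $ i \<partial>M) - (\<integral>\<omega>. indicator B (?X \<omega>) * ?v (?X \<omega>) $ i \<partial>M)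
      = (\<integral>\<omega>. indicator B (?X \<omega>) * (\<alpha>' *\<^sub>R Z \<omega> + \<beta>' *\<^sub>R X1 \<omega>) $ i - indicator B (?X \<omega>) * ?v (?X \<omega>) $ i \<partial>M)"
      by (intro Bochner_Integration.integral_diff[symmetric] ind I1 I2)
    also have "\<dots> = (\<integral>\<omega>. k * ?q (Z \<omega>, X1 \<omega>) \<partial>M)"
      by (intro Bochner_Integration.integral_cong refl) (simp add: dec indicator_def)
    also have "\<dots> = k * (\<integral>u. ?q u \<partial>base)"
      by (subst integral_mult_right_zero, subst tri[of ?q]) auto
    finally show "(LINT \<omega>:A|M. (\<alpha>' *\<^sub>R Z \<omega> + \<beta>' *\<^sub>R X1 \<omega>) $ i) = (LINT \<omega>:A|M. ?v (?X \<omega>) $ i)"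
      unfolding L q0 by simp
  qed
  note ce' = this
  have "AE \<omega> in M. f (?X \<omega>) $ i = ?v (?X \<omega>) $ i" for i
    using ce[of i] ce'[of i] by eventually_elim (simp only:)
  then have "AE \<omega> in M. \<forall>i. f (?X \<omega>) $ i = ?v (?X \<omega>) $ i" by (simp only: AE_all_countable) simp
  then have AEX: "AE \<omega> in M. f (?X \<omega>) = ?v (?X \<omega>)" by (simp only: vec_eq_iff)
  have fm[measurable]: "f \<in> borel_measurable borel" by (rule borel_measurable_continuous_onI[OF f])
  have "distr M borel ?X = law \<alpha> \<beta>"
    unfolding law_def joint[symmetric] by (subst distr_distr) (auto simp: comp_def)
  moreover have "{x \<in> space borel. f x = ?v x} \<in> sets borel" by measurable
  ultimately have "AE x in law \<alpha> \<beta>. f x = ?v x"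
    using AE_distr_iff[OF Xm, of "\<lambda>x. f x = ?v x"] AEX by (simp only:)
  from AE_law_imp_eq[OF \<alpha> this f continuous_velocity[OF \<alpha>]] show ?thesis .
qed

end

section \<open>From Jacobian bounds to Lipschitz bounds\<close>

lemma jacobian_loewner_imp_one_sided_lipschitz:
  fixes f :: "real ^ 'd \<Rightarrow> real ^ 'd"
  assumes d: "\<And>x. f differentiable (at x)" and J: "\<And>x. jacobian f (at x) \<preceq>\<^sub>L mat c"
  shows "(x - y) \<bullet> (f x - f y) \<le> c * (norm (x - y))\<^sup>2"
proof -
  let ?h = "x - y" and ?p = "\<lambda>s::real. y + s *\<^sub>R (x - y)"
  \<comment> \<open>Only the projection of \<open>f\<close> on the direction \<open>x - y\<close> is
    differentiated along the segment; the mean value theorem then involves just the quadratic form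
    of the Jacobian in that one direction.\<close>
  have D: "((\<lambda>s. ?h \<bullet> f (?p s)) has_real_derivative ?h \<bullet> (jacobian f (at (?p s)) *v ?h)) (at s)" for s
  proof -
    have "(f has_derivative (\<lambda>h. jacobian f (at (?p s)) *v h)) (at (?p s))"
      using d jacobian_works by blast
    moreover have "(?p has_derivative (\<lambda>t. t *\<^sub>R ?h)) (at s)"
      by (auto intro!: derivative_eq_intros)
    ultimately have "((\<lambda>s. f (?p s)) has_derivative (\<lambda>t. jacobian f (at (?p s)) *v (t *\<^sub>R ?h))) (at s)"
      by (rule has_derivative_compose[rotated])
    then have "((\<lambda>s. ?h \<bullet> f (?p s)) has_derivative (\<lambda>t. ?h \<bullet> (jacobian f (at (?p s)) *v (t *\<^sub>R ?h)))) (at s)"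
      by (rule has_derivative_inner_right)
    then show ?thesis unfolding has_field_derivative_def
      by (rule has_derivative_eq_rhs) (auto simp: matrix_vector_mult_scaleR mult.commute)
  qed
  from MVT2[of 0 1, OF _ D] obtain z where
    "?h \<bullet> f (?p 1) - ?h \<bullet> f (?p 0) = (1 - 0) * (?h \<bullet> (jacobian f (at (?p z)) *v ?h))" by auto
  then have "?h \<bullet> (f x - f y) = ?h \<bullet> (jacobian f (at (?p z)) *v ?h)" by (simp add: inner_diff_right)
  also have "\<dots> \<le> ?h \<bullet> (mat c *v ?h)" using J unfolding loewner_le_def by blast
  also have "mat c *v ?h = c *\<^sub>R ?h"
    by (simp add: vec_eq_iff matrix_vector_mult_def mat_def if_distrib[of "\<lambda>u. u * _"] cong: if_cong)
  finally show ?thesis by (simp add: power2_norm_eq_inner)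
qed

lemma jacobian_spectral_norm_imp_lipschitz:
  fixes f :: "real ^ 'd \<Rightarrow> real ^ 'd"
  assumes d: "\<And>x. f differentiable (at x)" and J: "\<And>x. spectral_norm (jacobian f (at x)) \<le> C"
  shows "norm (f x - f y) \<le> C * norm (x - y)"
proof (rule differentiable_bound[where S = UNIV and f' = "\<lambda>x h. jacobian f (at x) *v h"])
  show "(f has_derivative (\<lambda>h. jacobian f (at x) *v h)) (at x within UNIV)" for x
    using d jacobian_works by auto
  show "onorm ((*v) (jacobian f (at x))) \<le> C" for x
    using J[of x] by (simp add: spectral_norm_def)
qed auto

section \<open>Comparison of the two flows\<close>

text \<open>\<open>enn2real\<close> sends infinity to 0, so the real-valued function can replace the
  original one only where that is finite. Finiteness of the integral ensures this almost everywhere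
  on \<open>A\<close>, which is why the pointwise comparison carries \<open>AE\<close>.\<close>

lemma set_integrable_of_nn_integral:
  fixes E :: "real \<Rightarrow> ennreal"
  assumes [measurable]: "E \<in> borel_measurable borel" and A[measurable]: "A \<in> sets borel"
    and le: "(\<integral>\<^sup>+s\<in>A. E s \<partial>lborel) \<le> ennreal \<epsilon>" and \<epsilon>: "\<epsilon> \<ge> 0"
  shows "set_integrable lborel A (\<lambda>s. enn2real (E s))" "(LINT s:A|lborel. enn2real (E s)) \<le> \<epsilon>"
    "AE s in lborel. s \<in> A \<longrightarrow> E s \<le> ennreal (enn2real (E s))"
proof -
  have fin: "(\<integral>\<^sup>+s. E s * indicator A s \<partial>lborel) \<noteq> \<infinity>" using le by (auto simp: top_unique)
  have "AE s in lborel. E s * indicator A s \<noteq> \<infinity>"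
    by (rule nn_integral_PInf_AE[OF _ fin]) measurable
  then have AE: "AE s in lborel. s \<in> A \<longrightarrow> ennreal (enn2real (E s)) = E s"
    by eventually_elim (auto simp: top.not_eq_extremum)
  then show "AE s in lborel. s \<in> A \<longrightarrow> E s \<le> ennreal (enn2real (E s))" by eventually_elim auto
  have eq: "(\<integral>\<^sup>+s. ennreal (indicator A s *\<^sub>R enn2real (E s)) \<partial>lborel) = (\<integral>\<^sup>+s. E s * indicator A s \<partial>lborel)"
    by (rule nn_integral_cong_AE, use AE in eventually_elim) (auto simp: indicator_def)
  show i: "set_integrable lborel A (\<lambda>s. enn2real (E s))"
    unfolding set_integrable_def
  proof (rule integrableI_bounded)
    have "(\<integral>\<^sup>+s. ennreal (norm (indicator A s *\<^sub>R enn2real (E s))) \<partial>lborel) = (\<integral>\<^sup>+s. ennreal (indicator A s *\<^sub>R enn2real (E s)) \<partial>lborel)"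
      by (rule nn_integral_cong) (auto simp: indicator_def)
    then show "(\<integral>\<^sup>+s. ennreal (norm (indicator A s *\<^sub>R enn2real (E s))) \<partial>lborel) < \<infinity>"
      using fin unfolding eq by (simp add: top.not_eq_extremum)
  qed measurable
  have "ennreal (LINT s:A|lborel. enn2real (E s)) = (\<integral>\<^sup>+s. ennreal (indicator A s *\<^sub>R enn2real (E s)) \<partial>lborel)"
    unfolding set_lebesgue_integral_def using i
    by (intro nn_integral_eq_integral[symmetric]) (auto simp: set_integrable_def)
  also have "\<dots> \<le> ennreal \<epsilon>" using le unfolding eq .
  finally show "(LINT s:A|lborel. enn2real (E s)) \<le> \<epsilon>" using \<epsilon> by simp
qed

lemma set_integrable_norm_of_power2:
  fixes f :: "real \<Rightarrow> 'a::euclidean_space"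
  assumes [measurable]: "f \<in> borel_measurable borel"
    and fin: "(\<integral>\<^sup>+s\<in>{t..t'}. ennreal ((norm (f s))\<^sup>2) \<partial>lborel) < \<infinity>"
  shows "set_integrable lborel {t..t'} (\<lambda>s. (norm (f s))\<^sup>2)" "set_integrable lborel {t..t'} f"
proof -
  have i: "integrable lborel (\<lambda>s. indicator {t..t'} s *\<^sub>R (norm (f s))\<^sup>2)"
  proof (rule integrableI_bounded)
    have "(\<integral>\<^sup>+s. ennreal (norm (indicator {t..t'} s *\<^sub>R (norm (f s))\<^sup>2)) \<partial>lborel) = (\<integral>\<^sup>+s\<in>{t..t'}. ennreal ((norm (f s))\<^sup>2) \<partial>lborel)"
      by (rule nn_integral_cong) (auto simp: indicator_def)
    with fin show "(\<integral>\<^sup>+s. ennreal (norm (indicator {t..t'} s *\<^sub>R (norm (f s))\<^sup>2)) \<partial>lborel) < \<infinity>" by simp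
  qed measurable
  then show "set_integrable lborel {t..t'} (\<lambda>s. (norm (f s))\<^sup>2)" by (simp add: set_integrable_def)
  have one: "integrable lborel (\<lambda>s. indicator {t..t'} s *\<^sub>R (1::real))"
    using set_integrable_continuous_Icc[OF continuous_on_const[of "{t..t'}" "1::real"]] by (simp only: set_integrable_def)
  show "set_integrable lborel {t..t'} f"
    unfolding set_integrable_def
  proof (rule Bochner_Integration.integrable_bound[OF Bochner_Integration.integrable_add[OF one i]])
    show "AE s in lborel. norm (indicator {t..t'} s *\<^sub>R f s) \<le> norm (indicator {t..t'} s *\<^sub>R (1::real) + indicator {t..t'} s *\<^sub>R (norm (f s))\<^sup>2)"
    proof (intro AE_I2)
      fix s
      have "0 \<le> (norm (f s) - 1)\<^sup>2" by simp
      then have "norm (f s) * 2 \<le> 1 + (norm (f s))\<^sup>2" by (simp add: power2_eq_square algebra_simps)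
      then have "norm (f s) \<le> 1 + (norm (f s))\<^sup>2" using norm_ge_zero[of "f s"] by linarith
      then show "norm (indicator {t..t'} s *\<^sub>R f s) \<le> norm (indicator {t..t'} s *\<^sub>R (1::real) + indicator {t..t'} s *\<^sub>R (norm (f s))\<^sup>2)"
        by (auto simp: indicator_def)
    qed
  qed measurable
qed

text \<open>The energy estimate is applied to \<open>Y\<close> itself, compared with the constant
  curve 0, with \<open>k\<close> as error modulus and no noise. The fixed weight is bounded below on
  \<open>[0, 1]\<close>, so the weighted bound controls the second moment uniformly in time.\<close>

lemma flow_second_moment:
  fixes w Y :: "real \<Rightarrow> 'a::euclidean_space \<Rightarrow> 'a" and k :: "real \<Rightarrow> 'a \<Rightarrow> real"
  assumes \<mu>: "prob_space \<mu>" "sets \<mu> = sets borel" "integrable \<mu> (\<lambda>x. (norm x)\<^sup>2)"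
    and T: "0 \<le> T" "T \<le> 1"
    and Y_deriv: "\<And>s x. s \<in> {0..T} \<Longrightarrow> ((\<lambda>s. Y s x) has_vector_derivative w s (Y s x)) (at s within {0..T})"
    and Y_0: "\<And>x. Y 0 x = x"
    and Y_meas: "(\<lambda>(s, x). Y s x) \<in> borel_measurable (borel \<Otimes>\<^sub>M borel)"
    and Y_int: "AE x in \<mu>. set_integrable lborel {0..T} (\<lambda>s. w s (Y s x))"
    and l: "set_integrable lborel {0..1} l"
    and k_meas: "(\<lambda>(s, x). k s x) \<in> borel_measurable (borel \<Otimes>\<^sub>M borel)"
    and growth: "\<And>s y. s \<in> {0<..<T} \<Longrightarrow> y \<bullet> w s y \<le> l s * (norm y)\<^sup>2 + norm y * k s y"
    and fin: "(\<integral>\<^sup>+s\<in>{0..T}. (\<integral>\<^sup>+x. ennreal ((k s (Y s x))\<^sup>2) \<partial>\<mu>) \<partial>lborel) < \<infinity>"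
  shows "\<exists>C\<ge>0. \<forall>s\<in>{0..T}. (\<integral>\<^sup>+x. ennreal ((norm (Y s x))\<^sup>2) \<partial>\<mu>) \<le> ennreal C"
proof -
  interpret \<mu>: prob_space \<mu> by (rule \<mu>)
  interpret pair_sigma_finite \<mu> "lborel :: real measure" ..
  note [measurable_cong] = \<mu>(2)
  have Ym[measurable (raw)]: "(\<lambda>\<omega>. Y (f \<omega>) (g \<omega>)) \<in> borel_measurable N"
    if [measurable]: "f \<in> borel_measurable N" "g \<in> borel_measurable N" for f g and N :: "'z measure"
    using measurable_compose[OF measurable_Pair[OF that] Y_meas] by simp
  have Ym1: "Y s \<in> borel_measurable borel" for s
    using measurable_compose[OF measurable_Pair[OF measurable_const[of s borel borel] measurable_ident_sets[OF refl]] Y_meas] by simp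
  have kYm: "(\<lambda>p. k (snd p) (Y (snd p) (fst p))) \<in> borel_measurable (\<mu> \<Otimes>\<^sub>M lborel)"
  proof -
    have Y': "(\<lambda>p. Y (snd p) (fst p)) \<in> borel_measurable (\<mu> \<Otimes>\<^sub>M lborel)"
      using measurable_compose[of "\<lambda>p. (snd p, fst p)" "\<mu> \<Otimes>\<^sub>M lborel" "borel \<Otimes>\<^sub>M borel", OF _ Y_meas] by simp
    have "(\<lambda>p. (snd p, Y (snd p) (fst p))) \<in> \<mu> \<Otimes>\<^sub>M lborel \<rightarrow>\<^sub>M borel \<Otimes>\<^sub>M borel"
      using Y' by measurable
    from measurable_compose[OF this k_meas] show ?thesis by simp
  qed
  define K where "K x = (\<integral>\<^sup>+s\<in>{0..T}. ennreal ((k s (Y s x))\<^sup>2) \<partial>lborel)" for x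
  have m: "(\<lambda>p. ennreal ((k (snd p) (Y (snd p) (fst p)))\<^sup>2) * indicator {0..T} (snd p)) \<in> borel_measurable (\<mu> \<Otimes>\<^sub>M lborel)"
    using kYm by measurable
  have Km[measurable]: "K \<in> borel_measurable \<mu>"
    unfolding K_def using lborel.borel_measurable_nn_integral_fst[OF m] by simp
  have "(\<integral>\<^sup>+x. K x \<partial>\<mu>) = (\<integral>\<^sup>+s. (\<integral>\<^sup>+x. ennreal ((k s (Y s x))\<^sup>2) * indicator {0..T} s \<partial>\<mu>) \<partial>lborel)"
    unfolding K_def using Fubini[OF m] by simp
  also have "\<dots> = (\<integral>\<^sup>+s\<in>{0..T}. (\<integral>\<^sup>+x. ennreal ((k s (Y s x))\<^sup>2) \<partial>\<mu>) \<partial>lborel)"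
    by (intro nn_integral_cong) (auto simp: indicator_def)
  finally have Kfin: "(\<integral>\<^sup>+x. K x \<partial>\<mu>) < \<infinity>" using fin by simp
  then have AEK: "AE x in \<mu>. K x \<noteq> \<infinity>" by (intro nn_integral_PInf_AE) auto
  \<comment> \<open>Here only finiteness matters, so \<open>\<eta>\<close> is given the value 1 and
    not sent to 0.\<close>
  let ?W = "weight l 1"
  have Wpos: "?W s > 0" if "s \<in> {0..1}" for s by (rule weight_pos[OF l _ that]) simp
  obtain s0 where s0: "s0 \<in> {0..1}" "\<And>s. s \<in> {0..1} \<Longrightarrow> ?W s0 \<le> ?W s"
    using continuous_attains_inf[OF compact_Icc _ weight_continuous[OF l, of 1]] by force
  have key: "AE x in \<mu>. \<forall>s\<in>{0..T}. ennreal (?W s0) * ennreal ((norm (Y s x))\<^sup>2) \<le> ennreal (?W 0 * (norm x)\<^sup>2) + K x"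
    using AEK Y_int
  proof eventually_elim
    case (elim x)
    have kx: "(\<lambda>s. k s (Y s x)) \<in> borel_measurable borel"
    proof -
      have "(\<lambda>s. (s, Y s x)) \<in> borel \<rightarrow>\<^sub>M borel \<Otimes>\<^sub>M borel"
        using measurable_compose[of "\<lambda>s. (s, x)" borel "borel \<Otimes>\<^sub>M borel", OF _ Y_meas] by simp
      from measurable_compose[OF this k_meas] show ?thesis by simp
    qed
    have "K x < \<infinity>" using elim by (simp add: top.not_eq_extremum)
    then have ki: "set_integrable lborel {0..T} (\<lambda>s. (norm (k s (Y s x)))\<^sup>2)"
      unfolding K_def by (intro set_integrable_norm_of_power2(1) kx) simp
    show ?case
    proof
      fix s assume s: "s \<in> {0..T}"
      have sub: "{0..s} \<subseteq> {0..T}" using s by auto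
      have kis: "set_integrable lborel {0..s} (\<lambda>s. (k s (Y s x))\<^sup>2)"
        using set_integrable_Icc_subset[OF ki, of 0 s] s by simp
      have "?W s * (norm (Y s x))\<^sup>2 \<le> ?W 0 * (norm (Y 0 x))\<^sup>2 + (LINT r:{0..s}|lborel. (k r (Y r x))\<^sup>2 + 2 * ?W r * 0)"
      proof (rule weighted_energy_le[where d = "\<lambda>s. w s (Y s x)" and l = l])
        show "0 \<le> s" using s by simp
        show "((\<lambda>s. Y s x) has_vector_derivative w r (Y r x)) (at r within {0..s})" if "r \<in> {0..s}" for r
          by (rule has_vector_derivative_within_subset[OF Y_deriv sub]) (use that s in auto)
        show "set_integrable lborel {0..s} (\<lambda>s. w s (Y s x))" using elim(2) s by (auto intro: set_integrable_Icc_subset)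
        show "primitive_on 0 s ?W (\<lambda>s. - (2 * l s * ?W s + (?W s)\<^sup>2))"
          by (rule primitive_on_subinterval[OF weight_primitive[OF l]]) (use s T in auto)
        show "0 \<le> ?W r" if "r \<in> {0..s}" for r using Wpos[of r] that s T by auto
        show "set_integrable lborel {0..s} (\<lambda>s. (k s (Y s x))\<^sup>2 + 2 * ?W s * 0)" using kis by simp
        have "AE r in lborel. r \<noteq> 0 \<and> r \<noteq> T" using AE_lborel_singleton[of 0] AE_lborel_singleton[of T] by eventually_elim auto
        then show "AE r in lborel. r \<in> {0..s} \<longrightarrow> Y r x \<bullet> w r (Y r x) \<le> l r * (norm (Y r x))\<^sup>2 + norm (Y r x) * k r (Y r x) + 0"
          by eventually_elim (use growth s in auto)
      qed
      also have "\<dots> = ?W 0 * (norm x)\<^sup>2 + (LINT r:{0..s}|lborel. (k r (Y r x))\<^sup>2)" by (simp add: Y_0)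
      also have "(LINT r:{0..s}|lborel. (k r (Y r x))\<^sup>2) \<le> (LINT r:{0..T}|lborel. (k r (Y r x))\<^sup>2)"
        unfolding set_lebesgue_integral_def
        using kis ki sub by (intro integral_mono) (auto simp: set_integrable_def indicator_def)
      finally have le: "?W s * (norm (Y s x))\<^sup>2 \<le> ?W 0 * (norm x)\<^sup>2 + (LINT r:{0..T}|lborel. (k r (Y r x))\<^sup>2)" by simp
      have "?W s0 * (norm (Y s x))\<^sup>2 \<le> ?W s * (norm (Y s x))\<^sup>2"
        using s0(2)[of s] s T by (intro mult_right_mono) auto
      with le have le2: "?W s0 * (norm (Y s x))\<^sup>2 \<le> ?W 0 * (norm x)\<^sup>2 + (LINT r:{0..T}|lborel. (k r (Y r x))\<^sup>2)" by linarith
      have LI: "ennreal (LINT r:{0..T}|lborel. (k r (Y r x))\<^sup>2) = K x"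
        unfolding K_def set_lebesgue_integral_def using ki
        by (subst nn_integral_eq_integral[symmetric]) (auto simp: set_integrable_def indicator_def intro!: nn_integral_cong)
      have nn: "0 \<le> (LINT r:{0..T}|lborel. (k r (Y r x))\<^sup>2)"
        unfolding set_lebesgue_integral_def by (intro integral_nonneg_AE) auto
      have "ennreal (?W s0) * ennreal ((norm (Y s x))\<^sup>2) = ennreal (?W s0 * (norm (Y s x))\<^sup>2)"
        using Wpos[OF s0(1)] by (simp add: ennreal_mult)
      also have "\<dots> \<le> ennreal (?W 0 * (norm x)\<^sup>2 + (LINT r:{0..T}|lborel. (k r (Y r x))\<^sup>2))" by (rule ennreal_leI[OF le2])
      also have "\<dots> = ennreal (?W 0 * (norm x)\<^sup>2) + K x"
        unfolding LI[symmetric] using Wpos[of 0] nn by (intro ennreal_plus) auto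
      finally show "ennreal (?W s0) * ennreal ((norm (Y s x))\<^sup>2) \<le> ennreal (?W 0 * (norm x)\<^sup>2) + K x" .
    qed
  qed
  define c where "c = enn2real (\<integral>\<^sup>+x. K x \<partial>\<mu>)"
  have c: "(\<integral>\<^sup>+x. K x \<partial>\<mu>) = ennreal c" "c \<ge> 0" using Kfin by (auto simp: c_def)
  define m2 where "m2 = (\<integral>x. ?W 0 * (norm x)\<^sup>2 \<partial>\<mu>)"
  have m2: "(\<integral>\<^sup>+x. ennreal (?W 0 * (norm x)\<^sup>2) \<partial>\<mu>) = ennreal m2" "m2 \<ge> 0"
    unfolding m2_def using Wpos[of 0]
    by (intro nn_integral_eq_integral integrable_mult_right \<mu>(3) integral_nonneg_AE; simp)+
  show ?thesis
  proof (intro exI[of _ "(m2 + c) / ?W s0"] conjI ballI)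
    show "0 \<le> (m2 + c) / ?W s0" using m2 c Wpos[OF s0(1)] by simp
    fix s assume s: "s \<in> {0..T}"
    have "ennreal (?W s0) * (\<integral>\<^sup>+x. ennreal ((norm (Y s x))\<^sup>2) \<partial>\<mu>) = (\<integral>\<^sup>+x. ennreal (?W s0) * ennreal ((norm (Y s x))\<^sup>2) \<partial>\<mu>)"
      using Ym1[of s] by (intro nn_integral_cmult[symmetric]) measurable
    also have "\<dots> \<le> (\<integral>\<^sup>+x. ennreal (?W 0 * (norm x)\<^sup>2) + K x \<partial>\<mu>)"
      by (rule nn_integral_mono_AE, use key in eventually_elim) (use s in blast)
    also have "\<dots> = (\<integral>\<^sup>+x. ennreal (?W 0 * (norm x)\<^sup>2) \<partial>\<mu>) + (\<integral>\<^sup>+x. K x \<partial>\<mu>)"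
      by (rule nn_integral_add) measurable
    also have "\<dots> = ennreal (m2 + c)" unfolding m2 c(1) using m2(2) c(2) by simp
    finally have "ennreal (?W s0) * (\<integral>\<^sup>+x. ennreal ((norm (Y s x))\<^sup>2) \<partial>\<mu>) \<le> ennreal (m2 + c)" .
    then have "ennreal (1 / ?W s0) * (ennreal (?W s0) * (\<integral>\<^sup>+x. ennreal ((norm (Y s x))\<^sup>2) \<partial>\<mu>)) \<le> ennreal (1 / ?W s0) * ennreal (m2 + c)"
      by (intro mult_left_mono) auto
    moreover have "ennreal (1 / ?W s0) * ennreal (?W s0) = 1"
      using Wpos[OF s0(1)] by (subst ennreal_mult[symmetric]) auto
    moreover have "ennreal (1 / ?W s0) * ennreal (m2 + c) = ennreal ((m2 + c) / ?W s0)"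
      using Wpos[OF s0(1)] m2(2) c(2) by (subst ennreal_mult[symmetric]) auto
    ultimately show "(\<integral>\<^sup>+x. ennreal ((norm (Y s x))\<^sup>2) \<partial>\<mu>) \<le> ennreal ((m2 + c) / ?W s0)"
      by (simp add: mult.assoc[symmetric])
  qed
qed

section \<open>The two estimates for a measurable flow\<close>

lemma LINT_exp_nonneg: "0 \<le> (LINT s:A|M. exp (f s :: real))"
  unfolding set_lebesgue_integral_def by (intro integral_nonneg_AE) auto

locale flow_comparison = target_law \<nu> for \<nu> :: "(real ^ 'd) measure" +
  fixes a b a' b' :: "real \<Rightarrow> real" and w Y :: "real \<Rightarrow> real ^ 'd \<Rightarrow> real ^ 'd"
  assumes a_deriv: "\<And>t. t \<in> {0..<1} \<Longrightarrow> (a has_real_derivative a' t) (at t within {0..<1})"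
    and b_deriv: "\<And>t. t \<in> {0..<1} \<Longrightarrow> (b has_real_derivative b' t) (at t within {0..<1})"
    and cont: "continuous_on {0..<1} a'" "continuous_on {0..<1} b'"
    and a_pos: "\<And>t. t \<in> {0..<1} \<Longrightarrow> a t > 0"
    and a_lim: "(a \<longlongrightarrow> 0) (at_left 1)" and b_lim: "(b \<longlongrightarrow> 1) (at_left 1)"
    and Y_deriv: "\<And>s x. s \<in> {0..1} \<Longrightarrow> ((\<lambda>s. Y s x) has_vector_derivative w s (Y s x)) (at s within {0..1})"
    and Y_0: "\<And>x. Y 0 x = x"
    and Y_meas: "(\<lambda>(s, x). Y s x) \<in> borel_measurable (borel \<Otimes>\<^sub>M borel)"
    and w_meas: "(\<lambda>(s, x). w s x) \<in> borel_measurable (borel \<Otimes>\<^sub>M borel)"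
begin

text \<open>The formula divides by \<open>a s\<close>, which tends to 0 at time 1; the value 0
  outside \<open>[0, 1)\<close> keeps the field globally Borel, and a single time does not affect
  the integrals.\<close>

definition vel :: "real \<Rightarrow> real ^ 'd \<Rightarrow> real ^ 'd" where
  "vel s x = (if s \<in> {0..<1} then velocity (a s) (b s) (a' s) (b' s) x else 0)"

definition defect :: "real \<Rightarrow> real ^ 'd \<Rightarrow> real" where
  "defect s x = norm (vel s x - w s x)"

abbreviation \<mu> :: "(real ^ 'd) measure" where "\<mu> \<equiv> law (a 0) (b 0)"

sublocale \<mu>: prob_space \<mu> by (rule prob_space_law)

lemma a_cont: "continuous_on {0..<1} a" and b_cont: "continuous_on {0..<1} b"
  using DERIV_continuous_on[OF a_deriv] DERIV_continuous_on[OF b_deriv] by auto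

lemma velocity_cont: "continuous_on ({0..<1} \<times> UNIV) (\<lambda>(s, x). velocity (a s) (b s) (a' s) (b' s) x)"
proof -
  have f: "continuous_on ({0..<1} \<times> UNIV) (\<lambda>u::real \<times> (real ^ 'd). f (fst u))" if "continuous_on {0..<1} f" for f :: "real \<Rightarrow> real"
    by (rule continuous_on_compose2[OF that]) (auto intro!: continuous_intros)
  note c = f[OF a_cont] f[OF b_cont] f[OF cont(1)] f[OF cont(2)]
  have t: "continuous_on ({0..<1} \<times> UNIV) (\<lambda>u::real \<times> (real ^ 'd). (a (fst u), b (fst u), snd u))"
    by (intro continuous_intros c)
  have p: "continuous_on ({0..<1} \<times> UNIV) (\<lambda>u. pmean (a (fst u)) (b (fst u)) (snd u))"
    using continuous_on_compose2[OF continuous_on_pmean t] a_pos by (simp add: image_subset_iff)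
  show ?thesis unfolding velocity_def case_prod_unfold
    using a_pos by (intro continuous_intros c p) (auto simp: less_le)
qed

lemma vel_meas: "(\<lambda>(s, x). vel s x) \<in> borel_measurable (borel \<Otimes>\<^sub>M borel)"
proof -
  have "(\<lambda>(s, x). velocity (a s) (b s) (a' s) (b' s) x) \<in> borel_measurable (restrict_space borel ({0..<1} \<times> UNIV))"
    by (rule borel_measurable_continuous_on_restrict[OF velocity_cont])
  then have "(\<lambda>u. if u \<in> {0..<1} \<times> UNIV then (\<lambda>(s, x). velocity (a s) (b s) (a' s) (b' s) x) u else 0) \<in> borel_measurable borel"
    by (subst (asm) measurable_restrict_space_iff) (auto simp: borel_prod[symmetric])
  also have "(\<lambda>u. if u \<in> {0..<1} \<times> UNIV then (\<lambda>(s, x). velocity (a s) (b s) (a' s) (b' s) x) u else 0) = (\<lambda>(s, x). vel s x)"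
    by (auto simp: vel_def fun_eq_iff)
  finally show ?thesis by (simp add: borel_prod)
qed

lemma measurable_vel [measurable (raw)]:
  assumes "f \<in> borel_measurable M" "g \<in> borel_measurable M"
  shows "(\<lambda>\<omega>. vel (f \<omega>) (g \<omega>)) \<in> borel_measurable M"
  using measurable_compose[OF measurable_Pair[OF assms] vel_meas] by simp

lemma measurable_w [measurable (raw)]:
  assumes "f \<in> borel_measurable M" "g \<in> borel_measurable M"
  shows "(\<lambda>\<omega>. w (f \<omega>) (g \<omega>)) \<in> borel_measurable M"
  using measurable_compose[OF measurable_Pair[OF assms] w_meas] by simp

lemma measurable_Y [measurable (raw)]:
  assumes "f \<in> borel_measurable M" "g \<in> borel_measurable M"
  shows "(\<lambda>\<omega>. Y (f \<omega>) (g \<omega>)) \<in> borel_measurable M"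
  using measurable_compose[OF measurable_Pair[OF assms] Y_meas] by simp

lemma measurable_defect [measurable (raw)]:
  assumes [measurable]: "f \<in> borel_measurable M" "g \<in> borel_measurable M"
  shows "(\<lambda>\<omega>. defect (f \<omega>) (g \<omega>)) \<in> borel_measurable M"
  unfolding defect_def by measurable

lemma vel_path_cont:
  assumes T: "T < 1" and f: "continuous_on {0..T} f"
  shows "continuous_on {0..T} (\<lambda>s. vel s (f s))"
proof -
  have "continuous_on {0..T} (\<lambda>s. (s, f s))" by (intro continuous_intros f)
  moreover have "(\<lambda>s. (s, f s)) ` {0..T} \<subseteq> {0..<1} \<times> UNIV" using T by auto
  ultimately have "continuous_on {0..T} (\<lambda>s. velocity (a s) (b s) (a' s) (b' s) (f s))"
    using continuous_on_compose2[OF velocity_cont, of "{0..T}" "\<lambda>s. (s, f s)"] by simp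
  then show ?thesis by (rule continuous_on_eq) (use T in \<open>auto simp: vel_def\<close>)
qed

lemma Y_path_cont: "T \<le> 1 \<Longrightarrow> continuous_on {0..T} (\<lambda>s. Y s x)"
  unfolding continuous_on_eq_continuous_within
  using has_vector_derivative_continuous[OF has_vector_derivative_within_subset[OF Y_deriv, of _ "{0..T}"]] by force

lemma \<mu>_second_moment: "integrable \<mu> (\<lambda>x. (norm x)\<^sup>2)"
  unfolding distr_base_law[symmetric] by (subst integrable_distr_eq) (auto intro: integrable_base_affine)

text \<open>The difference of \<open>v\<close> at \<open>x\<close> and \<open>w\<close> at
  \<open>y\<close> is split at \<open>v y\<close>: the one-sided Lipschitz bound handles
  \<open>v x - v y\<close>, and the error \<open>v - w\<close> is evaluated at the position of
  \<open>Y\<close>. Its L2 norm depends only on the first marginal of the coupling, so it equals the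
  given average along the flow.\<close>

theorem W2_le_along_flow:
  assumes l: "set_integrable lborel {0..1} l"
    and osl: "\<And>s x y. s \<in> {0<..<1} \<Longrightarrow> (x - y) \<bullet> (vel s x - vel s y) \<le> l s * (norm (x - y))\<^sup>2"
    and \<epsilon>: "\<epsilon> \<ge> 0"
    and le: "(\<integral>\<^sup>+s\<in>{0..1}. (\<integral>\<^sup>+x. ennreal ((defect s (Y s x))\<^sup>2) \<partial>\<mu>) \<partial>lborel) \<le> ennreal \<epsilon>"
  shows "(W2 (distr \<mu> borel (Y 1)) \<nu>)\<^sup>2 \<le> ennreal (\<epsilon> * (LINT s:{0..1}|lborel. exp (2 * (LINT u:{s..1}|lborel. l u))))"
proof -
  note [measurable_cong] = sets_law
  interpret pair_sigma_finite \<mu> "lborel :: real measure" ..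
  define E where "E s = (\<integral>\<^sup>+x. ennreal ((defect s (Y s x))\<^sup>2) \<partial>\<mu>)" for s
  have Em: "E \<in> borel_measurable borel" unfolding E_def by measurable
  note E = set_integrable_of_nn_integral[OF Em _ le[folded E_def] \<epsilon>, simplified]
  have AEd: "AE x in \<mu>. (\<integral>\<^sup>+s\<in>{0..1}. ennreal ((defect s (Y s x))\<^sup>2) \<partial>lborel) \<noteq> \<infinity>"
  proof (rule nn_integral_PInf_AE)
    have m: "(\<lambda>p. ennreal ((defect (snd p) (Y (snd p) (fst p)))\<^sup>2) * indicator {0..1} (snd p)) \<in> borel_measurable (\<mu> \<Otimes>\<^sub>M lborel)"
      by measurable
    have "(\<integral>\<^sup>+x. (\<integral>\<^sup>+s\<in>{0..1}. ennreal ((defect s (Y s x))\<^sup>2) \<partial>lborel) \<partial>\<mu>) =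
       (\<integral>\<^sup>+s. (\<integral>\<^sup>+x. ennreal ((defect s (Y s x))\<^sup>2) * indicator {0..1} s \<partial>\<mu>) \<partial>lborel)"
      using Fubini[OF m] by simp
    also have "\<dots> = (\<integral>\<^sup>+s\<in>{0..1}. E s \<partial>lborel)"
      unfolding E_def by (intro nn_integral_cong) (auto simp: indicator_def)
    finally show "(\<integral>\<^sup>+x. (\<integral>\<^sup>+s\<in>{0..1}. ennreal ((defect s (Y s x))\<^sup>2) \<partial>lborel) \<partial>\<mu>) \<noteq> \<infinity>"
      using le by (auto simp: E_def top_unique)
  qed measurable
  \<comment> \<open>Along a path of the flow, \<open>w\<close> is \<open>vel\<close> minus the
    error. The former is continuous in time up to \<open>T < 1\<close>, and the latter is square
    integrable for almost every starting point by Tonelli.\<close>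
  have Y_int: "AE x in \<mu>. set_integrable lborel {0..T} (\<lambda>s. w s (Y s x))" if T: "T \<in> {0..<1}" for T
    using AEd
  proof eventually_elim
    case (elim x)
    let ?D = "\<lambda>s. vel s (Y s x) - w s (Y s x)"
    have "(\<integral>\<^sup>+s\<in>{0..1}. ennreal ((norm (?D s))\<^sup>2) \<partial>lborel) < \<infinity>"
      using elim by (simp add: defect_def top.not_eq_extremum)
    then have "set_integrable lborel {0..1} ?D" by (intro set_integrable_norm_of_power2(2)) measurable
    then have D: "set_integrable lborel {0..T} ?D" using T by (auto intro: set_integrable_Icc_subset)
    have V: "set_integrable lborel {0..T} (\<lambda>s. vel s (Y s x))"
      using T by (intro set_integrable_continuous_Icc vel_path_cont Y_path_cont) auto
    have "set_integrable lborel {0..T} (\<lambda>s. vel s (Y s x) - ?D s)" by (rule set_integral_diff(1)[OF V D])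
    then show ?case by simp
  qed
  \<comment> \<open>Growth of \<open>w\<close> is obtained from \<open>vel\<close>: the one-sided
    Lipschitz bound against the origin leaves \<open>norm (vel s 0)\<close>, bounded on
    \<open>[0, T]\<close> by continuity, besides the error itself.\<close>
  have Y_L2: "\<exists>C\<ge>0. \<forall>s\<in>{0..T}. (\<integral>\<^sup>+x. ennreal ((norm (Y s x))\<^sup>2) \<partial>\<mu>) \<le> ennreal C" if T: "T \<in> {0..<1}" for T
  proof (rule flow_second_moment[where k = "\<lambda>s x. defect s x + norm (vel s 0)" and l = l and w = w])
    show "((\<lambda>s. Y s x) has_vector_derivative w s (Y s x)) (at s within {0..T})" if "s \<in> {0..T}" for s x
      by (rule has_vector_derivative_within_subset[OF Y_deriv]) (use that T in auto)
    show "AE x in \<mu>. set_integrable lborel {0..T} (\<lambda>s. w s (Y s x))" by (rule Y_int[OF T])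
    show "(\<lambda>(s, x). defect s x + norm (vel s 0)) \<in> borel_measurable (borel \<Otimes>\<^sub>M borel)"
      unfolding case_prod_unfold by measurable
    show "y \<bullet> w s y \<le> l s * (norm y)\<^sup>2 + norm y * (defect s y + norm (vel s 0))" if s: "s \<in> {0<..<T}" for s y
    proof -
      have "y \<bullet> (vel s y - vel s 0) \<le> l s * (norm y)\<^sup>2" using osl[of s y 0] s T by simp
      moreover have "y \<bullet> vel s 0 \<le> norm y * norm (vel s 0)" by (rule norm_cauchy_schwarz)
      moreover have "(- y) \<bullet> (vel s y - w s y) \<le> norm y * defect s y"
        using norm_cauchy_schwarz[of "- y" "vel s y - w s y"] by (simp add: defect_def)
      ultimately show ?thesis by (simp add: inner_diff_right algebra_simps)
    qed
    have "compact ((\<lambda>s. vel s 0) ` {0..T})"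
      using T by (intro compact_continuous_image vel_path_cont compact_Icc) (auto intro!: continuous_intros)
    from compact_imp_bounded[OF this] obtain B where B': "\<And>x. x \<in> (\<lambda>s. vel s 0) ` {0..T} \<Longrightarrow> norm x \<le> B"
      unfolding bounded_iff by blast
    have B: "norm (vel s 0) \<le> B" if "s \<in> {0..T}" for s by (rule B'[OF imageI[OF that]])
    have "(\<integral>\<^sup>+s\<in>{0..T}. (\<integral>\<^sup>+x. ennreal ((defect s (Y s x) + norm (vel s 0))\<^sup>2) \<partial>\<mu>) \<partial>lborel)
      \<le> (\<integral>\<^sup>+s. ennreal 2 * (E s * indicator {0..1} s) + ennreal (2 * B\<^sup>2) * indicator {0..1} s \<partial>lborel)"
    proof (rule nn_integral_mono)
      fix s
      have "(\<integral>\<^sup>+x. ennreal ((defect s (Y s x) + norm (vel s 0))\<^sup>2) \<partial>\<mu>) \<le> ennreal 2 * E s + ennreal (2 * B\<^sup>2)" if s: "s \<in> {0..T}"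
      proof -
        have "(\<integral>\<^sup>+x. ennreal ((defect s (Y s x) + norm (vel s 0))\<^sup>2) \<partial>\<mu>) \<le> (\<integral>\<^sup>+x. ennreal 2 * ennreal ((defect s (Y s x))\<^sup>2) + ennreal (2 * B\<^sup>2) \<partial>\<mu>)"
        proof (rule nn_integral_mono)
          fix x
          have "(norm (vel s 0))\<^sup>2 \<le> B\<^sup>2" using B[OF s] by (intro power_mono) auto
          then have "(defect s (Y s x) + norm (vel s 0))\<^sup>2 \<le> 2 * (defect s (Y s x))\<^sup>2 + 2 * B\<^sup>2"
            using norm_add_power2_le[of "defect s (Y s x)" "norm (vel s 0)"] by simp
          then have "ennreal ((defect s (Y s x) + norm (vel s 0))\<^sup>2) \<le> ennreal (2 * (defect s (Y s x))\<^sup>2 + 2 * B\<^sup>2)" by (rule ennreal_leI)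
          then show "ennreal ((defect s (Y s x) + norm (vel s 0))\<^sup>2) \<le> ennreal 2 * ennreal ((defect s (Y s x))\<^sup>2) + ennreal (2 * B\<^sup>2)"
            by (simp add: ennreal_mult)
        qed
        also have "\<dots> = ennreal 2 * E s + ennreal (2 * B\<^sup>2)"
          unfolding E_def using \<mu>.emeasure_space_1
          by (subst nn_integral_add, measurable, subst nn_integral_cmult) auto
        finally show ?thesis .
      qed
      then show "(\<integral>\<^sup>+x. ennreal ((defect s (Y s x) + norm (vel s 0))\<^sup>2) \<partial>\<mu>) * indicator {0..T} s
        \<le> ennreal 2 * (E s * indicator {0..1} s) + ennreal (2 * B\<^sup>2) * indicator {0..1} s"
        using T by (auto simp: indicator_def)
    qed
    also have "\<dots> = ennreal 2 * (\<integral>\<^sup>+s\<in>{0..1}. E s \<partial>lborel) + ennreal (2 * B\<^sup>2)"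
      using Em by (subst nn_integral_add, measurable, subst (1 2) nn_integral_cmult) auto
    also have "\<dots> \<le> ennreal 2 * ennreal \<epsilon> + ennreal (2 * B\<^sup>2)"
      using le unfolding E_def[symmetric] by (intro add_right_mono mult_left_mono) auto
    also have "\<dots> < \<infinity>" by (simp add: ennreal_mult_less_top)
    finally show "(\<integral>\<^sup>+s\<in>{0..T}. (\<integral>\<^sup>+x. ennreal ((defect s (Y s x) + norm (vel s 0))\<^sup>2) \<partial>\<mu>) \<partial>lborel) < \<infinity>" .
  qed (use T l Y_0 Y_meas \<mu>_second_moment prob_space_law sets_law in auto)
  have "(W2 (distr \<mu> borel (Y 1)) \<nu>)\<^sup>2 \<le> ennreal ((LINT s:{0..1}|lborel. enn2real (E s)) * (LINT s:{0..1}|lborel. exp (2 * (LINT u:{s..1}|lborel. l u))))"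
  proof (rule W2_flow_le[OF a_deriv b_deriv cont a_pos a_lim b_lim Y_deriv Y_0 Y_meas Y_int Y_L2 l, where r = "\<lambda>s x y. defect s y"])
    show "(\<lambda>(s, x, y). defect s y) \<in> borel_measurable (borel \<Otimes>\<^sub>M (borel :: (real ^ 'd) measure) \<Otimes>\<^sub>M borel)"
      unfolding case_prod_unfold by measurable
    show "(x - y) \<bullet> (velocity (a s) (b s) (a' s) (b' s) x - w s y) \<le> l s * (norm (x - y))\<^sup>2 + norm (x - y) * defect s y"
      if s: "s \<in> {0<..<1}" for s x y
    proof -
      have "velocity (a s) (b s) (a' s) (b' s) x - w s y = (vel s x - vel s y) + (vel s y - w s y)" using s by (simp add: vel_def)
      then show ?thesis
        using osl[OF s, of x y] norm_cauchy_schwarz[of "x - y" "vel s y - w s y"] by (simp only: inner_add_right defect_def)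
    qed
    show "AE s in lborel. s \<in> {0..<1} \<longrightarrow> (\<forall>P. prob_space P \<longrightarrow> sets P = sets (borel \<Otimes>\<^sub>M borel) \<longrightarrow>
      distr P borel fst = \<mu> \<longrightarrow> distr P borel snd = law (a s) (b s) \<longrightarrow>
      (\<integral>\<^sup>+u. ennreal ((defect s (Y s (fst u)))\<^sup>2) \<partial>P) \<le> ennreal (enn2real (E s)))"
      using E(3)
    proof eventually_elim
      case (elim s)
      show ?case
      proof (intro impI allI)
        fix P :: "((real ^ 'd) \<times> (real ^ 'd)) measure"
        assume s: "s \<in> {0..<1}" and [measurable_cong]: "sets P = sets (borel \<Otimes>\<^sub>M borel)" and d: "distr P borel fst = \<mu>"
        have "(\<integral>\<^sup>+u. ennreal ((defect s (Y s (fst u)))\<^sup>2) \<partial>P) = E s"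
          unfolding E_def d[symmetric] by (subst nn_integral_distr) auto
        then show "(\<integral>\<^sup>+u. ennreal ((defect s (Y s (fst u)))\<^sup>2) \<partial>P) \<le> ennreal (enn2real (E s))" using elim s by simp
      qed
    qed
    show "set_integrable lborel {0..1} (\<lambda>s. enn2real (E s))" by (rule E(1))
  qed auto
  also have "\<dots> \<le> ennreal (\<epsilon> * (LINT s:{0..1}|lborel. exp (2 * (LINT u:{s..1}|lborel. l u))))"
    by (intro ennreal_leI mult_right_mono E(2) LINT_exp_nonneg)
  finally show ?thesis .
qed

text \<open>The difference is now split at \<open>w x\<close>: Lipschitz continuity of
  \<open>w\<close> handles \<open>w x - w y\<close>, and the error \<open>v - w\<close> is evaluated
  at the position of \<open>X\<close>, whose law is prescribed. As the hypothesis does not speak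
  about the error along \<open>Y\<close>, integrability of \<open>w\<close> along the flow has to be
  derived in another way.\<close>

theorem W2_le_along_interpolant:
  assumes C: "C \<ge> 0"
    and lip: "\<And>s x y. s \<in> {0..1} \<Longrightarrow> norm (w s x - w s y) \<le> C * norm (x - y)"
    and \<epsilon>: "\<epsilon> \<ge> 0"
    and le: "(\<integral>\<^sup>+s\<in>{0..1}. (\<integral>\<^sup>+u. ennreal ((defect s (a s *\<^sub>R fst u + b s *\<^sub>R snd u))\<^sup>2) \<partial>base) \<partial>lborel) \<le> ennreal \<epsilon>"
  shows "(W2 (distr \<mu> borel (Y 1)) \<nu>)\<^sup>2 \<le> ennreal (\<epsilon> * (LINT s:{0..1::real}|lborel. exp (2 * (LINT u:{s..1}|lborel. C))))"
proof -
  note [measurable_cong] = sets_law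
  interpret pair_sigma_finite base "lborel :: real measure" ..
  \<comment> \<open>Extension by 0 makes the schedule Borel on the whole line; all values at times
    in \<open>[0, 1)\<close> are kept.\<close>
  let ?a = "\<lambda>s. if s \<in> {0..<1} then a s else 0" and ?b = "\<lambda>s. if s \<in> {0..<1} then b s else 0"
  have ab[measurable]: "?a \<in> borel_measurable borel" "?b \<in> borel_measurable borel"
    using borel_measurable_continuous_on_restrict[OF a_cont] borel_measurable_continuous_on_restrict[OF b_cont]
    by (simp_all add: measurable_restrict_space_iff)
  define X where "X s u = ?a s *\<^sub>R fst u + ?b s *\<^sub>R snd u" for s and u :: "(real ^ 'd) \<times> (real ^ 'd)"
  have X_eq: "X s u = a s *\<^sub>R fst u + b s *\<^sub>R snd u" if "s \<in> {0..<1}" for s u using that by (simp add: X_def)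
  have Xm: "(\<lambda>\<omega>. X (f \<omega>) (g \<omega>)) \<in> borel_measurable N" if [measurable]: "f \<in> borel_measurable N" "g \<in> N \<rightarrow>\<^sub>M borel \<Otimes>\<^sub>M borel" for f g and N :: "'z measure"
    unfolding X_def using measurable_compose[OF that(1) ab(1)] measurable_compose[OF that(1) ab(2)] by measurable
  define E where "E s = (\<integral>\<^sup>+u. ennreal ((defect s (X s u))\<^sup>2) \<partial>base)" for s
  have dm: "(\<lambda>p. ennreal ((defect (snd p) (X (snd p) (fst p)))\<^sup>2)) \<in> borel_measurable (base \<Otimes>\<^sub>M borel)"
    using Xm[of snd "base \<Otimes>\<^sub>M borel" fst] by measurable
  have Em: "E \<in> borel_measurable borel"
    unfolding E_def using GT.borel_measurable_nn_integral[of "\<lambda>s u. ennreal ((defect s (X s u))\<^sup>2)" borel]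
      Xm[of fst "borel \<Otimes>\<^sub>M base" snd] by measurable
  have le': "(\<integral>\<^sup>+s\<in>{0..1}. E s \<partial>lborel) \<le> ennreal \<epsilon>"
  proof -
    have "AE s in lborel. s \<noteq> (1::real)" by (rule AE_lborel_singleton)
    then have "AE s in lborel. E s * indicator {0..1} s = (\<integral>\<^sup>+u. ennreal ((defect s (a s *\<^sub>R fst u + b s *\<^sub>R snd u))\<^sup>2) \<partial>base) * indicator {0..1} s"
      by eventually_elim (auto simp: E_def X_eq indicator_def)
    from nn_integral_cong_AE[OF this] le show ?thesis by simp
  qed
  note E = set_integrable_of_nn_integral[OF Em _ le' \<epsilon>, simplified]
  have "AE u in base. (\<integral>\<^sup>+s\<in>{0..1}. ennreal ((defect s (X s u))\<^sup>2) \<partial>lborel) \<noteq> \<infinity>"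
  proof (rule nn_integral_PInf_AE)
    have m: "(\<lambda>p. ennreal ((defect (snd p) (X (snd p) (fst p)))\<^sup>2) * indicator {0..1} (snd p)) \<in> borel_measurable (base \<Otimes>\<^sub>M lborel)"
      using dm by measurable
    show "(\<lambda>u. \<integral>\<^sup>+s\<in>{0..1}. ennreal ((defect s (X s u))\<^sup>2) \<partial>lborel) \<in> borel_measurable base"
      using lborel.borel_measurable_nn_integral_fst[OF m] by simp
    have "(\<integral>\<^sup>+u. (\<integral>\<^sup>+s\<in>{0..1}. ennreal ((defect s (X s u))\<^sup>2) \<partial>lborel) \<partial>base) =
       (\<integral>\<^sup>+s. (\<integral>\<^sup>+u. ennreal ((defect s (X s u))\<^sup>2) * indicator {0..1} s \<partial>base) \<partial>lborel)"
      using Fubini[OF m] by simp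
    also have "\<dots> = (\<integral>\<^sup>+s\<in>{0..1}. E s \<partial>lborel)"
      unfolding E_def by (intro nn_integral_cong) (auto simp: indicator_def)
    finally show "(\<integral>\<^sup>+u. (\<integral>\<^sup>+s\<in>{0..1}. ennreal ((defect s (X s u))\<^sup>2) \<partial>lborel) \<partial>base) \<noteq> \<infinity>"
      using le' by (auto simp: top_unique)
  qed
  note AE_X = this
  have "\<exists>u. (\<integral>\<^sup>+s\<in>{0..1}. ennreal ((defect s (X s u))\<^sup>2) \<partial>lborel) \<noteq> \<infinity>"
  proof (rule ccontr)
    assume n: "\<not> ?thesis"
    have "AE u in base. False" using AE_X by eventually_elim (use n in blast)
    then show False by simp
  qed
  then obtain u where u: "(\<integral>\<^sup>+s\<in>{0..1}. ennreal ((defect s (X s u))\<^sup>2) \<partial>lborel) \<noteq> \<infinity>" by blast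
  \<comment> \<open>A single \<open>u\<close> with finite error along its interpolation path
    suffices: on \<open>[0, T]\<close> that path and \<open>vel\<close> along it are bounded, so the
    Lipschitz bound transfers square integrability of the error to \<open>w\<close> at the
    origin.\<close>
  have w0: "(\<integral>\<^sup>+s\<in>{0..T}. ennreal ((norm (w s 0))\<^sup>2) \<partial>lborel) < \<infinity>" if T: "T \<in> {0..<1}" for T
  proof -
    have Xc: "continuous_on {0..T} (\<lambda>s. a s *\<^sub>R fst u + b s *\<^sub>R snd u)"
      using T by (intro continuous_intros continuous_on_subset[OF a_cont] continuous_on_subset[OF b_cont]) auto
    have "continuous_on {0..T} (\<lambda>s. norm (vel s (a s *\<^sub>R fst u + b s *\<^sub>R snd u)) + C * norm (a s *\<^sub>R fst u + b s *\<^sub>R snd u))"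
      using T by (intro continuous_intros vel_path_cont Xc) auto
    from compact_imp_bounded[OF compact_continuous_image[OF this compact_Icc]]
    obtain B where B': "\<And>x. x \<in> (\<lambda>s. norm (vel s (a s *\<^sub>R fst u + b s *\<^sub>R snd u)) + C * norm (a s *\<^sub>R fst u + b s *\<^sub>R snd u)) ` {0..T} \<Longrightarrow> norm x \<le> B"
      unfolding bounded_iff by blast
    have B: "norm (vel s (a s *\<^sub>R fst u + b s *\<^sub>R snd u)) + C * norm (a s *\<^sub>R fst u + b s *\<^sub>R snd u) \<le> B" if "s \<in> {0..T}" for s
      using B'[OF imageI[OF that]] unfolding real_norm_def by linarith
    have "(\<integral>\<^sup>+s\<in>{0..T}. ennreal ((norm (w s 0))\<^sup>2) \<partial>lborel) \<le>
      (\<integral>\<^sup>+s. ennreal 2 * (ennreal ((defect s (X s u))\<^sup>2) * indicator {0..1} s) + ennreal (2 * B\<^sup>2) * indicator {0..1} s \<partial>lborel)"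
    proof (rule nn_integral_mono)
      fix s
      have "ennreal ((norm (w s 0))\<^sup>2) \<le> ennreal 2 * ennreal ((defect s (X s u))\<^sup>2) + ennreal (2 * B\<^sup>2)" if s: "s \<in> {0..T}"
      proof -
        have s1: "s \<in> {0..<1}" using s T by auto
        have "w s 0 = - (vel s (X s u) - w s (X s u)) + (vel s (X s u) + (w s 0 - w s (X s u)))" by simp
        then have "norm (w s 0) \<le> norm (vel s (X s u) - w s (X s u)) + (norm (vel s (X s u)) + norm (w s 0 - w s (X s u)))"
          using norm_triangle_ineq[of "- (vel s (X s u) - w s (X s u))" "vel s (X s u) + (w s 0 - w s (X s u))"]
            norm_triangle_ineq[of "vel s (X s u)" "w s 0 - w s (X s u)"] by (simp only: norm_minus_cancel)
        also have "norm (w s 0 - w s (X s u)) \<le> C * norm (X s u)" using lip[of s 0 "X s u"] s1 by simp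
        also have "norm (vel s (X s u)) + C * norm (X s u) \<le> B" using B[OF s] by (simp add: X_eq[OF s1])
        finally have n: "norm (w s 0) \<le> defect s (X s u) + B" by (simp add: defect_def)
        then have "(norm (w s 0))\<^sup>2 \<le> (defect s (X s u) + B)\<^sup>2" by (intro power_mono) auto
        also have "\<dots> \<le> 2 * (defect s (X s u))\<^sup>2 + 2 * B\<^sup>2"
          using norm_add_power2_le[of "defect s (X s u)" B] by simp
        finally have "ennreal ((norm (w s 0))\<^sup>2) \<le> ennreal (2 * (defect s (X s u))\<^sup>2 + 2 * B\<^sup>2)" by (rule ennreal_leI)
        then show ?thesis by (simp add: ennreal_mult)
      qed
      then show "ennreal ((norm (w s 0))\<^sup>2) * indicator {0..T} s \<le>
        ennreal 2 * (ennreal ((defect s (X s u))\<^sup>2) * indicator {0..1} s) + ennreal (2 * B\<^sup>2) * indicator {0..1} s"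
        using T by (auto simp: indicator_def)
    qed
    also have "\<dots> = ennreal 2 * (\<integral>\<^sup>+s\<in>{0..1}. ennreal ((defect s (X s u))\<^sup>2) \<partial>lborel) + ennreal (2 * B\<^sup>2)"
    proof -
      have "(\<lambda>s. X s u) \<in> borel_measurable borel" by (rule Xm) (simp_all add: space_pair_measure)
      then show ?thesis by (subst nn_integral_add, measurable, subst (1 2) nn_integral_cmult) auto
    qed
    also have "\<dots> < \<infinity>" using u by (auto simp: ennreal_mult_eq_top_iff less_top[symmetric])
    finally show ?thesis .
  qed
  have Y_int: "AE x in \<mu>. set_integrable lborel {0..T} (\<lambda>s. w s (Y s x))" if T: "T \<in> {0..<1}" for T
  proof (intro AE_I2)
    fix x
    have "set_integrable lborel {0..T} (\<lambda>s. w s 0)"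
      by (rule set_integrable_norm_of_power2(2)[OF _ w0[OF T]]) measurable
    then have W: "set_integrable lborel {0..T} (\<lambda>s. norm (w s 0))" by (rule set_integrable_norm)
    have "set_integrable lborel {0..T} (\<lambda>s. C * norm (Y s x))"
      using T by (intro set_integrable_continuous_Icc continuous_intros Y_path_cont) auto
    from set_integral_add(1)[OF this W]
    show "set_integrable lborel {0..T} (\<lambda>s. w s (Y s x))"
    proof (rule set_integrable_bound)
      show "set_borel_measurable lborel {0..T} (\<lambda>s. w s (Y s x))" unfolding set_borel_measurable_def by measurable
      show "AE s in lborel. s \<in> {0..T} \<longrightarrow> norm (w s (Y s x)) \<le> norm (C * norm (Y s x) + norm (w s 0))"
      proof (intro AE_I2 impI)
        fix s assume s: "s \<in> {0..T}"
        have "norm (w s (Y s x)) \<le> norm (w s (Y s x) - w s 0) + norm (w s 0)" using norm_triangle_ineq[of "w s (Y s x) - w s 0" "w s 0"] by simp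
        also have "norm (w s (Y s x) - w s 0) \<le> C * norm (Y s x)" using lip[of s "Y s x" 0] s T by simp
        finally show "norm (w s (Y s x)) \<le> norm (C * norm (Y s x) + norm (w s 0))" by simp
      qed
    qed
  qed
  have l: "set_integrable lborel {0..1} (\<lambda>_ :: real. C)" by (intro set_integrable_continuous_Icc continuous_intros)
  have Y_L2: "\<exists>C\<ge>0. \<forall>s\<in>{0..T}. (\<integral>\<^sup>+x. ennreal ((norm (Y s x))\<^sup>2) \<partial>\<mu>) \<le> ennreal C" if T: "T \<in> {0..<1}" for T
  proof (rule flow_second_moment[where k = "\<lambda>s x. norm (w s 0)" and l = "\<lambda>_. C" and w = w])
    show "((\<lambda>s. Y s x) has_vector_derivative w s (Y s x)) (at s within {0..T})" if "s \<in> {0..T}" for s x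
      by (rule has_vector_derivative_within_subset[OF Y_deriv]) (use that T in auto)
    show "AE x in \<mu>. set_integrable lborel {0..T} (\<lambda>s. w s (Y s x))" by (rule Y_int[OF T])
    show "(\<lambda>(s, x). norm (w s 0)) \<in> borel_measurable (borel \<Otimes>\<^sub>M (borel :: (real ^ 'd) measure))"
      unfolding case_prod_unfold by measurable
    show "y \<bullet> w s y \<le> C * (norm y)\<^sup>2 + norm y * norm (w s 0)" if s: "s \<in> {0<..<T}" for s y
    proof -
      have "y \<bullet> (w s y - w s 0) \<le> norm y * norm (w s y - w s 0)" by (rule norm_cauchy_schwarz)
      also have "\<dots> \<le> norm y * (C * norm y)" using lip[of s y 0] s T by (intro mult_left_mono) auto
      finally have "y \<bullet> (w s y - w s 0) \<le> C * (norm y)\<^sup>2" by (simp add: power2_eq_square mult_ac)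
      moreover have "y \<bullet> w s 0 \<le> norm y * norm (w s 0)" by (rule norm_cauchy_schwarz)
      ultimately show ?thesis by (simp add: inner_diff_right)
    qed
    show "(\<integral>\<^sup>+s\<in>{0..T}. (\<integral>\<^sup>+x. ennreal ((norm (w s 0))\<^sup>2) \<partial>\<mu>) \<partial>lborel) < \<infinity>"
      using w0[OF T] \<mu>.emeasure_space_1 by simp
  qed (use T l Y_0 Y_meas \<mu>_second_moment prob_space_law sets_law in auto)
  have "(W2 (distr \<mu> borel (Y 1)) \<nu>)\<^sup>2 \<le> ennreal ((LINT s:{0..1}|lborel. enn2real (E s)) * (LINT s:{0..1::real}|lborel. exp (2 * (LINT u:{s..1}|lborel. C))))"
  proof (rule W2_flow_le[OF a_deriv b_deriv cont a_pos a_lim b_lim Y_deriv Y_0 Y_meas Y_int Y_L2 l, where r = "\<lambda>s x y. defect s x"])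
    show "(\<lambda>(s, x, y). defect s x) \<in> borel_measurable (borel \<Otimes>\<^sub>M borel \<Otimes>\<^sub>M (borel :: (real ^ 'd) measure))"
      unfolding case_prod_unfold by measurable
    show "(x - y) \<bullet> (velocity (a s) (b s) (a' s) (b' s) x - w s y) \<le> C * (norm (x - y))\<^sup>2 + norm (x - y) * defect s x"
      if s: "s \<in> {0<..<1}" for s x y
    proof -
      have eq: "(x - y) \<bullet> (velocity (a s) (b s) (a' s) (b' s) x - w s y) = (x - y) \<bullet> (w s x - w s y) + (x - y) \<bullet> (vel s x - w s x)"
        using s by (simp add: vel_def inner_diff_right)
      moreover have "(x - y) \<bullet> (w s x - w s y) \<le> norm (x - y) * (C * norm (x - y))"
        using lip[of s x y] s by (intro order_trans[OF norm_cauchy_schwarz] mult_left_mono) auto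
      ultimately show ?thesis
        using norm_cauchy_schwarz[of "x - y" "vel s x - w s x"] unfolding eq defect_def by (simp add: power2_eq_square mult_ac)
    qed
    show "AE s in lborel. s \<in> {0..<1} \<longrightarrow> (\<forall>P. prob_space P \<longrightarrow> sets P = sets (borel \<Otimes>\<^sub>M borel) \<longrightarrow>
      distr P borel fst = \<mu> \<longrightarrow> distr P borel snd = law (a s) (b s) \<longrightarrow>
      (\<integral>\<^sup>+u. ennreal ((defect s (snd u))\<^sup>2) \<partial>P) \<le> ennreal (enn2real (E s)))"
      using E(3)
    proof eventually_elim
      case (elim s)
      show ?case
      proof (intro impI allI)
        fix P :: "((real ^ 'd) \<times> (real ^ 'd)) measure"
        assume s: "s \<in> {0..<1}" and [measurable_cong]: "sets P = sets (borel \<Otimes>\<^sub>M borel)" and d: "distr P borel snd = law (a s) (b s)"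
        have "(\<integral>\<^sup>+u. ennreal ((defect s (snd u))\<^sup>2) \<partial>P) = (\<integral>\<^sup>+x. ennreal ((defect s x)\<^sup>2) \<partial>law (a s) (b s))"
          unfolding d[symmetric] by (subst nn_integral_distr) auto
        also have "\<dots> = E s"
          unfolding distr_base_law[symmetric] E_def X_eq[OF s] by (subst nn_integral_distr) auto
        finally show "(\<integral>\<^sup>+u. ennreal ((defect s (snd u))\<^sup>2) \<partial>P) \<le> ennreal (enn2real (E s))" using elim s by simp
      qed
    qed
    show "set_integrable lborel {0..1} (\<lambda>s. enn2real (E s))" by (rule E(1))
  qed auto
  also have "\<dots> \<le> ennreal (\<epsilon> * (LINT s:{0..1::real}|lborel. exp (2 * (LINT u:{s..1}|lborel. C))))"
    by (intro ennreal_leI mult_right_mono E(2) LINT_exp_nonneg)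
  finally show ?thesis .
qed

end

section \<open>Assembling the result\<close>

lemma LINT_exp_const:
  fixes C :: real
  assumes C: "C > 0"
  shows "(LINT s:{0..1::real}|lborel. exp (2 * (LINT u:{s..1}|lborel. C))) = (exp (2 * C) - 1) / (2 * C)"
proof -
  have c: "(LINT u:{s..1}|lborel. C) = C * (1 - s)" if "s \<in> {0..1}" for s :: real
    using that by (simp add: set_lebesgue_integral_def mult.commute)
  have P: "primitive_on 0 1 (\<lambda>s. - (exp (2 * (C * (1 - s))) / (2 * C))) (\<lambda>s. exp (2 * (C * (1 - s))))"
  proof (rule primitive_on_deriv)
    show "((\<lambda>s. - (exp (2 * (C * (1 - s))) / (2 * C))) has_real_derivative exp (2 * (C * (1 - s)))) (at s within {0..1})" for s
      using C by (auto intro!: derivative_eq_intros simp: field_simps)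
    show "set_integrable lborel {0..1} (\<lambda>s. exp (2 * (C * (1 - s))))"
      by (intro set_integrable_continuous_Icc continuous_intros)
  qed
  have "(LINT s:{0..1::real}|lborel. exp (2 * (LINT u:{s..1}|lborel. C))) = (LINT s:{0..1}|lborel. exp (2 * (C * (1 - s))))"
    by (rule set_lebesgue_integral_cong) (auto simp: c)
  also have "\<dots> = (exp (2 * C) - 1) / (2 * C)"
    using primitive_on_diff[OF P, of 0 1] C by (simp add: field_simps)
  finally show ?thesis .
qed

text \<open>\<open>a\<close> need not be differentiable at 1, so its limit there is obtained from
  the continuity of its square, through \<open>sqrt ((a t)\<^sup>2) = \<bar>a t\<bar>\<close>. The
  derivatives are taken relative to \<open>[0, 1)\<close>, which includes time 0.\<close>

lemma interpolation_schedule_derivatives: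
  assumes "interpolation_schedule a b"
  shows "\<exists>a' b'. (\<forall>t\<in>{0..<1}. (a has_real_derivative a' t) (at t within {0..<1})) \<and>
    (\<forall>t\<in>{0..<1}. (b has_real_derivative b' t) (at t within {0..<1})) \<and>
    continuous_on {0..<1} a' \<and> continuous_on {0..<1} b' \<and>
    (\<forall>t\<in>{0<..<1}. deriv a t = a' t) \<and> (\<forall>t\<in>{0<..<1}. deriv b t = b' t)"
    and "\<And>t. t \<in> {0..<1} \<Longrightarrow> a t > 0" "(a \<longlongrightarrow> 0) (at_left 1)" "(b \<longlongrightarrow> 1) (at_left 1)"
proof -
  have s: "C2_on {0..<1} a" "C2_on {0..<1} b" "C1_on {0..1} (\<lambda>t. (a t)\<^sup>2)" "C1_on {0..1} b"
    "\<And>t. t \<in> {0<..<1} \<Longrightarrow> a t > 0" "a 0 > 0" "a 1 = 0" "b 1 = 1"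
    using assms by (auto simp: interpolation_schedule_def)
  have C1c: "continuous_on S f'" if "C1_on S f'" for S f'
    using that unfolding C1_on_def by (auto intro: DERIV_continuous_on)
  obtain a' where a': "\<forall>t\<in>{0..<1}. (a has_real_derivative a' t) (at t within {0..<1})" "C1_on {0..<1} a'"
    using s(1) by (auto simp: C2_on_def)
  obtain b' where b': "\<forall>t\<in>{0..<1}. (b has_real_derivative b' t) (at t within {0..<1})" "C1_on {0..<1} b'"
    using s(2) by (auto simp: C2_on_def)
  \<comment> \<open>\<open>deriv\<close> is the two-sided derivative, so it is identified with the
    relative one at interior times, which are the times at which the velocity field refers to
    it.\<close>
  have der: "deriv f t = D" if "(f has_real_derivative D) (at t within {0..<1})" "t \<in> {0<..<1}" for f D and t :: real
  proof -
    have "(f has_real_derivative D) (at t within {0<..<1})" by (rule DERIV_subset[OF that(1)]) auto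
    then have "(f has_real_derivative D) (at t)" using at_within_open[OF that(2) open_greaterThanLessThan] by simp
    then show ?thesis by (rule DERIV_imp_deriv)
  qed
  have left: "(f \<longlongrightarrow> f 1) (at_left 1)" if "continuous_on {0..1} f" for f :: "real \<Rightarrow> real"
    using that unfolding continuous_on_def by (metis at_within_Icc_at_left atLeastAtMost_iff order_refl zero_le_one zero_less_one)
  have "((\<lambda>t. (a t)\<^sup>2) \<longlongrightarrow> 0) (at_left 1)" using left[OF C1c[OF s(3)]] s(7) by simp
  then have "((\<lambda>t. sqrt ((a t)\<^sup>2)) \<longlongrightarrow> sqrt 0) (at_left 1)" by (rule tendsto_real_sqrt)
  then show "(a \<longlongrightarrow> 0) (at_left 1)" by (simp add: tendsto_rabs_zero_iff)
  show "(b \<longlongrightarrow> 1) (at_left 1)" using left[OF C1c[OF s(4)]] s(8) by simp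
  show "a t > 0" if "t \<in> {0..<1}" for t using s(5)[of t] s(6) that by (cases "t = 0") auto
  have sub: "t \<in> {0..<1}" if "t \<in> {0<..<1}" for t :: real using that by simp
  have "\<forall>t\<in>{0<..<1}. deriv a t = a' t" by (intro ballI der[OF bspec[OF a'(1) sub]])
  moreover have "\<forall>t\<in>{0<..<1}. deriv b t = b' t" by (intro ballI der[OF bspec[OF b'(1) sub]])
  ultimately show "\<exists>a' b'. (\<forall>t\<in>{0..<1}. (a has_real_derivative a' t) (at t within {0..<1})) \<and>
    (\<forall>t\<in>{0..<1}. (b has_real_derivative b' t) (at t within {0..<1})) \<and>
    continuous_on {0..<1} a' \<and> continuous_on {0..<1} b' \<and>
    (\<forall>t\<in>{0<..<1}. deriv a t = a' t) \<and> (\<forall>t\<in>{0<..<1}. deriv b t = b' t)"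
    using a'(1) b'(1) C1c[OF a'(2)] C1c[OF b'(2)] by (intro exI[of _ a'] exI[of _ b'] conjI)
qed

theorem proposition39:
  fixes a b \<theta> :: "real \<Rightarrow> real"
    and M :: "'w measure"
    and Z X1 :: "'w \<Rightarrow> real ^ 'd"
    and \<nu> \<mu> :: "(real ^ 'd) measure"
    and p q :: "real \<Rightarrow> real ^ 'd \<Rightarrow> ennreal"
    and v w Y :: "real \<Rightarrow> real ^ 'd \<Rightarrow> real ^ 'd"
  assumes schedule: "interpolation_schedule a b"
    and nu: "prob_space \<nu>" "sets \<nu> = sets borel" "absolutely_continuous lborel \<nu>"
      "integrable \<nu> (\<lambda>x. (norm x)\<^sup>2)"
    and conds: "cond_A1 \<nu> \<or> cond_A2 \<nu> \<or> cond_A3 \<nu> \<or> cond_A4 \<nu>"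
    and M: "prob_space M"
    and indep: "prob_space.indep_var M borel Z borel X1"
    and law_Z: "distr M borel Z = gaussian 1"
    and law_X1: "distr M borel X1 = \<nu>"
    and p: "\<And>t. t \<in> {0..1} \<Longrightarrow> distributed M lborel (interpolant a b Z X1 t) (p t)"
    and mu: "\<mu> = distr M borel (interpolant a b Z X1 0)"
    and v: "velocity_field M a b Z X1 v"
    and theta: "\<And>t x. t \<in> {0..1} \<Longrightarrow> v t differentiable (at x) \<Longrightarrow>
      jacobian (v t) (at x) \<preceq>\<^sub>L mat (\<theta> t)"
    and theta_integrable: "set_integrable lborel {0..1} \<theta>"
    and w_measurable: "(\<lambda>(t, x). w t x) \<in> borel_measurable (restrict_space borel ({0..1} \<times> UNIV))"
    and Y: "flow_of w Y"
    and q: "\<And>t. t \<in> {0..1} \<Longrightarrow> distributed \<mu> lborel (Y t) (q t)"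
  shows
    "(\<forall>\<epsilon>\<ge>0.
        (\<integral>\<^sup>+ t\<in>{0..1}. (\<integral>\<^sup>+ x. ennreal ((norm (v t x - w t x))\<^sup>2) * q t x \<partial>lborel) \<partial>lborel) \<le> ennreal \<epsilon>
        \<longrightarrow> (W2 (distr \<mu> borel (Y 1)) \<nu>)\<^sup>2 \<le>
              ennreal \<epsilon> * (\<integral>\<^sup>+ s\<in>{0..1}. ennreal (exp (2 * (LINT u:{s..1}|lborel. \<theta> u))) \<partial>lborel))
     \<and>
     (\<forall>C3>0.
        (\<forall>t\<in>{0..1}. (\<forall>x. w t differentiable (at x)) \<and>
                     continuous_on UNIV (\<lambda>x. jacobian (w t) (at x))) \<and>
        (\<forall>t\<in>{0..1}. \<forall>x. spectral_norm (jacobian (w t) (at x)) \<le> C3)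
        \<longrightarrow> (W2 (distr \<mu> borel (Y 1)) \<nu>)\<^sup>2 \<le>
              ennreal ((exp (2 * C3) - 1) / (2 * C3)) *
              (\<integral>\<^sup>+ t\<in>{0..1}. (\<integral>\<^sup>+ x. ennreal ((norm (v t x - w t x))\<^sup>2) * p t x \<partial>lborel) \<partial>lborel))"
proof -
  interpret M: prob_space M by (rule M)
  interpret target_law \<nu> by (rule target_law.intro[OF nu(1,2,4)])
  note pos_lim = interpolation_schedule_derivatives(2-4)[OF schedule]
  from interpolation_schedule_derivatives(1)[OF schedule] obtain a' b' where ab:
    "\<forall>t\<in>{0..<1}. (a has_real_derivative a' t) (at t within {0..<1})"
    "\<forall>t\<in>{0..<1}. (b has_real_derivative b' t) (at t within {0..<1})"
    "continuous_on {0..<1} a'" "continuous_on {0..<1} b'"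
    and deriv_ab: "\<forall>t\<in>{0<..<1}. deriv a t = a' t" "\<forall>t\<in>{0<..<1}. deriv b t = b' t"
    by (elim exE conjE)
  have Zm[measurable]: "Z \<in> borel_measurable M" and X1m[measurable]: "X1 \<in> borel_measurable M"
    using indep unfolding M.indep_var_distribution_eq by auto
  have joint: "distr M (borel \<Otimes>\<^sub>M borel) (\<lambda>\<omega>. (Z \<omega>, X1 \<omega>)) = base"
    using indep unfolding M.indep_var_distribution_eq law_Z law_X1 by simp
  have interp: "distr M borel (interpolant a b Z X1 t) = law (a t) (b t)" for t
    unfolding law_def joint[symmetric] interpolant_def[abs_def]
    by (subst distr_distr) (auto simp: comp_def)
  have \<mu>: "\<mu> = law (a 0) (b 0)" unfolding mu interp ..
  \<comment> \<open>Clamping the time makes each path continuous on the whole line, so joint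
    measurability of the flow follows from measurability at fixed times. \<open>w\<close>,
    measurable over \<open>[0, 1]\<close>, is extended by 0 to be globally measurable.\<close>
  define Yc where "Yc s = Y (max 0 (min 1 s))" for s
  define wc where "wc s x = (if s \<in> {0..1} then w s x else 0)" for s x
  have Yc: "Yc s = Y s" if "s \<in> {0..1}" for s using that by (simp add: Yc_def)
  have wc: "wc s = w s" if "s \<in> {0..1}" for s using that by (simp add: wc_def fun_eq_iff)
  have Yd: "((\<lambda>s. Y s x) has_vector_derivative w s (Y s x)) (at s within {0..1})" if "s \<in> {0..1}" for s x
    using Y that by (auto simp: flow_of_def)
  interpret F: flow_comparison \<nu> a b a' b' wc Yc
  proof (unfold_locales, fact bspec[OF ab(1)], fact bspec[OF ab(2)], fact ab(3), fact ab(4), (fact pos_lim)+)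
    show "((\<lambda>s. Yc s x) has_vector_derivative wc s (Yc s x)) (at s within {0..1})" if s: "s \<in> {0..1}" for s x
      unfolding wc[OF s] Yc[OF s]
      by (rule has_vector_derivative_transform[OF s _ Yd[OF s]]) (simp add: Yc)
    show "Yc 0 x = x" for x using Y by (simp add: Yc flow_of_def)
    show "(\<lambda>(s, x). Yc s x) \<in> borel_measurable (borel \<Otimes>\<^sub>M borel)"
    proof (rule borel_measurable_caratheodory)
      show "continuous_on UNIV (\<lambda>s. Yc s x)" for x
        unfolding Yc_def
      proof (rule continuous_on_compose2[of "{0..1}" "\<lambda>s. Y s x"])
        show "continuous_on {0..1} (\<lambda>s. Y s x)"
          unfolding continuous_on_eq_continuous_within using has_vector_derivative_continuous[OF Yd] by blast
      qed (auto intro!: continuous_intros)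
      show "Yc s \<in> borel_measurable borel" for s
        using distributed_measurable[OF q, of "max 0 (min 1 s)"]
        by (simp add: Yc_def mu measurable_cong_sets[of \<mu> borel lborel borel])
    qed
    have "(\<lambda>u. if u \<in> {0..1} \<times> UNIV then (\<lambda>(t, x). w t x) u else 0) \<in> borel_measurable borel"
      using w_measurable by (subst (asm) measurable_restrict_space_iff) (auto simp: borel_prod[symmetric])
    also have "(\<lambda>u. if u \<in> {0..1} \<times> UNIV then (\<lambda>(t, x). w t x) u else 0) = (\<lambda>(s, x). wc s x)"
      by (auto simp: wc_def fun_eq_iff)
    finally show "(\<lambda>(s, x). wc s x) \<in> borel_measurable (borel \<Otimes>\<^sub>M borel)" by (simp add: borel_prod)
  qed
  \<comment> \<open>Both sides are continuous versions of the same conditional expectation. The end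
    points are left out: \<open>v\<close> is a limit there, which may fail to exist, and they are
    null for the time integral.\<close>
  have vel: "v t = F.vel t" if t: "t \<in> {0<..<1}" for t
  proof -
    have "v t = velocity (a t) (b t) (a' t) (b' t)"
      using v t by (intro velocity_eq_cond_exp[OF M Zm X1m joint])
        (auto simp: velocity_field_def interpolant_def[abs_def] deriv_ab pos_lim)
    then show ?thesis using t by (auto simp: F.vel_def fun_eq_iff)
  qed
  have defect: "norm (v t x - w t x) = F.defect t x" if "t \<in> {0<..<1}" for t x
    using that by (simp add: F.defect_def vel wc)
  have AE01: "AE t in lborel. t \<noteq> (0::real) \<and> t \<noteq> 1"
    using AE_lborel_singleton[of 0] AE_lborel_singleton[of 1] by eventually_elim auto
  have Y1: "Yc 1 = Y 1" by (simp add: Yc)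
  \<comment> \<open>The velocity is differentiable at every \<open>x\<close>, so the guard in the
    hypothesis on the Jacobian is always satisfied at interior times.\<close>
  have osl: "(x - y) \<bullet> (F.vel s x - F.vel s y) \<le> \<theta> s * (norm (x - y))\<^sup>2" if s: "s \<in> {0<..<1}" for s x y
  proof (rule jacobian_loewner_imp_one_sided_lipschitz)
    have "F.vel s = velocity (a s) (b s) (a' s) (b' s)" using s by (auto simp: F.vel_def fun_eq_iff)
    then show d: "F.vel s differentiable (at x)" for x
      using differentiable_velocity pos_lim(1)[of s] s by simp
    show "jacobian (F.vel s) (at x) \<preceq>\<^sub>L mat (\<theta> s)" for x
      using theta[of s x] d[of x] s unfolding vel[OF s] by auto
  qed
  have defm[measurable]: "F.defect t \<in> borel_measurable borel" for t
    using F.measurable_defect[of "\<lambda>_. t" borel "\<lambda>x. x"] by simp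
  \<comment> \<open>\<open>q t\<close> is the density of the image of \<open>\<mu>\<close> under
    \<open>Y t\<close>, so the inner integral becomes an average over starting points.\<close>
  have Eq: "(\<integral>\<^sup>+ t\<in>{0..1}. (\<integral>\<^sup>+ x. ennreal ((norm (v t x - w t x))\<^sup>2) * q t x \<partial>lborel) \<partial>lborel) =
    (\<integral>\<^sup>+ t\<in>{0..1}. (\<integral>\<^sup>+ x. ennreal ((F.defect t (Yc t x))\<^sup>2) \<partial>F.\<mu>) \<partial>lborel)"
  proof (rule nn_integral_cong_AE, use AE01 in eventually_elim)
    fix t :: real assume t: "t \<noteq> 0 \<and> t \<noteq> 1"
    have "(\<integral>\<^sup>+ x. ennreal ((norm (v t x - w t x))\<^sup>2) * q t x \<partial>lborel) = (\<integral>\<^sup>+ x. ennreal ((F.defect t (Yc t x))\<^sup>2) \<partial>F.\<mu>)"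
      if "t \<in> {0..1}"
    proof -
      have t': "t \<in> {0<..<1}" using that t by auto
      show ?thesis
        using distributed_nn_integral[OF q[OF that], of "\<lambda>x. ennreal ((F.defect t x)\<^sup>2)"]
        by (simp add: defect[OF t'] \<mu> Yc[OF that] mult.commute)
    qed
    then show "(\<integral>\<^sup>+ x. ennreal ((norm (v t x - w t x))\<^sup>2) * q t x \<partial>lborel) * indicator {0..1} t =
      (\<integral>\<^sup>+ x. ennreal ((F.defect t (Yc t x))\<^sup>2) \<partial>F.\<mu>) * indicator {0..1} t"
      by (auto simp: indicator_def)
  qed
  \<comment> \<open>\<open>p t\<close> is the density of the interpolant, and independence turns the
    expectation over \<open>M\<close> into one over the product measure \<open>base\<close>.\<close>
  have Ep: "(\<integral>\<^sup>+ t\<in>{0..1}. (\<integral>\<^sup>+ x. ennreal ((norm (v t x - w t x))\<^sup>2) * p t x \<partial>lborel) \<partial>lborel) =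
    (\<integral>\<^sup>+ t\<in>{0..1}. (\<integral>\<^sup>+ u. ennreal ((F.defect t (a t *\<^sub>R fst u + b t *\<^sub>R snd u))\<^sup>2) \<partial>base) \<partial>lborel)"
  proof (rule nn_integral_cong_AE, use AE01 in eventually_elim)
    fix t :: real assume t: "t \<noteq> 0 \<and> t \<noteq> 1"
    have "(\<integral>\<^sup>+ x. ennreal ((norm (v t x - w t x))\<^sup>2) * p t x \<partial>lborel) =
        (\<integral>\<^sup>+ u. ennreal ((F.defect t (a t *\<^sub>R fst u + b t *\<^sub>R snd u))\<^sup>2) \<partial>base)"
      if "t \<in> {0..1}"
    proof -
      have t': "t \<in> {0<..<1}" using that t by auto
      have "(\<integral>\<^sup>+ x. ennreal ((norm (v t x - w t x))\<^sup>2) * p t x \<partial>lborel) =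
          (\<integral>\<^sup>+ \<omega>. ennreal ((F.defect t (interpolant a b Z X1 t \<omega>))\<^sup>2) \<partial>M)"
        using distributed_nn_integral[OF p[OF that], of "\<lambda>x. ennreal ((F.defect t x)\<^sup>2)"]
        by (simp add: defect[OF t'] mult.commute)
      also have "\<dots> = (\<integral>\<^sup>+ u. ennreal ((F.defect t (a t *\<^sub>R fst u + b t *\<^sub>R snd u))\<^sup>2) \<partial>base)"
        unfolding joint[symmetric] interpolant_def by (subst nn_integral_distr) auto
      finally show ?thesis .
    qed
    then show "(\<integral>\<^sup>+ x. ennreal ((norm (v t x - w t x))\<^sup>2) * p t x \<partial>lborel) * indicator {0..1} t =
      (\<integral>\<^sup>+ u. ennreal ((F.defect t (a t *\<^sub>R fst u + b t *\<^sub>R snd u))\<^sup>2) \<partial>base) * indicator {0..1} t"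
      by (auto simp: indicator_def)
  qed
  show ?thesis
  proof (intro conjI allI impI)
    fix \<epsilon> :: real
    assume \<epsilon>: "\<epsilon> \<ge> 0"
      and le: "(\<integral>\<^sup>+ t\<in>{0..1}. (\<integral>\<^sup>+ x. ennreal ((norm (v t x - w t x))\<^sup>2) * q t x \<partial>lborel) \<partial>lborel) \<le> ennreal \<epsilon>"
    have "(W2 (distr \<mu> borel (Y 1)) \<nu>)\<^sup>2 \<le> ennreal (\<epsilon> * (LINT s:{0..1}|lborel. exp (2 * (LINT u:{s..1}|lborel. \<theta> u))))"
      using F.W2_le_along_flow[OF theta_integrable osl \<epsilon> le[unfolded Eq]] unfolding \<mu> Y1 .
    also have "\<dots> = ennreal \<epsilon> * ennreal (LINT s:{0..1}|lborel. exp (2 * (LINT u:{s..1}|lborel. \<theta> u)))"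
      using \<epsilon> by (rule ennreal_mult[OF _ LINT_exp_nonneg])
    also have "ennreal (LINT s:{0..1}|lborel. exp (2 * (LINT u:{s..1}|lborel. \<theta> u))) =
      (\<integral>\<^sup>+ s\<in>{0..1}. ennreal (exp (2 * (LINT u:{s..1}|lborel. \<theta> u))) \<partial>lborel)"
    proof -
      \<comment> \<open>The exponent is continuous in \<open>s\<close>, being a difference of values
        of a primitive of \<open>\<theta>\<close>; the outer integrand is therefore integrable on
        \<open>[0, 1]\<close>, and the real and the extended integrals agree.\<close>
      let ?L = "\<lambda>s. LINT u:{0..s}|lborel. \<theta> u"
      have P: "primitive_on 0 1 ?L \<theta>" by (rule primitive_on_LINT[OF theta_integrable])
      have "set_integrable lborel {0..1} (\<lambda>s. exp (2 * (?L 1 - ?L s)))"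
        by (intro set_integrable_continuous_Icc continuous_intros primitive_on_continuous[OF P])
      also have "?this \<longleftrightarrow> set_integrable lborel {0..1} (\<lambda>s. exp (2 * (LINT u:{s..1}|lborel. \<theta> u)))"
        using primitive_on_diff[OF P, of _ 1] by (intro set_integrable_cong) auto
      finally have i: "set_integrable lborel {0..1} (\<lambda>s. exp (2 * (LINT u:{s..1}|lborel. \<theta> u)))" .
      show ?thesis
        unfolding set_lebesgue_integral_def[of lborel "{0..1}"] using i
        by (subst nn_integral_eq_integral[symmetric])
           (auto simp: set_integrable_def indicator_def intro!: nn_integral_cong)
    qed
    finally show "(W2 (distr \<mu> borel (Y 1)) \<nu>)\<^sup>2 \<le>
      ennreal \<epsilon> * (\<integral>\<^sup>+ s\<in>{0..1}. ennreal (exp (2 * (LINT u:{s..1}|lborel. \<theta> u))) \<partial>lborel)" .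
  next
    fix C3 :: real
    assume C3: "C3 > 0"
      and w: "(\<forall>t\<in>{0..1}. (\<forall>x. w t differentiable (at x)) \<and> continuous_on UNIV (\<lambda>x. jacobian (w t) (at x))) \<and>
        (\<forall>t\<in>{0..1}. \<forall>x. spectral_norm (jacobian (w t) (at x)) \<le> C3)"
    let ?E = "\<integral>\<^sup>+ t\<in>{0..1}. (\<integral>\<^sup>+ x. ennreal ((norm (v t x - w t x))\<^sup>2) * p t x \<partial>lborel) \<partial>lborel"
    let ?K = "(exp (2 * C3) - 1) / (2 * C3)"
    have K: "?K > 0" using C3 by simp
    show "(W2 (distr \<mu> borel (Y 1)) \<nu>)\<^sup>2 \<le> ennreal ?K * ?E"
    \<comment> \<open>An infinite error makes the right-hand side infinite because the prefactor is
      positive; otherwise the error is a real number and serves as the bound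
      \<open>\<epsilon>\<close>.\<close>
    proof (cases "?E = \<top>")
      case True
      then show ?thesis using K C3 by (simp add: ennreal_mult_top)
    next
      case False
      define \<epsilon> where "\<epsilon> = enn2real ?E"
      have \<epsilon>: "?E = ennreal \<epsilon>" "\<epsilon> \<ge> 0" using False by (auto simp: \<epsilon>_def top.not_eq_extremum)
      have lip: "norm (wc s x - wc s y) \<le> C3 * norm (x - y)" if "s \<in> {0..1}" for s x y
        unfolding wc[OF that] using w that by (intro jacobian_spectral_norm_imp_lipschitz) auto
      have "(W2 (distr \<mu> borel (Y 1)) \<nu>)\<^sup>2 \<le> ennreal (\<epsilon> * (LINT s:{0..1::real}|lborel. exp (2 * (LINT u:{s..1}|lborel. C3))))"
        using F.W2_le_along_interpolant[OF less_imp_le[OF C3] lip \<epsilon>(2)] \<epsilon>(1) unfolding Ep \<mu> Y1 by simp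
      also have "\<dots> = ennreal ?K * ?E"
        unfolding LINT_exp_const[OF C3] \<epsilon>(1) using K \<epsilon>(2) by (simp add: ennreal_mult[symmetric] mult.commute)
      finally show ?thesis .
    qed
  qed
qed

end
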